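(* Let $p,q,r,J,K,n$ be positive integers with $J\le d_1:=p^2$ and $K\le d_3:=r^2$, put $d=pqr$, $d_2=q^2$, and let $T$ be a positive integer (number of iterations). Let $\mathbf X,\mathbf X_1,\dots,\mathbf X_n$ be i.i.d. centered random vectors in $\mathbb R^d$ with positive definite covariance $\Sigma=\mathbb E\mathbf X\mathbf X^\top$ satisfying Assumption (A) with constant $\omega>0$, and let $\widehat\Sigma=\frac1n\sum_{i=1}^n\mathbf X_i\mathbf X_i^\top$. Let $\mathcal T^*=U^*\times_1V^*\times_3\mathcal W^*$ (with $U^*\in\mathbb O_{d_1,J}$, $V^*\in\mathbb O_{d_3,K}$, $\mathcal W^*\in\mathbb R^{J\times d_2\times K}$) be a best $(J,K)$-TT-rank approximation of $\mathcal R(\Sigma)$ and $\overline{\mathcal E}=\mathcal R(\Sigma)-\mathcal T^*$. Let $\widehat{\mathcal T}$ be the output of HardTTh applied to $\mathcal Y=\mathcal R(\widehat\Sigma)$ with ranks $(J,K)$ and $T$ iterations, and set $\widetilde\Sigma=\mathcal R^{-1}(\widehat{\mathcal T})$. Write $\mathtt r_i=\mathtt r_i(\Sigma)$. Fix $\delta\in(0,1)$ and suppose $$\sigma_J(\mathtt m_1(\mathcal R(\Sigma)))\ge 25\|\mathtt m_1(\overline{\mathcal E})\|+768\,\omega\|\Sigma\|\sqrt{\frac{\mathtt r_1^2+\mathtt r_2^2\mathtt r_3^2+\log(6/\delta)}{n}},$$ $$\sigma_K(\mathtt m_3(\mathcal R(\Sigma)))\ge 25\|\mathtt m_3(\overline{\mathcal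 E})\|+768\,\omega\|\Sigma\|\sqrt{\frac{J\mathtt r_1^2+J\mathtt r_2^2+\mathtt r_3^2+\log(48/\delta)}{n}},$$ and $n\ge \mathtt R_\delta:=J\mathtt r_1^2+JK\mathtt r_2^2+K\mathtt r_3^2+\mathtt r_2^2\mathtt r_3^2+\log(48/\delta)$. Then with probability at least $1-\delta$, $$\|\widetilde\Sigma-\Sigma\|_{\rm F}\le \overline{\mathbf b}+96\,\omega\|\Sigma\|\sqrt{\frac{J\mathtt r_1^2+JK\mathtt r_2^2+K\mathtt r_3^2+\log(48/\delta)}{n}}+\widetilde\diamondsuit_2+\widetilde r_T,$$ where, writing $s_1=\sigma_J(\mathtt m_1(\mathcal R(\Sigma)))$, $s_3=\sigma_K(\mathtt m_3(\mathcal R(\Sigma)))$, $$\overline{\mathbf b}=\|\overline{\mathcal E}\|_{\rm F}+\sup_{U\in\mathbb O_{d_1,J},\,V\in\mathbb O_{d_3,K}}\|U^\top\times_1V^\top\times_3\overline{\mathcal E}\|_{\rm F}+4\sqrt J\|\mathtt m_1((V^* )^\top\times_3\overline{\mathcal E})\|+4\sqrt K\|\mathtt m_3((U^* )^\top\times_1\overline{\mathcal E})\|,$$ $$\widetilde\alpha_U=\|\mathtt m_1((V^* )^\top\times_3\overline{\mathcal E})\|+32\omega\|\Sigma\|\sqrt{\tfrac{\mathtt r_1^2+K\mathtt r_2^2+\log(48/\delta)}{n}},$$ $$\widetilde\beta_U=\sup_{V\in\mathbb R^{d_3\times K},\|V\|\le1}\|\mathtt m_1(V^\top\times_3\overline{\mathcal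 E})\|+32\omega\|\Sigma\|\sqrt{\tfrac{\mathtt r_1^2+K\mathtt r_2^2+K\mathtt r_3^2+\log(48/\delta)}{n}},$$ $$\widetilde\alpha_V=\|\mathtt m_3((U^* )^\top\times_1\overline{\mathcal E})\|+32\omega\|\Sigma\|\sqrt{\tfrac{\mathtt r_3^2+J\mathtt r_2^2+\log(48/\delta)}{n}},$$ $$\widetilde\beta_V=\sup_{U\in\mathbb R^{d_1\times J},\|U\|\le1}\|\mathtt m_3(U^\top\times_1\overline{\mathcal E})\|+32\omega\|\Sigma\|\sqrt{\tfrac{\mathtt r_2^2+J\mathtt r_1^2+J\mathtt r_3^2+\log(48/\delta)}{n}},$$ $$\widetilde\diamondsuit_2=96\Big(\frac{\sqrt K\,\widetilde\beta_V\widetilde\alpha_U}{s_1}+\frac{\sqrt J\,\widetilde\beta_U\widetilde\alpha_V}{s_3}\Big),$$ $$\widetilde r_T=(\sqrt J+\sqrt K)\Big(\frac{200\,\widetilde\beta_V\widetilde\beta_U}{s_1s_3}\Big)^T\Big(\|\mathtt m_1(\overline{\mathcal E})\|+32\omega\|\Sigma\|\sqrt{\tfrac{\mathtt r_1^2+\mathtt r_2^2\mathtt r_3^2+\log(6/\delta)}{n}}\Big).$$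
   Context: Notation: $\|M\|$ is the spectral norm, $\|M\|_{\rm F}$ the Frobenius norm (for tensors: Euclidean norm of all entries), $\sigma_k(M)$ the $k$-th largest singular value. $\mathbb O_{a,b}$ is the set of $a\times b$ real matrices with orthonormal columns. $y\%x\in\{0,\dots,x-1\}$ is the residue of $y$ modulo $x$. Mode products: for a tensor $\mathcal T\in\mathbb R^{n_1\times n_2\times n_3}$ and $M\in\mathbb R^{m\times n_i}$, $M\times_i\mathcal T$ replaces the $i$-th index: e.g. $(M\times_1\mathcal T)_{a b c}=\sum_{a'}M_{a a'}\mathcal T_{a' b c}$, $(M\times_3\mathcal T)_{abc}=\sum_{c'}M_{cc'}\mathcal T_{abc'}$; $A\times_1B\times_3\mathcal T$ means $A\times_1(B\times_3\mathcal T)$. Unfoldings: for $\mathcal T\in\mathbb R^{n_1\times n_2\times n_3}$, $\mathtt m_1(\mathcal T)\in\mathbb R^{n_1\times n_2n_3}$ with $\mathtt m_1(\mathcal T)_{a,(b-1)n_3+c}=\mathcal T_{abc}$, and $\mathtt m_3(\mathcal T)\in\mathbb R^{n_3\times n_1n_2}$ with $\mathtt m_3(\mathcal T)_{c,(a-1)n_2+b}=\mathcal T_{abc}$. Rearrangement: $\mathcal R:\mathbb R^{pqr\times pqr}\to\mathbb R^{p^2\times q^2\times r^2}$, $\mathcal R(A)_{a,b,c}=A_{(\lceil a/p\rceil-1)qr+(\lceil b/q\rceil-1)r+\lceil c/r\rceil,\ ((a-1)\%p)qr+((b-1)\%q)r+(c-1)\%r+1}$; it is a permutation of entries, hence invertible.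 Partial traces and effective dimensions: identify $\mathbb R^d=\mathbb R^p\otimes\mathbb R^q\otimes\mathbb R^r$ via Kronecker products, so matrices in $\mathbb R^{d\times d}$ are operators on this tensor product. ${\rm Tr}_1,{\rm Tr}_2,{\rm Tr}_3$ are the partial traces over the factor $\mathbb R^p,\mathbb R^q,\mathbb R^r$ respectively (e.g. ${\rm Tr}_1(X\otimes Y\otimes Z)={\rm Tr}(X)\,Y\otimes Z$, extended linearly), and ${\rm Tr}_{i_1\dots i_k}$ is the composition (trace over all indicated factors). Define $\mathtt r_1(\Sigma)=\max\{\|{\rm Tr}_1\Sigma\|/\|\Sigma\|,\ \|{\rm Tr}_{1,2}\Sigma\|/\|{\rm Tr}_2\Sigma\|\}$, $\mathtt r_2(\Sigma)=\max\{\|{\rm Tr}_2\Sigma\|/\|\Sigma\|,\ \|{\rm Tr}_{2,3}\Sigma\|/\|{\rm Tr}_3\Sigma\|\}$, $\mathtt r_3(\Sigma)=\max\{\|{\rm Tr}_3\Sigma\|/\|\Sigma\|,\ \|{\rm Tr}_{1,3}\Sigma\|/\|{\rm Tr}_1\Sigma\|,\ |{\rm Tr}_{1,2,3}\Sigma|/\|{\rm Tr}_{1,2}\Sigma\|\}$. Assumption (A): there is $\omega>0$ such that $\log\mathbb E\exp\{(\Sigma^{-1/2}\mathbf X)^\top V(\Sigma^{-1/2}\mathbf X)-{\rm Tr}(V)\}\le\omega^2\|V\|_{\rm F}^2$ for all $V\in\mathbb R^{d\times d}$ with $\|V\|_{\rm F}\le1/\omega$. TT-rank: a tensor in $\mathbb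 R^{d_1\times d_2\times d_3}$ has TT-ranks at most $(J,K)$ if it equals $U\times_1V\times_3\mathcal W$ for some $U\in\mathbb O_{d_1,J}$, $V\in\mathbb O_{d_3,K}$, $\mathcal W\in\mathbb R^{J\times d_2\times K}$; a best $(J,K)$-TT-rank approximation of $\mathcal R(\Sigma)$ is a minimizer of the Frobenius distance to $\mathcal R(\Sigma)$ over this set. HardTTh (input $\mathcal Y\in\mathbb R^{d_1\times d_2\times d_3}$, ranks $(J,K)$, $T$): let $\widehat U_0\in\mathbb O_{d_1,J}$ consist of $J$ leading left singular vectors of $\mathtt m_1(\mathcal Y)$ and $\widehat V_0\in\mathbb O_{d_3,K}$ of $K$ leading left singular vectors of $\mathtt m_3(\widehat U_0^\top\times_1\mathcal Y)$; for $t=1,\dots,T$, let $\widehat U_t$ consist of $J$ leading left singular vectors of $\mathtt m_1(\widehat V_{t-1}^\top\times_3\mathcal Y)$ and $\widehat V_t$ of $K$ leading left singular vectors of $\mathtt m_3(\widehat U_t^\top\times_1\mathcal Y)$. Set $\widehat U=\widehat U_T$, $\widehat V=\widehat V_T$, $\widehat{\mathcal W}=\widehat U^\top\times_1\widehat V^\top\times_3\mathcal Y$, and output $\widehat{\mathcal T}=\widehat U\times_1\widehat V\times_3\widehat{\mathcal W}$. *)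

theory Defs
  imports "HOL-Probability.Probability"
begin

(* Conventions: all indices are 0-based.  A matrix in R^{m x n} is a function
   nat => nat => real of which only the entries with row < m, col < n matter;
   a tensor in R^{n1 x n2 x n3} is a function nat => nat => nat => real of which
   only entries in the box {..<n1} x {..<n2} x {..<n3} matter. *)

type_synonym mat = "nat \<Rightarrow> nat \<Rightarrow> real"
type_synonym tensor = "nat \<Rightarrow> nat \<Rightarrow> nat \<Rightarrow> real"

definition vnorm :: "'i set \<Rightarrow> ('i \<Rightarrow> real) \<Rightarrow> real" where
  "vnorm I x = sqrt (\<Sum>i\<in>I. (x i)^2)"

definition opnorm :: "'i set \<Rightarrow> 'j set \<Rightarrow> ('i \<Rightarrow> 'j \<Rightarrow> real) \<Rightarrow> real" where
  "opnorm I J A = Sup {vnorm I (\<lambda>i. \<Sum>j\<in>J. A i j * x j) | x. vnorm J x \<le> 1}"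

definition snorm :: "nat \<Rightarrow> nat \<Rightarrow> mat \<Rightarrow> real" where
  "snorm m n A = opnorm {..<m} {..<n} A"

definition frob :: "nat \<Rightarrow> nat \<Rightarrow> mat \<Rightarrow> real" where
  "frob m n A = sqrt (\<Sum>i<m. \<Sum>j<n. (A i j)^2)"

definition tfrob :: "nat \<Rightarrow> nat \<Rightarrow> nat \<Rightarrow> tensor \<Rightarrow> real" where
  "tfrob n1 n2 n3 T = sqrt (\<Sum>a<n1. \<Sum>b<n2. \<Sum>c<n3. (T a b c)^2)"

definition orth :: "nat \<Rightarrow> nat \<Rightarrow> mat \<Rightarrow> bool" where
  "orth m k U \<longleftrightarrow> (\<forall>j1<k. \<forall>j2<k. (\<Sum>i<m. U i j1 * U i j2) = (if j1 = j2 then 1 else 0))"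

(* k-th largest singular value (1 <= k <= m) of an m x n matrix A, i.e. the square
   root of the k-th largest eigenvalue of A A^T, given by the Courant--Fischer
   max-min formula:  sigma_k(A) = max_{U \<in> O_{m,k}} min_{|y|=1} |A^T U y|. *)
definition sval :: "nat \<Rightarrow> nat \<Rightarrow> mat \<Rightarrow> nat \<Rightarrow> real" where
  "sval m n A k = Sup { Inf { vnorm {..<n} (\<lambda>j. \<Sum>i<m. A i j * (\<Sum>l<k. U i l * y l))
                              | y. vnorm {..<k} y = 1 } | U. orth m k U }"

(* U \<in> O_{m,k} consists of k leading left singular vectors of the m x n matrix A:
   its l-th column (0-based) is a unit left singular vector for sigma_{l+1}(A),
   i.e. A A^T u_l = sigma_{l+1}(A)^2 u_l, and the columns are orthonormal. *)
definition lead_lsv :: "nat \<Rightarrow> nat \<Rightarrow> mat \<Rightarrow> nat \<Rightarrow> mat \<Rightarrow> bool" where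
  "lead_lsv m n A k U \<longleftrightarrow> orth m k U \<and>
     (\<forall>l<k. \<forall>i<m. (\<Sum>i'<m. (\<Sum>j<n. A i j * A i' j) * U i' l) = (sval m n A (Suc l))^2 * U i l)"

definition mode1T :: "nat \<Rightarrow> mat \<Rightarrow> tensor \<Rightarrow> tensor" where
  "mode1T n1 U T = (\<lambda>j b c. \<Sum>a<n1. U a j * T a b c)"

definition mode3T :: "nat \<Rightarrow> mat \<Rightarrow> tensor \<Rightarrow> tensor" where
  "mode3T n3 V T = (\<lambda>a b k. \<Sum>c<n3. V c k * T a b c)"

definition ttprod :: "nat \<Rightarrow> nat \<Rightarrow> mat \<Rightarrow> mat \<Rightarrow> tensor \<Rightarrow> tensor" where
  "ttprod J K U V W = (\<lambda>a b c. \<Sum>j<J. U a j * (\<Sum>k<K. V c k * W j b k))"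

definition m1 :: "nat \<Rightarrow> nat \<Rightarrow> tensor \<Rightarrow> mat" where
  "m1 n2 n3 T = (\<lambda>a col. T a (col div n3) (col mod n3))"

definition m3 :: "nat \<Rightarrow> tensor \<Rightarrow> mat" where
  "m3 n2 T = (\<lambda>c col. T (col div n2) (col mod n2) c)"

definition Rearr :: "nat \<Rightarrow> nat \<Rightarrow> nat \<Rightarrow> mat \<Rightarrow> tensor" where
  "Rearr p q r A = (\<lambda>a b c.
      A ((a div p) * q * r + (b div q) * r + c div r)
        ((a mod p) * q * r + (b mod q) * r + c mod r))"

definition Rearr_inv :: "nat \<Rightarrow> nat \<Rightarrow> nat \<Rightarrow> tensor \<Rightarrow> mat" where
  "Rearr_inv p q r T = (\<lambda>i j.
      T ((i div (q * r)) * p + j div (q * r))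
        (((i div r) mod q) * q + (j div r) mod q)
        ((i mod r) * r + j mod r))"

(* Kronecker identification R^p \<otimes> R^q \<otimes> R^r = R^{pqr}: (a,b,c) |-> a*q*r + b*r + c *)
definition kidx :: "nat \<Rightarrow> nat \<Rightarrow> nat \<Rightarrow> nat \<Rightarrow> nat \<Rightarrow> nat" where
  "kidx q r a b c = a * q * r + b * r + c"

definition ptr1 :: "nat \<Rightarrow> nat \<Rightarrow> nat \<Rightarrow> mat \<Rightarrow> (nat \<times> nat) \<Rightarrow> (nat \<times> nat) \<Rightarrow> real" where
  "ptr1 p q r S = (\<lambda>(b, c) (b', c'). \<Sum>a<p. S (kidx q r a b c) (kidx q r a b' c'))"
definition ptr2 :: "nat \<Rightarrow> nat \<Rightarrow> nat \<Rightarrow> mat \<Rightarrow> (nat \<times> nat) \<Rightarrow> (nat \<times> nat) \<Rightarrow> real" where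
  "ptr2 p q r S = (\<lambda>(a, c) (a', c'). \<Sum>b<q. S (kidx q r a b c) (kidx q r a' b c'))"
definition ptr3 :: "nat \<Rightarrow> nat \<Rightarrow> nat \<Rightarrow> mat \<Rightarrow> (nat \<times> nat) \<Rightarrow> (nat \<times> nat) \<Rightarrow> real" where
  "ptr3 p q r S = (\<lambda>(a, b) (a', b'). \<Sum>c<r. S (kidx q r a b c) (kidx q r a' b' c))"
definition ptr12 :: "nat \<Rightarrow> nat \<Rightarrow> nat \<Rightarrow> mat \<Rightarrow> mat" where
  "ptr12 p q r S = (\<lambda>c c'. \<Sum>a<p. \<Sum>b<q. S (kidx q r a b c) (kidx q r a b c'))"
definition ptr13 :: "nat \<Rightarrow> nat \<Rightarrow> nat \<Rightarrow> mat \<Rightarrow> mat" where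
  "ptr13 p q r S = (\<lambda>b b'. \<Sum>a<p. \<Sum>c<r. S (kidx q r a b c) (kidx q r a b' c))"
definition ptr23 :: "nat \<Rightarrow> nat \<Rightarrow> nat \<Rightarrow> mat \<Rightarrow> mat" where
  "ptr23 p q r S = (\<lambda>a a'. \<Sum>b<q. \<Sum>c<r. S (kidx q r a b c) (kidx q r a' b c))"
definition ptr123 :: "nat \<Rightarrow> nat \<Rightarrow> nat \<Rightarrow> mat \<Rightarrow> real" where
  "ptr123 p q r S = (\<Sum>a<p. \<Sum>b<q. \<Sum>c<r. S (kidx q r a b c) (kidx q r a b c))"

definition reff1 :: "nat \<Rightarrow> nat \<Rightarrow> nat \<Rightarrow> mat \<Rightarrow> real" where
  "reff1 p q r S = max
     (opnorm ({..<q} \<times> {..<r}) ({..<q} \<times> {..<r}) (ptr1 p q r S) / snorm (p*q*r) (p*q*r) S)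
     (snorm r r (ptr12 p q r S) / opnorm ({..<p} \<times> {..<r}) ({..<p} \<times> {..<r}) (ptr2 p q r S))"
definition reff2 :: "nat \<Rightarrow> nat \<Rightarrow> nat \<Rightarrow> mat \<Rightarrow> real" where
  "reff2 p q r S = max
     (opnorm ({..<p} \<times> {..<r}) ({..<p} \<times> {..<r}) (ptr2 p q r S) / snorm (p*q*r) (p*q*r) S)
     (snorm p p (ptr23 p q r S) / opnorm ({..<p} \<times> {..<q}) ({..<p} \<times> {..<q}) (ptr3 p q r S))"
definition reff3 :: "nat \<Rightarrow> nat \<Rightarrow> nat \<Rightarrow> mat \<Rightarrow> real" where
  "reff3 p q r S = max (max
     (opnorm ({..<p} \<times> {..<q}) ({..<p} \<times> {..<q}) (ptr3 p q r S) / snorm (p*q*r) (p*q*r) S)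
     (snorm q q (ptr13 p q r S) / opnorm ({..<q} \<times> {..<r}) ({..<q} \<times> {..<r}) (ptr1 p q r S)))
     (\<bar>ptr123 p q r S\<bar> / snorm r r (ptr12 p q r S))"

definition sym_pd :: "nat \<Rightarrow> mat \<Rightarrow> bool" where
  "sym_pd d A \<longleftrightarrow> (\<forall>i<d. \<forall>j<d. A i j = A j i) \<and>
     (\<forall>x. (\<exists>j<d. x j \<noteq> 0) \<longrightarrow> (\<Sum>i<d. \<Sum>j<d. x i * A i j * x j) > 0)"

(* Sigma^{-1/2}: the unique symmetric positive definite B with B B Sigma = I
   (entries outside the d x d block set to 0 to make it unique) *)
definition inv_sqrt :: "nat \<Rightarrow> mat \<Rightarrow> mat" where
  "inv_sqrt d S = (THE B. sym_pd d B \<and>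
      (\<forall>i<d. \<forall>j<d. (\<Sum>k<d. \<Sum>l<d. B i k * B k l * S l j) = (if i = j then 1 else 0)) \<and>
      (\<forall>i j. d \<le> i \<or> d \<le> j \<longrightarrow> B i j = 0))"

(* Tt is an output of HardTTh on Y \<in> R^{d1 x d2 x d3} with ranks (J,K) and T iterations
   (for some admissible choice of the leading singular vectors at each step) *)
definition hardtth :: "nat \<Rightarrow> nat \<Rightarrow> nat \<Rightarrow> nat \<Rightarrow> nat \<Rightarrow> nat \<Rightarrow> tensor \<Rightarrow> tensor \<Rightarrow> bool" where
  "hardtth d1 d2 d3 J K T Y Tt \<longleftrightarrow> (\<exists>Us Vs :: nat \<Rightarrow> mat.
      lead_lsv d1 (d2 * d3) (m1 d2 d3 Y) J (Us 0) \<and>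
      lead_lsv d3 (J * d2) (m3 d2 (mode1T d1 (Us 0) Y)) K (Vs 0) \<and>
      (\<forall>t\<in>{1..T}.
         lead_lsv d1 (d2 * K) (m1 d2 K (mode3T d3 (Vs (t - 1)) Y)) J (Us t) \<and>
         lead_lsv d3 (J * d2) (m3 d2 (mode1T d1 (Us t) Y)) K (Vs t)) \<and>
      Tt = ttprod J K (Us T) (Vs T) (mode1T d1 (Us T) (mode3T d3 (Vs T) Y)))"

end

theory Submission
  imports Defs
begin

text \<open>Every noise quantity in the analysis of the iteration is a supremum of the trilinear form
  sum of (empirical covariance - Sigma)(m, n) V(x, y, z)(m, n) over contractions x, z and a unit
  tensor y. PAC-Bayes with standard Gaussian priors on the three blocks, each shifted by x, y, z,
  bounds it uniformly: by Assumption (A) the exponential moment at a weight matrix V is governed by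
  the quadratic form of Sigma in V, whose Gaussian averages over any subset of the blocks are
  controlled by the corresponding partial traces, hence by the effective dimensions. Unbounded
  Gaussians are handled by restricting the prior to a set of probability at least 1/2 and averaging
  over the eight sign flips of its blocks.

  On the resulting event the iteration is followed in Frobenius norm. With delta(U) the Frobenius norm
  of the part of the signal not captured by U, the Ky Fan principle shows that one half-step maps
  delta(V) to at most about 2(F + sqrt J eps + beta delta(V) / sigma), where F is the Frobenius noise
  level, while a spectral argument keeps all the angles below 1/11. Iterating the two half-steps
  contracts the initial error geometrically, and the remaining terms add up to the bias and
  variance of the bound.\<close>

section \<open>Vectors and matrices with index sets\<close>

text \<open>Assumption (A) controls exponential moments only for weights of bounded Frobenius norm,
  while a Gaussian perturbation of (x, y, z) is unbounded. Cutting a Gaussian down to a good set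
  would normally destroy its centering. Here the good set is defined by the squares of the eight
  pieces of the expanded trilinear form, so it is blind to signs, and averaging over the reflections
  cancels the seven pieces other than the central one exactly. The blocks are scaled by
  \<open>r1\<close>, \<open>sqrt (J K) r2\<close> and \<open>r3\<close>: with these radii all eight
  Gaussian averages obey the same bound, and the Gaussian cost (|x|^2 + |y|^2 + |z|^2) / 2 is at
  most half of J r1^2 + J K r2^2 + K r3^2. Since the noise is bounded in Frobenius norm uniformly
  over all contractions, it enters each half-step additively; only the bias multiplies the error of
  the preceding half-step, which is why the rate is a product of beta quantities over singular
  values.\<close>

definition dot :: "'i set \<Rightarrow> ('i \<Rightarrow> real) \<Rightarrow> ('i \<Rightarrow> real) \<Rightarrow> real" where
  "dot I x y = (\<Sum>i\<in>I. x i * y i)"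

definition mv :: "'j set \<Rightarrow> ('i \<Rightarrow> 'j \<Rightarrow> real) \<Rightarrow> ('j \<Rightarrow> real) \<Rightarrow> 'i \<Rightarrow> real" where
  "mv J A x = (\<lambda>i. \<Sum>j\<in>J. A i j * x j)"

text \<open>The transpose acting on a vector. \<open>sval\<close> is written through it, so nearly
  all estimates concern \<open>tmv\<close>; it sums over the row set only, which leaves the column
  set free to be of any type.\<close>

definition tmv :: "'i set \<Rightarrow> ('i \<Rightarrow> 'j \<Rightarrow> real) \<Rightarrow> ('i \<Rightarrow> real) \<Rightarrow> 'j \<Rightarrow> real" where
  "tmv I A y = (\<lambda>j. \<Sum>i\<in>I. A i j * y i)"

section \<open>Euclidean norm and inner product on index sets\<close>

lemma vnorm_L2: "vnorm I x = L2_set x I"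
  by (simp add: vnorm_def L2_set_def)

lemma vnorm_sq: "(vnorm I x)^2 = (\<Sum>i\<in>I. (x i)^2)"
  by (simp add: vnorm_def sum_nonneg)

lemma vnorm_sq_dot: "(vnorm I x)^2 = dot I x x"
  unfolding vnorm_sq dot_def by (simp add: power2_eq_square)

lemma vnorm_nonneg [simp]: "0 \<le> vnorm I x"
  by (simp add: vnorm_def sum_nonneg)

lemma vnorm_cong: "(\<And>i. i \<in> I \<Longrightarrow> x i = y i) \<Longrightarrow> vnorm I x = vnorm I y"
  by (simp add: vnorm_def cong: sum.cong)

lemma dot_cong: "(\<And>i. i \<in> I \<Longrightarrow> x i = x' i) \<Longrightarrow> (\<And>i. i \<in> I \<Longrightarrow> y i = y' i) \<Longrightarrow> dot I x y = dot I x' y'"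
  by (simp add: dot_def cong: sum.cong)

lemma tmv_cong: "(\<And>i. i \<in> I \<Longrightarrow> x i = y i) \<Longrightarrow> tmv I A x = tmv I A y"
  by (simp add: tmv_def cong: sum.cong)

lemma vnorm_scale: "vnorm I (\<lambda>i. c * x i) = \<bar>c\<bar> * vnorm I x"
  by (simp add: vnorm_def power_mult_distrib sum_distrib_left[symmetric] real_sqrt_mult)

lemma vnorm_zero [simp]: "vnorm I (\<lambda>i. 0) = 0"
  by (simp add: vnorm_def)

lemma vnorm_eq_0: "finite I \<Longrightarrow> vnorm I x = 0 \<longleftrightarrow> (\<forall>i\<in>I. x i = 0)"
  by (simp add: vnorm_L2 L2_set_eq_0_iff)

lemma vnorm_triangle: "vnorm I (\<lambda>i. x i + y i) \<le> vnorm I x + vnorm I y"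
  by (simp add: vnorm_L2 L2_set_triangle_ineq)

lemma vnorm_minus: "vnorm I (\<lambda>i. - x i) = vnorm I x"
  by (simp add: vnorm_def)

lemma vnorm_diff: "vnorm I (\<lambda>i. x i - y i) \<le> vnorm I x + vnorm I y"
  using vnorm_triangle[of I x "\<lambda>i. - y i"] by (simp add: vnorm_minus)

lemma vnorm_le_vnormI: "(vnorm I x)^2 \<le> (vnorm J y)^2 \<Longrightarrow> vnorm I x \<le> vnorm J y"
  by (rule power2_le_imp_le) simp_all

lemma dot_le: "\<bar>dot I x y\<bar> \<le> vnorm I x * vnorm I y"
proof -
  have "\<bar>dot I x y\<bar> \<le> (\<Sum>i\<in>I. \<bar>x i\<bar> * \<bar>y i\<bar>)"
    unfolding dot_def by (rule order_trans[OF sum_abs]) (simp add: abs_mult)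
  also have "\<dots> \<le> L2_set x I * L2_set y I" by (rule L2_set_mult_ineq)
  finally show ?thesis by (simp add: vnorm_L2)
qed

lemma dot_commute: "dot I x y = dot I y x"
  by (simp add: dot_def mult.commute)

lemma dot_add_left: "dot I (\<lambda>i. x i + y i) z = dot I x z + dot I y z"
  by (simp add: dot_def sum.distrib algebra_simps)

lemma dot_diff_left: "dot I (\<lambda>i. x i - y i) z = dot I x z - dot I y z"
  by (simp add: dot_def sum_subtractf algebra_simps)

lemma dot_add_right: "dot I z (\<lambda>i. x i + y i) = dot I z x + dot I z y"
  by (simp add: dot_def sum.distrib algebra_simps)

lemma dot_diff_right: "dot I z (\<lambda>i. x i - y i) = dot I z x - dot I z y"
  by (simp add: dot_def sum_subtractf algebra_simps)

lemma dot_scale_left: "dot I (\<lambda>i. c * x i) z = c * dot I x z"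
  by (simp add: dot_def sum_distrib_left algebra_simps)

lemma dot_scale_right: "dot I z (\<lambda>i. c * x i) = c * dot I z x"
  by (simp add: dot_def sum_distrib_left algebra_simps)

lemma dot_sum_left: "dot I (\<lambda>i. \<Sum>l\<in>L. f l i) z = (\<Sum>l\<in>L. dot I (f l) z)"
  unfolding dot_def by (subst sum.swap) (simp add: sum_distrib_right)

lemma dot_adjoint: "dot I (mv J A x) y = dot J x (tmv I A y)"
  unfolding dot_def mv_def tmv_def sum_distrib_left sum_distrib_right
  by (subst sum.swap) (simp add: algebra_simps)

lemma mv_add: "mv J A (\<lambda>j. x j + y j) = (\<lambda>i. mv J A x i + mv J A y i)"
  by (simp add: mv_def sum.distrib algebra_simps)

lemma mv_scale: "mv J A (\<lambda>j. c * x j) = (\<lambda>i. c * mv J A x i)"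
  by (simp add: mv_def sum_distrib_left algebra_simps)

lemma tmv_add: "tmv I A (\<lambda>j. x j + y j) = (\<lambda>i. tmv I A x i + tmv I A y i)"
  by (simp add: tmv_def sum.distrib algebra_simps)

lemma tmv_diff: "tmv I A (\<lambda>j. x j - y j) = (\<lambda>i. tmv I A x i - tmv I A y i)"
  by (simp add: tmv_def sum_subtractf algebra_simps)

lemma tmv_scale: "tmv I A (\<lambda>j. c * x j) = (\<lambda>i. c * tmv I A x i)"
  by (simp add: tmv_def sum_distrib_left algebra_simps)

lemma tmv_dot: "tmv I A y j = dot I (\<lambda>i. A i j) y"
  by (simp add: tmv_def dot_def)

section \<open>The operator norm as a supremum, and its transpose\<close>

lemma opnorm_bdd:
  assumes "finite I" "finite J"
  shows "bdd_above {vnorm I (\<lambda>i. \<Sum>j\<in>J. A i j * x j) | x. vnorm J x \<le> 1}"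
proof (rule bdd_aboveI, safe)
  fix x assume x: "vnorm J x \<le> 1"
  \<comment> \<open>Cauchy-Schwarz in every row: the bound is the Frobenius norm, which makes the
    supremum of reals meaningful.\<close>
  have "vnorm I (mv J A x) \<le> vnorm I (\<lambda>i. vnorm J (A i))"
    unfolding vnorm_L2
  proof (subst (1 2) L2_set_def, rule real_sqrt_le_mono, rule sum_mono)
    fix i
    have "\<bar>mv J A x i\<bar> \<le> vnorm J (A i) * vnorm J x"
      using dot_le[of J "A i" x] by (simp add: mv_def dot_def)
    also have "\<dots> \<le> vnorm J (A i) * 1" using x by (intro mult_left_mono) auto
    finally show "(mv J A x i)\<^sup>2 \<le> (L2_set (A i) J)^2"
      by (simp add: vnorm_L2 abs_le_square_iff[symmetric])
  qed
  then show "vnorm I (\<lambda>i. \<Sum>j\<in>J. A i j * x j) \<le> vnorm I (\<lambda>i. vnorm J (A i))"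
    by (simp add: mv_def)
qed

lemma vnorm_mv_le:
  assumes "finite I" "finite J"
  shows "vnorm I (mv J A x) \<le> opnorm I J A * vnorm J x"
proof (cases "vnorm J x = 0")
  case True
  then have "mv J A x i = 0" for i using assms by (simp add: vnorm_eq_0 mv_def)
  then show ?thesis using True by (simp add: vnorm_def)
next
  case False
  define c where "c = vnorm J x"
  have c: "c > 0" using False vnorm_nonneg[of J x] c_def by linarith
  have 1: "vnorm J (\<lambda>j. (1/c) * x j) \<le> 1" unfolding vnorm_scale using c by (simp add: c_def)
  have "vnorm I (\<lambda>i. \<Sum>j\<in>J. A i j * ((1/c) * x j)) \<le> opnorm I J A"
    unfolding opnorm_def
    by (rule cSup_upper[OF _ opnorm_bdd[OF assms]])
      (use 1 in \<open>blast intro: exI[of _ "\<lambda>j. (1/c) * x j"]\<close>)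
  also have "(\<lambda>i. \<Sum>j\<in>J. A i j * ((1/c) * x j)) = (\<lambda>i. (1/c) * mv J A x i)"
    using mv_scale[of J A "1/c" x] by (simp add: mv_def)
  finally show ?thesis unfolding vnorm_scale using c by (simp add: c_def field_simps)
qed

lemma opnorm_leI:
  assumes "\<And>x. vnorm I (mv J A x) \<le> B * vnorm J x" "0 \<le> B"
  shows "opnorm I J A \<le> B"
  unfolding opnorm_def
proof (rule cSup_least)
  show "{vnorm I (\<lambda>i. \<Sum>j\<in>J. A i j * x j) | x. vnorm J x \<le> 1} \<noteq> {}"
    using vnorm_zero[of J] by (auto intro!: exI[of _ "\<lambda>_. 0"])
  fix v assume "v \<in> {vnorm I (\<lambda>i. \<Sum>j\<in>J. A i j * x j) | x. vnorm J x \<le> 1}"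
  then obtain x where v: "v = vnorm I (mv J A x)" "vnorm J x \<le> 1" by (auto simp: mv_def)
  then have "v \<le> B * vnorm J x" using assms(1) by simp
  also have "\<dots> \<le> B * 1" using assms(2) v by (intro mult_left_mono) auto
  finally show "v \<le> B" by simp
qed

lemma opnorm_nonneg:
  assumes "finite I" "finite J"
  shows "0 \<le> opnorm I J A"
proof -
  have "vnorm I (\<lambda>i. \<Sum>j\<in>J. A i j * 0) \<le> opnorm I J A"
    unfolding opnorm_def
    by (rule cSup_upper[OF _ opnorm_bdd[OF assms]])
      (use vnorm_zero[of J] zero_le_one[where 'a=real] in \<open>auto intro!: exI[of _ "\<lambda>_. 0"] simp: vnorm_def\<close>)
  then show ?thesis by simp
qed

text \<open>Divides a^2 <= b a by a without asking for a > 0. Used whenever |v|^2 is written as an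
  inner product that contains v again.\<close>

lemma sq_le_mult: "a^2 \<le> b * a \<Longrightarrow> 0 \<le> b \<Longrightarrow> (a::real) \<le> b"
  by (smt (verit, ccfv_threshold) mult_le_cancel_right power2_eq_square)

text \<open>The transpose has no larger norm: |A^T y|^2 = <A A^T y, y>, and one factor |A^T y|
  cancels.\<close>

lemma vnorm_tmv_le:
  assumes "finite I" "finite J"
  shows "vnorm J (tmv I A y) \<le> opnorm I J A * vnorm I y"
proof (rule sq_le_mult)
  have "(vnorm J (tmv I A y))^2 = dot I (mv J A (tmv I A y)) y"
    by (simp add: vnorm_sq_dot dot_adjoint)
  also have "\<dots> \<le> vnorm I (mv J A (tmv I A y)) * vnorm I y"
    using dot_le[of I "mv J A (tmv I A y)" y] by linarith
  also have "\<dots> \<le> (opnorm I J A * vnorm J (tmv I A y)) * vnorm I y"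
    by (intro mult_right_mono vnorm_mv_le assms vnorm_nonneg)
  finally show "(vnorm J (tmv I A y))^2 \<le> opnorm I J A * vnorm I y * vnorm J (tmv I A y)"
    by (simp add: algebra_simps)
qed (simp add: opnorm_nonneg assms)

lemma opnorm_leI_tmv:
  assumes "\<And>y. vnorm J (tmv I A y) \<le> B * vnorm I y" "0 \<le> B"
  shows "opnorm I J A \<le> B"
proof (rule opnorm_leI)
  fix x
  show "vnorm I (mv J A x) \<le> B * vnorm J x"
  proof (rule sq_le_mult)
    have "(vnorm I (mv J A x))^2 = dot J x (tmv I A (mv J A x))"
      by (simp add: vnorm_sq_dot dot_adjoint)
    also have "\<dots> \<le> vnorm J x * vnorm J (tmv I A (mv J A x))"
      using dot_le[of J x "tmv I A (mv J A x)"] by linarith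
    also have "\<dots> \<le> vnorm J x * (B * vnorm I (mv J A x))"
      by (intro mult_left_mono assms vnorm_nonneg)
    finally show "(vnorm I (mv J A x))^2 \<le> B * vnorm J x * vnorm I (mv J A x)"
      by (simp add: algebra_simps)
  qed (simp add: assms)
qed (rule assms)

text \<open>Elimination with a pivot \<open>p\<close> of the last equation. It replaces dimension
  counts for matrices that are represented as functions: a nonzero vector in an intersection of
  subspaces, or surjectivity of a square matrix, is obtained by listing equations and
  unknowns.\<close>

lemma underdetermined:
  fixes H :: "nat \<Rightarrow> 'b \<Rightarrow> real"
  assumes "finite N" "k < card N"
  shows "\<exists>y. (\<exists>l\<in>N. y l \<noteq> 0) \<and> (\<forall>i<k. (\<Sum>l\<in>N. H i l * y l) = 0)"
  using assms
proof (induction k arbitrary: N H)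
  case 0
  then obtain l where "l \<in> N" by (metis card_gt_0_iff ex_in_conv)
  then show ?case by (intro exI[of _ "\<lambda>_. 1"]) auto
next
  case (Suc k)
  show ?case
  proof (cases "\<forall>l\<in>N. H k l = 0")
    case True
    obtain y where y: "\<exists>l\<in>N. y l \<noteq> 0" "\<forall>i<k. (\<Sum>l\<in>N. H i l * y l) = 0"
      using Suc.IH[of N H] Suc.prems by auto
    have "\<forall>i<Suc k. (\<Sum>l\<in>N. H i l * y l) = 0"
      using y(2) True by (auto simp: less_Suc_eq)
    then show ?thesis using y by blast
  next
    case False
    then obtain p where p: "p \<in> N" "H k p \<noteq> 0" by auto
    define N' where "N' = N - {p}"
    have N': "finite N'" "k < card N'" using Suc.prems p by (auto simp: N'_def)
    obtain y where y: "\<exists>l\<in>N'. y l \<noteq> 0"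
        "\<forall>i<k. (\<Sum>l\<in>N'. (H i l - H i p * H k l / H k p) * y l) = 0"
      using Suc.IH[OF N', of "\<lambda>i l. H i l - H i p * H k l / H k p"] by auto
    define c where "c = - (\<Sum>l\<in>N'. H k l * y l) / H k p"
    define z where "z = y(p := c)"
    have split: "(\<Sum>l\<in>N. H i l * z l) = H i p * c + (\<Sum>l\<in>N'. H i l * y l)" for i
      unfolding N'_def using Suc.prems(1) p(1)
      by (subst sum.remove[of N p]) (auto simp: z_def intro!: sum.cong)
    have "(\<Sum>l\<in>N. H i l * z l) = 0" if "i < Suc k" for i
    proof (cases "i = k")
      case True
      then show ?thesis unfolding split using p by (simp add: c_def)
    next
      case False
      then have "0 = (\<Sum>l\<in>N'. (H i l - H i p * H k l / H k p) * y l)" using y(2) that by simp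
      also have "\<dots> = (\<Sum>l\<in>N'. H i l * y l) - H i p / H k p * (\<Sum>l\<in>N'. H k l * y l)"
        by (simp add: sum_distrib_left sum_subtractf algebra_simps)
      finally show ?thesis unfolding split c_def by (simp add: algebra_simps)
    qed
    moreover have "\<exists>l\<in>N. z l \<noteq> 0" using y(1) by (auto simp: z_def N'_def)
    ultimately show ?thesis by blast
  qed
qed

text \<open>Columns are orthonormal or zero; allowing zero columns keeps the number of columns fixed
  in Gram--Schmidt orthogonalization of possibly dependent families.\<close>

definition sub_orth :: "nat \<Rightarrow> nat \<Rightarrow> mat \<Rightarrow> bool" where
  "sub_orth m k Q \<longleftrightarrow> (\<forall>l1<k. \<forall>l2<k. l1 \<noteq> l2 \<longrightarrow> dot {..<m} (\<lambda>i. Q i l1) (\<lambda>i. Q i l2) = 0)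
     \<and> (\<forall>l<k. dot {..<m} (\<lambda>i. Q i l) (\<lambda>i. Q i l) \<in> {0, 1})"

text \<open>Spectral norm at most one, by \<open>contr_snorm\<close>. The class contains the frames,
  the Gram-Schmidt families with zero columns and the matrices over which the suprema defining the
  beta quantities run, so one uniform bound serves all of them.\<close>

definition contr :: "nat \<Rightarrow> nat \<Rightarrow> mat \<Rightarrow> bool" where
  "contr m k U \<longleftrightarrow> (\<forall>y. vnorm {..<m} (mv {..<k} U y) \<le> vnorm {..<k} y)"

section \<open>Orthonormal frames, projections, Gram-Schmidt\<close>

lemma orth_sub_orth: "orth m k U \<Longrightarrow> sub_orth m k U"
  by (auto simp: orth_def sub_orth_def dot_def)

lemma orth_dot: "orth m k U \<Longrightarrow> l1 < k \<Longrightarrow> l2 < k \<Longrightarrow>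
    dot {..<m} (\<lambda>i. U i l1) (\<lambda>i. U i l2) = (if l1 = l2 then 1 else 0)"
  by (auto simp: orth_def dot_def)

lemma sub_orth_mv:
  assumes "sub_orth m k Q"
  shows "(vnorm {..<m} (mv {..<k} Q y))^2
    = (\<Sum>l<k. (y l)^2 * dot {..<m} (\<lambda>i. Q i l) (\<lambda>i. Q i l))"
proof -
  have "tmv {..<m} Q (mv {..<k} Q y) l = y l * dot {..<m} (\<lambda>i. Q i l) (\<lambda>i. Q i l)" if l: "l < k" for l
  proof -
    have "tmv {..<m} Q (mv {..<k} Q y) l = (\<Sum>l'<k. y l' * dot {..<m} (\<lambda>i. Q i l') (\<lambda>i. Q i l))"
      unfolding tmv_dot by (subst dot_commute, unfold mv_def, subst dot_sum_left)
        (simp add: dot_def sum_distrib_left algebra_simps)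
    also have "\<dots> = (\<Sum>l'<k. if l' = l then y l * dot {..<m} (\<lambda>i. Q i l) (\<lambda>i. Q i l) else 0)"
      using assms l by (intro sum.cong) (auto simp: sub_orth_def)
    finally show ?thesis using l by simp
  qed
  then show ?thesis unfolding vnorm_sq_dot dot_adjoint
    by (simp add: dot_def[of "{..<k}"] power2_eq_square algebra_simps)
qed

lemma sub_orth_contr:
  assumes "sub_orth m k Q" shows "contr m k Q"
  unfolding contr_def
proof (intro allI vnorm_le_vnormI)
  fix y
  have "(y l)^2 * dot {..<m} (\<lambda>i. Q i l) (\<lambda>i. Q i l) \<le> (y l)^2" if "l < k" for l
    using assms that by (auto simp: sub_orth_def)
  then show "(vnorm {..<m} (mv {..<k} Q y))\<^sup>2 \<le> (vnorm {..<k} y)\<^sup>2"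
    unfolding sub_orth_mv[OF assms] by (subst vnorm_sq) (auto intro: sum_mono)
qed

lemma orth_contr: "orth m k Q \<Longrightarrow> contr m k Q"
  by (rule sub_orth_contr[OF orth_sub_orth])

lemma orth_vnorm: "orth m k U \<Longrightarrow> vnorm {..<m} (mv {..<k} U y) = vnorm {..<k} y"
proof -
  assume U: "orth m k U"
  have "(vnorm {..<m} (mv {..<k} U y))^2 = (vnorm {..<k} y)^2"
    unfolding sub_orth_mv[OF orth_sub_orth[OF U]] by (subst vnorm_sq) (simp add: orth_dot[OF U])
  then show ?thesis by simp
qed

lemma contr_tmv: "contr m k U \<Longrightarrow> vnorm {..<k} (tmv {..<m} U z) \<le> vnorm {..<m} z"
proof -
  assume U: "contr m k U"
  have "opnorm {..<m} {..<k} U \<le> 1" by (rule opnorm_leI) (use U in \<open>auto simp: contr_def\<close>)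
  then have "opnorm {..<m} {..<k} U * vnorm {..<m} z \<le> 1 * vnorm {..<m} z"
    by (intro mult_right_mono) auto
  then show ?thesis using vnorm_tmv_le[of "{..<m}" "{..<k}" U z] by simp
qed

lemma contr_snorm: "contr m k U \<longleftrightarrow> snorm m k U \<le> 1"
proof
  assume "contr m k U"
  then show "snorm m k U \<le> 1" unfolding snorm_def by (intro opnorm_leI) (auto simp: contr_def)
next
  assume *: "snorm m k U \<le> 1"
  show "contr m k U" unfolding contr_def
  proof
    fix y
    have "vnorm {..<m} (mv {..<k} U y) \<le> snorm m k U * vnorm {..<k} y"
      unfolding snorm_def by (rule vnorm_mv_le) auto
    also have "\<dots> \<le> 1 * vnorm {..<k} y" using * by (intro mult_right_mono) auto
    finally show "vnorm {..<m} (mv {..<k} U y) \<le> vnorm {..<k} y" by simp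
  qed
qed

definition proj :: "nat \<Rightarrow> nat \<Rightarrow> mat \<Rightarrow> (nat \<Rightarrow> real) \<Rightarrow> nat \<Rightarrow> real" where
  "proj m k U z = mv {..<k} U (tmv {..<m} U z)"

lemma orth_tmv_mv: "orth m k U \<Longrightarrow> l < k \<Longrightarrow> tmv {..<m} U (mv {..<k} U y) l = y l"
proof -
  assume U: "orth m k U" and l: "l < k"
  have "tmv {..<m} U (mv {..<k} U y) l = (\<Sum>l'<k. y l' * dot {..<m} (\<lambda>i. U i l') (\<lambda>i. U i l))"
    unfolding tmv_dot by (subst dot_commute, unfold mv_def, subst dot_sum_left)
      (simp add: dot_def sum_distrib_left algebra_simps)
  also have "\<dots> = (\<Sum>l'<k. if l' = l then y l else 0)"
    using l by (intro sum.cong) (auto simp: orth_dot[OF U])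
  finally show ?thesis using l by simp
qed

lemma mv_cong: "(\<And>j. j \<in> J \<Longrightarrow> x j = y j) \<Longrightarrow> mv J A x = mv J A y"
  by (simp add: mv_def cong: sum.cong)

lemma tmv_proj: "orth m k U \<Longrightarrow> l < k \<Longrightarrow> tmv {..<m} U (proj m k U z) l = tmv {..<m} U z l"
  by (simp add: proj_def orth_tmv_mv)

lemma tmv_resid: "orth m k U \<Longrightarrow> l < k \<Longrightarrow> tmv {..<m} U (\<lambda>i. z i - proj m k U z i) l = 0"
  by (simp add: tmv_diff tmv_proj)

lemma pythagoras:
  assumes "orth m k U"
  shows "(vnorm {..<m} z)^2
    = (vnorm {..<k} (tmv {..<m} U z))^2 + (vnorm {..<m} (\<lambda>i. z i - proj m k U z i))^2"
proof -
  let ?w = "\<lambda>i. z i - proj m k U z i"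
  have 0: "dot {..<m} (proj m k U z) ?w = 0"
    unfolding proj_def dot_adjoint using tmv_resid[OF assms]
    by (simp add: dot_def proj_def[symmetric])
  have "(vnorm {..<m} z)^2 = dot {..<m} (\<lambda>i. proj m k U z i + ?w i) (\<lambda>i. proj m k U z i + ?w i)"
    by (simp add: vnorm_sq_dot)
  also have "\<dots> = (vnorm {..<m} (proj m k U z))^2 + (vnorm {..<m} ?w)^2"
    unfolding dot_add_left dot_add_right using 0 dot_commute[of "{..<m}" ?w "proj m k U z"]
    by (simp add: vnorm_sq_dot)
  finally show ?thesis unfolding proj_def orth_vnorm[OF assms] .
qed

lemma bessel:
  "orth m k U \<Longrightarrow> (vnorm {..<k} (tmv {..<m} U z))^2 \<le> (vnorm {..<m} z)^2"
  by (subst (2) pythagoras) auto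

text \<open>\<open>G\<close> is kept because orthogonality of \<open>D\<close> to another frame has
  to be inherited by \<open>Q\<close>, and the last clause because vectors in the span of
  \<open>D\<close> have to be recovered from their coordinates in \<open>Q\<close>.\<close>

lemma gram_schmidt:
  fixes D :: mat
  shows "\<exists>Q G. sub_orth m k Q \<and> (\<forall>l<k. \<forall>i<m. Q i l = (\<Sum>l'<k. D i l' * G l' l))
     \<and> (\<forall>l<k. \<forall>i<m. D i l = proj m k Q (\<lambda>i. D i l) i)"
proof (induction k)
  case 0
  show ?case by (auto simp: sub_orth_def)
next
  case (Suc k)
  then obtain Q G where Q: "sub_orth m k Q" and G: "\<forall>l<k. \<forall>i<m. Q i l = (\<Sum>l'<k. D i l' * G l' l)"
    and D: "\<forall>l<k. \<forall>i<m. D i l = proj m k Q (\<lambda>i. D i l) i" by blast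
  define c where "c = tmv {..<m} Q (\<lambda>i. D i k)"
  define v where "v = (\<lambda>i. D i k - mv {..<k} Q c i)"
  define nv where "nv = vnorm {..<m} v"
  \<comment> \<open>A dependent column yields a zero column of the new family rather than a shorter
    family.\<close>
  define w where "w = (\<lambda>i. if nv = 0 then 0 else v i / nv)"
  define Q' where "Q' = (\<lambda>i l. if l < k then Q i l else w i)"
  \<comment> \<open>Coefficients of \<open>w\<close> in the columns of \<open>D\<close>: column k
    itself has coefficient 1, the projection subtracted from it is rewritten through the earlier
    \<open>G\<close>, and everything is divided by the norm.\<close>
  define gk where "gk = (\<lambda>l'. if nv = 0 then 0 else
      (if l' = k then 1 else - (\<Sum>l<k. G l' l * c l)) / nv)"
  define G' where "G' = (\<lambda>l' l. if l < k then (if l' < k then G l' l else 0) else gk l')"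
  \<comment> \<open>On a zero column of \<open>Q\<close> the coefficient \<open>c l\<close> vanishes
    as well, so multiplying by the squared norm 0 or 1 changes nothing.\<close>
  have selfc: "dot {..<m} (\<lambda>i. Q i l) (\<lambda>i. Q i l) * c l = c l" if l: "l < k" for l
  proof -
    have "dot {..<m} (\<lambda>i. Q i l) (\<lambda>i. Q i l) \<in> {0,1}" using Q l by (auto simp: sub_orth_def)
    moreover have "c l = 0" if "dot {..<m} (\<lambda>i. Q i l) (\<lambda>i. Q i l) = 0"
    proof -
      have "vnorm {..<m} (\<lambda>i. Q i l) = 0" using that vnorm_sq_dot[of "{..<m}" "\<lambda>i. Q i l"] by simp
      then show ?thesis by (simp add: vnorm_eq_0 c_def tmv_def)
    qed
    ultimately show ?thesis by auto
  qed
  have Qv: "dot {..<m} (\<lambda>i. Q i l) v = 0" if l: "l < k" for l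
  proof -
    have "dot {..<m} (\<lambda>i. Q i l) (mv {..<k} Q c) = (\<Sum>l'<k. c l' * dot {..<m} (\<lambda>i. Q i l') (\<lambda>i. Q i l))"
      by (subst dot_commute, unfold mv_def, subst dot_sum_left)
        (simp add: dot_def sum_distrib_left algebra_simps)
    also have "\<dots> = (\<Sum>l'<k. if l' = l then c l * dot {..<m} (\<lambda>i. Q i l) (\<lambda>i. Q i l) else 0)"
      using Q l by (intro sum.cong) (auto simp: sub_orth_def)
    also have "\<dots> = c l" using l selfc[OF l] by (simp add: mult.commute)
    finally show ?thesis unfolding v_def dot_diff_right by (simp add: c_def tmv_dot)
  qed
  have w: "w = (\<lambda>i. (if nv = 0 then 0 else 1 / nv) * v i)" by (auto simp: w_def)
  have Qw: "dot {..<m} (\<lambda>i. Q i l) w = 0" if l: "l < k" for l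
    unfolding w dot_scale_right using Qv[OF l] by simp
  have ww: "dot {..<m} w w \<in> {0,1}"
    unfolding w dot_scale_right dot_scale_left vnorm_sq_dot[symmetric] nv_def[symmetric]
    by (auto simp: power2_eq_square)
  have so: "sub_orth m (Suc k) Q'"
    unfolding sub_orth_def
  proof (intro conjI allI impI)
    fix l1 l2 assume "l1 < Suc k" "l2 < Suc k" "l1 \<noteq> l2"
    then show "dot {..<m} (\<lambda>i. Q' i l1) (\<lambda>i. Q' i l2) = 0"
      using Q Qw dot_commute[of "{..<m}" w] by (auto simp: Q'_def less_Suc_eq sub_orth_def)
  next
    fix l assume "l < Suc k"
    then show "dot {..<m} (\<lambda>i. Q' i l) (\<lambda>i. Q' i l) \<in> {0,1}"
      using Q ww by (cases "l = k") (auto simp: Q'_def sub_orth_def)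
  qed
  have exp: "Q' i l = (\<Sum>l'<Suc k. D i l' * G' l' l)" if "l < Suc k" "i < m" for i l
  proof (cases "l < k")
    case True
    then show ?thesis using G that by (auto simp: Q'_def G'_def intro!: sum.cong)
  next
    case False
    then have l: "l = k" using that by simp
    have "mv {..<k} Q c i = (\<Sum>l<k. (\<Sum>l'<k. D i l' * G l' l) * c l)"
      using G that by (simp add: mv_def)
    also have "\<dots> = (\<Sum>l'<k. D i l' * (\<Sum>l<k. G l' l * c l))"
      unfolding sum_distrib_right sum_distrib_left by (subst sum.swap) (simp add: algebra_simps)
    finally have "v i = D i k + (\<Sum>l'<k. D i l' * - (\<Sum>l<k. G l' l * c l))"
      by (simp add: v_def sum_negf)
    then have "v i / nv = (\<Sum>l'<k. D i l' * (- (\<Sum>l<k. G l' l * c l) / nv)) + D i k * (1 / nv)"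
      by (simp only: times_divide_eq_right sum_divide_distrib[symmetric]) (simp add: add_divide_distrib)
    then show ?thesis using l
      by (auto simp: Q'_def G'_def w_def gk_def intro!: sum.cong)
  qed
  have Q'0: "proj m (Suc k) Q' z i = proj m k Q z i + w i * dot {..<m} w z" for z i
    by (simp add: proj_def mv_def tmv_def Q'_def dot_def)
  have vi: "v i = w i * dot {..<m} w v" if "i < m" for i
  proof (cases "nv = 0")
    case True
    then have "v i = 0" using that by (simp add: nv_def vnorm_eq_0)
    then show ?thesis by (simp add: w)
  next
    case False
    have "dot {..<m} w v = nv" unfolding w dot_scale_left vnorm_sq_dot[symmetric] nv_def[symmetric]
      using False by (simp add: power2_eq_square)
    then show ?thesis using False by (simp add: w)
  qed
  have wD: "dot {..<m} w (mv {..<k} Q y) = 0" for y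
    by (subst dot_commute, subst dot_adjoint) (simp add: dot_def tmv_dot Qw[unfolded dot_def])
  have rec: "D i l = proj m (Suc k) Q' (\<lambda>i. D i l) i" if "l < Suc k" "i < m" for i l
  proof (cases "l < k")
    case True
    then have "dot {..<m} w (\<lambda>i. D i l) = dot {..<m} w (proj m k Q (\<lambda>i. D i l))"
      using D by (intro dot_cong) auto
    also have "\<dots> = 0" by (simp add: proj_def wD)
    finally show ?thesis using D True that by (simp add: Q'0)
  next
    case False
    then have l: "l = k" using that by simp
    have "dot {..<m} w v = dot {..<m} w (\<lambda>i. D i k)"
      unfolding v_def dot_diff_right wD by simp
    moreover have "D i k = proj m k Q (\<lambda>i. D i k) i + v i" by (simp add: v_def proj_def c_def)
    ultimately show ?thesis using vi[OF that(2)] unfolding l Q'0 by simp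
  qed
  show ?case using so exp rec by blast
qed

section \<open>Leading singular subspaces\<close>

lemma vnorm_orth_sum:
  fixes f :: "nat \<Rightarrow> 'c \<Rightarrow> real"
  assumes "\<And>l l'. l < k \<Longrightarrow> l' < k \<Longrightarrow> l \<noteq> l' \<Longrightarrow> dot C (f l) (f l') = 0"
  shows "(vnorm C (\<lambda>j. \<Sum>l<k. y l * f l j))^2 = (\<Sum>l<k. (y l)^2 * (vnorm C (f l))^2)"
proof -
  have "(vnorm C (\<lambda>j. \<Sum>l<k. y l * f l j))^2
      = (\<Sum>l<k. y l * dot C (f l) (\<lambda>j. \<Sum>l<k. y l * f l j))"
    unfolding vnorm_sq_dot by (subst dot_sum_left) (simp add: dot_scale_left)
  also have "\<dots> = (\<Sum>l<k. y l * (\<Sum>l'<k. y l' * dot C (f l') (f l)))"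
    by (subst dot_commute, subst dot_sum_left) (simp add: dot_scale_left)
  also have "\<dots> = (\<Sum>l<k. y l * (\<Sum>l'<k. if l' = l then y l * dot C (f l) (f l) else 0))"
    using assms by (intro sum.cong refl arg_cong2[where f="(*)"]) auto
  finally show ?thesis unfolding vnorm_sq_dot by (simp add: power2_eq_square algebra_simps)
qed

lemma tmv_mv: "tmv I A (mv L F y) = (\<lambda>j. \<Sum>l\<in>L. y l * tmv I A (\<lambda>i. F i l) j)"
  unfolding tmv_def mv_def sum_distrib_left sum_distrib_right
  by (subst sum.swap) (simp add: algebra_simps)

text \<open>What perturbation theory needs from leading left singular vectors: they are eigenvectors
  of A A^T, and on their orthogonal complement A A^T stays below each of their eigenvalues. No
  ordering of the columns is recorded and the column set of A is arbitrary, so the notion is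
  invariant under enumeration of the columns.\<close>

definition lead :: "'c set \<Rightarrow> nat \<Rightarrow> (nat \<Rightarrow> 'c \<Rightarrow> real) \<Rightarrow> nat \<Rightarrow> mat \<Rightarrow> bool" where
  "lead C m A k U \<longleftrightarrow> orth m k U \<and> (\<exists>s.
     (\<forall>l<k. \<forall>i<m. mv C A (tmv {..<m} A (\<lambda>i. U i l)) i = s l * U i l) \<and>
     (\<forall>l<k. \<forall>z. (\<forall>l'<k. dot {..<m} (\<lambda>i. U i l') z = 0) \<longrightarrow>
        (vnorm C (tmv {..<m} A z))^2 \<le> s l * (vnorm {..<m} z)^2))"

lemma dot_tmv_tmv: "dot C (tmv I A u) (tmv I A v) = dot I (mv C A (tmv I A v)) u"
  by (subst dot_adjoint) (simp add: dot_commute)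

lemma eig_dot:
  assumes "\<forall>i<m. mv C A (tmv {..<m} A v) i = s * v i"
  shows "dot C (tmv {..<m} A u) (tmv {..<m} A v) = s * dot {..<m} v u"
proof -
  have "dot C (tmv {..<m} A u) (tmv {..<m} A v) = dot {..<m} (\<lambda>i. s * v i) u"
    unfolding dot_tmv_tmv using assms by (intro dot_cong) auto
  then show ?thesis by (simp add: dot_scale_left)
qed

section \<open>Max-min singular values\<close>

lemma unit_vec: "0 < k \<Longrightarrow> vnorm {..<k} (\<lambda>l. if l = (0::nat) then 1 else 0) = 1"
  by (simp add: vnorm_def if_distrib[where f="\<lambda>x. x^2"] cong: if_cong)

lemma sval_bdd:
  fixes A :: mat
  assumes "0 < k"
  shows "bdd_above {Inf {vnorm {..<n} (tmv {..<m} A (mv {..<k} U y)) | y. vnorm {..<k} y = 1} | U. orth m k U}"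
proof (rule bdd_aboveI, safe)
  fix U assume U: "orth m k U"
  let ?e = "\<lambda>l. if l = (0::nat) then 1 else 0 :: real"
  have "Inf {vnorm {..<n} (tmv {..<m} A (mv {..<k} U y)) | y. vnorm {..<k} y = 1}
      \<le> vnorm {..<n} (tmv {..<m} A (mv {..<k} U ?e))"
    by (rule cInf_lower) (use unit_vec[OF assms] in \<open>auto intro!: bdd_belowI[of _ 0]\<close>)
  also have "\<dots> \<le> opnorm {..<m} {..<n} A * vnorm {..<m} (mv {..<k} U ?e)"
    by (rule vnorm_tmv_le) simp_all
  also have "\<dots> = opnorm {..<m} {..<n} A" by (simp add: orth_vnorm[OF U] unit_vec assms)
  finally show "Inf {vnorm {..<n} (tmv {..<m} A (mv {..<k} U y)) | y. vnorm {..<k} y = 1}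
      \<le> opnorm {..<m} {..<n} A" .
qed

lemma sval_eq: "sval m n A k =
    Sup {Inf {vnorm {..<n} (tmv {..<m} A (mv {..<k} U y)) | y. vnorm {..<k} y = 1} | U. orth m k U}"
  by (simp add: sval_def tmv_def mv_def)

lemma sval_ge:
  assumes "orth m k U" "0 < k"
    and "\<And>y. vnorm {..<k} y = 1 \<Longrightarrow> c \<le> vnorm {..<n} (tmv {..<m} A (mv {..<k} U y))"
  shows "c \<le> sval m n A k"
proof -
  have "c \<le> Inf {vnorm {..<n} (tmv {..<m} A (mv {..<k} U y)) | y. vnorm {..<k} y = 1}"
    by (rule cInf_greatest) (use assms unit_vec[OF assms(2)] in blast)+
  also have "\<dots> \<le> sval m n A k" unfolding sval_eq
    by (rule cSup_upper[OF _ sval_bdd]) (use assms in auto)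
  finally show ?thesis .
qed

text \<open>Attainment of the supremum is not established, so a frame is extracted for every c
  strictly below it; \<open>U0\<close> shows that the family of competitors is nonempty.\<close>

lemma sval_witness:
  assumes "orth m k U0" "0 < k" "c < sval m n A k"
  shows "\<exists>U. orth m k U \<and> (\<forall>y. c * vnorm {..<k} y \<le> vnorm {..<n} (tmv {..<m} A (mv {..<k} U y)))"
proof -
  let ?F = "\<lambda>U. {vnorm {..<n} (tmv {..<m} A (mv {..<k} U y)) | y. vnorm {..<k} y = 1}"
  have "\<exists>v\<in>{Inf (?F U) | U. orth m k U}. c < v"
    using less_cSupD[of "{Inf (?F U) | U. orth m k U}" c] assms unfolding sval_eq by blast
  then obtain U where U: "orth m k U" "c < Inf (?F U)" by blast
  have "c * vnorm {..<k} y \<le> vnorm {..<n} (tmv {..<m} A (mv {..<k} U y))" for y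
  proof (cases "vnorm {..<k} y = 0")
    case False
    then have ny: "0 < vnorm {..<k} y" by (simp add: less_le)
    define w where "w = (\<lambda>i. (1 / vnorm {..<k} y) * y i)"
    have "vnorm {..<k} w = 1" unfolding w_def vnorm_scale using ny by simp
    then have "Inf (?F U) \<le> vnorm {..<n} (tmv {..<m} A (mv {..<k} U w))"
      by (intro cInf_lower) (auto intro!: bdd_belowI[of _ 0])
    also have "\<dots> = vnorm {..<n} (tmv {..<m} A (mv {..<k} U y)) / vnorm {..<k} y"
      unfolding w_def mv_scale tmv_scale vnorm_scale using ny by simp
    finally have "c \<le> vnorm {..<n} (tmv {..<m} A (mv {..<k} U y)) / vnorm {..<k} y"
      using U(2) by linarith
    then show ?thesis using ny by (simp add: field_simps)
  qed simp
  then show ?thesis using U by blast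
qed

text \<open>The eigenvalues are given as squares of max-min values; domination on the complement has
  to be deduced. For a unit w orthogonal to all columns put zeta = |A^T w|. If zeta is at most each
  of the first l values, then the first l columns together with w form a competitor F for value l +
  1 with |A^T F y| >= zeta on unit y, so zeta is at most that value too.\<close>

lemma lead_lsv_lead:
  assumes L: "lead_lsv m n A k U"
  shows "lead {..<n} m A k U"
proof -
  define s where "s = (\<lambda>l. (sval m n A (Suc l))^2)"
  have U: "orth m k U" using L by (simp add: lead_lsv_def)
  have gram: "mv {..<n} A (tmv {..<m} A v) i = (\<Sum>i'<m. (\<Sum>j<n. A i j * A i' j) * v i')" for v i
    unfolding mv_def tmv_def sum_distrib_left sum_distrib_right
    by (subst sum.swap) (simp add: algebra_simps)
  have eig: "\<forall>i<m. mv {..<n} A (tmv {..<m} A (\<lambda>i. U i l)) i = s l * U i l" if "l < k" for l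
    using L that unfolding gram by (simp add: lead_lsv_def s_def)
  have norm_eig: "(vnorm {..<n} (tmv {..<m} A (\<lambda>i. U i l)))^2 = s l" if "l < k" for l
    unfolding vnorm_sq_dot eig_dot[OF eig[OF that]] using orth_dot[OF U that that] by simp
  have dominated: "(vnorm {..<n} (tmv {..<m} A z))^2 \<le> s l * (vnorm {..<m} z)^2"
    if z: "\<forall>l'<k. dot {..<m} (\<lambda>i. U i l') z = 0" and l: "l < k" for z l
  proof (cases "vnorm {..<m} z = 0")
    case True
    then have "tmv {..<m} A z = (\<lambda>j. 0)" by (simp add: tmv_def vnorm_eq_0)
    then show ?thesis using True by simp
  next
    case False
    define nz where "nz = vnorm {..<m} z"
    have nz: "0 < nz" using False vnorm_nonneg[of "{..<m}" z] by (simp add: nz_def less_le)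
    define w where "w = (\<lambda>i. (1 / nz) * z i)"
    have w1: "dot {..<m} w w = 1"
      unfolding w_def dot_scale_left dot_scale_right vnorm_sq_dot[symmetric] nz_def[symmetric]
      using nz by (simp add: power2_eq_square)
    have wU: "dot {..<m} (\<lambda>i. U i l') w = 0" if "l' < k" for l'
      using z that unfolding w_def dot_scale_right by simp
    define zeta where "zeta = vnorm {..<n} (tmv {..<m} A w)"
    have "zeta \<le> sval m n A (Suc l)" using l
    proof (induction l rule: less_induct)
      case (less l)
      define F where "F = (\<lambda>i l'. if l' < l then U i l' else w i)"
      have Fo: "orth m (Suc l) F" unfolding orth_def
      proof (intro allI impI)
        fix j1 j2 assume "j1 < Suc l" "j2 < Suc l"
        moreover have "dot {..<m} w (\<lambda>i. U i l') = 0" if "l' < k" for l'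
          using wU[OF that] by (simp only: dot_commute)
        moreover have "(\<lambda>i. F i l') = (if l' < l then (\<lambda>i. U i l') else w)" for l'
          by (auto simp: F_def)
        ultimately have "dot {..<m} (\<lambda>i. F i j1) (\<lambda>i. F i j2) = (if j1 = j2 then 1 else 0)"
          using orth_dot[OF U] wU w1 less.prems by (auto simp: less_Suc_eq)
        then show "(\<Sum>i<m. F i j1 * F i j2) = (if j1 = j2 then 1 else 0)" by (simp add: dot_def)
      qed
      show ?case
      proof (rule sval_ge[OF Fo])
        fix y :: "nat \<Rightarrow> real" assume y: "vnorm {..<Suc l} y = 1"
        have F1: "(\<lambda>i. F i l') = (if l' < l then (\<lambda>i. U i l') else w)" for l' by (auto simp: F_def)
        have UU: "dot {..<n} (tmv {..<m} A (\<lambda>i. U i l1)) (tmv {..<m} A (\<lambda>i. U i l2)) = 0"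
          if "l1 < k" "l2 < k" "l1 \<noteq> l2" for l1 l2
          using eig_dot[OF eig[OF that(2)], of "\<lambda>i. U i l1"] orth_dot[OF U that(2,1)] that by simp
        have wU': "dot {..<n} (tmv {..<m} A w) (tmv {..<m} A (\<lambda>i. U i l2)) = 0"
          if "l2 < k" for l2
          using eig_dot[OF eig[OF that], of w] wU[OF that] by simp
        have orthog: "dot {..<n} (tmv {..<m} A (\<lambda>i. F i l1)) (tmv {..<m} A (\<lambda>i. F i l2)) = 0"
          if "l1 < Suc l" "l2 < Suc l" "l1 \<noteq> l2" for l1 l2
        proof (cases "l1 < l")
          case True
          then show ?thesis
          proof (cases "l2 < l")
            case True
            then show ?thesis using \<open>l1 < l\<close> UU[of l1 l2] that less.prems by (simp add: F1)
          next
            case False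
            then show ?thesis using \<open>l1 < l\<close> wU'[of l1] less.prems
              by (simp add: F1 dot_commute[of _ "tmv {..<m} A (\<lambda>i. U i l1)"])
          qed
        next
          case False
          then have "l2 < l" using that by auto
          then show ?thesis using False wU'[of l2] less.prems by (simp add: F1)
        qed
        have ge: "zeta^2 \<le> (vnorm {..<n} (tmv {..<m} A (\<lambda>i. F i l')))^2" if "l' < Suc l" for l'
        proof (cases "l' < l")
          case True
          then have "zeta \<le> sval m n A (Suc l')" using less by simp
          then have "zeta^2 \<le> s l'" unfolding s_def by (intro power_mono) (simp_all add: zeta_def)
          then show ?thesis using True less.prems norm_eig[of l'] by (simp add: F1)
        qed (simp add: F1 zeta_def)
        have "zeta^2 = (\<Sum>l'<Suc l. (y l')^2 * zeta^2)"
          using y vnorm_sq[of "{..<Suc l}" y] by (simp add: sum_distrib_right[symmetric])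
        also have "\<dots> \<le> (\<Sum>l'<Suc l. (y l')^2 * (vnorm {..<n} (tmv {..<m} A (\<lambda>i. F i l')))^2)"
          by (intro sum_mono mult_left_mono ge) auto
        also have "\<dots> = (vnorm {..<n} (tmv {..<m} A (mv {..<Suc l} F y)))^2"
          unfolding tmv_mv by (rule vnorm_orth_sum[symmetric]) (use orthog in auto)
        finally show "zeta \<le> vnorm {..<n} (tmv {..<m} A (mv {..<Suc l} F y))"
          by (rule power2_le_imp_le) simp
      qed simp
    qed
    then have "zeta^2 \<le> s l" unfolding s_def by (intro power_mono) (simp_all add: zeta_def)
    moreover have "zeta = vnorm {..<n} (tmv {..<m} A z) / nz"
      unfolding zeta_def w_def tmv_scale vnorm_scale using nz by simp
    ultimately show ?thesis using nz by (simp add: power_divide divide_le_eq nz_def)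
  qed
  show ?thesis unfolding lead_def using U eig dominated by blast
qed

section \<open>Perturbation of leading subspaces\<close>

lemma lead_norm_eig:
  assumes "orth m k U" "l < k" "\<forall>i<m. mv C A (tmv {..<m} A (\<lambda>i. U i l)) i = s * U i l"
  shows "(vnorm C (tmv {..<m} A (\<lambda>i. U i l)))^2 = s"
  unfolding vnorm_sq_dot eig_dot[OF assms(3)] using orth_dot[OF assms(1,2,2)] by simp

text \<open>Weyl's bound for the first omitted singular value. On the span of the columns of
  \<open>U\<close> and z, M^T maps an orthogonal basis to orthogonal vectors and stretches each
  basis vector by at least |M^T z| / |z|. This span has dimension k + 1, hence contains a nonzero w
  orthogonal to the k columns of \<open>W\<close>, where M^T w = E^T w.\<close>

lemma lead_spectral:
  assumes L: "lead C m M k U" and M: "\<And>i j. i < m \<Longrightarrow> j \<in> C \<Longrightarrow> M i j = (\<Sum>l<k. W i l * B l j) + E i j"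
    and e: "\<And>w. vnorm C (tmv {..<m} E w) \<le> e * vnorm {..<m} w" "0 \<le> e"
    and z: "\<forall>l<k. dot {..<m} (\<lambda>i. U i l) z = 0"
  shows "vnorm C (tmv {..<m} M z) \<le> e * vnorm {..<m} z"
proof (cases "vnorm {..<m} z = 0")
  case True
  then have "tmv {..<m} M z = (\<lambda>j. 0)" by (simp add: tmv_def vnorm_eq_0)
  then show ?thesis using True by simp
next
  case False
  obtain s where U: "orth m k U"
    and eig: "\<And>l. l < k \<Longrightarrow> \<forall>i<m. mv C M (tmv {..<m} M (\<lambda>i. U i l)) i = s l * U i l"
    and dom: "\<And>l. l < k \<Longrightarrow> (vnorm C (tmv {..<m} M z))^2 \<le> s l * (vnorm {..<m} z)^2"
    using L z unfolding lead_def by blast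
  define nz where "nz = vnorm {..<m} z"
  have nz: "0 < nz" using False vnorm_nonneg[of "{..<m}" z] by (simp add: nz_def less_le)
  define F where "F = (\<lambda>i l. if l < k then U i l else z i / nz)"
  have F1: "(\<lambda>i. F i l) = (if l < k then (\<lambda>i. U i l) else (\<lambda>i. (1 / nz) * z i))" for l
    by (auto simp: F_def)
  have Fo: "orth m (Suc k) F" unfolding orth_def
  proof (intro allI impI)
    fix j1 j2 assume "j1 < Suc k" "j2 < Suc k"
    moreover have "dot {..<m} z z = nz^2" by (simp add: nz_def vnorm_sq_dot)
    then have "dot {..<m} (\<lambda>i. (1 / nz) * z i) (\<lambda>i. (1 / nz) * z i) = 1"
      unfolding dot_scale_left dot_scale_right using nz by (simp add: power2_eq_square)
    moreover have "dot {..<m} (\<lambda>i. U i l) (\<lambda>i. (1 / nz) * z i) = 0"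
      "dot {..<m} (\<lambda>i. (1 / nz) * z i) (\<lambda>i. U i l) = 0" if "l < k" for l
      unfolding dot_scale_left dot_scale_right using z that dot_commute[of "{..<m}" z "\<lambda>i. U i l"] by simp_all
    ultimately have "dot {..<m} (\<lambda>i. F i j1) (\<lambda>i. F i j2) = (if j1 = j2 then 1 else 0)"
      using orth_dot[OF U] unfolding F1 by (auto simp: less_Suc_eq simp del: times_divide_eq_left)
    then show "(\<Sum>i<m. F i j1 * F i j2) = (if j1 = j2 then 1 else 0)" by (simp add: dot_def)
  qed
  \<comment> \<open>k conditions on k + 1 coefficients: the resulting vector \<open>w\<close> kills
    the low-rank part.\<close>
  obtain y where y: "\<exists>l\<in>{..k}. y l \<noteq> 0"
      "\<forall>i<k. (\<Sum>l\<in>{..k}. dot {..<m} (\<lambda>j. W j i) (\<lambda>j. F j l) * y l) = 0"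
    using underdetermined[of "{..k}" k "\<lambda>i l. dot {..<m} (\<lambda>j. W j i) (\<lambda>j. F j l)"] by auto
  define w where "w = mv {..<Suc k} F y"
  have Ww: "dot {..<m} (\<lambda>j. W j i) w = 0" if "i < k" for i
  proof -
    have "dot {..<m} (\<lambda>j. W j i) w = (\<Sum>l<Suc k. y l * dot {..<m} (\<lambda>j. F j l) (\<lambda>j. W j i))"
      unfolding w_def mv_def by (subst dot_commute, subst dot_sum_left)
        (simp only: dot_scale_right dot_scale_left mult.commute)
    also have "\<dots> = (\<Sum>l\<in>{..k}. dot {..<m} (\<lambda>j. W j i) (\<lambda>j. F j l) * y l)"
      by (simp add: lessThan_Suc_atMost dot_commute mult.commute)
    finally show ?thesis using y(2) that by simp
  qed
  have "tmv {..<m} M w j = tmv {..<m} E w j" if j: "j \<in> C" for j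
  proof -
    have "tmv {..<m} M w j = (\<Sum>i<m. (\<Sum>l<k. W i l * B l j) * w i) + tmv {..<m} E w j"
      using M j by (simp add: tmv_def sum.distrib[symmetric] algebra_simps)
    also have "(\<Sum>i<m. (\<Sum>l<k. W i l * B l j) * w i) = (\<Sum>l<k. B l j * dot {..<m} (\<lambda>i. W i l) w)"
      unfolding sum_distrib_right dot_def sum_distrib_left
      by (subst sum.swap) (simp add: algebra_simps)
    also have "\<dots> = 0" using Ww by simp
    finally show ?thesis by simp
  qed
  then have Mw: "vnorm C (tmv {..<m} M w) \<le> e * vnorm {..<m} w"
    using e(1)[of w] vnorm_cong[of C "tmv {..<m} M w" "tmv {..<m} E w"] by simp
  define t where "t = (vnorm C (tmv {..<m} M z))^2 / nz^2"
  have UU: "dot C (tmv {..<m} M (\<lambda>i. U i l1)) (tmv {..<m} M (\<lambda>i. U i l2)) = 0"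
    if "l1 < k" "l2 < k" "l1 \<noteq> l2" for l1 l2
    using eig_dot[OF eig[OF that(2)], of "\<lambda>i. U i l1"] orth_dot[OF U that(2,1)] that by simp
  have zU: "dot C (tmv {..<m} M z) (tmv {..<m} M (\<lambda>i. U i l2)) = 0" if "l2 < k" for l2
    using eig_dot[OF eig[OF that], of z] z that by simp
  define v where "v = (\<lambda>i. (1 / nz) * z i)"
  have zv: "dot C (tmv {..<m} M v) (tmv {..<m} M (\<lambda>i. U i l2)) = 0"
    "dot C (tmv {..<m} M (\<lambda>i. U i l2)) (tmv {..<m} M v) = 0" if "l2 < k" for l2
    unfolding v_def tmv_scale dot_scale_left dot_scale_right
    using zU[OF that] dot_commute[of C "tmv {..<m} M (\<lambda>i. U i l2)"] by simp_all
  have F2: "(\<lambda>i. F i l) = (if l < k then (\<lambda>i. U i l) else v)" for l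
    by (auto simp: F_def v_def)
  have orthog: "dot C (tmv {..<m} M (\<lambda>i. F i l1)) (tmv {..<m} M (\<lambda>i. F i l2)) = 0"
    if "l1 < Suc k" "l2 < Suc k" "l1 \<noteq> l2" for l1 l2
    using that UU zv unfolding F2 by (auto simp: less_Suc_eq)
  have ge: "t \<le> (vnorm C (tmv {..<m} M (\<lambda>i. F i l)))^2" if "l < Suc k" for l
  proof (cases "l < k")
    case True
    then show ?thesis using dom[OF True] nz lead_norm_eig[OF U True eig[OF True]]
      by (simp add: F1 t_def nz_def[symmetric] divide_le_eq)
  next
    case False
    have "vnorm C (tmv {..<m} M (\<lambda>i. (1 / nz) * z i)) = vnorm C (tmv {..<m} M z) / nz"
      unfolding tmv_scale vnorm_scale using nz by simp
    then show ?thesis using False by (simp only: F1 if_False t_def power_divide order_refl)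
  qed
  have nw: "(vnorm {..<m} w)^2 = (\<Sum>l<Suc k. (y l)^2)"
    unfolding w_def orth_vnorm[OF Fo] vnorm_sq ..
  have "t * (vnorm {..<m} w)^2 \<le> (\<Sum>l<Suc k. (y l)^2 * (vnorm C (tmv {..<m} M (\<lambda>i. F i l)))^2)"
    unfolding nw sum_distrib_left
    by (intro sum_mono) (metis ge lessThan_iff mult.commute mult_right_mono zero_le_power2)
  also have "\<dots> = (vnorm C (tmv {..<m} M w))^2"
    unfolding w_def tmv_mv by (rule vnorm_orth_sum[symmetric]) (use orthog in auto)
  also have "\<dots> \<le> (e * vnorm {..<m} w)^2" using Mw by (intro power_mono) auto
  finally have "t * (vnorm {..<m} w)^2 \<le> e^2 * (vnorm {..<m} w)^2" by (simp add: power_mult_distrib)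
  moreover have "0 < (vnorm {..<m} w)^2"
  proof -
    obtain l where "l < Suc k" "y l \<noteq> 0" using y(1) by (auto simp: less_Suc_eq_le)
    then show ?thesis unfolding nw by (intro sum_pos2[of _ l]) auto
  qed
  ultimately have "t \<le> e^2" by simp
  then have "(vnorm C (tmv {..<m} M z))^2 \<le> (e * nz)^2"
    using nz by (simp add: t_def divide_le_eq power_mult_distrib)
  moreover have "0 \<le> e * nz" using e(2) nz by simp
  ultimately show ?thesis unfolding nz_def[symmetric] by (rule power2_le_imp_le)
qed

text \<open>With \<open>mu\<close> the smallest eigenvalue, a vector q splits into a part in the
  span of \<open>U\<close>, weighted by \<open>s l\<close>, and a part in the complement, weighted
  by at most \<open>mu\<close>. Summed over the frame \<open>Q\<close>, each direction of
  \<open>U\<close> receives weight \<open>t l\<close> <= 1 by Bessel, so lifting the missing weight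
  from \<open>mu\<close> to \<open>s l\<close> only increases the sum.\<close>

lemma ky_fan:
  assumes L: "lead C m M k U" and Q: "orth m k Q"
  shows "(\<Sum>l<k. (vnorm C (tmv {..<m} M (\<lambda>i. Q i l)))^2) \<le> (\<Sum>l<k. (vnorm C (tmv {..<m} M (\<lambda>i. U i l)))^2)"
proof (cases "k = 0")
  case False
  obtain s where U: "orth m k U"
    and eig: "\<And>l. l < k \<Longrightarrow> \<forall>i<m. mv C M (tmv {..<m} M (\<lambda>i. U i l)) i = s l * U i l"
    and dom: "\<And>l z. l < k \<Longrightarrow> \<forall>l'<k. dot {..<m} (\<lambda>i. U i l') z = 0 \<Longrightarrow>
        (vnorm C (tmv {..<m} M z))^2 \<le> s l * (vnorm {..<m} z)^2"
    using L unfolding lead_def by blast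
  define mu where "mu = Min (s ` {..<k})"
  have mu: "mu \<le> s l" if "l < k" for l unfolding mu_def using that by (intro Min_le) auto
  obtain l0 where l0: "l0 < k" "mu = s l0"
    using Min_in[of "s ` {..<k}"] False unfolding mu_def by fastforce
  have UU: "dot C (tmv {..<m} M (\<lambda>i. U i l1)) (tmv {..<m} M (\<lambda>i. U i l2)) = 0"
    if "l1 < k" "l2 < k" "l1 \<noteq> l2" for l1 l2
    using eig_dot[OF eig[OF that(2)], of "\<lambda>i. U i l1"] orth_dot[OF U that(2,1)] that by simp
  have step: "(vnorm C (tmv {..<m} M q))^2 \<le>
      (\<Sum>l<k. s l * (tmv {..<m} U q l)^2) + mu * ((vnorm {..<m} q)^2 - (\<Sum>l<k. (tmv {..<m} U q l)^2))" for q
  proof -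
    define a where "a = proj m k U q"
    define b where "b = (\<lambda>i. q i - a i)"
    have b0: "\<forall>l<k. dot {..<m} (\<lambda>i. U i l) b = 0"
      using tmv_resid[OF U] by (simp add: b_def a_def tmv_dot)
    have Ma: "tmv {..<m} M a = (\<lambda>j. \<Sum>l<k. tmv {..<m} U q l * tmv {..<m} M (\<lambda>i. U i l) j)"
      by (simp add: a_def proj_def tmv_mv)
    have ab: "dot C (tmv {..<m} M a) (tmv {..<m} M b) = 0"
      unfolding Ma dot_sum_left dot_scale_left
    proof (intro sum.neutral ballI)
      fix l assume "l \<in> {..<k}"
      then have l: "l < k" by simp
      have "dot C (tmv {..<m} M (\<lambda>i. U i l)) (tmv {..<m} M b) = 0"
        using eig_dot[OF eig[OF l], of b] b0 l by (simp add: dot_commute[of C "tmv {..<m} M (\<lambda>i. U i l)"])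
      then show "tmv {..<m} U q l * dot C (tmv {..<m} M (\<lambda>i. U i l)) (tmv {..<m} M b) = 0" by simp
    qed
    have "(vnorm C (tmv {..<m} M q))^2 = (vnorm C (\<lambda>j. tmv {..<m} M a j + tmv {..<m} M b j))^2"
      unfolding tmv_add[symmetric] by (simp add: b_def)
    also have "\<dots> = (vnorm C (tmv {..<m} M a))^2 + (vnorm C (tmv {..<m} M b))^2"
      unfolding vnorm_sq_dot dot_add_left dot_add_right
      using ab dot_commute[of C "tmv {..<m} M a" "tmv {..<m} M b"] by simp
    also have "(vnorm C (tmv {..<m} M a))^2 = (\<Sum>l<k. (tmv {..<m} U q l)^2 * (vnorm C (tmv {..<m} M (\<lambda>i. U i l)))^2)"
      unfolding Ma by (rule vnorm_orth_sum) (rule UU)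
    also have "\<dots> = (\<Sum>l<k. s l * (tmv {..<m} U q l)^2)"
      by (intro sum.cong refl) (simp add: lead_norm_eig[OF U _ eig])
    also have "(vnorm C (tmv {..<m} M b))^2 \<le> mu * (vnorm {..<m} b)^2"
      unfolding l0(2) using dom[OF l0(1) b0] .
    also have "(vnorm {..<m} b)^2 = (vnorm {..<m} q)^2 - (vnorm {..<k} (tmv {..<m} U q))^2"
      unfolding b_def a_def using pythagoras[OF U, of q] by simp
    finally show ?thesis by (simp add: vnorm_sq[of "{..<k}"])
  qed
  define t where "t = (\<lambda>l. \<Sum>j<k. (tmv {..<m} U (\<lambda>i. Q i j) l)^2)"
  have t: "t l \<le> 1" if "l < k" for l
  proof -
    have "t l = (vnorm {..<k} (tmv {..<m} Q (\<lambda>i. U i l)))^2"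
      unfolding t_def vnorm_sq tmv_dot by (simp add: dot_commute)
    also have "\<dots> \<le> (vnorm {..<m} (\<lambda>i. U i l))^2" by (rule bessel[OF Q])
    also have "\<dots> = 1" using orth_dot[OF U that that] by (simp add: vnorm_sq_dot)
    finally show ?thesis .
  qed
  have nQ: "(vnorm {..<m} (\<lambda>i. Q i j))^2 = 1" if "j < k" for j
    using orth_dot[OF Q that that] by (simp add: vnorm_sq_dot)
  have "(\<Sum>j<k. (vnorm C (tmv {..<m} M (\<lambda>i. Q i j)))^2) \<le>
     (\<Sum>j<k. (\<Sum>l<k. s l * (tmv {..<m} U (\<lambda>i. Q i j) l)^2) + mu * (1 - (\<Sum>l<k. (tmv {..<m} U (\<lambda>i. Q i j) l)^2)))"
  proof (rule sum_mono)
    fix j assume "j \<in> {..<k}"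
    then show "(vnorm C (tmv {..<m} M (\<lambda>i. Q i j)))^2 \<le>
      (\<Sum>l<k. s l * (tmv {..<m} U (\<lambda>i. Q i j) l)^2) + mu * (1 - (\<Sum>l<k. (tmv {..<m} U (\<lambda>i. Q i j) l)^2))"
      using step[of "\<lambda>i. Q i j"] nQ[of j] by simp
  qed
  also have "\<dots> = (\<Sum>j<k. \<Sum>l<k. s l * (tmv {..<m} U (\<lambda>i. Q i j) l)^2)
      + mu * (real k - (\<Sum>j<k. \<Sum>l<k. (tmv {..<m} U (\<lambda>i. Q i j) l)^2))"
    by (simp add: sum.distrib sum_distrib_left[symmetric] sum_subtractf)
  also have "\<dots> = (\<Sum>l<k. s l * t l) + mu * (\<Sum>l<k. 1 - t l)"
    by (subst (1 2) sum.swap) (simp add: t_def sum_distrib_left sum_subtractf)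
  also have "\<dots> = (\<Sum>l<k. s l * t l + mu * (1 - t l))" by (simp add: sum.distrib sum_distrib_left)
  also have "\<dots> \<le> (\<Sum>l<k. s l)"
  proof (rule sum_mono)
    fix l assume "l \<in> {..<k}"
    then have "0 \<le> (s l - mu) * (1 - t l)" using mu t by simp
    then show "s l * t l + mu * (1 - t l) \<le> s l" by (simp add: algebra_simps)
  qed
  also have "\<dots> = (\<Sum>l<k. (vnorm C (tmv {..<m} M (\<lambda>i. U i l)))^2)"
    by (intro sum.cong refl) (simp add: lead_norm_eig[OF U _ eig])
  finally show ?thesis .
qed simp

lemma sub_orth_bessel:
  "sub_orth m k Q \<Longrightarrow> (vnorm {..<k} (tmv {..<m} Q z))^2 \<le> (vnorm {..<m} z)^2"
  by (intro power_mono contr_tmv sub_orth_contr) auto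

lemma dot_proj: "dot {..<m} (proj m k U u) v = dot {..<k} (tmv {..<m} U u) (tmv {..<m} U v)"
  by (simp add: proj_def dot_adjoint)

lemma proj_sym: "dot {..<m} (proj m k U u) v = dot {..<m} u (proj m k U v)"
  unfolding dot_proj by (subst dot_commute, subst dot_proj[symmetric], rule dot_commute)

text \<open>Only the projections of the noise on families of k orthonormal vectors enter, since all
  comparisons take place in the span of the columns of U and Us.\<close>

lemma lead_frobenius:
  assumes L: "lead C m M k U" and Us: "orth m k Us"
    and M: "\<And>i j. i < m \<Longrightarrow> j \<in> C \<Longrightarrow> M i j = (\<Sum>l<k. Us i l * B l j) + E i j"
    and e: "\<And>Q. sub_orth m k Q \<Longrightarrow> (\<Sum>j\<in>C. (vnorm {..<k} (tmv {..<m} Q (\<lambda>i. E i j)))^2) \<le> e^2" "0 \<le> e"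
    and A: "\<And>j. A j = mv {..<k} Us (\<lambda>l. B l j)"
  shows "(\<Sum>j\<in>C. (vnorm {..<m} (\<lambda>i. A j i - proj m k U (A j) i))^2) \<le> (2 * e)^2"
proof -
  have U: "orth m k U" using L by (simp add: lead_def)
  \<comment> \<open>\<open>D\<close> is the part of \<open>Us\<close> missed by \<open>U\<close>,
    and \<open>D'\<close> the part of \<open>U\<close> missed by \<open>Us\<close>. Their
    Gram-Schmidt families \<open>Q\<close> and \<open>R\<close> satisfy span(U, Q) = span(Us, R),
    and every comparison is made in this common space.\<close>
  define D where "D = (\<lambda>i l. Us i l - proj m k U (\<lambda>i. Us i l) i)"
  define D' where "D' = (\<lambda>i l. U i l - proj m k Us (\<lambda>i. U i l) i)"
  obtain Q G where QQ: "sub_orth m k Q \<and> (\<forall>l<k. \<forall>i<m. Q i l = (\<Sum>l'<k. D i l' * G l' l)) \<and>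
      (\<forall>l<k. \<forall>i<m. D i l = proj m k Q (\<lambda>i. D i l) i)"
    using gram_schmidt[where D=D and k=k and m=m] by (elim exE) (rule that)
  note Q = QQ[THEN conjunct1] and QG = QQ[THEN conjunct2, THEN conjunct1] and QD = QQ[THEN conjunct2, THEN conjunct2]
  obtain R H where RR: "sub_orth m k R \<and> (\<forall>l<k. \<forall>i<m. R i l = (\<Sum>l'<k. D' i l' * H l' l)) \<and>
      (\<forall>l<k. \<forall>i<m. D' i l = proj m k R (\<lambda>i. D' i l) i)"
    using gram_schmidt[where D=D' and k=k and m=m] by (elim exE) (rule that)
  note R = RR[THEN conjunct1] and RH = RR[THEN conjunct2, THEN conjunct1] and RD = RR[THEN conjunct2, THEN conjunct2]
  have UD: "dot {..<m} (\<lambda>i. U i l') (\<lambda>i. D i l) = 0" if "l' < k" for l l'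
    using tmv_resid[OF U that] by (simp add: D_def tmv_dot)
  have UsD': "dot {..<m} (\<lambda>i. Us i l') (\<lambda>i. D' i l) = 0" if "l' < k" for l l'
    using tmv_resid[OF Us that] by (simp add: D'_def tmv_dot)
  have UQ: "dot {..<m} (\<lambda>i. U i l') (\<lambda>i. Q i l) = 0" if "l' < k" "l < k" for l l'
  proof -
    have "dot {..<m} (\<lambda>i. U i l') (\<lambda>i. Q i l) = dot {..<m} (mv {..<k} D (\<lambda>l'. G l' l)) (\<lambda>i. U i l')"
      using QG that by (subst dot_commute) (auto intro!: dot_cong simp: mv_def)
    also have "\<dots> = dot {..<k} (\<lambda>l'. G l' l) (tmv {..<m} D (\<lambda>i. U i l'))" by (rule dot_adjoint)
    also have "\<dots> = 0" using UD[OF that(1)] by (simp add: dot_def[of "{..<k}"] tmv_dot dot_commute)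
    finally show ?thesis .
  qed
  have UsR: "dot {..<m} (\<lambda>i. Us i l') (\<lambda>i. R i l) = 0" if "l' < k" "l < k" for l l'
  proof -
    have "dot {..<m} (\<lambda>i. Us i l') (\<lambda>i. R i l) = dot {..<m} (mv {..<k} D' (\<lambda>l'. H l' l)) (\<lambda>i. Us i l')"
      using RH that by (subst dot_commute) (auto intro!: dot_cong simp: mv_def)
    also have "\<dots> = dot {..<k} (\<lambda>l'. H l' l) (tmv {..<m} D' (\<lambda>i. Us i l'))" by (rule dot_adjoint)
    also have "\<dots> = 0" using UsD'[OF that(1)] by (simp add: dot_def[of "{..<k}"] tmv_dot dot_commute)
    finally show ?thesis .
  qed
  have TQU: "tmv {..<m} Q (mv {..<k} U y) l = 0" if "l < k" for l y
    unfolding tmv_dot by (subst dot_commute, subst dot_adjoint)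
      (use UQ that in \<open>simp add: dot_def[of "{..<k}"] tmv_dot\<close>)
  have resid: "vnorm {..<m} (\<lambda>i. A j i - proj m k U (A j) i) \<le> vnorm {..<k} (tmv {..<m} Q (A j))" for j
  proof -
    define a where "a = (\<lambda>i. A j i - proj m k U (A j) i)"
    have pm: "proj m k U (A j) i = (\<Sum>l<k. B l j * proj m k U (\<lambda>i. Us i l) i)" for i
      unfolding A proj_def tmv_mv unfolding mv_def sum_distrib_left
      by (subst sum.swap) (simp add: algebra_simps)
    have a1: "a i = mv {..<k} D (\<lambda>l. B l j) i" for i
      unfolding a_def pm by (simp add: A mv_def D_def sum_subtractf[symmetric] algebra_simps)
    have a2: "a i = mv {..<k} Q (tmv {..<m} Q a) i" if i: "i < m" for i
    proof -
      have "a i = (\<Sum>l<k. B l j * proj m k Q (\<lambda>i. D i l) i)"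
        unfolding a1 mv_def using QD i by (intro sum.cong) auto
      also have "\<dots> = mv {..<k} Q (tmv {..<m} Q (mv {..<k} D (\<lambda>l. B l j))) i"
        unfolding proj_def tmv_mv unfolding mv_def sum_distrib_left
        by (subst sum.swap) (simp add: algebra_simps)
      also have "mv {..<k} D (\<lambda>l. B l j) = a" using a1 by auto
      finally show ?thesis .
    qed
    have a3: "tmv {..<m} Q a l = tmv {..<m} Q (A j) l" if "l < k" for l
      unfolding a_def tmv_diff proj_def using TQU[OF that] by simp
    have "vnorm {..<m} a = vnorm {..<m} (mv {..<k} Q (tmv {..<m} Q a))"
      using a2 by (intro vnorm_cong) auto
    also have "\<dots> \<le> vnorm {..<k} (tmv {..<m} Q a)"
      using sub_orth_contr[OF Q] by (simp add: contr_def)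
    also have "\<dots> = vnorm {..<k} (tmv {..<m} Q (A j))" using a3 by (intro vnorm_cong) auto
    finally show ?thesis by (simp add: a_def)
  qed
  \<comment> \<open>Orthogonal projection onto span(Us, R), because \<open>R\<close> is orthogonal
    to \<open>Us\<close>; it fixes the columns of \<open>U\<close>, \<open>Us\<close> and
    \<open>Q\<close>.\<close>
  define P where "P = (\<lambda>z i. proj m k Us z i + proj m k R z i)"
  have Psym: "dot {..<m} (P u) v = dot {..<m} u (P v)" for u v
    unfolding P_def dot_add_left dot_add_right proj_sym ..
  have TRUs: "tmv {..<m} R (mv {..<k} Us y) l = 0" if "l < k" for l y
    unfolding tmv_dot by (subst dot_commute, subst dot_adjoint)
      (use UsR that in \<open>simp add: dot_def[of "{..<k}"] tmv_dot\<close>)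
  have PU: "P (\<lambda>i. U i l) i = U i l" if "l < k" "i < m" for l i
  proof -
    have "tmv {..<m} R (\<lambda>i. D' i l) l' = tmv {..<m} R (\<lambda>i. U i l) l'" if "l' < k" for l'
      unfolding D'_def tmv_diff proj_def using TRUs[OF that] by simp
    then have "proj m k R (\<lambda>i. D' i l) i = proj m k R (\<lambda>i. U i l) i"
      unfolding proj_def mv_def by simp
    then have "D' i l = proj m k R (\<lambda>i. U i l) i" using RD that by simp
    then show ?thesis by (simp add: P_def D'_def)
  qed
  have PUs: "P (\<lambda>i. Us i l) i = Us i l" if "l < k" "i < m" for l i
  proof -
    have "tmv {..<m} R (\<lambda>i. Us i l) l' = 0" if "l' < k" for l'
      using UsR[OF \<open>l < k\<close> that] by (simp add: tmv_dot dot_commute)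
    moreover have "tmv {..<m} Us (\<lambda>i. Us i l) l' = (if l' = l then 1 else 0)" if "l' < k" for l'
      using orth_dot[OF Us that \<open>l < k\<close>] by (simp add: tmv_dot)
    ultimately show ?thesis using that
      by (simp add: P_def proj_def mv_def if_distrib[where f="\<lambda>x. _ * x"] cong: if_cong)
  qed
  have Plin: "P (mv {..<k} F y) i = (\<Sum>l<k. y l * P (\<lambda>i. F i l) i)" for F y i
    unfolding P_def proj_def tmv_mv unfolding mv_def sum_distrib_left sum.distrib distrib_left
    by (subst (1 2) sum.swap) (simp add: algebra_simps)
  have PQ: "P (\<lambda>i. Q i l) i = Q i l" if "l < k" "i < m" for l i
  proof -
    define c where "c = (\<lambda>l'. G l' l)"
    define f where "f = tmv {..<m} U (mv {..<k} Us c)"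
    have Qv: "Q i l = mv {..<k} Us c i - mv {..<k} U f i" if "i < m" for i
    proof -
      have "Q i l = (\<Sum>l'<k. D i l' * c l')" using QG \<open>l < k\<close> that by (simp add: c_def)
      also have "\<dots> = mv {..<k} Us c i - (\<Sum>l'<k. proj m k U (\<lambda>i. Us i l') i * c l')"
        by (simp add: D_def mv_def sum_subtractf algebra_simps)
      also have "(\<Sum>l'<k. proj m k U (\<lambda>i. Us i l') i * c l') = mv {..<k} U f i"
        unfolding proj_def f_def tmv_mv unfolding mv_def sum_distrib_left sum_distrib_right
        by (subst sum.swap) (simp add: algebra_simps)
      finally show ?thesis .
    qed
    have "P (\<lambda>i. Q i l) i = P (\<lambda>i. mv {..<k} Us c i - mv {..<k} U f i) i"
    proof -
      have "tmv {..<m} F (\<lambda>i. Q i l) = tmv {..<m} F (\<lambda>i. mv {..<k} Us c i - mv {..<k} U f i)" for F :: mat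
        using Qv by (intro tmv_cong) auto
      then show ?thesis by (simp only: P_def proj_def)
    qed
    also have "\<dots> = P (mv {..<k} Us c) i - P (mv {..<k} U f) i"
      by (simp add: P_def proj_def tmv_diff mv_def sum_subtractf algebra_simps)
    also have "\<dots> = mv {..<k} Us c i - mv {..<k} U f i"
      unfolding Plin using PU PUs that by (simp add: mv_def mult.commute)
    finally show ?thesis using Qv that by simp
  qed
  \<comment> \<open>Both systems live in the range of \<open>P\<close>: the left side is at most |P
    v|^2 by Bessel for (Q, U), and |P v|^2 is at most the right side.\<close>
  have main: "(vnorm {..<k} (tmv {..<m} Q v))^2 + (vnorm {..<k} (tmv {..<m} U v))^2
      \<le> (vnorm {..<k} (tmv {..<m} Us v))^2 + (vnorm {..<k} (tmv {..<m} R v))^2" for v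
  proof -
    have TU: "tmv {..<m} U v l = tmv {..<m} U (P v) l" if "l < k" for l
    proof -
      have "tmv {..<m} U v l = dot {..<m} (P (\<lambda>i. U i l)) v"
        unfolding tmv_dot using PU that by (intro dot_cong) auto
      then show ?thesis by (simp add: Psym tmv_dot)
    qed
    have TQ: "tmv {..<m} Q v l = tmv {..<m} Q (P v) l" if "l < k" for l
    proof -
      have "tmv {..<m} Q v l = dot {..<m} (P (\<lambda>i. Q i l)) v"
        unfolding tmv_dot using PQ that by (intro dot_cong) auto
      then show ?thesis by (simp add: Psym tmv_dot)
    qed
    define r where "r = (\<lambda>i. P v i - proj m k U (P v) i)"
    have Qr: "tmv {..<m} Q (P v) l = tmv {..<m} Q r l" if "l < k" for l
      unfolding r_def tmv_diff proj_def using TQU[OF that] by simp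
    have "(vnorm {..<k} (tmv {..<m} Q v))^2 + (vnorm {..<k} (tmv {..<m} U v))^2
      = (vnorm {..<k} (tmv {..<m} Q r))^2 + (vnorm {..<k} (tmv {..<m} U (P v)))^2"
      using TU TQ Qr vnorm_cong[of "{..<k}" "tmv {..<m} Q v" "tmv {..<m} Q r"]
        vnorm_cong[of "{..<k}" "tmv {..<m} U v" "tmv {..<m} U (P v)"] by simp
    also have "\<dots> \<le> (vnorm {..<m} r)^2 + (vnorm {..<k} (tmv {..<m} U (P v)))^2"
      using sub_orth_bessel[OF Q] by simp
    also have "\<dots> = (vnorm {..<m} (P v))^2" unfolding r_def using pythagoras[OF U, of "P v"] by simp
    also have "\<dots> \<le> (vnorm {..<k} (tmv {..<m} Us v))^2 + (vnorm {..<k} (tmv {..<m} R v))^2"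
    proof -
      have 0: "dot {..<m} (proj m k R v) (proj m k Us v) = 0"
        unfolding proj_def dot_adjoint using TRUs by (simp add: dot_def)
      have "(vnorm {..<m} (P v))^2 = (vnorm {..<m} (proj m k Us v))^2 + (vnorm {..<m} (proj m k R v))^2"
        unfolding vnorm_sq_dot P_def dot_add_left dot_add_right
        using 0 dot_commute[of "{..<m}" "proj m k R v" "proj m k Us v"] by simp
      also have "(vnorm {..<m} (proj m k R v))^2 \<le> (vnorm {..<k} (tmv {..<m} R v))^2"
        unfolding proj_def using sub_orth_contr[OF R] by (intro power_mono) (auto simp: contr_def)
      finally show ?thesis unfolding proj_def orth_vnorm[OF Us] by simp
    qed
    finally show ?thesis .
  qed
  have swap: "(\<Sum>j\<in>C. (vnorm {..<k} (tmv {..<m} F (\<lambda>i. M i j)))^2)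
      = (\<Sum>l<k. (vnorm C (tmv {..<m} M (\<lambda>i. F i l)))^2)" for F :: mat
    unfolding vnorm_sq by (subst sum.swap) (simp add: tmv_dot dot_commute)
  have RE: "vnorm {..<k} (tmv {..<m} R (\<lambda>i. M i j)) = vnorm {..<k} (tmv {..<m} R (\<lambda>i. E i j))" if "j \<in> C" for j
  proof (rule vnorm_cong)
    fix l assume l: "l \<in> {..<k}"
    have "tmv {..<m} R (\<lambda>i. M i j) = tmv {..<m} R (\<lambda>i. A j i + E i j)"
      using M that by (intro tmv_cong) (simp add: A mv_def)
    then show "tmv {..<m} R (\<lambda>i. M i j) l = tmv {..<m} R (\<lambda>i. E i j) l"
      using TRUs l by (simp add: tmv_add A)
  qed
  define S where "S = (\<lambda>F. \<Sum>j\<in>C. (vnorm {..<k} (tmv {..<m} F (\<lambda>i. M i j)))^2)"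
  \<comment> \<open>\<open>R\<close> is orthogonal to the signal and sees only the noise, so
    \<open>S R\<close> <= e^2; Ky Fan gives \<open>S Us\<close> <= \<open>S U\<close>. What remains
    is \<open>S Q\<close> <= e^2.\<close>
  have "S Q + S U \<le> S Us + S R"
    unfolding S_def sum.distrib[symmetric] by (intro sum_mono main)
  moreover have "S Us \<le> S U" unfolding S_def swap by (rule ky_fan[OF L Us])
  moreover have "S R \<le> e^2" unfolding S_def using e(1)[OF R] RE by simp
  ultimately have SQ: "S Q \<le> e^2" by simp
  have L2: "(\<Sum>j\<in>C. (vnorm {..<k} (f j))^2) = (L2_set (\<lambda>j. vnorm {..<k} (f j)) C)^2" for f :: "'a \<Rightarrow> nat \<Rightarrow> real"
    by (simp add: L2_set_def sum_nonneg)
  have "L2_set (\<lambda>j. vnorm {..<m} (\<lambda>i. A j i - proj m k U (A j) i)) C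
     \<le> L2_set (\<lambda>j. vnorm {..<k} (tmv {..<m} Q (\<lambda>i. M i j)) + vnorm {..<k} (tmv {..<m} Q (\<lambda>i. E i j))) C"
  proof (rule L2_set_mono)
    fix j assume j: "j \<in> C"
    have "tmv {..<m} Q (A j) = tmv {..<m} Q (\<lambda>i. M i j - E i j)"
      using M j by (intro tmv_cong) (simp add: A mv_def)
    then have "vnorm {..<k} (tmv {..<m} Q (A j)) \<le>
        vnorm {..<k} (tmv {..<m} Q (\<lambda>i. M i j)) + vnorm {..<k} (tmv {..<m} Q (\<lambda>i. E i j))"
      by (simp add: tmv_diff vnorm_diff)
    then show "vnorm {..<m} (\<lambda>i. A j i - proj m k U (A j) i) \<le>
        vnorm {..<k} (tmv {..<m} Q (\<lambda>i. M i j)) + vnorm {..<k} (tmv {..<m} Q (\<lambda>i. E i j))"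
      using resid[of j] by linarith
  qed simp
  also have "\<dots> \<le> L2_set (\<lambda>j. vnorm {..<k} (tmv {..<m} Q (\<lambda>i. M i j))) C
      + L2_set (\<lambda>j. vnorm {..<k} (tmv {..<m} Q (\<lambda>i. E i j))) C" by (rule L2_set_triangle_ineq)
  \<comment> \<open>Origin of the factor 2: the signal seen through \<open>Q\<close> is data minus
    noise, each of size at most e.\<close>
  also have "\<dots> \<le> e + e"
  proof (rule add_mono)
    show "L2_set (\<lambda>j. vnorm {..<k} (tmv {..<m} Q (\<lambda>i. M i j))) C \<le> e"
      by (rule power2_le_imp_le[OF _ e(2)]) (use SQ in \<open>simp add: S_def L2\<close>)
    show "L2_set (\<lambda>j. vnorm {..<k} (tmv {..<m} Q (\<lambda>i. E i j))) C \<le> e"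
      by (rule power2_le_imp_le[OF _ e(2)]) (use e(1)[OF Q] in \<open>simp add: L2\<close>)
  qed
  finally have "(L2_set (\<lambda>j. vnorm {..<m} (\<lambda>i. A j i - proj m k U (A j) i)) C)^2 \<le> (2 * e)^2"
    by (intro power_mono) auto
  then show ?thesis by (simp add: L2_set_def sum_nonneg)
qed

text \<open>A frame \<open>U\<close> with |M^T U y| >= (c + e) |y| gives |B^T G y| >= c |y| for the
  k x k matrix G = Us^T U. Then G is injective, hence onto, and w = G v satisfies |w| <=
  |v|.\<close>

lemma sval_lower:
  assumes Us: "orth m k Us" and k: "0 < k"
    and M: "\<And>i j. i < m \<Longrightarrow> j < n \<Longrightarrow> M i j = (\<Sum>l<k. Us i l * B l j) + E i j"
    and e: "\<And>w. vnorm {..<n} (tmv {..<m} E w) \<le> e * vnorm {..<m} w"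
    and c: "c < sval m n M k - e" "0 < c"
  shows "c * vnorm {..<k} w \<le> vnorm {..<n} (tmv {..<k} B w)"
proof -
  obtain U where U: "orth m k U"
    and low: "\<And>y. (c + e) * vnorm {..<k} y \<le> vnorm {..<n} (tmv {..<m} M (mv {..<k} U y))"
    using sval_witness[OF Us k, of "c + e" n M] c by auto
  define G where "G = (\<lambda>y. tmv {..<m} Us (mv {..<k} U y))"
  have lowG: "c * vnorm {..<k} y \<le> vnorm {..<n} (tmv {..<k} B (G y))" for y
  proof -
    let ?u = "mv {..<k} U y"
    have "tmv {..<m} M ?u j = tmv {..<k} B (G y) j + tmv {..<m} E ?u j" if "j < n" for j
    proof -
      have "tmv {..<m} M ?u j = (\<Sum>i<m. (\<Sum>l<k. Us i l * B l j) * ?u i) + tmv {..<m} E ?u j"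
        using M that by (simp add: tmv_def sum.distrib[symmetric] algebra_simps)
      also have "(\<Sum>i<m. (\<Sum>l<k. Us i l * B l j) * ?u i) = tmv {..<k} B (G y) j"
        unfolding G_def tmv_def sum_distrib_left sum_distrib_right
        by (subst sum.swap) (simp add: algebra_simps)
      finally show ?thesis .
    qed
    then have "vnorm {..<n} (tmv {..<m} M ?u) = vnorm {..<n} (\<lambda>j. tmv {..<k} B (G y) j + tmv {..<m} E ?u j)"
      by (intro vnorm_cong) auto
    also have "\<dots> \<le> vnorm {..<n} (tmv {..<k} B (G y)) + e * vnorm {..<k} y"
      using vnorm_triangle[of "{..<n}" "tmv {..<k} B (G y)" "tmv {..<m} E ?u"] e[of ?u]
      by (simp add: orth_vnorm[OF U])
    finally show ?thesis using low[of y] by (simp add: algebra_simps)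
  qed
  have Glin: "G y l = (\<Sum>l'<k. y l' * tmv {..<m} Us (\<lambda>i. U i l') l)" for y l
    by (simp add: G_def tmv_mv)
  \<comment> \<open>Surjectivity of G by counting: the k + 1 unknowns are a vector and a multiplier
    \<open>y k\<close> of w, the k equations say that G maps the vector to \<open>y k\<close> times
    w, and injectivity excludes a zero multiplier.\<close>
  obtain y where y: "\<exists>l\<in>{..k}. y l \<noteq> 0"
    "\<forall>i<k. (\<Sum>l\<in>{..k}. (if l < k then tmv {..<m} Us (\<lambda>i. U i l) i else - w i) * y l) = 0"
    using underdetermined[of "{..k}" k "\<lambda>i l. if l < k then tmv {..<m} Us (\<lambda>i. U i l) i else - w i"] by auto
  have Gy: "G y i = y k * w i" if "i < k" for i
  proof -
    have "(\<Sum>l\<in>{..k}. (if l < k then tmv {..<m} Us (\<lambda>i. U i l) i else - w i) * y l)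
       = G y i - y k * w i"
      unfolding Glin by (simp add: lessThan_Suc_atMost[symmetric] algebra_simps)
    then show ?thesis using y(2) that by simp
  qed
  have "y k \<noteq> 0"
  proof
    assume 0: "y k = 0"
    then have "tmv {..<k} B (G y) = (\<lambda>j. 0)" using Gy by (simp add: tmv_def)
    then have "c * vnorm {..<k} y \<le> 0" using lowG[of y] by simp
    then have "vnorm {..<k} y = 0" using c(2) vnorm_nonneg[of "{..<k}" y]
      by (simp add: mult_le_0_iff)
    then have "\<forall>l<k. y l = 0" by (simp add: vnorm_eq_0)
    then show False using y(1) 0 by (auto simp: le_less)
  qed
  define v where "v = (\<lambda>l. (1 / y k) * y l)"
  have Gv: "G v i = w i" if "i < k" for i
    using Gy[OF that] \<open>y k \<noteq> 0\<close> unfolding v_def G_def mv_scale tmv_scale by simp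
  have "vnorm {..<k} w = vnorm {..<k} (G v)" using Gv by (intro vnorm_cong) auto
  also have "\<dots> \<le> vnorm {..<m} (mv {..<k} U v)" unfolding G_def by (rule contr_tmv[OF orth_contr[OF Us]])
  also have "\<dots> = vnorm {..<k} v" by (rule orth_vnorm[OF U])
  finally have "c * vnorm {..<k} w \<le> c * vnorm {..<k} v" using c(2) by simp
  also have "\<dots> \<le> vnorm {..<n} (tmv {..<k} B (G v))" by (rule lowG)
  also have "tmv {..<k} B (G v) = tmv {..<k} B w" using Gv by (intro tmv_cong) auto
  finally show ?thesis .
qed

section \<open>Square roots of positive definite matrices\<close>

text \<open>Each row of a square frame has norm at most 1 by Bessel, and the squared row norms add
  up to d, as the columns show. So all of them equal 1 and every unit vector lies in the column
  span.\<close>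

lemma orth_complete:
  assumes V: "orth d d V" and ij: "i < d" "j < d"
  shows "(\<Sum>l<d. V i l * V j l) = (if i = j then 1 else 0)"
proof -
  define e :: "nat \<Rightarrow> nat \<Rightarrow> real" where "e = (\<lambda>i j. if j = i then 1 else 0)"
  have te: "tmv {..<d} V (e i) l = V i l" if "i < d" for i l
    using that by (simp add: tmv_def e_def if_distrib[where f="\<lambda>x. _ * x"] cong: if_cong)
  have ne: "(vnorm {..<d} (e i))^2 = 1" if "i < d" for i
    using that by (simp add: vnorm_sq e_def if_distrib[where f="\<lambda>x. x^2"] cong: if_cong)
  have nV: "(vnorm {..<d} (tmv {..<d} V (e i)))^2 = (\<Sum>l<d. (V i l)^2)" if "i < d" for i
    unfolding vnorm_sq te[OF that] ..
  have le: "(\<Sum>l<d. (V i l)^2) \<le> 1" if "i < d" for i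
    using bessel[OF V, of "e i"] unfolding ne[OF that] nV[OF that] .
  have "(\<Sum>i<d. \<Sum>l<d. (V i l)^2) = (\<Sum>l<d. dot {..<d} (\<lambda>i. V i l) (\<lambda>i. V i l))"
    by (subst sum.swap) (simp add: dot_def power2_eq_square)
  also have "\<dots> = real d" using orth_dot[OF V] by simp
  finally have "(\<Sum>i<d. 1 - (\<Sum>l<d. (V i l)^2)) = 0" by (simp add: sum_subtractf)
  then have one: "(\<Sum>l<d. (V i l)^2) = 1" if "i < d" for i
    using sum_nonneg_eq_0_iff[of "{..<d}" "\<lambda>i. 1 - (\<Sum>l<d. (V i l)^2)"] le that by auto
  have "(vnorm {..<d} (\<lambda>j. e i j - proj d d V (e i) j))^2 = 0"
    using pythagoras[OF V, of "e i"] unfolding ne[OF ij(1)] nV[OF ij(1)] one[OF ij(1)] by simp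
  then have "e i j - proj d d V (e i) j = 0" using ij(2) by (simp add: vnorm_eq_0)
  moreover have "proj d d V (e i) j = (\<Sum>l<d. V i l * V j l)"
    by (simp add: proj_def mv_def te[OF ij(1)] mult.commute)
  ultimately show ?thesis by (auto simp: e_def)
qed

text \<open>First-order optimality: for a small t of the sign opposite to a the linear term would
  win.\<close>

lemma linear_coeff_zero:
  fixes a b :: real
  assumes "\<And>t. 0 \<le> 2 * t * a + t^2 * b" shows "a = 0"
proof (rule ccontr)
  assume a: "a \<noteq> 0"
  define t where "t = - a / (\<bar>b\<bar> + 1)"
  have c: "0 < \<bar>b\<bar> + 1" by simp
  have t: "t * (\<bar>b\<bar> + 1) = - a" using c by (simp add: t_def)
  have "0 \<le> (2 * t * a + t^2 * b) * (\<bar>b\<bar> + 1)^2"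
    using assms[of t] by (intro mult_nonneg_nonneg) auto
  also have "\<dots> = 2 * (t * (\<bar>b\<bar> + 1)) * a * (\<bar>b\<bar> + 1) + (t * (\<bar>b\<bar> + 1))^2 * b"
    by (simp add: power2_eq_square algebra_simps)
  also have "\<dots> = a^2 * (b - 2 * \<bar>b\<bar> - 2)" unfolding t by (simp add: power2_eq_square algebra_simps)
  also have "\<dots> < 0" using a by (intro mult_pos_neg) auto
  finally show False by simp
qed

lemma sym_dot:
  assumes "\<forall>i<d. \<forall>j<d. S i j = (S j i :: real)"
  shows "dot {..<d} (mv {..<d} S x) y = dot {..<d} x (mv {..<d} S y)"
  unfolding dot_adjoint
proof (rule dot_cong)
  fix i assume "i \<in> {..<d}"
  then show "tmv {..<d} S y i = mv {..<d} S y i"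
    unfolding tmv_def mv_def using assms by (intro sum.cong) auto
qed simp

text \<open>Maximise the Rayleigh quotient over unit vectors orthogonal to the eigenvectors already
  found; the maximiser is an eigenvector because S preserves that complement.\<close>

lemma eigenvector_step:
  fixes S :: mat
  assumes sym: "\<forall>i<d. \<forall>j<d. S i j = S j i" and k: "k < d"
    and eig: "\<forall>l<k. \<forall>i<d. mv {..<d} S (\<lambda>i. V i l) i = mu l * V i l"
  shows "\<exists>v c. dot {..<d} v v = 1 \<and> (\<forall>l<k. dot {..<d} (\<lambda>i. V i l) v = 0)
    \<and> (\<forall>i<d. mv {..<d} S v i = c * v i)"
proof -
  define q where "q = (\<lambda>x. dot {..<d} x (mv {..<d} S x))"
  \<comment> \<open>Coordinates from d on are pinned to 0, which makes the constrained sphere a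
    closed subset of a compact product inside the space of all real sequences.\<close>
  define K where "K = (PiE UNIV (\<lambda>i. if i < d then {-1..1} else {0::real})) \<inter>
     {x. dot {..<d} x x = 1} \<inter> (\<Inter>l\<in>{..<k}. {x. dot {..<d} (\<lambda>i. V i l) x = 0})"
  have cc: "continuous_on UNIV (\<lambda>x::nat\<Rightarrow>real. x i)" for i
    by (rule continuous_on_product_coordinates)
  have cq: "continuous_on UNIV q" unfolding q_def dot_def mv_def
    by (intro continuous_intros cc)
  have "compactin (product_topology (\<lambda>i. euclidean) UNIV)
      (PiE UNIV (\<lambda>i. if i < d then {-1..1} else {0::real}))"
    unfolding compactin_PiE by auto
  then have "compact (PiE UNIV (\<lambda>i. if i < d then {-1..1} else {0::real}))"
    by (simp add: euclidean_product_topology)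
  moreover have "closed {x. dot {..<d} x x = 1}"
    unfolding dot_def by (intro closed_Collect_eq continuous_intros cc)
  moreover have "closed (\<Inter>l\<in>{..<k}. {x. dot {..<d} (\<lambda>i. V i l) x = 0})"
    unfolding dot_def by (intro closed_INT ballI closed_Collect_eq continuous_intros cc)
  ultimately have "compact K" unfolding K_def by (intro compact_Int_closed)
  have inK: "(\<lambda>i. if i < d then x i / vnorm {..<d} x else 0) \<in> K"
    if x0: "vnorm {..<d} x \<noteq> 0" and xV: "\<forall>l<k. dot {..<d} (\<lambda>i. V i l) x = 0" for x
  proof -
    let ?w = "\<lambda>i. if i < d then x i / vnorm {..<d} x else 0"
    have w: "?w i = (1 / vnorm {..<d} x) * x i" if "i \<in> {..<d}" for i using that by simp
    have "dot {..<d} ?w ?w = dot {..<d} (\<lambda>i. (1 / vnorm {..<d} x) * x i) (\<lambda>i. (1 / vnorm {..<d} x) * x i)"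
      using w by (intro dot_cong)
    also have "\<dots> = 1" unfolding dot_scale_left dot_scale_right vnorm_sq_dot[symmetric]
      using x0 by (simp add: power2_eq_square)
    finally have 1: "dot {..<d} ?w ?w = 1" .
    have "dot {..<d} (\<lambda>i. V i l) ?w = 0" if "l < k" for l
    proof -
      have "dot {..<d} (\<lambda>i. V i l) ?w = dot {..<d} (\<lambda>i. V i l) (\<lambda>i. (1 / vnorm {..<d} x) * x i)"
        using w by (intro dot_cong) auto
      then show ?thesis using xV that unfolding dot_scale_right by simp
    qed
    moreover have wle: "\<bar>?w i\<bar> \<le> 1" for i
    proof (cases "i < d")
      case True
      have "(?w i)^2 \<le> dot {..<d} ?w ?w"
        unfolding dot_def power2_eq_square using True by (intro member_le_sum) auto
      then have "(?w i)^2 \<le> 1" using 1 by simp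
      then show ?thesis by (rule abs_le_square_iff[THEN iffD2, of _ 1, simplified])
    qed simp
    have "?w i \<in> (if i < d then {-1..1} else {0::real})" for i
      using wle[of i] abs_le_D1[of "?w i" 1] abs_le_D2[of "?w i" 1] by (cases "i < d") auto
    then have "?w \<in> PiE UNIV (\<lambda>i. if i < d then {-1..1} else {0::real})"
      unfolding PiE_UNIV_domain by (rule Pi_I)
    ultimately show ?thesis using 1 unfolding K_def by blast
  qed
  obtain y where y: "\<exists>l\<in>{..<d}. y l \<noteq> 0" "\<forall>i<k. (\<Sum>l\<in>{..<d}. V l i * y l) = 0"
    using underdetermined[of "{..<d}" k "\<lambda>i l. V l i"] k by auto
  have "vnorm {..<d} y \<noteq> 0" using y(1) by (simp add: vnorm_eq_0)
  then have "K \<noteq> {}" using inK[of y] y(2) by (auto simp: dot_def)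
  then obtain v where v: "v \<in> K" "\<forall>x\<in>K. q x \<le> q v"
    using continuous_attains_sup[OF \<open>compact K\<close> _ continuous_on_subset[OF cq subset_UNIV]] by blast
  have v1: "dot {..<d} v v = 1" and vV: "\<forall>l<k. dot {..<d} (\<lambda>i. V i l) v = 0"
    using v(1) by (auto simp: K_def)
  have le: "q x \<le> q v * dot {..<d} x x" if xV: "\<forall>l<k. dot {..<d} (\<lambda>i. V i l) x = 0" for x
  proof (cases "vnorm {..<d} x = 0")
    case True
    then have "q x = 0" by (simp add: q_def vnorm_eq_0 dot_def)
    moreover have "dot {..<d} x x = 0" using True by (simp add: vnorm_sq_dot[symmetric])
    ultimately show ?thesis by simp
  next
    case False
    let ?c = "vnorm {..<d} x"
    let ?w = "\<lambda>i. if i < d then x i / ?c else 0"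
    have "q ?w \<le> q v" using v(2) inK[OF False xV] by blast
    also have "q ?w = dot {..<d} (\<lambda>i. (1 / ?c) * x i) (mv {..<d} S (\<lambda>i. (1 / ?c) * x i))"
      unfolding q_def by (intro dot_cong fun_cong[OF mv_cong]) auto
    also have "\<dots> = q x / ?c^2"
      unfolding mv_scale dot_scale_left dot_scale_right q_def by (simp add: power2_eq_square)
    finally show ?thesis using False by (simp add: vnorm_sq_dot[symmetric] divide_le_eq)
  qed
  \<comment> \<open>Residual of the eigenvalue equation, itself an admissible direction. Optimality
    of v along h makes the pairing of h with this residual vanish, that is |h|^2 = 0.\<close>
  define h where "h = (\<lambda>i. mv {..<d} S v i - q v * v i)"
  have hV: "\<forall>l<k. dot {..<d} (\<lambda>i. V i l) h = 0"
  proof (intro allI impI)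
    fix l assume l: "l < k"
    have "dot {..<d} (\<lambda>i. V i l) (mv {..<d} S v) = dot {..<d} (mv {..<d} S (\<lambda>i. V i l)) v"
      by (rule sym_dot[OF sym, symmetric])
    also have "\<dots> = dot {..<d} (\<lambda>i. mu l * V i l) v" using eig l by (intro dot_cong) auto
    also have "\<dots> = 0" using vV l by (simp add: dot_scale_left)
    finally show "dot {..<d} (\<lambda>i. V i l) h = 0"
      unfolding h_def dot_diff_right dot_scale_right using vV l by simp
  qed
  have "q v * dot {..<d} h v - dot {..<d} h (mv {..<d} S v) = 0"
  proof (rule linear_coeff_zero[where b = "q v * dot {..<d} h h - q h"])
    fix t :: real
    define x where "x = (\<lambda>i. v i + t * h i)"
    have "\<forall>l<k. dot {..<d} (\<lambda>i. V i l) x = 0"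
      unfolding x_def dot_add_right dot_scale_right using vV hV by simp
    then have "q x \<le> q v * dot {..<d} x x" by (rule le)
    moreover have "q x = q v + 2 * t * dot {..<d} h (mv {..<d} S v) + t^2 * q h"
    proof -
      have "dot {..<d} v (mv {..<d} S h) = dot {..<d} h (mv {..<d} S v)"
        by (subst dot_commute) (rule sym_dot[OF sym])
      then show ?thesis
        unfolding q_def x_def mv_add mv_scale dot_add_left dot_add_right dot_scale_left dot_scale_right
        by (simp add: power2_eq_square algebra_simps)
    qed
    moreover have "dot {..<d} x x = 1 + 2 * t * dot {..<d} h v + t^2 * dot {..<d} h h"
      unfolding x_def dot_add_left dot_add_right dot_scale_left dot_scale_right v1 dot_commute[of _ v h]
      by (simp add: power2_eq_square algebra_simps)
    ultimately show "0 \<le> 2 * t * (q v * dot {..<d} h v - dot {..<d} h (mv {..<d} S v))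
        + t^2 * (q v * dot {..<d} h h - q h)" by (simp add: algebra_simps)
  qed
  then have "dot {..<d} h h = 0"
    by (subst (2) h_def) (simp add: dot_diff_right dot_scale_right)
  then have "vnorm {..<d} h = 0" by (simp add: vnorm_sq_dot[symmetric])
  then have "\<forall>i<d. mv {..<d} S v i = q v * v i" by (simp add: vnorm_eq_0 h_def)
  then show ?thesis using v1 vV by blast
qed

lemma spectral_theorem:
  fixes S :: mat
  assumes sym: "\<forall>i<d. \<forall>j<d. S i j = S j i"
  shows "\<exists>V mu. orth d d V \<and> (\<forall>l<d. \<forall>i<d. mv {..<d} S (\<lambda>i. V i l) i = mu l * V i l)"
proof -
  have "\<exists>V mu. orth d k V \<and> (\<forall>l<k. \<forall>i<d. mv {..<d} S (\<lambda>i. V i l) i = mu l * V i l)" if "k \<le> d" for k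
    using that
  proof (induction k)
    case 0
    show ?case by (auto simp: orth_def)
  next
    case (Suc k)
    then obtain V mu where V: "orth d k V"
      and eig: "\<forall>l<k. \<forall>i<d. mv {..<d} S (\<lambda>i. V i l) i = mu l * V i l" by auto
    obtain v c where v: "dot {..<d} v v = 1" "\<forall>l<k. dot {..<d} (\<lambda>i. V i l) v = 0"
      "\<forall>i<d. mv {..<d} S v i = c * v i"
      using eigenvector_step[OF sym _ eig] Suc.prems by (meson Suc_le_lessD)
    define W where "W = (\<lambda>i l. if l < k then V i l else v i)"
    have W: "(\<lambda>i. W i l) = (if l < k then (\<lambda>i. V i l) else v)" for l by (auto simp: W_def)
    have vl: "dot {..<d} v (\<lambda>i. V i l) = 0" if "l < k" for l
      using v(2) that dot_commute[of "{..<d}" v "\<lambda>i. V i l"] by simp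
    have "orth d (Suc k) W" unfolding orth_def
    proof (intro allI impI)
      fix j1 j2 assume "j1 < Suc k" "j2 < Suc k"
      then have "dot {..<d} (\<lambda>i. W i j1) (\<lambda>i. W i j2) = (if j1 = j2 then 1 else 0)"
        using orth_dot[OF V] v vl unfolding W by (auto simp: less_Suc_eq)
      then show "(\<Sum>i<d. W i j1 * W i j2) = (if j1 = j2 then 1 else 0)" by (simp add: dot_def)
    qed
    moreover have "\<forall>l<Suc k. \<forall>i<d. mv {..<d} S (\<lambda>i. W i l) i = (if l < k then mu l else c) * W i l"
      using eig v unfolding W by (auto simp: W_def less_Suc_eq)
    ultimately show ?case by (intro exI[of _ W] exI[of _ "\<lambda>l. if l < k then mu l else c"] conjI)
  qed
  then show ?thesis by (meson order_refl)
qed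

lemma matmul_assoc:
  "(\<Sum>k\<in>K. (\<Sum>l\<in>L. f l * B l k) * g k) = (\<Sum>l\<in>L. f l * (\<Sum>k\<in>K. B l k * (g k :: real)))"
  unfolding sum_distrib_left sum_distrib_right by (subst sum.swap) (simp add: algebra_simps)

lemma sym_pd_quad_nonneg: "sym_pd d B \<Longrightarrow> 0 \<le> (\<Sum>i<d. \<Sum>j<d. x i * B i j * x j)"
proof -
  assume B: "sym_pd d B"
  show ?thesis
  proof (cases "\<exists>j<d. x j \<noteq> 0")
    case True
    then have "(\<Sum>i<d. \<Sum>j<d. x i * B i j * x j) > 0" using B unfolding sym_pd_def by blast
    then show ?thesis by simp
  next
    case False
    then show ?thesis by (intro sum_nonneg) auto
  qed
qed

text \<open>With D = B1 - B2, equality of the squares reads B1 D + D B2 = 0. Pairing this with D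
  gives quadratic forms of \<open>B1\<close> on the columns and of \<open>B2\<close> on the rows of
  D, all nonnegative; so each vanishes, and positive definiteness of \<open>B1\<close> forces D =
  0.\<close>

lemma sym_pd_sqrt_unique:
  assumes B1: "sym_pd d B1" and B2: "sym_pd d B2"
    and eq: "\<And>i j. i < d \<Longrightarrow> j < d \<Longrightarrow> (\<Sum>k<d. B1 i k * B1 k j) = (\<Sum>k<d. B2 i k * B2 k j)"
    and ij: "i < d" "j < d"
  shows "B1 i j = B2 i j"
proof -
  define D where "D = (\<lambda>i j. B1 i j - B2 i j)"
  have s1: "B1 i j = B1 j i" and s2: "B2 i j = B2 j i" if "i < d" "j < d" for i j
    using B1 B2 that by (auto simp: sym_pd_def)
  have "(\<Sum>k<d. B1 i k * D k j) + (\<Sum>k<d. D i k * B2 k j) = 0" if "i < d" "j < d" for i j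
    using eq[OF that] by (simp add: D_def sum.distrib[symmetric] sum_subtractf algebra_simps)
  then have "0 = (\<Sum>i<d. \<Sum>j<d. D i j * ((\<Sum>k<d. B1 i k * D k j) + (\<Sum>k<d. D i k * B2 k j)))" by simp
  also have "\<dots> = (\<Sum>i<d. \<Sum>j<d. \<Sum>k<d. D i j * B1 i k * D k j) + (\<Sum>i<d. \<Sum>j<d. \<Sum>k<d. D i j * D i k * B2 k j)"
    by (simp add: sum.distrib distrib_left sum_distrib_left mult.assoc)
  also have "(\<Sum>i<d. \<Sum>j<d. \<Sum>k<d. D i j * B1 i k * D k j) = (\<Sum>j<d. \<Sum>i<d. \<Sum>k<d. D i j * B1 i k * D k j)"
    by (rule sum.swap)
  also have "(\<Sum>i<d. \<Sum>j<d. \<Sum>k<d. D i j * D i k * B2 k j) = (\<Sum>i<d. \<Sum>j<d. \<Sum>k<d. D i j * B2 j k * D i k)"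
    by (intro sum.cong refl) (use s2 in \<open>auto simp: algebra_simps\<close>)
  finally have sum0: "(\<Sum>j<d. \<Sum>i<d. \<Sum>k<d. D i j * B1 i k * D k j)
      + (\<Sum>i<d. \<Sum>j<d. \<Sum>k<d. D i j * B2 j k * D i k) = 0" by simp
  have n1: "0 \<le> (\<Sum>i<d. \<Sum>k<d. D i j * B1 i k * D k j)" for j
    using sym_pd_quad_nonneg[OF B1, of "\<lambda>i. D i j"] by simp
  have n2: "0 \<le> (\<Sum>j<d. \<Sum>k<d. D i j * B2 j k * D i k)" for i
    using sym_pd_quad_nonneg[OF B2, of "\<lambda>j. D i j"] by simp
  have "(\<Sum>j<d. \<Sum>i<d. \<Sum>k<d. D i j * B1 i k * D k j) = 0"
    using sum0 sum_nonneg[of "{..<d}" "\<lambda>j. \<Sum>i<d. \<Sum>k<d. D i j * B1 i k * D k j"]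
      sum_nonneg[of "{..<d}" "\<lambda>i. \<Sum>j<d. \<Sum>k<d. D i j * B2 j k * D i k"] n1 n2 by simp
  then have "(\<Sum>i<d. \<Sum>k<d. D i j * B1 i k * D k j) = 0"
    using sum_nonneg_eq_0_iff[of "{..<d}" "\<lambda>j. \<Sum>i<d. \<Sum>k<d. D i j * B1 i k * D k j"] n1 ij by auto
  then have "\<not> (\<exists>i<d. D i j \<noteq> 0)"
    using B1[unfolded sym_pd_def, THEN conjunct2, THEN spec[of _ "\<lambda>i. D i j"]] by auto
  then show ?thesis using ij by (auto simp: D_def)
qed

text \<open>\<open>inv_sqrt\<close> is a definite description, so existence and uniqueness come
  before any property of it. \<open>C\<close> is the square root of \<open>S\<close>; it turns the
  whitened vector of Assumption (A) back into the original one.\<close>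

lemma inv_sqrt_factor:
  assumes S: "sym_pd d S"
  shows "\<exists>C. (\<forall>i<d. \<forall>j<d. C i j = C j i) \<and>
    (\<forall>i<d. \<forall>j<d. (\<Sum>k<d. C i k * inv_sqrt d S k j) = (if i = j then 1 else 0)) \<and>
    (\<forall>i<d. \<forall>j<d. (\<Sum>k<d. C i k * C k j) = S i j)"
proof -
  have sym: "\<forall>i<d. \<forall>j<d. S i j = S j i" using S by (simp add: sym_pd_def)
  obtain V mu where V: "orth d d V" and eig: "\<forall>l<d. \<forall>i<d. mv {..<d} S (\<lambda>i. V i l) i = mu l * V i l"
    using spectral_theorem[OF sym] by blast
  note comp = orth_complete[OF V]
  have mu: "0 < mu l" if l: "l < d" for l
  proof -
    have "\<exists>j<d. V j l \<noteq> 0"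
    proof (rule ccontr)
      assume "\<not> ?thesis"
      then have "dot {..<d} (\<lambda>i. V i l) (\<lambda>i. V i l) = 0" by (simp add: dot_def)
      then show False using orth_dot[OF V l l] by simp
    qed
    then have "0 < (\<Sum>i<d. \<Sum>j<d. V i l * S i j * V j l)"
      using S[unfolded sym_pd_def, THEN conjunct2, THEN spec[of _ "\<lambda>i. V i l"]] by simp
    also have "\<dots> = dot {..<d} (\<lambda>i. V i l) (mv {..<d} S (\<lambda>i. V i l))"
      by (simp add: dot_def mv_def sum_distrib_left algebra_simps)
    also have "\<dots> = dot {..<d} (\<lambda>i. V i l) (\<lambda>i. mu l * V i l)"
      using eig l by (intro dot_cong) auto
    also have "\<dots> = mu l" using orth_dot[OF V l l] by (simp add: dot_scale_right)
    finally show ?thesis .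
  qed
  \<comment> \<open>Functional calculus V diag(f) V^T, multiplicative in f by \<open>Fmul\<close>.
    The functions 1 / sqrt, sqrt and the identity of the eigenvalues give \<open>B\<close>,
    \<open>C\<close> and \<open>S\<close>.\<close>
  define F where "F = (\<lambda>f i j. \<Sum>l<d. V i l * f l * V j l :: real)"
  have Fmul: "(\<Sum>k<d. F f i k * F g k j) = F (\<lambda>l. f l * g l) i j" for f g i j
  proof -
    have "(\<Sum>k<d. F f i k * F g k j) = (\<Sum>k<d. \<Sum>l<d. \<Sum>l'<d. (V i l * f l) * (g l' * V j l') * (V k l * V k l'))"
      unfolding F_def sum_product by (intro sum.cong refl) (simp add: algebra_simps)
    also have "\<dots> = (\<Sum>l<d. \<Sum>k<d. \<Sum>l'<d. (V i l * f l) * (g l' * V j l') * (V k l * V k l'))"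
      by (rule sum.swap)
    also have "\<dots> = (\<Sum>l<d. \<Sum>l'<d. \<Sum>k<d. (V i l * f l) * (g l' * V j l') * (V k l * V k l'))"
      by (intro sum.cong refl sum.swap)
    also have "\<dots> = (\<Sum>l<d. \<Sum>l'<d. (V i l * f l) * (g l' * V j l') * (if l = l' then 1 else 0))"
      unfolding sum_distrib_left[symmetric]
      by (intro sum.cong refl) (use V in \<open>auto simp: orth_def\<close>)
    also have "\<dots> = F (\<lambda>l. f l * g l) i j"
      unfolding F_def by (intro sum.cong refl) (simp add: if_distrib[where f="\<lambda>x. _ * x"] cong: if_cong)
    finally show ?thesis .
  qed
  have F1: "F (\<lambda>l. 1) i j = (if i = j then 1 else 0)" if "i < d" "j < d" for i j
    using comp[OF that] by (simp add: F_def)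
  have Fcong: "F f i j = F g i j" if "\<And>l. l < d \<Longrightarrow> f l = g l" for f g i j
    using that by (simp add: F_def)
  have FS: "F mu i j = S i j" if ij: "i < d" "j < d" for i j
  proof -
    have "F mu i j = (\<Sum>l<d. (\<Sum>k<d. S i k * V k l) * V j l)"
      unfolding F_def using eig ij by (intro sum.cong refl) (auto simp: mv_def algebra_simps)
    also have "\<dots> = (\<Sum>k<d. S i k * (\<Sum>l<d. V k l * V j l))" by (rule matmul_assoc)
    also have "\<dots> = (\<Sum>k<d. S i k * (if k = j then 1 else 0))"
      using comp ij by (intro sum.cong refl) auto
    also have "\<dots> = S i j" using ij by (simp add: if_distrib[where f="\<lambda>x. _ * x"] cong: if_cong)
    finally show ?thesis .
  qed
  define f where "f = (\<lambda>l. 1 / sqrt (mu l))"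
  define B where "B = (\<lambda>i j. if i < d \<and> j < d then F f i j else 0)"
  define C where "C = F (\<lambda>l. sqrt (mu l))"
  have Fsym: "F f i j = F f j i" for f i j by (simp add: F_def mult.commute mult.left_commute)
  have quad: "(\<Sum>i<d. \<Sum>j<d. x i * F f i j * x j) = (\<Sum>l<d. f l * (tmv {..<d} V x l)^2)" for x
  proof -
    have "(\<Sum>i<d. \<Sum>j<d. x i * F f i j * x j) = (\<Sum>i<d. \<Sum>j<d. \<Sum>l<d. f l * ((V i l * x i) * (V j l * x j)))"
      unfolding F_def sum_distrib_left sum_distrib_right by (intro sum.cong refl) (simp add: algebra_simps)
    also have "\<dots> = (\<Sum>i<d. \<Sum>l<d. \<Sum>j<d. f l * ((V i l * x i) * (V j l * x j)))"
      by (intro sum.cong refl sum.swap)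
    also have "\<dots> = (\<Sum>l<d. \<Sum>i<d. \<Sum>j<d. f l * ((V i l * x i) * (V j l * x j)))" by (rule sum.swap)
    also have "\<dots> = (\<Sum>l<d. f l * (tmv {..<d} V x l)^2)"
      unfolding tmv_def power2_eq_square sum_product sum_distrib_left[of "f _"] by (rule refl)
    finally show ?thesis .
  qed
  have Bpd: "sym_pd d B" unfolding sym_pd_def
  proof (intro conjI allI impI)
    fix i j assume "i < d" "j < d" then show "B i j = B j i" by (simp add: B_def Fsym[of f i j])
  next
    fix x :: "nat \<Rightarrow> real" assume "\<exists>j<d. x j \<noteq> 0"
    then have "0 < (vnorm {..<d} x)^2" by (auto simp: vnorm_eq_0)
    moreover have "proj d d V x i = x i" if "i < d" for i
    proof -
      have "proj d d V x i = (\<Sum>k<d. (\<Sum>l<d. V i l * V k l) * x k)"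
        unfolding proj_def mv_def tmv_def by (rule matmul_assoc[symmetric])
      also have "\<dots> = (\<Sum>k<d. (if i = k then 1 else 0) * x k)" using comp that by (intro sum.cong refl) auto
      finally show ?thesis using that by (simp add: if_distrib[where f="\<lambda>x. x * _"] cong: if_cong)
    qed
    then have "(vnorm {..<d} x)^2 = (vnorm {..<d} (tmv {..<d} V x))^2"
      using pythagoras[OF V, of x] by (simp add: vnorm_sq[of _ "\<lambda>i. x i - _ i"])
    ultimately have "0 < (\<Sum>l<d. (tmv {..<d} V x l)^2)" by (simp add: vnorm_sq)
    then obtain l where l: "l < d" "tmv {..<d} V x l \<noteq> 0"
      by (metis (no_types, lifting) lessThan_iff less_irrefl power_zero_numeral sum.neutral)
    have "0 < (\<Sum>l<d. f l * (tmv {..<d} V x l)^2)"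
    proof (rule sum_pos2[of _ l])
      show "0 < f l * (tmv {..<d} V x l)^2" using l mu[OF l(1)] by (simp add: f_def)
      fix l' assume "l' \<in> {..<d}"
      then show "0 \<le> f l' * (tmv {..<d} V x l')^2" using mu[of l'] by (simp add: f_def)
    qed (use l in auto)
    also have "\<dots> = (\<Sum>i<d. \<Sum>j<d. x i * B i j * x j)"
      unfolding quad[symmetric] by (intro sum.cong refl) (auto simp: B_def)
    finally show "0 < (\<Sum>i<d. \<Sum>j<d. x i * B i j * x j)" .
  qed
  have BF: "B i j = F f i j" if "i < d" "j < d" for i j using that by (simp add: B_def)
  have BBS: "(\<Sum>k<d. \<Sum>l<d. B i k * B k l * S l j) = (if i = j then 1 else 0)" if ij: "i < d" "j < d" for i j
  proof -
    have "(\<Sum>k<d. \<Sum>l<d. B i k * B k l * S l j) = (\<Sum>k<d. F f i k * (\<Sum>l<d. F f k l * F mu l j))"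
      unfolding sum_distrib_left using ij by (intro sum.cong refl) (auto simp: BF FS)
    also have "\<dots> = F (\<lambda>l. f l * (f l * mu l)) i j" by (simp only: Fmul)
    also have "\<dots> = F (\<lambda>l. 1) i j"
    proof (rule Fcong)
      fix l assume "l < d"
      then have "0 < mu l" by (rule mu)
      then show "f l * (f l * mu l) = 1" by (simp add: f_def)
    qed
    finally show ?thesis by (simp add: F1 ij)
  qed
  let ?P = "\<lambda>B. sym_pd d B \<and> (\<forall>i<d. \<forall>j<d. (\<Sum>k<d. \<Sum>l<d. B i k * B k l * S l j) = (if i = j then 1 else 0)) \<and>
      (\<forall>i j. d \<le> i \<or> d \<le> j \<longrightarrow> B i j = 0)"
  have "inv_sqrt d S = B" unfolding inv_sqrt_def
  proof (rule the_equality)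
    show "?P B" using Bpd BBS by (auto simp: B_def)
  next
    fix B' assume B': "?P B'"
    \<comment> \<open>The inverse of \<open>S\<close>. Every admissible \<open>B'\<close> squares to
      it, as does \<open>B\<close>, so uniqueness of positive square roots applies.\<close>
    let ?G = "F (\<lambda>l. f l * f l)"
    have SG: "(\<Sum>k<d. S i k * ?G k j) = (if i = j then 1 else 0)" if ij: "i < d" "j < d" for i j
    proof -
      have "(\<Sum>k<d. S i k * ?G k j) = (\<Sum>k<d. F mu i k * ?G k j)" using ij by (intro sum.cong refl) (auto simp: FS)
      also have "\<dots> = F (\<lambda>l. 1) i j" unfolding Fmul
      proof (rule Fcong)
        fix l assume "l < d"
        then have "0 < mu l" by (rule mu)
        then show "mu l * (f l * f l) = 1" by (simp add: f_def)
      qed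
      finally show ?thesis by (simp add: F1 ij)
    qed
    have B'2: "(\<Sum>k<d. B' i k * B' k j) = ?G i j" if ij: "i < d" "j < d" for i j
    proof -
      define H where "H = (\<lambda>i j. \<Sum>k<d. B' i k * B' k j)"
      have HS: "(\<Sum>l<d. H i l * S l j) = (if i = j then 1 else 0)" if "i < d" "j < d" for i j
      proof -
        have "(\<Sum>l<d. H i l * S l j) = (\<Sum>l<d. \<Sum>k<d. B' i k * B' k l * S l j)"
          by (simp add: H_def sum_distrib_right)
        also have "\<dots> = (\<Sum>k<d. \<Sum>l<d. B' i k * B' k l * S l j)" by (rule sum.swap)
        finally show ?thesis using B' that by simp
      qed
      have "H i j = (\<Sum>l<d. H i l * (if l = j then 1 else 0))"
        using ij by (simp add: if_distrib[where f="\<lambda>x. _ * x"] cong: if_cong)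
      also have "\<dots> = (\<Sum>l<d. H i l * (\<Sum>k<d. S l k * ?G k j))"
        using SG ij by (intro sum.cong refl) auto
      also have "\<dots> = (\<Sum>k<d. (\<Sum>l<d. H i l * S l k) * ?G k j)" by (rule matmul_assoc[symmetric])
      also have "\<dots> = (\<Sum>k<d. (if i = k then 1 else 0) * ?G k j)"
        using HS ij by (intro sum.cong refl) auto
      also have "\<dots> = ?G i j" using ij by (simp add: if_distrib[where f="\<lambda>x. x * _"] cong: if_cong)
      finally show ?thesis by (simp add: H_def)
    qed
    have "B' i j = B i j" if "i < d" "j < d" for i j
    proof (rule sym_pd_sqrt_unique[OF _ Bpd _ that])
      show "sym_pd d B'" using B' by blast
      fix i j assume ij: "i < d" "j < d"
      have "(\<Sum>k<d. B i k * B k j) = (\<Sum>k<d. F f i k * F f k j)"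
        using ij by (intro sum.cong refl) (auto simp: BF)
      then show "(\<Sum>k<d. B' i k * B' k j) = (\<Sum>k<d. B i k * B k j)"
        unfolding B'2[OF ij] Fmul by simp
    qed
    then show "B' = B" using B' by (intro ext) (metis B_def not_le)
  qed
  moreover have "(\<Sum>k<d. C i k * B k j) = (if i = j then 1 else 0)" if ij: "i < d" "j < d" for i j
  proof -
    have "(\<Sum>k<d. C i k * B k j) = (\<Sum>k<d. F (\<lambda>l. sqrt (mu l)) i k * F f k j)"
      using ij by (intro sum.cong refl) (auto simp: BF C_def)
    also have "\<dots> = F (\<lambda>l. 1) i j" unfolding Fmul
    proof (rule Fcong)
      fix l assume "l < d"
      then have "0 < mu l" by (rule mu)
      then show "sqrt (mu l) * f l = 1" by (simp add: f_def)
    qed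
    finally show ?thesis by (simp add: F1 ij)
  qed
  moreover have "(\<Sum>k<d. C i k * C k j) = S i j" if ij: "i < d" "j < d" for i j
  proof -
    have "(\<Sum>k<d. C i k * C k j) = F mu i j" unfolding C_def Fmul
      using mu by (intro Fcong) (simp add: less_imp_le)
    then show ?thesis by (simp add: FS ij)
  qed
  moreover have "C i j = C j i" for i j by (simp add: C_def Fsym)
  ultimately show ?thesis by blast
qed

section \<open>Gaussian product measures\<close>

definition stdn :: "real measure" where "stdn = density lborel std_normal_density"

definition gauss :: "'i set \<Rightarrow> ('i \<Rightarrow> real) measure" where "gauss I = PiM I (\<lambda>_. stdn)"

lemma prob_space_stdn: "prob_space stdn"
  unfolding stdn_def by (rule prob_space_normal_density) simp

lemma sets_stdn [simp]: "sets stdn = sets borel"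
  by (simp add: stdn_def)

lemma space_stdn [simp]: "space stdn = UNIV"
  by (simp add: stdn_def)

lemma measurable_stdn: "borel_measurable stdn = borel_measurable borel"
  by (rule measurable_cong_sets) simp_all

lemma measurable_to_stdn: "f \<in> borel_measurable M \<Longrightarrow> f \<in> measurable M stdn"
  by (simp cong: measurable_cong_sets)

lemma product_sigma_stdn: "product_sigma_finite (\<lambda>_. stdn)"
  by (intro product_sigma_finite.intro prob_space_imp_sigma_finite prob_space_stdn)

lemma prob_space_gauss: "prob_space (gauss I)"
  unfolding gauss_def by (intro prob_space_PiM prob_space_stdn)

lemma gauss_coord [measurable (raw)]: "i \<in> I \<Longrightarrow> (\<lambda>g. g i) \<in> borel_measurable (gauss I)"
proof -
  assume "i \<in> I"
  then have "(\<lambda>g. g i) \<in> measurable (gauss I) stdn"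
    unfolding gauss_def by (rule measurable_component_singleton)
  then show ?thesis by (simp cong: measurable_cong_sets)
qed

text \<open>Cameron-Martin on the line, combined with a reflection when e = -1: the density at a + e
  g is the density at g times the exponential weight, because e^2 = 1.\<close>

lemma stdn_shift:
  assumes e: "e = 1 \<or> e = (-1::real)" and A: "A \<in> sets borel"
  shows "(\<integral>\<^sup>+g. ennreal (exp (- e * (a * g) - a^2 / 2)) * indicator A (a + e * g) \<partial>stdn) = emeasure stdn A"
proof -
  have [measurable]: "A \<in> sets borel" by (rule A)
  have dens: "std_normal_density g * exp (- e * (a * g) - a^2 / 2) = std_normal_density (a + e * g)" for g
  proof -
    have "- (g^2) / 2 + (- e * (a * g) - a^2 / 2) = - ((a + e * g)^2) / 2"
      using e by (auto simp: power2_eq_square algebra_simps)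
    then have "exp (- (g^2) / 2) * exp (- e * (a * g) - a^2 / 2) = exp (- ((a + e * g)^2) / 2)"
      by (metis exp_add)
    then show ?thesis by (simp add: std_normal_density_def mult.assoc)
  qed
  have "(\<integral>\<^sup>+g. ennreal (exp (- e * (a * g) - a^2 / 2)) * indicator A (a + e * g) \<partial>stdn)
     = (\<integral>\<^sup>+g. ennreal (std_normal_density g) * (ennreal (exp (- e * (a * g) - a^2 / 2)) * indicator A (a + e * g)) \<partial>lborel)"
    unfolding stdn_def by (subst nn_integral_density) auto
  also have "\<dots> = (\<integral>\<^sup>+g. ennreal (std_normal_density (a + e * g)) * indicator A (a + e * g) \<partial>lborel)"
  proof (rule nn_integral_cong)
    fix g
    have "ennreal (std_normal_density g) * ennreal (exp (- e * (a * g) - a^2 / 2)) = ennreal (std_normal_density (a + e * g))"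
      unfolding dens[symmetric] by (rule ennreal_mult'[symmetric]) simp
    then show "ennreal (std_normal_density g) * (ennreal (exp (- e * (a * g) - a^2 / 2)) * indicator A (a + e * g))
      = ennreal (std_normal_density (a + e * g)) * indicator A (a + e * g)"
      by (simp only: mult.assoc[symmetric])
  qed
  also have "\<dots> = (\<integral>\<^sup>+g. ennreal (std_normal_density g) * indicator A g \<partial>lborel)"
    using e by (subst (2) nn_integral_real_affine[of _ e a]) auto
  also have "\<dots> = emeasure stdn A" unfolding stdn_def by (subst emeasure_density) auto
  finally show ?thesis .
qed

text \<open>The reweighted and shifted product is identified with the Gaussian product on boxes,
  where everything factorises. The restriction to \<open>I\<close> appears because points of the
  product space take the value \<open>undefined\<close> outside \<open>I\<close>.\<close>

lemma gauss_shift: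
  assumes I: "finite I" and e: "e = 1 \<or> e = (-1::real)" and F: "F \<in> borel_measurable (gauss I)"
  shows "(\<integral>\<^sup>+g. F g \<partial>gauss I) =
    (\<integral>\<^sup>+g. ennreal (exp (- e * (\<Sum>i\<in>I. a i * g i) - (\<Sum>i\<in>I. (a i)^2) / 2)) * F (\<lambda>i\<in>I. a i + e * g i) \<partial>gauss I)"
proof -
  note [measurable] = F
  define w where "w = (\<lambda>g. ennreal (exp (- e * (\<Sum>i\<in>I. a i * g i) - (\<Sum>i\<in>I. (a i)^2) / 2)))"
  define h where "h = (\<lambda>g. \<lambda>i\<in>I. a i + e * g i)"
  have w_meas [measurable]: "w \<in> borel_measurable (gauss I)"
    unfolding w_def by measurable
  have h_meas [measurable]: "h \<in> measurable (gauss I) (gauss I)"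
  proof -
    have "(\<lambda>g. \<lambda>i\<in>I. a i + e * g i) \<in> measurable (gauss I) (PiM I (\<lambda>_. stdn))"
      by (rule measurable_restrict, rule measurable_to_stdn) measurable
    then show ?thesis by (simp add: h_def gauss_def)
  qed
  have wprod: "w g = (\<Prod>i\<in>I. ennreal (exp (- e * (a i * g i) - (a i)^2 / 2)))" for g
    unfolding w_def using I
    by (subst prod_ennreal) (auto simp: exp_sum[symmetric] sum_subtractf sum_distrib_left sum_divide_distrib sum_negf)
  have "distr (density (gauss I) w) (gauss I) h = PiM I (\<lambda>_. stdn)"
  proof (rule product_sigma_finite.PiM_eqI[OF product_sigma_stdn I])
    show "sets (distr (density (gauss I) w) (gauss I) h) = sets (PiM I (\<lambda>_. stdn))"
      by (simp add: gauss_def)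
    fix A assume A: "\<And>i. i \<in> I \<Longrightarrow> A i \<in> sets stdn"
    have PA: "PiE I A \<in> sets (gauss I)" unfolding gauss_def using A I by (intro sets_PiM_I_finite)
    have "emeasure (distr (density (gauss I) w) (gauss I) h) (PiE I A)
       = (\<integral>\<^sup>+g. w g * indicator (PiE I A) (h g) \<partial>gauss I)"
    proof -
      have m: "h -` PiE I A \<inter> space (gauss I) \<in> sets (gauss I)"
        using measurable_sets[OF h_meas PA] .
      show ?thesis using PA m
        by (subst emeasure_distr, simp, simp, subst emeasure_density)
          (auto intro!: nn_integral_cong simp: indicator_def)
    qed
    also have "\<dots> = (\<integral>\<^sup>+g. (\<Prod>i\<in>I. ennreal (exp (- e * (a i * g i) - (a i)^2 / 2)) * indicator (A i) (a i + e * g i)) \<partial>gauss I)"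
    proof (intro nn_integral_cong)
      fix g
      have "indicator (PiE I A) (h g) = (\<Prod>i\<in>I. indicator (A i) (a i + e * g i) :: ennreal)"
        using I by (auto simp: indicator_def h_def PiE_iff prod_zero_iff)
      then show "w g * indicator (PiE I A) (h g) = (\<Prod>i\<in>I. ennreal (exp (- e * (a i * g i) - (a i)^2 / 2)) * indicator (A i) (a i + e * g i))"
        by (simp add: wprod prod.distrib)
    qed
    also have "\<dots> = (\<Prod>i\<in>I. \<integral>\<^sup>+g. ennreal (exp (- e * (a i * g) - (a i)^2 / 2)) * indicator (A i) (a i + e * g) \<partial>stdn)"
      unfolding gauss_def
    proof (rule product_sigma_finite.product_nn_integral_prod[OF product_sigma_stdn I])
      fix i assume "i \<in> I"
      then have [measurable]: "A i \<in> sets borel" using A by simp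
      show "(\<lambda>g. ennreal (exp (- e * (a i * g) - (a i)^2 / 2)) * indicator (A i) (a i + e * g)) \<in> borel_measurable stdn"
        unfolding measurable_stdn by measurable
    qed
    also have "\<dots> = (\<Prod>i\<in>I. emeasure stdn (A i))"
      using A by (intro prod.cong refl stdn_shift e) auto
    finally show "emeasure (distr (density (gauss I) w) (gauss I) h) (PiE I A) = (\<Prod>i\<in>I. emeasure stdn (A i))" .
  qed
  then have "(\<integral>\<^sup>+g. F g \<partial>gauss I) = (\<integral>\<^sup>+g. F g \<partial>distr (density (gauss I) w) (gauss I) h)"
    by (simp add: gauss_def)
  also have "\<dots> = (\<integral>\<^sup>+g. F (h g) \<partial>density (gauss I) w)"
    by (rule nn_integral_distr) auto
  also have "\<dots> = (\<integral>\<^sup>+g. w g * F (h g) \<partial>gauss I)" by (rule nn_integral_density) auto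
  finally show ?thesis by (simp add: w_def h_def)
qed

lemma stdn_integrals:
  "integrable stdn (\<lambda>x. x)" "integrable stdn (\<lambda>x. x^2)" "(\<integral>x. x \<partial>stdn) = 0" "(\<integral>x. x^2 \<partial>stdn) = 1"
proof -
  have m: "has_bochner_integral lborel (\<lambda>x. std_normal_density x * x) 0"
    using std_normal_moment_odd[of 0] by simp
  have v: "has_bochner_integral lborel (\<lambda>x. std_normal_density x * x^2) 1"
    using std_normal_moment_even[of 1] by simp
  show "integrable stdn (\<lambda>x. x)" unfolding stdn_def
    by (subst integrable_density) (use integrable.intros[OF m] in simp_all)
  show "integrable stdn (\<lambda>x. x^2)" unfolding stdn_def
    by (subst integrable_density) (use integrable.intros[OF v] in simp_all)
  show "(\<integral>x. x \<partial>stdn) = 0" unfolding stdn_def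
    using m by (subst integral_density) (auto simp: has_bochner_integral_integral_eq)
  show "(\<integral>x. x^2 \<partial>stdn) = 1" unfolding stdn_def
    using v by (subst integral_density) (auto simp: has_bochner_integral_integral_eq)
qed

lemma gauss_cov:
  assumes I: "finite I" "i \<in> I" "j \<in> I"
  shows "integrable (gauss I) (\<lambda>g. g i * g j)" "(\<integral>g. g i * g j \<partial>gauss I) = (if i = j then 1 else 0)"
proof -
  interpret S: prob_space stdn by (rule prob_space_stdn)
  define f :: "'a \<Rightarrow> real \<Rightarrow> real" where
    "f = (\<lambda>k x. (if k = i then x else 1) * (if k = j then x else 1))"
  have int: "integrable stdn (f k)" for k
    using stdn_integrals(1,2) S.integrable_const[of 1]
    unfolding f_def by (cases "k = i"; cases "k = j"; simp only: if_True if_False simp_thms power2_eq_square mult_1_left mult_1_right)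
  have prod: "(\<Prod>k\<in>I. f k (g k)) = g i * g j" for g
    using I by (simp add: f_def prod.distrib)
  show "integrable (gauss I) (\<lambda>g. g i * g j)"
    using product_sigma_finite.product_integrable_prod[OF product_sigma_stdn I(1), of f] int by (simp add: prod gauss_def)
  have "(\<integral>g. g i * g j \<partial>gauss I) = (\<Prod>k\<in>I. integral\<^sup>L stdn (f k))"
    using product_sigma_finite.product_integral_prod[OF product_sigma_stdn I(1), of f] int by (simp add: prod gauss_def)
  also have "\<dots> = (if i = j then 1 else 0)"
  proof (cases "i = j")
    case True
    have "integral\<^sup>L stdn (f k) = 1" for k
    proof (cases "k = i")
      case k: True
      then show ?thesis using stdn_integrals(4) True by (simp add: f_def power2_eq_square)
    next
      case False
      then show ?thesis using True S.prob_space by (simp add: f_def)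
    qed
    then show ?thesis using True by simp
  next
    case False
    have "integral\<^sup>L stdn (f i) = 0" using stdn_integrals(3) False by (simp add: f_def)
    then show ?thesis using I False by (auto intro!: prod_zero)
  qed
  finally show "(\<integral>g. g i * g j \<partial>gauss I) = (if i = j then 1 else 0)" .
qed

lemma gauss_sq:
  assumes I: "finite I"
  shows "(\<integral>\<^sup>+g. ennreal ((\<Sum>i\<in>I. c i * g i)^2) \<partial>gauss I) = ennreal (\<Sum>i\<in>I. (c i)^2)"
proof -
  have eq: "(\<Sum>i\<in>I. c i * g i)^2 = (\<Sum>i\<in>I. \<Sum>j\<in>I. (c i * c j) * (g i * g j))" for g :: "'a \<Rightarrow> real"
    unfolding power2_eq_square sum_product by (intro sum.cong refl) (simp add: algebra_simps)
  have int: "integrable (gauss I) (\<lambda>g. (\<Sum>i\<in>I. c i * g i)^2)"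
    unfolding eq using gauss_cov(1)[OF I] by (intro Bochner_Integration.integrable_sum integrable_mult_right) auto
  have "(\<integral>g. (\<Sum>i\<in>I. c i * g i)^2 \<partial>gauss I) = (\<Sum>i\<in>I. \<Sum>j\<in>I. (c i * c j) * (if i = j then 1 else 0))"
    unfolding eq using gauss_cov[OF I]
    by (subst Bochner_Integration.integral_sum, force)
      (intro sum.cong refl, subst Bochner_Integration.integral_sum, force, intro sum.cong refl, simp)
  also have "\<dots> = (\<Sum>i\<in>I. (c i)^2)"
    using I by (simp add: if_distrib[where f="\<lambda>x. _ * x"] power2_eq_square cong: if_cong)
  finally show ?thesis using nn_integral_eq_integral[OF int] by simp
qed

section \<open>Trilinear forms in three Gaussian blocks\<close>

definition tl :: "'i set \<Rightarrow> 'j set \<Rightarrow> 'k set \<Rightarrow> ('i \<Rightarrow> 'j \<Rightarrow> 'k \<Rightarrow> real) \<Rightarrow> ('i \<Rightarrow> real) \<Rightarrow> ('j \<Rightarrow> real) \<Rightarrow> ('k \<Rightarrow> real) \<Rightarrow> real" where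
  "tl I J K A x y z = (\<Sum>i\<in>I. \<Sum>j\<in>J. \<Sum>k\<in>K. A i j k * x i * y j * z k)"

lemma tl_cong:
  assumes "\<And>i. i \<in> I \<Longrightarrow> x i = x' i" "\<And>i. i \<in> J \<Longrightarrow> y i = y' i" "\<And>i. i \<in> K \<Longrightarrow> z i = z' i"
  shows "tl I J K A x y z = tl I J K A x' y' z'"
  unfolding tl_def using assms by (intro sum.cong refl) auto

lemma tl_lin1: "tl I J K A (\<lambda>i. x i + e * g i) y z = tl I J K A x y z + e * tl I J K A g y z"
  by (simp add: tl_def sum.distrib[symmetric] sum_distrib_left algebra_simps)

lemma tl_lin2: "tl I J K A x (\<lambda>i. y i + e * g i) z = tl I J K A x y z + e * tl I J K A x g z"
  by (simp add: tl_def sum.distrib[symmetric] sum_distrib_left algebra_simps)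

lemma tl_lin3: "tl I J K A x y (\<lambda>i. z i + e * g i) = tl I J K A x y z + e * tl I J K A x y g"
  by (simp add: tl_def sum.distrib[symmetric] sum_distrib_left algebra_simps)

text \<open>\<open>None\<close> stands for keeping a fixed vector and \<open>Some i\<close> for
  replacing it by the i-th basis vector. The Gaussian mean of a squared linear form is the sum of
  its squares on basis vectors, so a sum over \<open>opt I\<close> computes the fixed and the
  Gaussian alternative together.\<close>

definition opt :: "'i set \<Rightarrow> 'i option set" where "opt I = insert None (Some ` I)"

definition pk :: "('i \<Rightarrow> real) \<Rightarrow> 'i option \<Rightarrow> 'i \<Rightarrow> real" where
  "pk x u = (case u of None \<Rightarrow> x | Some i \<Rightarrow> (\<lambda>j. if j = i then 1 else 0))"

lemma sum_opt: "finite I \<Longrightarrow> (\<Sum>u\<in>opt I. f u) = f None + (\<Sum>i\<in>I. f (Some i))"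
  unfolding opt_def by (subst sum.insert) (auto simp: sum.reindex)

lemma gauss_pick:
  assumes I: "finite I"
  shows "(\<integral>\<^sup>+g. ennreal (\<Sum>b\<in>UNIV. (\<Sum>i\<in>I. c i * (if b then g i else x i))^2) \<partial>gauss I)
    = ennreal (\<Sum>u\<in>opt I. (\<Sum>i\<in>I. c i * pk x u i)^2)"
proof -
  interpret G: prob_space "gauss I" by (rule prob_space_gauss)
  have "(\<integral>\<^sup>+g. ennreal (\<Sum>b\<in>UNIV. (\<Sum>i\<in>I. c i * (if b then g i else x i))^2) \<partial>gauss I)
     = (\<integral>\<^sup>+g. ennreal ((\<Sum>i\<in>I. c i * g i)^2) + ennreal ((\<Sum>i\<in>I. c i * x i)^2) \<partial>gauss I)"
    by (simp add: UNIV_bool add.commute)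
  also have "\<dots> = ennreal (\<Sum>i\<in>I. (c i)^2) + ennreal ((\<Sum>i\<in>I. c i * x i)^2)"
    by (subst nn_integral_add) (auto simp: gauss_sq[OF I] G.emeasure_space_1)
  also have "\<dots> = ennreal (\<Sum>u\<in>opt I. (\<Sum>i\<in>I. c i * pk x u i)^2)"
    using I by (simp add: sum_opt pk_def sum_nonneg if_distrib[where f="\<lambda>x. _ * x"] add.commute cong: if_cong)
  finally show ?thesis .
qed

lemma sum_rev3:
  fixes f :: "'a \<Rightarrow> 'b \<Rightarrow> 'c \<Rightarrow> 'd::comm_monoid_add"
  shows "(\<Sum>w\<in>C. \<Sum>v\<in>B. \<Sum>u\<in>A. f u v w) = (\<Sum>u\<in>A. \<Sum>v\<in>B. \<Sum>w\<in>C. f u v w)"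
proof -
  have "(\<Sum>w\<in>C. \<Sum>v\<in>B. \<Sum>u\<in>A. f u v w) = (\<Sum>w\<in>C. \<Sum>u\<in>A. \<Sum>v\<in>B. f u v w)"
    by (intro sum.cong refl sum.swap)
  also have "\<dots> = (\<Sum>u\<in>A. \<Sum>w\<in>C. \<Sum>v\<in>B. f u v w)" by (rule sum.swap)
  also have "\<dots> = (\<Sum>u\<in>A. \<Sum>v\<in>B. \<Sum>w\<in>C. f u v w)"
    by (intro sum.cong refl sum.swap)
  finally show ?thesis .
qed

text \<open>Logarithm of the Cameron-Martin weight for centre a and sign e. Its linear part is odd
  in e and cancels in the sum over signs, leaving the cost |a|^2 / 2.\<close>

definition wt :: "real \<Rightarrow> 'x set \<Rightarrow> ('x \<Rightarrow> real) \<Rightarrow> ('x \<Rightarrow> real) \<Rightarrow> real" where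
  "wt e S a g = - e * (\<Sum>i\<in>S. a i * g i) - (\<Sum>i\<in>S. (a i)^2) / 2"

lemma gauss_affine:
  "(\<lambda>g. \<lambda>i\<in>S. a i + e * g i) \<in> measurable (gauss S) (gauss S)"
proof -
  have "(\<lambda>g. \<lambda>i\<in>S. a i + e * g i) \<in> measurable (gauss S) (PiM S (\<lambda>_. stdn))"
    by (rule measurable_restrict, rule measurable_to_stdn) measurable
  then show ?thesis by (simp add: gauss_def)
qed

lemma wt_measurable: "wt e S a \<in> borel_measurable (gauss S)"
  unfolding wt_def by measurable

lemma wt_exp: "(\<lambda>v. ennreal (exp (wt e S a v))) \<in> borel_measurable (gauss S)"
  unfolding wt_def by measurable

lemma nn_integral_pull:
  assumes "sigma_finite_measure N" and "H \<in> borel_measurable (M \<Otimes>\<^sub>M N)"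
    and "a \<in> borel_measurable M" "b \<in> borel_measurable N"
  shows "c * (\<integral>\<^sup>+v. a v * (\<integral>\<^sup>+w. b w * H (v, w) \<partial>N) \<partial>M) = (\<integral>\<^sup>+v. \<integral>\<^sup>+w. c * a v * b w * H (v, w) \<partial>N \<partial>M)"
proof -
  interpret sigma_finite_measure N by fact
  note [measurable] = assms(2-)
  have "c * (\<integral>\<^sup>+v. a v * (\<integral>\<^sup>+w. b w * H (v, w) \<partial>N) \<partial>M) = (\<integral>\<^sup>+v. c * (a v * (\<integral>\<^sup>+w. b w * H (v, w) \<partial>N)) \<partial>M)"
    by (rule nn_integral_cmult[symmetric]) measurable
  also have "\<dots> = (\<integral>\<^sup>+v. \<integral>\<^sup>+w. c * a v * b w * H (v, w) \<partial>N \<partial>M)"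
  proof (rule nn_integral_cong)
    fix v assume [measurable]: "v \<in> space M"
    have "c * (a v * (\<integral>\<^sup>+w. b w * H (v, w) \<partial>N)) = (\<integral>\<^sup>+w. (c * a v) * (b w * H (v, w)) \<partial>N)"
      by (subst mult.assoc[symmetric], rule nn_integral_cmult[symmetric]) measurable
    then show "c * (a v * (\<integral>\<^sup>+w. b w * H (v, w) \<partial>N)) = (\<integral>\<^sup>+w. c * a v * b w * H (v, w) \<partial>N)"
      by (simp only: mult.assoc)
  qed
  finally show ?thesis .
qed

locale gauss3 =
  fixes I :: "'i set" and J :: "'j set" and K :: "'k set"
  assumes fin: "finite I" "finite J" "finite K"
begin

definition G where "G = gauss I \<Otimes>\<^sub>M (gauss J \<Otimes>\<^sub>M gauss K)"

abbreviation "T \<equiv> tl I J K"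

lemma coords [measurable]:
  "i \<in> I \<Longrightarrow> (\<lambda>g. fst g i) \<in> borel_measurable G"
  "j \<in> J \<Longrightarrow> (\<lambda>g. fst (snd g) j) \<in> borel_measurable G"
  "k \<in> K \<Longrightarrow> (\<lambda>g. snd (snd g) k) \<in> borel_measurable G"
  unfolding G_def
  by (rule measurable_compose[OF measurable_fst gauss_coord], assumption,
      rule measurable_compose[OF measurable_compose[OF measurable_snd measurable_fst] gauss_coord], assumption,
      rule measurable_compose[OF measurable_compose[OF measurable_snd measurable_snd] gauss_coord], assumption)

lemma iter:
  assumes "F \<in> borel_measurable G"
  shows "(\<integral>\<^sup>+g. F g \<partial>G) = (\<integral>\<^sup>+x. \<integral>\<^sup>+y. \<integral>\<^sup>+z. F (x, y, z) \<partial>gauss K \<partial>gauss J \<partial>gauss I)"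
proof -
  interpret GK: sigma_finite_measure "gauss K" by (intro prob_space_imp_sigma_finite prob_space_gauss)
  interpret GJK: sigma_finite_measure "gauss J \<Otimes>\<^sub>M gauss K"
    by (intro prob_space_imp_sigma_finite prob_space_pair prob_space_gauss)
  note [measurable] = assms[unfolded G_def]
  have "(\<integral>\<^sup>+g. F g \<partial>G) = (\<integral>\<^sup>+x. \<integral>\<^sup>+w. F (x, w) \<partial>(gauss J \<Otimes>\<^sub>M gauss K) \<partial>gauss I)"
    unfolding G_def by (rule GJK.nn_integral_fst[symmetric]) measurable
  also have "\<dots> = (\<integral>\<^sup>+x. \<integral>\<^sup>+y. \<integral>\<^sup>+z. F (x, y, z) \<partial>gauss K \<partial>gauss J \<partial>gauss I)"
  proof (rule nn_integral_cong)
    fix x assume "x \<in> space (gauss I)"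
    then have [measurable]: "(\<lambda>w. F (x, w)) \<in> borel_measurable (gauss J \<Otimes>\<^sub>M gauss K)" by measurable
    show "(\<integral>\<^sup>+w. F (x, w) \<partial>(gauss J \<Otimes>\<^sub>M gauss K)) = (\<integral>\<^sup>+y. \<integral>\<^sup>+z. F (x, y, z) \<partial>gauss K \<partial>gauss J)"
      by (rule GK.nn_integral_fst[symmetric]) measurable
  qed
  finally show ?thesis .
qed

lemma prob_G: "prob_space G"
  unfolding G_def by (intro prob_space_pair prob_space_gauss)

text \<open>\<open>Fc\<close> says that F sees only coordinates in the three index sets, so the
  restricted shifts produced by \<open>gauss_shift\<close> may be replaced by plain ones. The three
  signs are chosen independently.\<close>

lemma shift3:
  assumes e: "e1 = 1 \<or> e1 = (-1::real)" "e2 = 1 \<or> e2 = (-1::real)" "e3 = 1 \<or> e3 = (-1::real)"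
    and F: "F \<in> borel_measurable G"
    and Fc: "\<And>u v w u' v' w'. (\<And>i. i \<in> I \<Longrightarrow> u i = u' i) \<Longrightarrow> (\<And>i. i \<in> J \<Longrightarrow> v i = v' i) \<Longrightarrow> (\<And>i. i \<in> K \<Longrightarrow> w i = w' i)
      \<Longrightarrow> F (u, v, w) = F (u', v', w')"
  shows "(\<integral>\<^sup>+g. F g \<partial>G) = (\<integral>\<^sup>+g. ennreal (exp (wt e1 I x (fst g) + wt e2 J y (fst (snd g)) + wt e3 K z (snd (snd g)))) *
     F ((\<lambda>i. x i + e1 * fst g i), (\<lambda>i. y i + e2 * fst (snd g) i), (\<lambda>i. z i + e3 * snd (snd g) i)) \<partial>G)"
proof -
  note [measurable] = F[unfolded G_def]
  interpret GK: sigma_finite_measure "gauss K" by (intro prob_space_imp_sigma_finite prob_space_gauss)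
  interpret GJ: sigma_finite_measure "gauss J" by (intro prob_space_imp_sigma_finite prob_space_gauss)
  note h = gauss_affine
  note [measurable] = h[where S=I] h[where S=J] h[where S=K]
  note [measurable] = wt_measurable[where S=I] wt_measurable[where S=J] wt_measurable[where S=K]
  let ?hx = "\<lambda>g. \<lambda>i\<in>I. x i + e1 * g i" and ?hy = "\<lambda>g. \<lambda>i\<in>J. y i + e2 * g i" and ?hz = "\<lambda>g. \<lambda>i\<in>K. z i + e3 * g i"
  have "(\<integral>\<^sup>+g. F g \<partial>G) = (\<integral>\<^sup>+u. \<integral>\<^sup>+v. \<integral>\<^sup>+w. F (u, v, w) \<partial>gauss K \<partial>gauss J \<partial>gauss I)"
    by (rule iter[OF F])
  also have "\<dots> = (\<integral>\<^sup>+u. ennreal (exp (wt e1 I x u)) * (\<integral>\<^sup>+v. \<integral>\<^sup>+w. F (?hx u, v, w) \<partial>gauss K \<partial>gauss J) \<partial>gauss I)"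
    unfolding wt_def by (rule gauss_shift[OF fin(1) e(1)]) measurable
  also have "\<dots> = (\<integral>\<^sup>+u. ennreal (exp (wt e1 I x u)) * (\<integral>\<^sup>+v. ennreal (exp (wt e2 J y v)) *
      (\<integral>\<^sup>+w. F (?hx u, ?hy v, w) \<partial>gauss K) \<partial>gauss J) \<partial>gauss I)"
  proof (rule nn_integral_cong, rule arg_cong2[where f="(*)", OF refl])
    fix u assume "u \<in> space (gauss I)"
    then have [measurable]: "?hx u \<in> space (gauss I)" using measurable_space[OF h[where S=I and a=x and e=e1]] by blast
    show "(\<integral>\<^sup>+v. \<integral>\<^sup>+w. F (?hx u, v, w) \<partial>gauss K \<partial>gauss J) =
      (\<integral>\<^sup>+v. ennreal (exp (wt e2 J y v)) * (\<integral>\<^sup>+w. F (?hx u, ?hy v, w) \<partial>gauss K) \<partial>gauss J)"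
      unfolding wt_def by (rule gauss_shift[OF fin(2) e(2)]) measurable
  qed
  also have "\<dots> = (\<integral>\<^sup>+u. ennreal (exp (wt e1 I x u)) * (\<integral>\<^sup>+v. ennreal (exp (wt e2 J y v)) *
      (\<integral>\<^sup>+w. ennreal (exp (wt e3 K z w)) * F (?hx u, ?hy v, ?hz w) \<partial>gauss K) \<partial>gauss J) \<partial>gauss I)"
  proof (rule nn_integral_cong, rule arg_cong2[where f="(*)", OF refl],
      rule nn_integral_cong, rule arg_cong2[where f="(*)", OF refl])
    fix u v assume "u \<in> space (gauss I)" "v \<in> space (gauss J)"
    then have [measurable]: "?hx u \<in> space (gauss I)" "?hy v \<in> space (gauss J)"
      using measurable_space[OF h[where S=I and a=x and e=e1]] measurable_space[OF h[where S=J and a=y and e=e2]] by blast+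
    show "(\<integral>\<^sup>+w. F (?hx u, ?hy v, w) \<partial>gauss K) =
      (\<integral>\<^sup>+w. ennreal (exp (wt e3 K z w)) * F (?hx u, ?hy v, ?hz w) \<partial>gauss K)"
      unfolding wt_def by (rule gauss_shift[OF fin(3) e(3)]) measurable
  qed
  also have "\<dots> = (\<integral>\<^sup>+u. \<integral>\<^sup>+v. \<integral>\<^sup>+w. ennreal (exp (wt e1 I x u + wt e2 J y v + wt e3 K z w)) *
     F (?hx u, ?hy v, ?hz w) \<partial>gauss K \<partial>gauss J \<partial>gauss I)"
  proof (rule nn_integral_cong)
    fix u assume u: "u \<in> space (gauss I)"
    then have hu: "?hx u \<in> space (gauss I)" using measurable_space[OF h[where S=I and a=x and e=e1]] by blast
    have m: "(\<lambda>p. F (?hx u, ?hy (fst p), ?hz (snd p))) \<in> borel_measurable (gauss J \<Otimes>\<^sub>M gauss K)"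
      by (rule measurable_compose[OF _ F[unfolded G_def]])
        (intro measurable_Pair measurable_const hu measurable_compose[OF measurable_fst h]
          measurable_compose[OF measurable_snd h])
    have "ennreal (exp (wt e1 I x u)) * (\<integral>\<^sup>+v. ennreal (exp (wt e2 J y v)) *
      (\<integral>\<^sup>+w. ennreal (exp (wt e3 K z w)) * F (?hx u, ?hy v, ?hz w) \<partial>gauss K) \<partial>gauss J)
     = (\<integral>\<^sup>+v. \<integral>\<^sup>+w. ennreal (exp (wt e1 I x u)) * ennreal (exp (wt e2 J y v)) * ennreal (exp (wt e3 K z w)) *
       F (?hx u, ?hy v, ?hz w) \<partial>gauss K \<partial>gauss J)"
      using nn_integral_pull[OF GK.sigma_finite_measure_axioms m, where c="ennreal (exp (wt e1 I x u))"
          and a="\<lambda>v. ennreal (exp (wt e2 J y v))" and b="\<lambda>w. ennreal (exp (wt e3 K z w))",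
          OF wt_exp wt_exp]
      by (simp only: fst_conv snd_conv)
    then show "ennreal (exp (wt e1 I x u)) * (\<integral>\<^sup>+v. ennreal (exp (wt e2 J y v)) *
      (\<integral>\<^sup>+w. ennreal (exp (wt e3 K z w)) * F (?hx u, ?hy v, ?hz w) \<partial>gauss K) \<partial>gauss J)
      = (\<integral>\<^sup>+v. \<integral>\<^sup>+w. ennreal (exp (wt e1 I x u + wt e2 J y v + wt e3 K z w)) *
       F (?hx u, ?hy v, ?hz w) \<partial>gauss K \<partial>gauss J)"
      by (simp only: exp_add ennreal_mult' exp_ge_zero mult_nonneg_nonneg)
  qed
  also have "\<dots> = (\<integral>\<^sup>+g. ennreal (exp (wt e1 I x (fst g) + wt e2 J y (fst (snd g)) + wt e3 K z (snd (snd g)))) *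
     F (?hx (fst g), ?hy (fst (snd g)), ?hz (snd (snd g))) \<partial>G)"
  proof (subst iter)
    have "(\<lambda>g. F (?hx (fst g), ?hy (fst (snd g)), ?hz (snd (snd g)))) \<in> borel_measurable G"
    proof (rule measurable_compose[OF _ F])
      show "(\<lambda>g. (?hx (fst g), ?hy (fst (snd g)), ?hz (snd (snd g)))) \<in> measurable G G"
        unfolding G_def
        by (rule measurable_Pair[OF measurable_compose[OF measurable_fst h]
            measurable_Pair[OF measurable_compose[OF measurable_compose[OF measurable_snd measurable_fst] h]
              measurable_compose[OF measurable_compose[OF measurable_snd measurable_snd] h]]])
    qed
    moreover have "(\<lambda>g. ennreal (exp (wt e1 I x (fst g) + wt e2 J y (fst (snd g)) + wt e3 K z (snd (snd g))))) \<in> borel_measurable G"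
      unfolding wt_def by measurable
    ultimately show "(\<lambda>g. ennreal (exp (wt e1 I x (fst g) + wt e2 J y (fst (snd g)) + wt e3 K z (snd (snd g)))) *
        F (?hx (fst g), ?hy (fst (snd g)), ?hz (snd (snd g)))) \<in> borel_measurable G"
      by (intro borel_measurable_times_ennreal)
  qed (simp only: fst_conv snd_conv)
  also have "\<dots> = (\<integral>\<^sup>+g. ennreal (exp (wt e1 I x (fst g) + wt e2 J y (fst (snd g)) + wt e3 K z (snd (snd g)))) *
     F ((\<lambda>i. x i + e1 * fst g i), (\<lambda>i. y i + e2 * fst (snd g) i), (\<lambda>i. z i + e3 * snd (snd g) i)) \<partial>G)"
    by (intro nn_integral_cong arg_cong2[where f="(*)"] refl Fc) auto
  finally show ?thesis .
qed

definition pick :: "bool \<Rightarrow> ('x \<Rightarrow> real) \<Rightarrow> ('x \<Rightarrow> real) \<Rightarrow> 'x \<Rightarrow> real" where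
  "pick b g x = (\<lambda>i. if b then g i else x i)"

lemma T_meas [measurable]:
  "(\<lambda>g. T A (pick b1 (fst g) x) (pick b2 (fst (snd g)) y) (pick b3 (snd (snd g)) z)) \<in> borel_measurable G"
  unfolding tl_def pick_def by measurable

text \<open>Integrating out one block after another turns each choice between fixed and Gaussian
  into a sum over \<open>opt\<close>. The form is linear in every block, so each stage is an
  instance of \<open>gauss_pick\<close>.\<close>

lemma moment:
  "(\<integral>\<^sup>+g. ennreal (\<Sum>b1\<in>UNIV. \<Sum>b2\<in>UNIV. \<Sum>b3\<in>UNIV.
      (T A (pick b1 (fst g) x) (pick b2 (fst (snd g)) y) (pick b3 (snd (snd g)) z))^2) \<partial>G)
   = ennreal (\<Sum>u\<in>opt I. \<Sum>v\<in>opt J. \<Sum>w\<in>opt K. (T A (pk x u) (pk y v) (pk z w))^2)"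
proof -
  have T3: "T A a b c = (\<Sum>k\<in>K. (\<Sum>i\<in>I. \<Sum>j\<in>J. A i j k * a i * b j) * c k)" for a b c
  proof -
    have "T A a b c = (\<Sum>i\<in>I. \<Sum>k\<in>K. \<Sum>j\<in>J. A i j k * a i * b j * c k)"
      unfolding tl_def by (intro sum.cong refl sum.swap)
    also have "\<dots> = (\<Sum>k\<in>K. \<Sum>i\<in>I. \<Sum>j\<in>J. A i j k * a i * b j * c k)" by (rule sum.swap)
    finally show ?thesis by (simp only: sum_distrib_right)
  qed
  have T2: "T A a b c = (\<Sum>j\<in>J. (\<Sum>i\<in>I. \<Sum>k\<in>K. A i j k * a i * c k) * b j)" for a b c
    unfolding tl_def sum_distrib_right
    by (subst sum.swap[of _ I J]) (simp add: algebra_simps)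
  have T1: "T A a b c = (\<Sum>i\<in>I. (\<Sum>j\<in>J. \<Sum>k\<in>K. A i j k * b j * c k) * a i)" for a b c
    unfolding tl_def sum_distrib_right by (simp add: algebra_simps)
  note gp = gauss_pick[unfolded pick_def[symmetric, abs_def]]
  have s3: "(\<integral>\<^sup>+g. ennreal (\<Sum>b3\<in>UNIV. (T A a b (pick b3 g z))^2) \<partial>gauss K) = ennreal (\<Sum>w\<in>opt K. (T A a b (pk z w))^2)" for a b
    unfolding T3 pick_def by (rule gauss_pick[OF fin(3)])
  have s2: "(\<integral>\<^sup>+g. ennreal (\<Sum>b2\<in>UNIV. (T A a (pick b2 g y) c)^2) \<partial>gauss J) = ennreal (\<Sum>w\<in>opt J. (T A a (pk y w) c)^2)" for a c
    unfolding T2 pick_def by (rule gauss_pick[OF fin(2)])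
  have s1: "(\<integral>\<^sup>+g. ennreal (\<Sum>b1\<in>UNIV. (T A (pick b1 g x) b c)^2) \<partial>gauss I) = ennreal (\<Sum>w\<in>opt I. (T A (pk x w) b c)^2)" for b c
    unfolding T1 pick_def by (rule gauss_pick[OF fin(1)])
  have m3: "(\<lambda>g. T A a b (pick b3 g z)) \<in> borel_measurable (gauss K)" for a b b3
    unfolding T3 pick_def by measurable
  have m2: "(\<lambda>g. T A a (pick b3 g y) c) \<in> borel_measurable (gauss J)" for a c b3
    unfolding T2 pick_def by measurable
  have m1: "(\<lambda>g. T A (pick b3 g x) b c) \<in> borel_measurable (gauss I)" for b c b3
    unfolding T1 pick_def by measurable
  note mm = measurable_compose[OF _ measurable_ennreal, OF borel_measurable_sum, OF borel_measurable_power]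
  note mm1 = mm[OF m1] and mm2 = mm[OF m2] and mm3 = mm[OF m3]
  let ?R = "\<lambda>u v w. ennreal (\<Sum>b1\<in>UNIV. \<Sum>b2\<in>UNIV. \<Sum>b3\<in>UNIV. (T A (pick b1 u x) (pick b2 v y) (pick b3 w z))^2)"
  have Rm: "(\<lambda>g. ?R (fst g) (fst (snd g)) (snd (snd g))) \<in> borel_measurable G"
    by (intro measurable_compose[OF _ measurable_ennreal] borel_measurable_sum borel_measurable_power T_meas)
  have "(\<integral>\<^sup>+g. ?R (fst g) (fst (snd g)) (snd (snd g)) \<partial>G) = (\<integral>\<^sup>+u. \<integral>\<^sup>+v. \<integral>\<^sup>+w. ?R u v w \<partial>gauss K \<partial>gauss J \<partial>gauss I)"
    by (subst iter[OF Rm]) (simp only: fst_conv snd_conv)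
  also have "\<dots> = (\<integral>\<^sup>+u. \<integral>\<^sup>+v. (\<Sum>b1\<in>UNIV. \<Sum>b2\<in>UNIV. ennreal (\<Sum>w\<in>opt K. (T A (pick b1 u x) (pick b2 v y) (pk z w))^2)) \<partial>gauss J \<partial>gauss I)"
  proof (intro nn_integral_cong)
    fix u v
    have "?R u v w = (\<Sum>b1\<in>UNIV. \<Sum>b2\<in>UNIV. ennreal (\<Sum>b3\<in>UNIV. (T A (pick b1 u x) (pick b2 v y) (pick b3 w z))^2))" for w
      by (simp only: sum_ennreal sum_nonneg zero_le_power2)
    then show "(\<integral>\<^sup>+w. ?R u v w \<partial>gauss K) =
        (\<Sum>b1\<in>UNIV. \<Sum>b2\<in>UNIV. ennreal (\<Sum>w\<in>opt K. (T A (pick b1 u x) (pick b2 v y) (pk z w))^2))"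
      by (simp only: nn_integral_sum borel_measurable_sum mm3 s3)
  qed
  also have "\<dots> = (\<integral>\<^sup>+u. \<integral>\<^sup>+v. (\<Sum>b1\<in>UNIV. \<Sum>w\<in>opt K. ennreal (\<Sum>b2\<in>UNIV. (T A (pick b1 u x) (pick b2 v y) (pk z w))^2)) \<partial>gauss J \<partial>gauss I)"
    by (intro nn_integral_cong) (simp add: sum_nonneg sum.swap[of _ "opt K" UNIV])
  also have "\<dots> = (\<integral>\<^sup>+u. (\<Sum>b1\<in>UNIV. \<Sum>w\<in>opt K. ennreal (\<Sum>v\<in>opt J. (T A (pick b1 u x) (pk y v) (pk z w))^2)) \<partial>gauss I)"
    by (simp only: nn_integral_sum borel_measurable_sum mm2 s2)
  also have "\<dots> = (\<integral>\<^sup>+u. (\<Sum>w\<in>opt K. \<Sum>v\<in>opt J. ennreal (\<Sum>b1\<in>UNIV. (T A (pick b1 u x) (pk y v) (pk z w))^2)) \<partial>gauss I)"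
    by (intro nn_integral_cong)
      (simp add: sum_nonneg sum.swap[of _ "opt K" UNIV] sum.swap[of _ "opt J" UNIV])
  also have "\<dots> = (\<Sum>w\<in>opt K. \<Sum>v\<in>opt J. ennreal (\<Sum>u\<in>opt I. (T A (pk x u) (pk y v) (pk z w))^2))"
    by (simp only: nn_integral_sum borel_measurable_sum mm1 s1)
  also have "\<dots> = ennreal (\<Sum>w\<in>opt K. \<Sum>v\<in>opt J. \<Sum>u\<in>opt I. (T A (pk x u) (pk y v) (pk z w))^2)"
    by (simp only: sum_ennreal sum_nonneg zero_le_power2)
  also have "\<dots> = ennreal (\<Sum>u\<in>opt I. \<Sum>v\<in>opt J. \<Sum>w\<in>opt K. (T A (pk x u) (pk y v) (pk z w))^2)"
    by (rule arg_cong[where f=ennreal], rule sum_rev3)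
  finally show ?thesis by simp
qed

end

section \<open>A PAC-Bayes bound for trilinear forms\<close>

text \<open>Unnormalised average over the eight sign patterns; the general codomain admits both
  reals and \<open>ennreal\<close> integrals.\<close>

definition sgsum :: "(real \<Rightarrow> real \<Rightarrow> real \<Rightarrow> 'a::comm_monoid_add) \<Rightarrow> 'a" where
  "sgsum f = f 1 1 1 + f 1 1 (-1) + f 1 (-1) 1 + f 1 (-1) (-1)
     + f (-1) 1 1 + f (-1) 1 (-1) + f (-1) (-1) 1 + f (-1) (-1) (-1)"

text \<open>Expansion of a trilinear form at (x + e1 g1, y + e2 g2, z + e3 g3), see
  \<open>T_shift\<close>; an argument of t is \<open>True\<close> when that slot holds the
  Gaussian.\<close>

definition multi8 :: "(bool \<Rightarrow> bool \<Rightarrow> bool \<Rightarrow> real) \<Rightarrow> real \<Rightarrow> real \<Rightarrow> real \<Rightarrow> real" where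
  "multi8 t e1 e2 e3 = t False False False + e1 * t True False False + e2 * t False True False
     + e3 * t False False True + e1 * e2 * t True True False + e1 * e3 * t True False True
     + e2 * e3 * t False True True + e1 * e2 * e3 * t True True True"

lemma sgsum_multi8: "sgsum (multi8 t) = 8 * t False False False"
  by (simp add: sgsum_def multi8_def)

text \<open>Parseval on {1, -1}^3, by the parallelogram law in one sign at a time.\<close>

lemma sgsum_multi8_sq:
  "sgsum (\<lambda>e1 e2 e3. (multi8 t e1 e2 e3)^2) = 8 * (\<Sum>b1\<in>UNIV. \<Sum>b2\<in>UNIV. \<Sum>b3\<in>UNIV. (t b1 b2 b3)^2)"
proof -
  have par: "(u + e * v)^2 + (u + (- e) * v)^2 = 2 * u^2 + 2 * v^2" if "e = 1" for u v e :: real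
    using that by (simp add: power2_eq_square algebra_simps)
  define f where "f = (\<lambda>e1 b2 b3. t False b2 b3 + e1 * t True b2 b3)"
  define g where "g = (\<lambda>e1 e2 b3. f e1 False b3 + e2 * f e1 True b3)"
  have m: "multi8 t e1 e2 e3 = g e1 e2 False + e3 * g e1 e2 True" for e1 e2 e3
    by (simp add: multi8_def f_def g_def algebra_simps)
  have s3: "(multi8 t e1 e2 1)^2 + (multi8 t e1 e2 (- 1))^2 = 2 * (g e1 e2 False)^2 + 2 * (g e1 e2 True)^2" for e1 e2
    unfolding m by (rule par) simp
  have s2: "(g e1 1 b)^2 + (g e1 (- 1) b)^2 = 2 * (f e1 False b)^2 + 2 * (f e1 True b)^2" for e1 b
    unfolding g_def by (rule par) simp
  have s1: "(f 1 b c)^2 + (f (- 1) b c)^2 = 2 * (t False b c)^2 + 2 * (t True b c)^2" for b c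
    unfolding f_def by (rule par) simp
  show ?thesis
    using s3[of 1 1] s3[of 1 "-1"] s3[of "-1" 1] s3[of "-1" "-1"]
      s2[of 1 False] s2[of 1 True] s2[of "-1" False] s2[of "-1" True]
      s1[of False False] s1[of False True] s1[of True False] s1[of True True]
    unfolding sgsum_def UNIV_bool by simp
qed

lemma multi8_sq_le:
  assumes "e1 \<in> {1, -1}" "e2 \<in> {1, -1}" "e3 \<in> {1, -1}"
  shows "(multi8 t e1 e2 e3)^2 \<le> 8 * (\<Sum>b1\<in>UNIV. \<Sum>b2\<in>UNIV. \<Sum>b3\<in>UNIV. (t b1 b2 b3)^2)"
  unfolding sgsum_multi8_sq[symmetric] using assms by (auto simp: sgsum_def)

text \<open>Jensen for the uniform distribution on signs, from the tangent of exp at the mean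
  m.\<close>

lemma sgsum_exp_ge:
  fixes m :: real
  assumes "sgsum h = 8 * m"
  shows "8 * exp m \<le> sgsum (\<lambda>e1 e2 e3. exp (h e1 e2 e3))"
proof -
  have ge: "exp m * (1 + (u - m)) \<le> exp u" for u :: real
  proof -
    have "exp m * (1 + (u - m)) \<le> exp m * exp (u - m)" by (rule mult_left_mono[OF exp_ge_add_one_self[of "u - m"]]) simp
    then show ?thesis by (simp add: exp_add[symmetric])
  qed
  have "8 * exp m = exp m * (8 + (sgsum h - 8 * m))" using assms by simp
  also have "\<dots> = sgsum (\<lambda>e1 e2 e3. exp m * (1 + (h e1 e2 e3 - m)))"
    by (simp add: sgsum_def algebra_simps)
  also have "\<dots> \<le> sgsum (\<lambda>e1 e2 e3. exp (h e1 e2 e3))"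
    unfolding sgsum_def by (intro add_mono ge)
  finally show ?thesis .
qed

lemma (in gauss3) T_shift:
  "T A (\<lambda>i. x i + e1 * g1 i) (\<lambda>i. y i + e2 * g2 i) (\<lambda>i. z i + e3 * g3 i)
     = multi8 (\<lambda>b1 b2 b3. T A (pick b1 g1 x) (pick b2 g2 y) (pick b3 g3 z)) e1 e2 e3"
  unfolding tl_lin1 tl_lin2 tl_lin3 multi8_def pick_def by (simp add: algebra_simps)

lemma sgsum_cmult: "sgsum (\<lambda>e1 e2 e3. c * f e1 e2 e3) = (c::real) * sgsum f"
  by (simp add: sgsum_def algebra_simps)

lemma sgsum_sum: "sgsum (\<lambda>e1 e2 e3. \<Sum>s\<in>S. f s e1 e2 e3) = (\<Sum>s\<in>S. sgsum (f s) :: real)"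
  by (simp add: sgsum_def sum.distrib)

lemma measurable_tilt:
  fixes a q :: "'m \<Rightarrow> real" and c nu :: real
  assumes [measurable]: "a \<in> borel_measurable N" "q \<in> borel_measurable N"
  shows "(\<lambda>p. if c * q p \<le> 1 then ennreal (exp (a p - nu * q p)) else 0) \<in> borel_measurable N"
  by measurable

lemma measurable_ennreal_exp:
  fixes a :: "'m \<Rightarrow> real"
  assumes [measurable]: "a \<in> borel_measurable N"
  shows "(\<lambda>p. ennreal (exp (a p))) \<in> borel_measurable N"
  by measurable

text \<open>\<open>Z\<close> integrates the tilted exponential over the Gaussian prior and has mean
  at most 1, so by Markov delta Z < 1 outside an event of probability at most delta. That event
  mentions no (x, y, z), which is the source of uniformity. For a given centre, shifting the prior
  rewrites \<open>Z\<close> as any of eight integrals; Jensen over the signs on the good set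
  \<open>C\<close> bounds their sum below by the exponential of the form at the centre, less the
  costs.\<close>

lemma (in gauss3) pac_bayes:
  fixes E :: "'w \<Rightarrow> 'i \<Rightarrow> 'j \<Rightarrow> 'k \<Rightarrow> real" and W :: "'s \<Rightarrow> 'i \<Rightarrow> 'j \<Rightarrow> 'k \<Rightarrow> real"
  assumes M: "prob_space M"
    and Em: "\<And>i j k. i \<in> I \<Longrightarrow> j \<in> J \<Longrightarrow> k \<in> K \<Longrightarrow> (\<lambda>\<omega>. E \<omega> i j k) \<in> borel_measurable M"
    and H: "\<And>x y z. kap * (\<Sum>s\<in>S. (T (W s) x y z)^2) \<le> 1 \<Longrightarrow>
      (\<integral>\<^sup>+\<omega>. ennreal (exp (T (E \<omega>) x y z)) \<partial>M) \<le> ennreal (exp (nu * (\<Sum>s\<in>S. (T (W s) x y z)^2)))"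
    and delta: "0 < delta" and B: "0 < B" "128 * kap * B \<le> 1" and nn: "0 \<le> nu" "0 \<le> kap"
  shows "\<exists>A\<in>sets M. measure M A \<ge> 1 - delta \<and> (\<forall>\<omega>\<in>A. \<forall>x y z.
    (\<Sum>s\<in>S. \<Sum>u\<in>opt I. \<Sum>v\<in>opt J. \<Sum>w\<in>opt K. (T (W s) (pk x u) (pk y v) (pk z w))^2) \<le> 8 * B \<longrightarrow>
    T (E \<omega>) x y z \<le> 16 * nu * B + ((\<Sum>i\<in>I. (x i)^2) + (\<Sum>i\<in>J. (y i)^2) + (\<Sum>i\<in>K. (z i)^2)) / 2 + ln (2 / delta))"
proof -
  interpret P: prob_space M by (rule M)
  interpret PG: prob_space G by (rule prob_G)
  interpret MG: pair_sigma_finite M G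
    by (intro pair_sigma_finite.intro prob_space_imp_sigma_finite M prob_G)
  define Q where "Q = (\<lambda>x y z. \<Sum>s\<in>S. (T (W s) x y z)^2)"
  \<comment> \<open>Weights outside the range of the moment hypothesis contribute 0, which keeps the
    mean of \<open>Z\<close> at most 1.\<close>
  define Psi where "Psi = (\<lambda>\<omega> x y z. if kap * Q x y z \<le> 1 then ennreal (exp (T (E \<omega>) x y z - nu * Q x y z)) else 0)"
  have Tc: "T A x y z = T A x' y' z'"
    if "\<And>i. i \<in> I \<Longrightarrow> x i = x' i" "\<And>i. i \<in> J \<Longrightarrow> y i = y' i" "\<And>i. i \<in> K \<Longrightarrow> z i = z' i"
    for A x y z x' y' z' using that by (rule tl_cong)
  define Z where "Z = (\<lambda>\<omega>. \<integral>\<^sup>+g. Psi \<omega> (fst g) (fst (snd g)) (snd (snd g)) \<partial>G)"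
  have Em' [measurable]: "(\<lambda>p. E (fst p) i j k) \<in> borel_measurable (M \<Otimes>\<^sub>M G)"
    if "i \<in> I" "j \<in> J" "k \<in> K" for i j k
    using measurable_compose[OF measurable_fst Em[OF that]] .
  have cm [measurable]:
    "i \<in> I \<Longrightarrow> (\<lambda>p. fst (snd p) i) \<in> borel_measurable (M \<Otimes>\<^sub>M G)"
    "j \<in> J \<Longrightarrow> (\<lambda>p. fst (snd (snd p)) j) \<in> borel_measurable (M \<Otimes>\<^sub>M G)"
    "k \<in> K \<Longrightarrow> (\<lambda>p. snd (snd (snd p)) k) \<in> borel_measurable (M \<Otimes>\<^sub>M G)" for i j k
    by (rule measurable_compose[OF measurable_snd coords(1)], assumption,
        rule measurable_compose[OF measurable_snd coords(2)], assumption,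
        rule measurable_compose[OF measurable_snd coords(3)], assumption)
  have TE: "(\<lambda>p. T (E (fst p)) (fst (snd p)) (fst (snd (snd p))) (snd (snd (snd p)))) \<in> borel_measurable (M \<Otimes>\<^sub>M G)"
    unfolding tl_def by (intro borel_measurable_sum borel_measurable_times Em' cm)
  have QM: "(\<lambda>p. Q (fst (snd p)) (fst (snd (snd p))) (snd (snd (snd p)))) \<in> borel_measurable (M \<Otimes>\<^sub>M G)"
    unfolding tl_def Q_def by measurable
  have PsiM: "(\<lambda>p. Psi (fst p) (fst (snd p)) (fst (snd (snd p))) (snd (snd (snd p)))) \<in> borel_measurable (M \<Otimes>\<^sub>M G)"
    unfolding Psi_def by (rule measurable_tilt[OF TE QM])
  have Zm: "Z \<in> borel_measurable M"
    unfolding Z_def using PG.borel_measurable_nn_integral[of "\<lambda>\<omega> g. Psi \<omega> (fst g) (fst (snd g)) (snd (snd g))" M] PsiM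
    by (simp add: case_prod_unfold)
  have EZ: "(\<integral>\<^sup>+\<omega>. Z \<omega> \<partial>M) \<le> 1"
  proof -
    have "(\<integral>\<^sup>+\<omega>. Z \<omega> \<partial>M) = (\<integral>\<^sup>+g. \<integral>\<^sup>+\<omega>. Psi \<omega> (fst g) (fst (snd g)) (snd (snd g)) \<partial>M \<partial>G)"
      unfolding Z_def
      using MG.Fubini'[of "\<lambda>\<omega> g. Psi \<omega> (fst g) (fst (snd g)) (snd (snd g))"] PsiM
      by (simp add: case_prod_unfold)
    also have "\<dots> \<le> (\<integral>\<^sup>+g. 1 \<partial>G)"
    proof (rule nn_integral_mono)
      fix g :: "('i \<Rightarrow> real) \<times> ('j \<Rightarrow> real) \<times> ('k \<Rightarrow> real)"
      let ?x = "fst g" and ?y = "fst (snd g)" and ?z = "snd (snd g)"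
      have TEm: "(\<lambda>\<omega>. T (E \<omega>) ?x ?y ?z) \<in> borel_measurable M"
        unfolding tl_def by (intro borel_measurable_sum borel_measurable_times borel_measurable_const Em)
      show "(\<integral>\<^sup>+\<omega>. Psi \<omega> ?x ?y ?z \<partial>M) \<le> 1"
      proof (cases "kap * Q ?x ?y ?z \<le> 1")
        case True
        have "(\<integral>\<^sup>+\<omega>. Psi \<omega> ?x ?y ?z \<partial>M)
            = (\<integral>\<^sup>+\<omega>. ennreal (exp (- nu * Q ?x ?y ?z)) * ennreal (exp (T (E \<omega>) ?x ?y ?z)) \<partial>M)"
          using True by (simp add: Psi_def ennreal_mult'[symmetric] exp_add[symmetric])
        also have "\<dots> = ennreal (exp (- nu * Q ?x ?y ?z)) * (\<integral>\<^sup>+\<omega>. ennreal (exp (T (E \<omega>) ?x ?y ?z)) \<partial>M)"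
          by (rule nn_integral_cmult[OF measurable_ennreal_exp[OF TEm]])
        also have "\<dots> \<le> ennreal (exp (- nu * Q ?x ?y ?z)) * ennreal (exp (nu * Q ?x ?y ?z))"
          using H[of ?x ?y ?z] True by (intro mult_left_mono) (auto simp: Q_def)
        also have "\<dots> = 1" by (simp add: ennreal_mult'[symmetric] exp_add[symmetric])
        finally show ?thesis .
      qed (simp add: Psi_def)
    qed
    also have "\<dots> = 1" by (simp add: PG.emeasure_space_1)
    finally show ?thesis .
  qed
  define A where "A = {\<omega> \<in> space M. \<not> 1 \<le> ennreal delta * Z \<omega>}"
  define A' where "A' = {\<omega> \<in> space M. 1 \<le> ennreal delta * Z \<omega>}"
  note [measurable] = Zm
  have sA: "A \<in> sets M" "A' \<in> sets M" unfolding A_def A'_def by measurable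
  have "emeasure M A' \<le> ennreal delta * (\<integral>\<^sup>+\<omega>. Z \<omega> * indicator (space M) \<omega> \<partial>M)"
    unfolding A'_def using nn_integral_Markov_inequality[of Z "space M" M "ennreal delta"] Zm by simp
  also have "(\<integral>\<^sup>+\<omega>. Z \<omega> * indicator (space M) \<omega> \<partial>M) = (\<integral>\<^sup>+\<omega>. Z \<omega> \<partial>M)"
    by (intro nn_integral_cong) simp
  also have "ennreal delta * (\<integral>\<^sup>+\<omega>. Z \<omega> \<partial>M) \<le> ennreal delta * 1"
    using EZ by (intro mult_left_mono) auto
  finally have "measure M A' \<le> delta" using delta
    by (simp add: P.emeasure_eq_measure)
  moreover have "A = space M - A'" by (auto simp: A_def A'_def)
  ultimately have mA: "measure M A \<ge> 1 - delta" using P.prob_compl[OF sA(2)] by simp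
  have main: "T (E \<omega>) x y z \<le> 16 * nu * B + ((\<Sum>i\<in>I. (x i)^2) + (\<Sum>i\<in>J. (y i)^2) + (\<Sum>i\<in>K. (z i)^2)) / 2 + ln (2 / delta)"
    if w: "\<omega> \<in> A" and m8: "(\<Sum>s\<in>S. \<Sum>u\<in>opt I. \<Sum>v\<in>opt J. \<Sum>w\<in>opt K. (T (W s) (pk x u) (pk y v) (pk z w))^2) \<le> 8 * B"
    for \<omega> x y z
  proof -
    define N where "N = ((\<Sum>i\<in>I. (x i)^2) + (\<Sum>i\<in>J. (y i)^2) + (\<Sum>i\<in>K. (z i)^2)) / 2"
    define t where "t = (\<lambda>A g b1 b2 b3. T A (pick b1 (fst g) x) (pick b2 (fst (snd g)) y) (pick b3 (snd (snd g)) z))"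
    define phi where "phi = (\<lambda>g. \<Sum>s\<in>S. \<Sum>b1\<in>UNIV. \<Sum>b2\<in>UNIV. \<Sum>b3\<in>UNIV. (t (W s) g b1 b2 b3)^2)"
    have tm: "(\<lambda>g. t A g b1 b2 b3) \<in> borel_measurable G" for A b1 b2 b3
      unfolding t_def by (rule T_meas)
    have phim [measurable]: "phi \<in> borel_measurable G"
      unfolding phi_def by (intro borel_measurable_sum borel_measurable_power tm)
    have phi0: "0 \<le> phi g" for g unfolding phi_def by (intro sum_nonneg) simp
    have "(\<integral>\<^sup>+g. ennreal (phi g) \<partial>G) = (\<Sum>s\<in>S. \<integral>\<^sup>+g. ennreal (\<Sum>b1\<in>UNIV. \<Sum>b2\<in>UNIV. \<Sum>b3\<in>UNIV. (t (W s) g b1 b2 b3)^2) \<partial>G)"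
    proof -
      have "ennreal (phi g) = (\<Sum>s\<in>S. ennreal (\<Sum>b1\<in>UNIV. \<Sum>b2\<in>UNIV. \<Sum>b3\<in>UNIV. (t (W s) g b1 b2 b3)^2))" for g
        unfolding phi_def by (simp only: sum_ennreal sum_nonneg zero_le_power2)
      moreover have "(\<lambda>g. ennreal (\<Sum>b1\<in>UNIV. \<Sum>b2\<in>UNIV. \<Sum>b3\<in>UNIV. (t (W s) g b1 b2 b3)^2)) \<in> borel_measurable G" for s
        by (intro measurable_compose[OF _ measurable_ennreal] borel_measurable_sum borel_measurable_power tm)
      ultimately show ?thesis by (simp only: nn_integral_sum)
    qed
    also have "\<dots> = ennreal (\<Sum>s\<in>S. \<Sum>u\<in>opt I. \<Sum>v\<in>opt J. \<Sum>w\<in>opt K. (T (W s) (pk x u) (pk y v) (pk z w))^2)"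
      unfolding t_def moment by (simp only: sum_ennreal sum_nonneg zero_le_power2)
    also have "\<dots> \<le> ennreal (8 * B)" using m8 by (rule ennreal_leI)
    finally have Ephi: "(\<integral>\<^sup>+g. ennreal (phi g) \<partial>G) \<le> ennreal (8 * B)" .
    \<comment> \<open>Markov at twice the mean bound 8 B gives probability at least 1/2, which
      becomes the 2 in ln (2 / delta).\<close>
    define C where "C = {g \<in> space G. phi g \<le> 16 * B}"
    have sC [measurable]: "C \<in> sets G" unfolding C_def by measurable
    have half: "1 / 2 \<le> measure G C"
    proof -
      have "1 = (\<integral>\<^sup>+g. 1 \<partial>G)" by (simp add: PG.emeasure_space_1)
      also have "\<dots> \<le> (\<integral>\<^sup>+g. indicator C g + ennreal (1 / (16 * B)) * ennreal (phi g) \<partial>G)"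
      proof (rule nn_integral_mono)
        fix g assume "g \<in> space G"
        show "1 \<le> indicator C g + ennreal (1 / (16 * B)) * ennreal (phi g)"
        proof (cases "g \<in> C")
          case False
          then have "16 * B < phi g" using \<open>g \<in> space G\<close> by (simp add: C_def)
          then have "1 \<le> 1 / (16 * B) * phi g" using B(1) by (simp add: field_simps)
          then show ?thesis using B(1) False by (simp add: ennreal_mult'[symmetric] ennreal_1[symmetric] ennreal_leI del: ennreal_1)
        qed simp
      qed
      also have "\<dots> = emeasure G C + ennreal (1 / (16 * B)) * (\<integral>\<^sup>+g. ennreal (phi g) \<partial>G)"
        by (subst nn_integral_add) (auto simp: nn_integral_cmult)
      also have "\<dots> \<le> emeasure G C + ennreal (1 / (16 * B)) * ennreal (8 * B)"
        by (intro add_left_mono mult_left_mono Ephi) simp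
      also have "ennreal (1 / (16 * B)) * ennreal (8 * B) = ennreal (1 / 2)"
        using B(1) by (subst ennreal_mult'[symmetric]) (auto simp: field_simps)
      also have "emeasure G C + ennreal (1 / 2) = ennreal (measure G C + 1 / 2)"
        by (simp add: PG.emeasure_eq_measure)
      finally have "ennreal 1 \<le> ennreal (measure G C + 1 / 2)" by (simp only: ennreal_1)
      then have "1 \<le> measure G C + 1 / 2" by (subst (asm) ennreal_le_iff) simp_all
      then show ?thesis by simp
    qed
    define L where "L = T (E \<omega>) x y z - 16 * nu * B - N"
    define Y where "Y = (\<lambda>e1 e2 e3 g.
       ennreal (exp (wt e1 I x (fst g) + wt e2 J y (fst (snd g)) + wt e3 K z (snd (snd g)))) *
       Psi \<omega> (\<lambda>i. x i + e1 * fst g i) (\<lambda>i. y i + e2 * fst (snd g) i) (\<lambda>i. z i + e3 * snd (snd g) i))"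
    have wM: "\<omega> \<in> space M" using w by (simp add: A_def)
    have PsiG: "(\<lambda>g. Psi \<omega> (fst g) (fst (snd g)) (snd (snd g))) \<in> borel_measurable G"
      unfolding Psi_def
    proof (rule measurable_tilt)
      show "(\<lambda>g. T (E \<omega>) (fst g) (fst (snd g)) (snd (snd g))) \<in> borel_measurable G"
        unfolding tl_def by measurable
      show "(\<lambda>g. Q (fst g) (fst (snd g)) (snd (snd g))) \<in> borel_measurable G"
        unfolding Q_def tl_def by measurable
    qed
    have ZY: "Z \<omega> = (\<integral>\<^sup>+g. Y e1 e2 e3 g \<partial>G)" if "e1 \<in> {1,-1}" "e2 \<in> {1,-1}" "e3 \<in> {1,-1}" for e1 e2 e3
    proof -
      have c: "Psi \<omega> u v w = Psi \<omega> u' v' w'"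
        if "\<And>i. i \<in> I \<Longrightarrow> u i = u' i" "\<And>i. i \<in> J \<Longrightarrow> v i = v' i" "\<And>i. i \<in> K \<Longrightarrow> w i = w' i"
        for u v w u' v' w'
      proof -
        have "T A u v w = T A u' v' w'" for A using that by (rule Tc)
        then show ?thesis by (simp only: Psi_def Q_def)
      qed
      let ?F = "\<lambda>g. Psi \<omega> (fst g) (fst (snd g)) (snd (snd g))"
      have "(\<integral>\<^sup>+g. ?F g \<partial>G) = (\<integral>\<^sup>+g. ennreal (exp (wt e1 I x (fst g) + wt e2 J y (fst (snd g)) + wt e3 K z (snd (snd g)))) *
         ?F ((\<lambda>i. x i + e1 * fst g i), (\<lambda>i. y i + e2 * fst (snd g) i), (\<lambda>i. z i + e3 * snd (snd g) i)) \<partial>G)"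
      proof (rule shift3[OF _ _ _ PsiG])
        show "e1 = 1 \<or> e1 = - 1" "e2 = 1 \<or> e2 = - 1" "e3 = 1 \<or> e3 = - 1" using that by auto
        fix u u' :: "'i \<Rightarrow> real" and v v' :: "'j \<Rightarrow> real" and w w' :: "'k \<Rightarrow> real"
        assume "\<And>i. i \<in> I \<Longrightarrow> u i = u' i" "\<And>i. i \<in> J \<Longrightarrow> v i = v' i" "\<And>i. i \<in> K \<Longrightarrow> w i = w' i"
        then show "?F (u, v, w) = ?F (u', v', w')" unfolding fst_conv snd_conv by (rule c)
      qed
      then show ?thesis by (simp only: Z_def Y_def fst_conv snd_conv)
    qed
    have Ym: "Y e1 e2 e3 \<in> borel_measurable G" for e1 e2 e3
      unfolding Y_def Psi_def
    proof (intro borel_measurable_times_ennreal measurable_ennreal_exp measurable_tilt)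
      show "(\<lambda>g. wt e1 I x (fst g) + wt e2 J y (fst (snd g)) + wt e3 K z (snd (snd g))) \<in> borel_measurable G"
        unfolding wt_def by measurable
      show "(\<lambda>g. T (E \<omega>) (\<lambda>i. x i + e1 * fst g i) (\<lambda>i. y i + e2 * fst (snd g) i) (\<lambda>i. z i + e3 * snd (snd g) i)) \<in> borel_measurable G"
        unfolding tl_def by measurable
      show "(\<lambda>g. Q (\<lambda>i. x i + e1 * fst g i) (\<lambda>i. y i + e2 * fst (snd g) i) (\<lambda>i. z i + e3 * snd (snd g) i)) \<in> borel_measurable G"
        unfolding Q_def tl_def by measurable
    qed
    have low: "ennreal (8 * exp L) * indicator C g \<le> sgsum (\<lambda>e1 e2 e3. Y e1 e2 e3 g)" for g
    proof (cases "g \<in> C")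
      case True
      then have ph: "phi g \<le> 16 * B" by (simp add: C_def)
      define q where "q = (\<lambda>e1 e2 e3. \<Sum>s\<in>S. (multi8 (t (W s) g) e1 e2 e3)^2)"
      have Qq: "Q (\<lambda>i. x i + e1 * fst g i) (\<lambda>i. y i + e2 * fst (snd g) i) (\<lambda>i. z i + e3 * snd (snd g) i) = q e1 e2 e3" for e1 e2 e3
        unfolding Q_def q_def T_shift t_def ..
      define h where "h = (\<lambda>e1 e2 e3. wt e1 I x (fst g) + wt e2 J y (fst (snd g)) + wt e3 K z (snd (snd g))
          + (multi8 (t (E \<omega>) g) e1 e2 e3 - nu * q e1 e2 e3))"
      have Yh: "Y e1 e2 e3 g = ennreal (exp (h e1 e2 e3))"
        if "e1 \<in> {1,-1}" "e2 \<in> {1,-1}" "e3 \<in> {1,-1}" for e1 e2 e3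
      proof -
        \<comment> \<open>On \<open>C\<close> the constraint must hold for all eight sign patterns
          at once: by \<open>multi8_sq_le\<close> each pattern gives at most 8 phi <= 128 B, the
          constant in the hypothesis on B.\<close>
        have "q e1 e2 e3 \<le> 8 * phi g"
          unfolding q_def phi_def sum_distrib_left[of 8 _ S] by (intro sum_mono multi8_sq_le that)
        then have "q e1 e2 e3 \<le> 128 * B" using ph by linarith
        then have "kap * q e1 e2 e3 \<le> kap * (128 * B)" using nn by (intro mult_left_mono) auto
        also have "\<dots> \<le> 1" using B by (simp add: mult_ac)
        finally have k: "kap * q e1 e2 e3 \<le> 1" .
        show ?thesis
          unfolding Y_def Psi_def Qq T_shift h_def exp_add
          using k by (simp add: ennreal_mult'[symmetric] t_def)
      qed
      have wtsum: "sgsum (\<lambda>e1 e2 e3. wt e1 I x (fst g) + wt e2 J y (fst (snd g)) + wt e3 K z (snd (snd g))) = - 8 * N"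
        by (simp add: sgsum_def wt_def N_def)
      have qs: "sgsum q = 8 * phi g"
        unfolding q_def sgsum_sum sgsum_multi8_sq phi_def by (simp add: sum_distrib_left)
      \<comment> \<open>Summed over signs, the form keeps only its value at the centre, the
        quadratic penalty becomes nu phi by Parseval, and the weights leave -N, each taken eight
        times.\<close>
      have "sgsum h = - 8 * N + (8 * t (E \<omega>) g False False False + sgsum (\<lambda>e1 e2 e3. (- nu) * q e1 e2 e3))"
        unfolding wtsum[symmetric] sgsum_multi8[of "t (E \<omega>) g", symmetric]
        by (simp add: sgsum_def h_def)
      also have "\<dots> = 8 * (T (E \<omega>) x y z - nu * phi g - N)"
        unfolding sgsum_cmult qs by (simp add: t_def pick_def)
      finally have sh: "sgsum h = 8 * (T (E \<omega>) x y z - nu * phi g - N)" .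
      have "nu * phi g \<le> nu * (16 * B)" using ph nn by (intro mult_left_mono) auto
      then have "8 * exp L \<le> 8 * exp (T (E \<omega>) x y z - nu * phi g - N)" by (simp add: L_def)
      also have "\<dots> \<le> sgsum (\<lambda>e1 e2 e3. exp (h e1 e2 e3))" by (rule sgsum_exp_ge[OF sh])
      finally have "ennreal (8 * exp L) \<le> ennreal (sgsum (\<lambda>e1 e2 e3. exp (h e1 e2 e3)))" by (rule ennreal_leI)
      also have "\<dots> = sgsum (\<lambda>e1 e2 e3. Y e1 e2 e3 g)"
        by (simp add: sgsum_def Yh ennreal_plus[symmetric] del: ennreal_plus)
      finally show ?thesis using True by simp
    qed simp
    have "ennreal (8 * exp L) * emeasure G C = (\<integral>\<^sup>+g. ennreal (8 * exp L) * indicator C g \<partial>G)"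
      by (rule nn_integral_cmult_indicator[symmetric]) (rule sC)
    also have "\<dots> \<le> (\<integral>\<^sup>+g. sgsum (\<lambda>e1 e2 e3. Y e1 e2 e3 g) \<partial>G)" by (intro nn_integral_mono low)
    also have "\<dots> = sgsum (\<lambda>e1 e2 e3. \<integral>\<^sup>+g. Y e1 e2 e3 g \<partial>G)"
      unfolding sgsum_def by (simp add: nn_integral_add Ym borel_measurable_add)
    \<comment> \<open>Every sign pattern is an exact change of variables for the same
      integral.\<close>
    also have "\<dots> = 8 * Z \<omega>"
    proof -
      have "8 * Z \<omega> = (1 + 1 + 1 + 1 + 1 + 1 + 1 + 1) * Z \<omega>" by simp
      then have "8 * Z \<omega> = Z \<omega> + Z \<omega> + Z \<omega> + Z \<omega> + Z \<omega> + Z \<omega> + Z \<omega> + Z \<omega>"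
        by (simp only: distrib_right mult_1_left)
      then show ?thesis unfolding sgsum_def by (simp add: ZY[symmetric])
    qed
    finally have Zlow: "ennreal (8 * exp L) * emeasure G C \<le> 8 * Z \<omega>" .
    have Zup: "ennreal delta * Z \<omega> \<le> 1" using w by (auto simp: A_def not_le)
    have "ennreal delta * (ennreal (8 * exp L) * emeasure G C) \<le> ennreal delta * (8 * Z \<omega>)"
      using Zlow by (intro mult_left_mono) auto
    also have "\<dots> = 8 * (ennreal delta * Z \<omega>)" by (simp add: mult_ac)
    also have "\<dots> \<le> 8 * 1" using Zup by (intro mult_left_mono) auto
    finally have "ennreal (delta * (8 * exp L * measure G C)) \<le> ennreal 8"
      using delta by (simp add: PG.emeasure_eq_measure ennreal_mult')
    then have d1: "delta * (8 * exp L * measure G C) \<le> 8" by (subst (asm) ennreal_le_iff) simp_all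
    have "delta * (8 * exp L) * (1 / 2) \<le> delta * (8 * exp L) * measure G C"
      by (rule mult_left_mono[OF half]) (use delta in simp)
    also have "\<dots> \<le> 8" using d1 by (simp only: mult.assoc)
    finally have "delta * exp L \<le> 2" by simp
    then have "exp L \<le> 2 / delta" using delta by (simp add: le_divide_eq mult.commute)
    then have "L \<le> ln (2 / delta)" using delta by (simp add: ln_ge_iff)
    then show ?thesis by (simp add: L_def N_def)
  qed
  show ?thesis using sA(1) mA main by blast
qed

section \<open>Partial traces and Gaussian averages of a quadratic form\<close>

text \<open>Tr(V^T S V S) for symmetric S. For a positive definite covariance it is the squared
  Frobenius norm of S^(1/2) V S^(1/2), see \<open>quad_sqrt\<close>, which is the quantity measured
  by Assumption (A).\<close>

definition quad :: "'d set \<Rightarrow> ('d \<Rightarrow> 'd \<Rightarrow> real) \<Rightarrow> ('d \<Rightarrow> 'd \<Rightarrow> real) \<Rightarrow> real" where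
  "quad D S V = (\<Sum>m\<in>D. \<Sum>m'\<in>D. \<Sum>n\<in>D. \<Sum>n'\<in>D. V m m' * V n n' * S m n * S m' n')"

lemma quad_cong:
  assumes "\<And>m n. m \<in> D \<Longrightarrow> n \<in> D \<Longrightarrow> V m n = V' m n"
    and "\<And>m n. m \<in> D \<Longrightarrow> n \<in> D \<Longrightarrow> S m n = S' m n"
  shows "quad D S V = quad D S' V'"
  unfolding quad_def using assms by (intro sum.cong refl) auto

lemma quad_zero: "quad D S (\<lambda>m n. 0) = 0"
  by (simp add: quad_def)

text \<open>The form is the inner product of V with S V S^T, and multiplication by S on either side
  costs one factor of its operator norm in Frobenius norm.\<close>

lemma quad_le:
  assumes D: "finite D"
  shows "quad D S V \<le> (opnorm D D S)^2 * (\<Sum>m\<in>D. \<Sum>n\<in>D. (V m n)^2)"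
proof -
  define ob where "ob = opnorm D D S"
  have ob0: "0 \<le> ob" unfolding ob_def by (rule opnorm_nonneg[OF D D])
  define Y where "Y = (\<lambda>n m'. \<Sum>n'\<in>D. S m' n' * V n n')"
  define U where "U = (\<lambda>m m'. \<Sum>n\<in>D. S m n * Y n m')"
  have step: "(\<Sum>i\<in>D. (\<Sum>j\<in>D. S i j * f j)^2) \<le> ob^2 * (\<Sum>j\<in>D. (f j)^2)" for f
  proof -
    have "vnorm D (mv D S f) \<le> ob * vnorm D f" unfolding ob_def by (rule vnorm_mv_le[OF D D])
    then have "(vnorm D (mv D S f))^2 \<le> (ob * vnorm D f)^2" by (intro power_mono) auto
    then show ?thesis by (simp add: vnorm_sq power_mult_distrib mv_def)
  qed
  have "(\<Sum>m\<in>D. \<Sum>m'\<in>D. (U m m')^2) = (\<Sum>m'\<in>D. \<Sum>m\<in>D. (U m m')^2)" by (rule sum.swap)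
  also have "\<dots> \<le> (\<Sum>m'\<in>D. ob^2 * (\<Sum>n\<in>D. (Y n m')^2))" unfolding U_def by (intro sum_mono step)
  also have "\<dots> = ob^2 * (\<Sum>n\<in>D. \<Sum>m'\<in>D. (Y n m')^2)"
    unfolding sum_distrib_left by (rule sum.swap)
  also have "\<dots> \<le> ob^2 * (\<Sum>n\<in>D. ob^2 * (\<Sum>n'\<in>D. (V n n')^2))"
    unfolding Y_def by (intro mult_left_mono sum_mono step) simp
  finally have U: "(\<Sum>m\<in>D. \<Sum>m'\<in>D. (U m m')^2) \<le> (ob^2)^2 * (\<Sum>m\<in>D. \<Sum>n\<in>D. (V m n)^2)"
    by (simp add: sum_distrib_left power2_eq_square mult.assoc)
  define v where "v = vnorm (D \<times> D) (\<lambda>(m, n). V m n)"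
  define u where "u = vnorm (D \<times> D) (\<lambda>(m, n). U m n)"
  have v2: "v^2 = (\<Sum>m\<in>D. \<Sum>n\<in>D. (V m n)^2)"
    unfolding v_def vnorm_sq sum.cartesian_product by (intro sum.cong) auto
  have u2: "u^2 = (\<Sum>m\<in>D. \<Sum>n\<in>D. (U m n)^2)"
    unfolding u_def vnorm_sq sum.cartesian_product by (intro sum.cong) auto
  have "quad D S V = (\<Sum>m\<in>D. \<Sum>m'\<in>D. V m m' * U m m')"
    unfolding quad_def U_def Y_def sum_distrib_left
    by (intro sum.cong refl) (simp add: algebra_simps)
  also have "\<dots> = dot (D \<times> D) (\<lambda>(m, n). V m n) (\<lambda>(m, n). U m n)"
    unfolding dot_def sum.cartesian_product by (intro sum.cong) auto
  also have "\<dots> \<le> v * u"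
    using dot_le[of "D \<times> D" "\<lambda>(m, n). V m n" "\<lambda>(m, n). U m n"] unfolding v_def u_def by linarith
  also have "\<dots> \<le> v * (ob^2 * v)"
  proof (rule mult_left_mono)
    have "u^2 \<le> (ob^2 * v)^2" using U unfolding u2 power_mult_distrib v2 .
    then show "u \<le> ob^2 * v" by (rule power2_le_imp_le) (simp add: v_def)
  qed (simp add: v_def)
  finally show ?thesis unfolding v2[symmetric] ob_def[symmetric] by (simp add: power2_eq_square mult_ac)
qed

lemma sum_fst_delta:
  assumes "finite A" "finite B" "a0 \<in> A"
  shows "(\<Sum>m\<in>A \<times> B. if fst m = a0 then g (snd m) else 0) = (\<Sum>b\<in>B. g b)"
proof -
  have "(\<Sum>m\<in>A \<times> B. if fst m = a0 then g (snd m) else 0) = (\<Sum>a\<in>A. \<Sum>b\<in>B. if a = a0 then g b else 0)"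
    unfolding sum.cartesian_product by (intro sum.cong) auto
  also have "\<dots> = (\<Sum>a\<in>A. if a = a0 then (\<Sum>b\<in>B. g b) else 0)" by (intro sum.cong refl) auto
  finally show ?thesis using assms by simp
qed

lemma sum_swap2:
  fixes g :: "'a \<Rightarrow> 'b \<Rightarrow> 'c \<Rightarrow> 'd::comm_monoid_add"
  shows "(\<Sum>a\<in>A. \<Sum>a'\<in>A'. \<Sum>j\<in>C. g a a' j) = (\<Sum>j\<in>C. \<Sum>a\<in>A. \<Sum>a'\<in>A'. g a a' j)"
proof -
  have "(\<Sum>a\<in>A. \<Sum>a'\<in>A'. \<Sum>j\<in>C. g a a' j) = (\<Sum>a\<in>A. \<Sum>j\<in>C. \<Sum>a'\<in>A'. g a a' j)"
    by (intro sum.cong refl sum.swap)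
  also have "\<dots> = (\<Sum>j\<in>C. \<Sum>a\<in>A. \<Sum>a'\<in>A'. g a a' j)" by (rule sum.swap)
  finally show ?thesis .
qed

lemma mult_ite:
  "(if P then a else 0) * (b::real) = (if P then a * b else 0)"
  "b * (if P then a else 0) = (if P then b * a else 0)"
  by auto

lemma sum_prod_scale:
  fixes c :: real
  shows "c * sum f A * sum g B = (\<Sum>a\<in>A. \<Sum>b\<in>B. c * f a * g b)"
proof -
  have "c * sum f A * sum g B = c * (\<Sum>a\<in>A. \<Sum>b\<in>B. f a * g b)"
    unfolding sum_product[symmetric] by simp
  then show ?thesis by (simp add: sum_distrib_left mult.assoc)
qed

lemma sum4:
  "(\<Sum>b\<in>B. \<Sum>b'\<in>B. \<Sum>n\<in>B. \<Sum>n'\<in>B. g b b' n n')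
   = (\<Sum>j\<in>B \<times> B \<times> B \<times> B. g (fst j) (fst (snd j)) (fst (snd (snd j))) (snd (snd (snd j))))"
  unfolding sum.cartesian_product by (intro sum.cong refl) auto

text \<open>When \<open>V a0 a0'\<close> is the matrix unit for (a0, a0') tensored with W, the form
  meets only the diagonal blocks of S at a0 and at a0'. Summing over a0 and a0' separately turns
  each block into the partial trace. This is how Gaussian averaging over a block produces partial
  traces.\<close>

lemma quad_trace:
  assumes fin: "finite A" "finite B" and f: "bij_betw f (A \<times> B) D"
    and V: "\<And>a0 a0' a a' b b'. a0 \<in> A \<Longrightarrow> a0' \<in> A \<Longrightarrow> a \<in> A \<Longrightarrow> a' \<in> A \<Longrightarrow> b \<in> B \<Longrightarrow> b' \<in> B \<Longrightarrow>
       V a0 a0' (f (a, b)) (f (a', b')) = (if a = a0 \<and> a' = a0' then W b b' else 0)"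
  shows "(\<Sum>a0\<in>A. \<Sum>a0'\<in>A. quad D S (V a0 a0')) = quad B (\<lambda>b b'. \<Sum>a\<in>A. S (f (a, b)) (f (a, b'))) W"
proof -
  have one: "quad D S (V a0 a0') = (\<Sum>b\<in>B. \<Sum>b'\<in>B. \<Sum>n\<in>B. \<Sum>n'\<in>B.
      W b b' * W n n' * S (f (a0, b)) (f (a0, n)) * S (f (a0', b')) (f (a0', n')))"
    if a0: "a0 \<in> A" "a0' \<in> A" for a0 a0'
  proof -
    have "quad D S (V a0 a0') = (\<Sum>m\<in>A\<times>B. \<Sum>m'\<in>A\<times>B. \<Sum>n\<in>A\<times>B. \<Sum>n'\<in>A\<times>B.
      V a0 a0' (f m) (f m') * V a0 a0' (f n) (f n') * S (f m) (f n) * S (f m') (f n'))"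
      unfolding quad_def by (simp only: sum.reindex_bij_betw[OF f, symmetric])
    also have "\<dots> = (\<Sum>m\<in>A\<times>B. if fst m = a0 then (\<Sum>m'\<in>A\<times>B. if fst m' = a0' then
       (\<Sum>n\<in>A\<times>B. if fst n = a0 then (\<Sum>n'\<in>A\<times>B. if fst n' = a0' then
        W (snd m) (snd m') * W (snd n) (snd n') * S (f (a0, snd m)) (f (a0, snd n)) * S (f (a0', snd m')) (f (a0', snd n'))
        else 0) else 0) else 0) else 0)"
      using V[OF a0]
      by (auto intro!: sum.cong sum.neutral)
    also have "\<dots> = (\<Sum>b\<in>B. \<Sum>b'\<in>B. \<Sum>n\<in>B. \<Sum>n'\<in>B.
      W b b' * W n n' * S (f (a0, b)) (f (a0, n)) * S (f (a0', b')) (f (a0', n')))"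
    proof -
      have i4: "(\<Sum>n'\<in>A\<times>B. if fst n' = a0' then
        W b b' * W n (snd n') * S (f (a0, b)) (f (a0, n)) * S (f (a0', b')) (f (a0', snd n')) else 0)
        = (\<Sum>n'\<in>B. W b b' * W n n' * S (f (a0, b)) (f (a0, n)) * S (f (a0', b')) (f (a0', n')))" for b b' n
        by (rule sum_fst_delta[OF fin a0(2)])
      show ?thesis unfolding i4
        by (subst sum_fst_delta[OF fin a0(1)] sum_fst_delta[OF fin a0(2)], intro sum.cong refl)+
    qed
    finally show ?thesis .
  qed
  have "(\<Sum>a0\<in>A. \<Sum>a0'\<in>A. quad D S (V a0 a0')) = (\<Sum>a0\<in>A. \<Sum>a0'\<in>A. \<Sum>b\<in>B. \<Sum>b'\<in>B. \<Sum>n\<in>B. \<Sum>n'\<in>B.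
      W b b' * W n n' * S (f (a0, b)) (f (a0, n)) * S (f (a0', b')) (f (a0', n')))"
    using one by (intro sum.cong refl) auto
  also have "\<dots> = (\<Sum>b\<in>B. \<Sum>b'\<in>B. \<Sum>n\<in>B. \<Sum>n'\<in>B. \<Sum>a0\<in>A. \<Sum>a0'\<in>A.
      W b b' * W n n' * S (f (a0, b)) (f (a0, n)) * S (f (a0', b')) (f (a0', n')))"
    unfolding sum4 by (rule sum_swap2)
  also have "\<dots> = quad B (\<lambda>b b'. \<Sum>a\<in>A. S (f (a, b)) (f (a, b'))) W"
    unfolding quad_def by (intro sum.cong refl) (simp only: sum_prod_scale)
  finally show ?thesis .
qed

section \<open>The trilinear weight and its partial traces\<close>

definition ei :: "'i \<Rightarrow> 'i \<Rightarrow> real" where "ei i = (\<lambda>j. if j = i then 1 else 0)"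

locale tri =
  fixes p q r J K :: nat and S :: "nat \<times> nat \<times> nat \<Rightarrow> nat \<times> nat \<times> nat \<Rightarrow> real"
begin

definition I1 where "I1 = {..<p} \<times> {..<p} \<times> {..<J}"
definition I2 where "I2 = {..<J} \<times> {..<q} \<times> {..<q} \<times> {..<K}"
definition I3 where "I3 = {..<r} \<times> {..<r} \<times> {..<K}"
definition D where "D = {..<p} \<times> {..<q} \<times> {..<r}"

text \<open>The matrix whose rearrangement is the TT-format tensor with factors x, y, z: an index of
  x joins the row and column coordinates of the first Kronecker factor with a rank index, likewise z
  for the third, and the rank indices are contracted against y.\<close>

definition V :: "(nat \<times> nat \<times> nat \<Rightarrow> real) \<Rightarrow> (nat \<times> nat \<times> nat \<times> nat \<Rightarrow> real) \<Rightarrow> (nat \<times> nat \<times> nat \<Rightarrow> real)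
    \<Rightarrow> nat \<times> nat \<times> nat \<Rightarrow> nat \<times> nat \<times> nat \<Rightarrow> real" where
  "V x y z = (\<lambda>(a, b, c) (a', b', c'). \<Sum>j<J. \<Sum>k<K. x (a, a', j) * y (j, b, b', k) * z (c, c', k))"

definition Psi where "Psi x y z = quad D S (V x y z)"

definition S1 where "S1 = (\<lambda>(b, c) (b', c'). \<Sum>a<p. S (a, b, c) (a, b', c'))"
definition S2 where "S2 = (\<lambda>(a, c) (a', c'). \<Sum>b<q. S (a, b, c) (a', b, c'))"
definition S3 where "S3 = (\<lambda>(a, b) (a', b'). \<Sum>c<r. S (a, b, c) (a', b', c))"
definition S12 where "S12 = (\<lambda>c c'. \<Sum>b<q. S1 (b, c) (b, c'))"
definition S13 where "S13 = (\<lambda>b b'. \<Sum>c<r. S1 (b, c) (b', c))"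
definition S23 where "S23 = (\<lambda>a a'. \<Sum>c<r. S2 (a, c) (a', c))"
definition S123 where "S123 = (\<Sum>c<r. S12 c c)"

lemma sum_I1: "(\<Sum>i\<in>I1. g i) = (\<Sum>j<J. \<Sum>a<p. \<Sum>a'<p. g (a, a', j))"
proof -
  have "(\<Sum>i\<in>I1. g i) = (\<Sum>a<p. \<Sum>a'<p. \<Sum>j<J. g (a, a', j))"
    unfolding I1_def sum.cartesian_product by (intro sum.cong) auto
  also have "\<dots> = (\<Sum>a<p. \<Sum>j<J. \<Sum>a'<p. g (a, a', j))" by (intro sum.cong refl sum.swap)
  also have "\<dots> = (\<Sum>j<J. \<Sum>a<p. \<Sum>a'<p. g (a, a', j))" by (rule sum.swap)
  finally show ?thesis .
qed

lemma sum_I3: "(\<Sum>i\<in>I3. g i) = (\<Sum>j<K. \<Sum>a<r. \<Sum>a'<r. g (a, a', j))"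
proof -
  have "(\<Sum>i\<in>I3. g i) = (\<Sum>a<r. \<Sum>a'<r. \<Sum>j<K. g (a, a', j))"
    unfolding I3_def sum.cartesian_product by (intro sum.cong) auto
  also have "\<dots> = (\<Sum>a<r. \<Sum>j<K. \<Sum>a'<r. g (a, a', j))" by (intro sum.cong refl sum.swap)
  also have "\<dots> = (\<Sum>j<K. \<Sum>a<r. \<Sum>a'<r. g (a, a', j))" by (rule sum.swap)
  finally show ?thesis .
qed

lemma sum_I2: "(\<Sum>i\<in>I2. g i) = (\<Sum>j<J. \<Sum>k<K. \<Sum>b<q. \<Sum>b'<q. g (j, b, b', k))"
proof -
  have "(\<Sum>i\<in>I2. g i) = (\<Sum>j<J. \<Sum>b<q. \<Sum>b'<q. \<Sum>k<K. g (j, b, b', k))"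
    unfolding I2_def sum.cartesian_product by (intro sum.cong) auto
  also have "\<dots> = (\<Sum>j<J. \<Sum>b<q. \<Sum>k<K. \<Sum>b'<q. g (j, b, b', k))" by (intro sum.cong refl sum.swap)
  also have "\<dots> = (\<Sum>j<J. \<Sum>k<K. \<Sum>b<q. \<Sum>b'<q. g (j, b, b', k))" by (intro sum.cong refl sum.swap)
  finally show ?thesis .
qed

lemma bij1: "bij_betw (\<lambda>(a, b, c). (a, b, c)) ({..<p} \<times> ({..<q} \<times> {..<r})) D"
  by (rule bij_betwI[where g="\<lambda>(a, b, c). (a, b, c)"]) (auto simp: D_def)

lemma bij2: "bij_betw (\<lambda>(b, a, c). (a, b, c)) ({..<q} \<times> ({..<p} \<times> {..<r})) D"
  by (rule bij_betwI[where g="\<lambda>(a, b, c). (b, a, c)"]) (auto simp: D_def)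

lemma bij3: "bij_betw (\<lambda>(c, a, b). (a, b, c)) ({..<r} \<times> ({..<p} \<times> {..<q})) D"
  by (rule bij_betwI[where g="\<lambda>(a, b, c). (c, a, b)"]) (auto simp: D_def)

text \<open>A basis vector in the x slot carries a matrix unit on the first Kronecker factor and
  selects one rank index j. Summation therefore traces out that factor; the other trace lemmas treat
  the remaining slots and their combinations in the same way.\<close>

lemma tr1: "(\<Sum>i\<in>I1. Psi (ei i) y z)
    = (\<Sum>j<J. quad ({..<q} \<times> {..<r}) S1 (\<lambda>(b, c) (b', c'). \<Sum>k<K. y (j, b, b', k) * z (c, c', k)))"
  unfolding sum_I1
proof (rule sum.cong[OF refl])
  fix j assume j: "j \<in> {..<J}"
  have V1: "V (ei (a0, a0', j)) y z (a, b, c) (a', b', c')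
      = (if a = a0 \<and> a' = a0' then \<Sum>k<K. y (j, b, b', k) * z (c, c', k) else 0)" for a0 a0' a b c a' b' c'
  proof -
    have "V (ei (a0, a0', j)) y z (a, b, c) (a', b', c') =
      (\<Sum>j'<J. if j' = j then (if a = a0 \<and> a' = a0' then \<Sum>k<K. y (j, b, b', k) * z (c, c', k) else 0) else 0)"
      unfolding V_def prod.case by (intro sum.cong[OF refl]) (auto simp: ei_def mult_ite)
    then show ?thesis using j by simp
  qed
  show "(\<Sum>a<p. \<Sum>a'<p. Psi (ei (a, a', j)) y z)
    = quad ({..<q} \<times> {..<r}) S1 (\<lambda>(b, c) (b', c'). \<Sum>k<K. y (j, b, b', k) * z (c, c', k))"
    unfolding Psi_def
    by (subst quad_trace[OF _ _ bij1, where W="\<lambda>(b, c) (b', c'). \<Sum>k<K. y (j, b, b', k) * z (c, c', k)"])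
      (auto simp: V1 S1_def intro!: quad_cong)
qed

lemma tr2: "(\<Sum>i\<in>I2. Psi x (ei i) z)
    = (\<Sum>j<J. \<Sum>k<K. quad ({..<p} \<times> {..<r}) S2 (\<lambda>(a, c) (a', c'). x (a, a', j) * z (c, c', k)))"
  unfolding sum_I2
proof (intro sum.cong[OF refl])
  fix j k assume j: "j \<in> {..<J}" "k \<in> {..<K}"
  have V1: "V x (ei (j, b0, b0', k)) z (a, b, c) (a', b', c')
      = (if b = b0 \<and> b' = b0' then x (a, a', j) * z (c, c', k) else 0)" for b0 b0' a b c a' b' c'
  proof -
    have "V x (ei (j, b0, b0', k)) z (a, b, c) (a', b', c') =
      (\<Sum>j'<J. if j' = j then (\<Sum>k'<K. if k' = k then (if b = b0 \<and> b' = b0' then x (a, a', j) * z (c, c', k) else 0) else 0) else 0)"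
      unfolding V_def prod.case
    proof (rule sum.cong[OF refl])
      fix j'
      show "(\<Sum>k'<K. x (a, a', j') * ei (j, b0, b0', k) (j', b, b', k') * z (c, c', k')) =
        (if j' = j then (\<Sum>k'<K. if k' = k then (if b = b0 \<and> b' = b0' then x (a, a', j) * z (c, c', k) else 0) else 0) else 0)"
        by (cases "j' = j") (auto simp: ei_def mult_ite intro!: sum.cong sum.neutral)
    qed
    then show ?thesis using j by simp
  qed
  show "(\<Sum>b<q. \<Sum>b'<q. Psi x (ei (j, b, b', k)) z)
    = quad ({..<p} \<times> {..<r}) S2 (\<lambda>(a, c) (a', c'). x (a, a', j) * z (c, c', k))"
    unfolding Psi_def
    by (subst quad_trace[OF _ _ bij2, where W="\<lambda>(a, c) (a', c'). x (a, a', j) * z (c, c', k)"])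
      (auto simp: V1 S2_def intro!: quad_cong)
qed

lemma tr3: "(\<Sum>i\<in>I3. Psi x y (ei i))
    = (\<Sum>k<K. quad ({..<p} \<times> {..<q}) S3 (\<lambda>(a, b) (a', b'). \<Sum>j<J. x (a, a', j) * y (j, b, b', k)))"
  unfolding sum_I3
proof (rule sum.cong[OF refl])
  fix k assume k: "k \<in> {..<K}"
  have V1: "V x y (ei (c0, c0', k)) (a, b, c) (a', b', c')
      = (if c = c0 \<and> c' = c0' then \<Sum>j<J. x (a, a', j) * y (j, b, b', k) else 0)" for c0 c0' a b c a' b' c'
  proof -
    have "V x y (ei (c0, c0', k)) (a, b, c) (a', b', c') =
      (\<Sum>j<J. \<Sum>k'<K. if k' = k then (if c = c0 \<and> c' = c0' then x (a, a', j) * y (j, b, b', k) else 0) else 0)"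
      unfolding V_def by (auto simp: ei_def mult_ite intro!: sum.cong)
    then show ?thesis using k by (cases "c = c0 \<and> c' = c0'") auto
  qed
  show "(\<Sum>c<r. \<Sum>c'<r. Psi x y (ei (c, c', k)))
    = quad ({..<p} \<times> {..<q}) S3 (\<lambda>(a, b) (a', b'). \<Sum>j<J. x (a, a', j) * y (j, b, b', k))"
    unfolding Psi_def
    by (subst quad_trace[OF _ _ bij3, where W="\<lambda>(a, b) (a', b'). \<Sum>j<J. x (a, a', j) * y (j, b, b', k)"])
      (auto simp: V1 S3_def intro!: quad_cong)
qed

lemma bij_id: "bij_betw (\<lambda>x. x) (A \<times> B) (A \<times> B)" by (simp add: bij_betw_def)

lemma bij_swap: "bij_betw (\<lambda>(b, a). (a, b)) (B \<times> A) (A \<times> B)"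
  by (rule bij_betwI[where g="\<lambda>(a, b). (b, a)"]) auto

text \<open>The y slot fixes (j, k) and the x slot its own rank index, so only matching j survive;
  the result no longer depends on j, whence the factor J.\<close>

lemma tr12: "(\<Sum>i2\<in>I2. \<Sum>i1\<in>I1. Psi (ei i1) (ei i2) z) = real J * (\<Sum>k<K. quad {..<r} S12 (\<lambda>c c'. z (c, c', k)))"
proof -
  have "(\<Sum>b<q. \<Sum>b'<q. quad ({..<q} \<times> {..<r}) S1
       (\<lambda>(b1, c) (b1', c'). \<Sum>k'<K. ei (j, b, b', k) (j', b1, b1', k') * z (c, c', k')))
     = (if j' = j then quad {..<r} S12 (\<lambda>c c'. z (c, c', k)) else 0)" if k: "k < K" for j j' k
  proof -
    have V1: "(\<Sum>k'<K. ei (j, b, b', k) (j', b1, b1', k') * z (c, c', k'))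
       = (if b1 = b \<and> b1' = b' then (if j' = j then z (c, c', k) else 0) else 0)" for b b' b1 b1' c c'
    proof -
      have "(\<Sum>k'<K. ei (j, b, b', k) (j', b1, b1', k') * z (c, c', k')) =
        (\<Sum>k'<K. if k' = k then (if b1 = b \<and> b1' = b' then (if j' = j then z (c, c', k) else 0) else 0) else 0)"
        by (auto simp: ei_def mult_ite intro!: sum.cong)
      then show ?thesis using k by simp
    qed
    show ?thesis
      by (subst quad_trace[OF _ _ bij_id, where W="\<lambda>c c'. if j' = j then z (c, c', k) else 0"])
        (auto simp: V1 S12_def quad_zero intro!: quad_cong)
  qed
  note * = this
  have "(\<Sum>i2\<in>I2. \<Sum>i1\<in>I1. Psi (ei i1) (ei i2) z) =
      (\<Sum>j<J. \<Sum>k<K. \<Sum>j'<J. if j' = j then quad {..<r} S12 (\<lambda>c c'. z (c, c', k)) else 0)"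
    unfolding tr1 sum_I2
    by (intro sum.cong[OF refl], subst sum_swap2, intro sum.cong[OF refl]) (rule *, simp)
  also have "\<dots> = (\<Sum>j<J. \<Sum>k<K. quad {..<r} S12 (\<lambda>c c'. z (c, c', k)))"
    by (intro sum.cong refl) simp
  finally show ?thesis by simp
qed

end

lemma sum_swap22:
  fixes g :: "'a \<Rightarrow> 'b \<Rightarrow> 'c \<Rightarrow> 'd \<Rightarrow> 'e::comm_monoid_add"
  shows "(\<Sum>a\<in>A. \<Sum>a'\<in>A'. \<Sum>b\<in>B. \<Sum>b'\<in>B'. g a a' b b') = (\<Sum>b\<in>B. \<Sum>b'\<in>B'. \<Sum>a\<in>A. \<Sum>a'\<in>A'. g a a' b b')"
proof -
  have "(\<Sum>a\<in>A. \<Sum>a'\<in>A'. \<Sum>b\<in>B. \<Sum>b'\<in>B'. g a a' b b') = (\<Sum>b\<in>B. \<Sum>a\<in>A. \<Sum>a'\<in>A'. \<Sum>b'\<in>B'. g a a' b b')"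
    by (rule sum_swap2)
  also have "\<dots> = (\<Sum>b\<in>B. \<Sum>b'\<in>B'. \<Sum>a\<in>A. \<Sum>a'\<in>A'. g a a' b b')"
    by (intro sum.cong refl sum_swap2)
  finally show ?thesis .
qed

lemma sum_pairs:
  fixes h :: "'a \<times> 'b \<Rightarrow> 'a \<times> 'b \<Rightarrow> real"
  shows "(\<Sum>m\<in>A \<times> B. \<Sum>n\<in>A \<times> B. h m n) = (\<Sum>b\<in>A. \<Sum>b'\<in>A. \<Sum>c\<in>B. \<Sum>c'\<in>B. h (b, c) (b', c'))"
proof -
  have "(\<Sum>m\<in>A \<times> B. \<Sum>n\<in>A \<times> B. h m n) = (\<Sum>b\<in>A. \<Sum>c\<in>B. \<Sum>b'\<in>A. \<Sum>c'\<in>B. h (b, c) (b', c'))"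
    by (simp only: sum.cartesian_product')
  also have "\<dots> = (\<Sum>b\<in>A. \<Sum>b'\<in>A. \<Sum>c\<in>B. \<Sum>c'\<in>B. h (b, c) (b', c'))"
    by (intro sum.cong refl sum.swap)
  finally show ?thesis .
qed

context tri
begin

lemma tr13: "(\<Sum>i3\<in>I3. \<Sum>i1\<in>I1. Psi (ei i1) y (ei i3)) = (\<Sum>j<J. \<Sum>k<K. quad {..<q} S13 (\<lambda>b b'. y (j, b, b', k)))"
proof -
  have *: "(\<Sum>c<r. \<Sum>c'<r. quad ({..<q} \<times> {..<r}) S1
       (\<lambda>(b, c1) (b', c1'). \<Sum>k'<K. y (j, b, b', k') * ei (c, c', k) (c1, c1', k')))
     = quad {..<q} S13 (\<lambda>b b'. y (j, b, b', k))" if k: "k < K" for j k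
  proof -
    have V1: "(\<Sum>k'<K. y (j, b, b', k') * ei (c, c', k) (c1, c1', k'))
       = (if c1 = c \<and> c1' = c' then y (j, b, b', k) else 0)" for b b' c c' c1 c1'
    proof -
      have "(\<Sum>k'<K. y (j, b, b', k') * ei (c, c', k) (c1, c1', k')) =
        (\<Sum>k'<K. if k' = k then (if c1 = c \<and> c1' = c' then y (j, b, b', k) else 0) else 0)"
        by (auto simp: ei_def mult_ite intro!: sum.cong)
      then show ?thesis using k by simp
    qed
    show ?thesis
      by (subst quad_trace[OF _ _ bij_swap, where W="\<lambda>b b'. y (j, b, b', k)"])
        (auto simp: V1 S13_def intro!: quad_cong)
  qed
  have "(\<Sum>i3\<in>I3. \<Sum>i1\<in>I1. Psi (ei i1) y (ei i3)) =
      (\<Sum>k<K. \<Sum>j<J. quad {..<q} S13 (\<lambda>b b'. y (j, b, b', k)))"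
    unfolding tr1 sum_I3
    by (intro sum.cong[OF refl], subst sum_swap2, intro sum.cong[OF refl]) (rule *, simp)
  also have "\<dots> = (\<Sum>j<J. \<Sum>k<K. quad {..<q} S13 (\<lambda>b b'. y (j, b, b', k)))" by (rule sum.swap)
  finally show ?thesis .
qed

lemma tr23: "(\<Sum>i3\<in>I3. \<Sum>i2\<in>I2. Psi x (ei i2) (ei i3)) = real K * (\<Sum>j<J. quad {..<p} S23 (\<lambda>a a'. x (a, a', j)))"
proof -
  have *: "(\<Sum>c<r. \<Sum>c'<r. \<Sum>k'<K. quad ({..<p} \<times> {..<r}) S2
       (\<lambda>(a, c1) (a', c1'). x (a, a', j) * ei (c, c', k) (c1, c1', k')))
     = quad {..<p} S23 (\<lambda>a a'. x (a, a', j))" if k: "k < K" for j k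
  proof -
    have "(\<Sum>c<r. \<Sum>c'<r. quad ({..<p} \<times> {..<r}) S2
       (\<lambda>(a, c1) (a', c1'). x (a, a', j) * ei (c, c', k) (c1, c1', k')))
      = (if k' = k then quad {..<p} S23 (\<lambda>a a'. x (a, a', j)) else 0)" for k'
      by (subst quad_trace[OF _ _ bij_swap, where W="\<lambda>a a'. if k' = k then x (a, a', j) else 0"])
        (auto simp: ei_def S23_def quad_zero intro!: quad_cong)
    then show ?thesis by (subst sum_swap2) (use k in simp)
  qed
  have "(\<Sum>i3\<in>I3. \<Sum>i2\<in>I2. Psi x (ei i2) (ei i3)) = (\<Sum>k<K. \<Sum>j<J. quad {..<p} S23 (\<lambda>a a'. x (a, a', j)))"
    unfolding tr2 sum_I3
    by (intro sum.cong[OF refl], subst sum_swap2, intro sum.cong[OF refl]) (rule *, simp)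
  then show ?thesis by simp
qed

lemma tr123: "(\<Sum>i3\<in>I3. \<Sum>i2\<in>I2. \<Sum>i1\<in>I1. Psi (ei i1) (ei i2) (ei i3)) = real J * real K * S123^2"
proof -
  \<comment> \<open>Nothing is left after the last trace, so the complementary factor in
    \<open>quad_trace\<close> is indexed by the unit type.\<close>
  have bij: "bij_betw fst ({..<r} \<times> {()}) {..<r}"
    by (rule bij_betwI[where g="\<lambda>c. (c, ())"]) auto
  have *: "(\<Sum>c<r. \<Sum>c'<r. \<Sum>k'<K. quad {..<r} S12 (\<lambda>c1 c1'. ei (c, c', k) (c1, c1', k'))) = S123^2" if k: "k < K" for k
  proof -
    have "(\<Sum>c<r. \<Sum>c'<r. quad {..<r} S12 (\<lambda>c1 c1'. ei (c, c', k) (c1, c1', k')))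
      = (if k' = k then S123^2 else 0)" for k'
      by (subst quad_trace[OF _ _ bij, where W="\<lambda>_ _. if k' = k then 1 else 0"])
        (auto simp: ei_def S123_def quad_def power2_eq_square)
    then show ?thesis by (subst sum_swap2) (use k in simp)
  qed
  have "(\<Sum>i3\<in>I3. \<Sum>i2\<in>I2. \<Sum>i1\<in>I1. Psi (ei i1) (ei i2) (ei i3)) = (\<Sum>k<K. real J * S123^2)"
    unfolding tr12 sum_I3 sum_distrib_left[symmetric]
    by (intro sum.cong[OF refl] arg_cong2[where f="(*)"] refl) (rule *, simp)
  then show ?thesis by simp
qed

lemma Psi_scale1: "Psi (\<lambda>i. c * x i) y z = c^2 * Psi x y z"
proof -
  have "V (\<lambda>i. c * x i) y z m n = c * V x y z m n" for m n
    by (cases m; cases n) (simp add: V_def sum_distrib_left algebra_simps)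
  then show ?thesis by (simp add: Psi_def quad_def sum_distrib_left power2_eq_square algebra_simps)
qed

lemma Psi_scale2: "Psi x (\<lambda>i. c * y i) z = c^2 * Psi x y z"
proof -
  have "V x (\<lambda>i. c * y i) z m n = c * V x y z m n" for m n
    by (cases m; cases n) (simp add: V_def sum_distrib_left algebra_simps)
  then show ?thesis by (simp add: Psi_def quad_def sum_distrib_left power2_eq_square algebra_simps)
qed

lemma Psi_scale3: "Psi x y (\<lambda>i. c * z i) = c^2 * Psi x y z"
proof -
  have "V x y (\<lambda>i. c * z i) m n = c * V x y z m n" for m n
    by (cases m; cases n) (simp add: V_def sum_distrib_left algebra_simps)
  then show ?thesis by (simp add: Psi_def quad_def sum_distrib_left power2_eq_square algebra_simps)
qed

lemma finI: "finite I1" "finite I2" "finite I3" "finite D"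
  by (simp_all add: I1_def I2_def I3_def D_def)

lemma quad_le':
  assumes "finite E" "opnorm E E R \<le> t" "(\<Sum>m\<in>E. \<Sum>n\<in>E. (W m n)^2) \<le> u" "0 \<le> u"
  shows "quad E R W \<le> t^2 * u"
proof -
  have o: "0 \<le> opnorm E E R" by (rule opnorm_nonneg[OF assms(1,1)])
  have "quad E R W \<le> (opnorm E E R)^2 * (\<Sum>m\<in>E. \<Sum>n\<in>E. (W m n)^2)" by (rule quad_le[OF assms(1)])
  also have "\<dots> \<le> t^2 * u"
    using assms o by (intro mult_mono power_mono sum_nonneg) auto
  finally show ?thesis .
qed

lemma sum_quad_le:
  assumes "finite E" "opnorm E E R \<le> t" "(\<Sum>l\<in>L. \<Sum>m\<in>E. \<Sum>n\<in>E. (W l m n)^2) \<le> u"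
  shows "(\<Sum>l\<in>L. quad E R (W l)) \<le> t^2 * u"
proof -
  have "(\<Sum>l\<in>L. quad E R (W l)) \<le> (\<Sum>l\<in>L. t^2 * (\<Sum>m\<in>E. \<Sum>n\<in>E. (W l m n)^2))"
    by (intro sum_mono quad_le'[OF assms(1,2)] sum_nonneg) auto
  also have "\<dots> \<le> t^2 * u" unfolding sum_distrib_left[symmetric] using assms(3) by (intro mult_left_mono) auto
  finally show ?thesis .
qed

text \<open>Replacing a scaled block by basis vectors loses the square of its scale r1, t or r3 but
  gains a trace: the operator norm picks up r1, r2 or r3, and the y slot also brings J K. The choice
  t^2 = J K r2^2 makes these exchanges even, so all eight terms obey the same bound.\<close>

lemma moment_bound:
  assumes xc: "\<And>w. (\<Sum>a<p. \<Sum>a'<p. (\<Sum>j<J. x (a, a', j) * w j)^2) \<le> (\<Sum>j<J. (w j)^2)"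
    and zc: "\<And>w. (\<Sum>c<r. \<Sum>c'<r. (\<Sum>k<K. z (c, c', k) * w k)^2) \<le> (\<Sum>k<K. (w k)^2)"
    and y1: "(\<Sum>j<J. \<Sum>k<K. \<Sum>b<q. \<Sum>b'<q. (y (j, b, b', k))^2) \<le> 1"
    and nS: "opnorm D D S \<le> s"
    and n1: "opnorm ({..<q} \<times> {..<r}) ({..<q} \<times> {..<r}) S1 \<le> r1 * s"
    and n2: "opnorm ({..<p} \<times> {..<r}) ({..<p} \<times> {..<r}) S2 \<le> r2 * s"
    and n3: "opnorm ({..<p} \<times> {..<q}) ({..<p} \<times> {..<q}) S3 \<le> r3 * s"
    and n12: "opnorm {..<r} {..<r} S12 \<le> r1 * r2 * s"
    and n13: "opnorm {..<q} {..<q} S13 \<le> r1 * r3 * s"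
    and n23: "opnorm {..<p} {..<p} S23 \<le> r2 * r3 * s"
    and n123: "\<bar>S123\<bar> \<le> r1 * r2 * r3 * s"
    and t: "t^2 = real J * real K * r2^2"
  shows "(\<Sum>u\<in>opt I1. \<Sum>v\<in>opt I2. \<Sum>w\<in>opt I3. Psi (pk (\<lambda>i. r1 * x i) u) (pk (\<lambda>i. t * y i) v) (pk (\<lambda>i. r3 * z i) w))
    \<le> 8 * ((r1 * t * r3)^2 * s^2)"
proof -
  have x1: "(\<Sum>a<p. \<Sum>a'<p. (x (a, a', j))^2) \<le> 1" if "j < J" for j
    using xc[of "\<lambda>l. if l = j then 1 else 0"] that by (simp add: mult_ite if_distrib[where f="\<lambda>x. x^2"] cong: if_cong)
  have z1: "(\<Sum>c<r. \<Sum>c'<r. (z (c, c', k))^2) \<le> 1" if "k < K" for k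
    using zc[of "\<lambda>l. if l = k then 1 else 0"] that by (simp add: mult_ite if_distrib[where f="\<lambda>x. x^2"] cong: if_cong)
  \<comment> \<open>Contracting y with z, and later with x, cannot increase its Frobenius norm,
    since x and z act as contractions on the rank indices.\<close>
  have yz: "(\<Sum>j<J. \<Sum>b<q. \<Sum>b'<q. \<Sum>c<r. \<Sum>c'<r. (\<Sum>k<K. y (j, b, b', k) * z (c, c', k))^2) \<le> 1"
  proof -
    have "(\<Sum>j<J. \<Sum>b<q. \<Sum>b'<q. \<Sum>c<r. \<Sum>c'<r. (\<Sum>k<K. y (j, b, b', k) * z (c, c', k))^2)
       \<le> (\<Sum>j<J. \<Sum>b<q. \<Sum>b'<q. \<Sum>k<K. (y (j, b, b', k))^2)"
      using zc[of "\<lambda>k. y (_, _, _, k)"] by (intro sum_mono) (simp add: mult.commute)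
    also have "\<dots> = (\<Sum>j<J. \<Sum>k<K. \<Sum>b<q. \<Sum>b'<q. (y (j, b, b', k))^2)"
      by (intro sum.cong refl sum_swap2)
    finally show ?thesis using y1 by linarith
  qed
  have xy: "(\<Sum>k<K. \<Sum>a<p. \<Sum>a'<p. \<Sum>b<q. \<Sum>b'<q. (\<Sum>j<J. x (a, a', j) * y (j, b, b', k))^2) \<le> 1"
  proof -
    have "(\<Sum>k<K. \<Sum>a<p. \<Sum>a'<p. \<Sum>b<q. \<Sum>b'<q. (\<Sum>j<J. x (a, a', j) * y (j, b, b', k))^2)
      = (\<Sum>k<K. \<Sum>b<q. \<Sum>b'<q. \<Sum>a<p. \<Sum>a'<p. (\<Sum>j<J. x (a, a', j) * y (j, b, b', k))^2)"
      by (rule sum.cong[OF refl], rule sum_swap22)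
    also have "\<dots> \<le> (\<Sum>k<K. \<Sum>b<q. \<Sum>b'<q. \<Sum>j<J. (y (j, b, b', k))^2)"
      by (intro sum_mono xc)
    also have "\<dots> = (\<Sum>k<K. \<Sum>j<J. \<Sum>b<q. \<Sum>b'<q. (y (j, b, b', k))^2)" by (intro sum.cong refl sum_swap2)
    also have "\<dots> = (\<Sum>j<J. \<Sum>k<K. \<Sum>b<q. \<Sum>b'<q. (y (j, b, b', k))^2)" by (rule sum.swap)
    finally show ?thesis using y1 by linarith
  qed
  have xyz: "(\<Sum>m\<in>D. \<Sum>n\<in>D. (V x y z m n)^2) \<le> 1"
  proof -
    have "(\<Sum>m\<in>D. \<Sum>n\<in>D. (V x y z m n)^2) = (\<Sum>a<p. \<Sum>a'<p. \<Sum>b<q. \<Sum>b'<q. \<Sum>c<r. \<Sum>c'<r. (V x y z (a, b, c) (a', b', c'))^2)"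
      unfolding D_def
      by (subst sum_pairs, rule sum.cong[OF refl], rule sum.cong[OF refl], rule sum_pairs)
    also have "\<dots> = (\<Sum>a<p. \<Sum>a'<p. \<Sum>b<q. \<Sum>b'<q. \<Sum>c<r. \<Sum>c'<r. (\<Sum>j<J. x (a, a', j) * (\<Sum>k<K. y (j, b, b', k) * z (c, c', k)))^2)"
      by (simp add: V_def sum_distrib_left mult.assoc)
    also have "\<dots> = (\<Sum>b<q. \<Sum>b'<q. \<Sum>c<r. \<Sum>c'<r. \<Sum>a<p. \<Sum>a'<p. (\<Sum>j<J. x (a, a', j) * (\<Sum>k<K. y (j, b, b', k) * z (c, c', k)))^2)"
      by (subst sum_swap22, intro sum.cong refl sum_swap22)
    also have "\<dots> \<le> (\<Sum>b<q. \<Sum>b'<q. \<Sum>c<r. \<Sum>c'<r. \<Sum>j<J. (\<Sum>k<K. y (j, b, b', k) * z (c, c', k))^2)"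
      by (intro sum_mono xc)
    also have "\<dots> = (\<Sum>b<q. \<Sum>b'<q. \<Sum>j<J. \<Sum>c<r. \<Sum>c'<r. (\<Sum>k<K. y (j, b, b', k) * z (c, c', k))^2)"
      by (intro sum.cong refl sum_swap2)
    also have "\<dots> = (\<Sum>j<J. \<Sum>b<q. \<Sum>b'<q. \<Sum>c<r. \<Sum>c'<r. (\<Sum>k<K. y (j, b, b', k) * z (c, c', k))^2)"
      by (rule sum_swap2)
    finally show ?thesis using yz by linarith
  qed
  have T000: "Psi x y z \<le> s^2 * 1" unfolding Psi_def by (rule quad_le'[OF finI(4) nS xyz]) simp
  have T100: "(\<Sum>i\<in>I1. Psi (ei i) y z) \<le> (r1 * s)^2 * 1"
    unfolding tr1 by (rule sum_quad_le[OF _ n1]) (use yz in \<open>simp_all add: sum_pairs\<close>)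
  have T001: "(\<Sum>i\<in>I3. Psi x y (ei i)) \<le> (r3 * s)^2 * 1"
    unfolding tr3 by (rule sum_quad_le[OF _ n3]) (use xy in \<open>simp_all add: sum_pairs\<close>)
  have T010: "(\<Sum>i\<in>I2. Psi x (ei i) z) \<le> real J * (real K * ((r2 * s)^2 * 1))"
  proof -
    have "quad ({..<p} \<times> {..<r}) S2 (\<lambda>(a, c) (a', c'). x (a, a', j) * z (c, c', k)) \<le> (r2 * s)^2 * 1"
      if "j < J" "k < K" for j k
    proof (rule quad_le'[OF _ n2])
      have "(\<Sum>a<p. \<Sum>a'<p. \<Sum>c<r. \<Sum>c'<r. (x (a, a', j) * z (c, c', k))^2)
        = (\<Sum>a<p. \<Sum>a'<p. (x (a, a', j))^2) * (\<Sum>c<r. \<Sum>c'<r. (z (c, c', k))^2)"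
        by (simp add: sum_distrib_right sum_distrib_left power_mult_distrib) (rule sum_swap22)
      also have "\<dots> \<le> 1 * 1" using x1 z1 that by (intro mult_mono sum_nonneg) auto
      finally show "(\<Sum>m\<in>{..<p} \<times> {..<r}. \<Sum>n\<in>{..<p} \<times> {..<r}.
          ((case m of (a, c) \<Rightarrow> \<lambda>(a', c'). x (a, a', j) * z (c, c', k)) n)^2) \<le> 1"
        by (simp add: sum_pairs)
    qed auto
    then have "(\<Sum>j<J. \<Sum>k<K. quad ({..<p} \<times> {..<r}) S2 (\<lambda>(a, c) (a', c'). x (a, a', j) * z (c, c', k)))
      \<le> (\<Sum>j<J. \<Sum>k<K. (r2 * s)^2 * 1)" by (intro sum_mono) auto
    then show ?thesis unfolding tr2 by simp
  qed
  have T110: "(\<Sum>i2\<in>I2. \<Sum>i1\<in>I1. Psi (ei i1) (ei i2) z) \<le> real J * ((r1 * r2 * s)^2 * real K)"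
  proof -
    have "(\<Sum>k<K. \<Sum>c<r. \<Sum>c'<r. (z (c, c', k))^2) \<le> (\<Sum>k<K. 1)" by (intro sum_mono z1) simp
    then show ?thesis unfolding tr12 by (intro mult_left_mono sum_quad_le[OF _ n12]) auto
  qed
  have T101: "(\<Sum>i3\<in>I3. \<Sum>i1\<in>I1. Psi (ei i1) y (ei i3)) \<le> (r1 * r3 * s)^2 * 1"
  proof -
    have "(\<Sum>j<J. \<Sum>k<K. quad {..<q} S13 (\<lambda>b b'. y (j, b, b', k)))
      = (\<Sum>l\<in>{..<J} \<times> {..<K}. quad {..<q} S13 (\<lambda>b b'. y (fst l, b, b', snd l)))"
      unfolding sum.cartesian_product by (intro sum.cong) auto
    also have "\<dots> \<le> (r1 * r3 * s)^2 * 1"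
    proof (rule sum_quad_le[OF _ n13])
      have "(\<Sum>l\<in>{..<J} \<times> {..<K}. \<Sum>m<q. \<Sum>n<q. (y (fst l, m, n, snd l))^2)
        = (\<Sum>j<J. \<Sum>k<K. \<Sum>b<q. \<Sum>b'<q. (y (j, b, b', k))^2)"
        by (simp only: sum.cartesian_product' fst_conv snd_conv)
      then show "(\<Sum>l\<in>{..<J} \<times> {..<K}. \<Sum>m<q. \<Sum>n<q. (y (fst l, m, n, snd l))^2) \<le> 1" using y1 by simp
    qed simp
    finally show ?thesis unfolding tr13 .
  qed
  have T011: "(\<Sum>i3\<in>I3. \<Sum>i2\<in>I2. Psi x (ei i2) (ei i3)) \<le> real K * ((r2 * r3 * s)^2 * real J)"
  proof -
    have "(\<Sum>j<J. \<Sum>a<p. \<Sum>a'<p. (x (a, a', j))^2) \<le> (\<Sum>j<J. 1)" by (intro sum_mono x1) simp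
    then show ?thesis unfolding tr23 by (intro mult_left_mono sum_quad_le[OF _ n23]) auto
  qed
  have T111: "(\<Sum>i3\<in>I3. \<Sum>i2\<in>I2. \<Sum>i1\<in>I1. Psi (ei i1) (ei i2) (ei i3)) \<le> real J * real K * (r1 * r2 * r3 * s)^2"
  proof -
    have "S123^2 \<le> (r1 * r2 * r3 * s)^2" using n123 by (simp add: abs_le_square_iff[symmetric])
    then show ?thesis unfolding tr123 by (intro mult_left_mono) auto
  qed
  have pkN: "pk f None = f" and pkS: "pk f (Some i) = ei i" for f :: "'z \<Rightarrow> real" and i
    by (simp_all add: pk_def ei_def)
  let ?x = "\<lambda>i. r1 * x i" and ?y = "\<lambda>i. t * y i" and ?z = "\<lambda>i. r3 * z i"
  have "(\<Sum>u\<in>opt I1. \<Sum>v\<in>opt I2. \<Sum>w\<in>opt I3. Psi (pk ?x u) (pk ?y v) (pk ?z w))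
    = Psi ?x ?y ?z + (\<Sum>i3\<in>I3. Psi ?x ?y (ei i3)) + (\<Sum>i2\<in>I2. Psi ?x (ei i2) ?z)
      + (\<Sum>i2\<in>I2. \<Sum>i3\<in>I3. Psi ?x (ei i2) (ei i3))
      + (\<Sum>i1\<in>I1. Psi (ei i1) ?y ?z) + (\<Sum>i1\<in>I1. \<Sum>i3\<in>I3. Psi (ei i1) ?y (ei i3))
      + (\<Sum>i1\<in>I1. \<Sum>i2\<in>I2. Psi (ei i1) (ei i2) ?z) + (\<Sum>i1\<in>I1. \<Sum>i2\<in>I2. \<Sum>i3\<in>I3. Psi (ei i1) (ei i2) (ei i3))"
    by (simp add: sum_opt finI pkN pkS sum.distrib)
  also have "\<dots> = r1^2 * t^2 * r3^2 * Psi x y z + r1^2 * t^2 * (\<Sum>i3\<in>I3. Psi x y (ei i3))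
      + r1^2 * r3^2 * (\<Sum>i2\<in>I2. Psi x (ei i2) z)
      + r1^2 * (\<Sum>i3\<in>I3. \<Sum>i2\<in>I2. Psi x (ei i2) (ei i3))
      + t^2 * r3^2 * (\<Sum>i1\<in>I1. Psi (ei i1) y z) + t^2 * (\<Sum>i3\<in>I3. \<Sum>i1\<in>I1. Psi (ei i1) y (ei i3))
      + r3^2 * (\<Sum>i2\<in>I2. \<Sum>i1\<in>I1. Psi (ei i1) (ei i2) z)
      + (\<Sum>i3\<in>I3. \<Sum>i2\<in>I2. \<Sum>i1\<in>I1. Psi (ei i1) (ei i2) (ei i3))"
  proof -
    have "(\<Sum>i2\<in>I2. \<Sum>i3\<in>I3. Psi ?x (ei i2) (ei i3)) = (\<Sum>i3\<in>I3. \<Sum>i2\<in>I2. Psi ?x (ei i2) (ei i3))"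
      "(\<Sum>i1\<in>I1. \<Sum>i3\<in>I3. Psi (ei i1) ?y (ei i3)) = (\<Sum>i3\<in>I3. \<Sum>i1\<in>I1. Psi (ei i1) ?y (ei i3))"
      "(\<Sum>i1\<in>I1. \<Sum>i2\<in>I2. Psi (ei i1) (ei i2) ?z) = (\<Sum>i2\<in>I2. \<Sum>i1\<in>I1. Psi (ei i1) (ei i2) ?z)"
      by (rule sum.swap)+
    moreover have "(\<Sum>i1\<in>I1. \<Sum>i2\<in>I2. \<Sum>i3\<in>I3. Psi (ei i1) (ei i2) (ei i3)) = (\<Sum>i3\<in>I3. \<Sum>i2\<in>I2. \<Sum>i1\<in>I1. Psi (ei i1) (ei i2) (ei i3))"
      by (rule sum_rev3)
    ultimately show ?thesis
      by (simp only: Psi_scale1 Psi_scale2 Psi_scale3 sum_distrib_left[symmetric] mult.assoc)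
  qed
  also have "\<dots> \<le> r1^2 * t^2 * r3^2 * (s^2 * 1) + r1^2 * t^2 * ((r3 * s)^2 * 1)
      + r1^2 * r3^2 * (real J * (real K * ((r2 * s)^2 * 1)))
      + r1^2 * (real K * ((r2 * r3 * s)^2 * real J))
      + t^2 * r3^2 * ((r1 * s)^2 * 1) + t^2 * ((r1 * r3 * s)^2 * 1)
      + r3^2 * (real J * ((r1 * r2 * s)^2 * real K))
      + real J * real K * (r1 * r2 * r3 * s)^2"
    by (intro add_mono mult_left_mono T000 T001 T010 T011 T100 T101 T110 T111) auto
  also have "\<dots> = 8 * ((r1 * t * r3)^2 * s^2)"
    unfolding power_mult_distrib t by (simp add: algebra_simps)
  finally show ?thesis .
qed

end

section \<open>Uniform noise bounds\<close>

lemma quad_reindex: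
  assumes "bij_betw f E D"
  shows "quad D S V = quad E (\<lambda>m n. S (f m) (f n)) (\<lambda>m n. V (f m) (f n))"
  unfolding quad_def by (simp only: sum.reindex_bij_betw[OF assms, symmetric])

lemma quad_scale: "quad D S (\<lambda>m n. c * V m n) = c^2 * quad D S V"
  by (simp add: quad_def sum_distrib_left power2_eq_square algebra_simps)

lemma sum_sq2:
  fixes f :: "'i \<Rightarrow> 'j \<Rightarrow> real"
  shows "(\<Sum>i\<in>A. \<Sum>j\<in>B. f i j)^2 = (\<Sum>i\<in>A. \<Sum>j\<in>B. \<Sum>i'\<in>A. \<Sum>j'\<in>B. f i j * f i' j')"
proof -
  define S where "S = (\<Sum>i\<in>A. \<Sum>j\<in>B. f i j)"
  have "S^2 = (\<Sum>i\<in>A. \<Sum>j\<in>B. f i j * S)"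
    unfolding sum_distrib_right[symmetric] by (simp add: S_def power2_eq_square)
  then show ?thesis unfolding S_def by (simp only: sum_distrib_left)
qed

lemma quad_sqrt:
  fixes C S :: mat
  assumes sym: "\<forall>i<d. \<forall>j<d. C i j = C j i" and CC: "\<forall>i<d. \<forall>j<d. (\<Sum>k<d. C i k * C k j) = S i j"
  shows "(\<Sum>s<d. \<Sum>t<d. (\<Sum>i<d. \<Sum>j<d. C s i * C j t * V i j)^2) = quad {..<d} S V"
proof -
  have "(\<Sum>s<d. \<Sum>t<d. (\<Sum>i<d. \<Sum>j<d. C s i * C j t * V i j)^2)
    = (\<Sum>s<d. \<Sum>t<d. \<Sum>i<d. \<Sum>j<d. \<Sum>i'<d. \<Sum>j'<d. (C s i * C j t * V i j) * (C s i' * C j' t * V i' j'))"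
    by (simp only: sum_sq2)
  also have "\<dots> = (\<Sum>i<d. \<Sum>j<d. \<Sum>i'<d. \<Sum>j'<d. \<Sum>s<d. \<Sum>t<d. (C s i * C j t * V i j) * (C s i' * C j' t * V i' j'))"
    by (subst sum_swap22, rule sum.cong[OF refl], rule sum.cong[OF refl], rule sum_swap22)
  also have "\<dots> = (\<Sum>i<d. \<Sum>j<d. \<Sum>i'<d. \<Sum>j'<d. V i j * V i' j' * S i i' * S j j')"
  proof (intro sum.cong refl)
    fix i j i' j' assume ij: "i \<in> {..<d}" "j \<in> {..<d}" "i' \<in> {..<d}" "j' \<in> {..<d}"
    have "S i i' = (\<Sum>s<d. C s i * C s i')"
      using CC sym ij by (metis (no_types, lifting) lessThan_iff sum.cong)
    moreover have "S j j' = (\<Sum>t<d. C j t * C j' t)"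
      using CC sym ij by (metis (no_types, lifting) lessThan_iff sum.cong)
    ultimately show "(\<Sum>s<d. \<Sum>t<d. (C s i * C j t * V i j) * (C s i' * C j' t * V i' j')) = V i j * V i' j' * S i i' * S j j'"
      by (simp only: sum_prod_scale) (intro sum.cong refl, simp add: algebra_simps)
  qed
  also have "\<dots> = quad {..<d} S V" by (simp only: quad_def)
  finally show ?thesis .
qed

text \<open>Assumption (A) is applied to U = C V C with C the square root of the covariance: X = C Z
  makes the two quadratic forms equal, the centering terms match, and the squared Frobenius norm of
  U is \<open>quad\<close>.\<close>

lemma mgf_single:
  fixes Sig :: mat and X0 :: "'a \<Rightarrow> nat \<Rightarrow> real"
  assumes M: "prob_space M" and pd: "sym_pd d Sig" and om: "0 < om"
    and Xm: "\<And>j. j < d \<Longrightarrow> (\<lambda>w. X0 w j) \<in> borel_measurable M"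
    and A: "\<forall>V. frob d d V \<le> 1 / om \<longrightarrow>
       (let Z = (\<lambda>w i. \<Sum>k<d. inv_sqrt d Sig i k * X0 w k);
            f = (\<lambda>w. exp ((\<Sum>i<d. \<Sum>j<d. Z w i * V i j * Z w j) - (\<Sum>i<d. V i i)))
        in integrable M f \<and> ln (\<integral>w. f w \<partial>M) \<le> om^2 * (frob d d V)^2)"
    and V: "om^2 * quad {..<d} Sig V \<le> 1"
  shows "(\<integral>\<^sup>+w. ennreal (exp (\<Sum>i<d. \<Sum>j<d. (X0 w i * X0 w j - Sig i j) * V i j)) \<partial>M) \<le> ennreal (exp (om^2 * quad {..<d} Sig V))"
proof -
  interpret prob_space M by (rule M)
  obtain C where Cs: "\<forall>i<d. \<forall>j<d. C i j = C j i"
    and CB: "\<forall>i<d. \<forall>j<d. (\<Sum>k<d. C i k * inv_sqrt d Sig k j) = (if i = j then 1 else 0)"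
    and CC: "\<forall>i<d. \<forall>j<d. (\<Sum>k<d. C i k * C k j) = Sig i j"
    using inv_sqrt_factor[OF pd] by blast
  define U where "U = (\<lambda>s t. \<Sum>i<d. \<Sum>j<d. C s i * C j t * V i j)"
  have fr: "(frob d d U)^2 = quad {..<d} Sig V"
    unfolding quad_sqrt[OF Cs CC, symmetric] frob_def U_def by (simp add: sum_nonneg)
  have "frob d d U \<le> 1 / om"
  proof -
    have "(om * frob d d U)^2 \<le> 1^2" using V by (simp add: power_mult_distrib fr)
    then have "om * frob d d U \<le> 1" by (rule power2_le_imp_le) simp
    then show ?thesis using om by (simp add: field_simps)
  qed
  define Z where "Z = (\<lambda>w i. \<Sum>k<d. inv_sqrt d Sig i k * X0 w k)"
  define f where "f = (\<lambda>w. exp ((\<Sum>i<d. \<Sum>j<d. Z w i * U i j * Z w j) - (\<Sum>i<d. U i i)))"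
  have fi: "integrable M f" and fl: "ln (\<integral>w. f w \<partial>M) \<le> om^2 * quad {..<d} Sig V"
    using A[rule_format, OF \<open>frob d d U \<le> 1 / om\<close>] unfolding fr[symmetric] by (auto simp: Let_def Z_def f_def)
  have XZ: "X0 w i = (\<Sum>s<d. C s i * Z w s)" if "i < d" for w i
  proof -
    have "(\<Sum>s<d. C s i * Z w s) = (\<Sum>s<d. C i s * (\<Sum>k<d. inv_sqrt d Sig s k * X0 w k))"
      using Cs that by (auto simp: Z_def intro!: sum.cong)
    also have "\<dots> = (\<Sum>k<d. (\<Sum>s<d. C i s * inv_sqrt d Sig s k) * X0 w k)"
      by (rule matmul_assoc[symmetric])
    also have "\<dots> = (\<Sum>k<d. (if i = k then 1 else 0) * X0 w k)"
      using CB that by (intro sum.cong refl) auto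
    finally show ?thesis using that by (simp add: mult_ite cong: if_cong)
  qed
  have q: "(\<Sum>s<d. \<Sum>t<d. Z w s * U s t * Z w t) = (\<Sum>i<d. \<Sum>j<d. X0 w i * X0 w j * V i j)" for w
  proof -
    have "(\<Sum>s<d. \<Sum>t<d. Z w s * U s t * Z w t)
      = (\<Sum>s<d. \<Sum>t<d. \<Sum>i<d. \<Sum>j<d. V i j * (C s i * Z w s) * (C j t * Z w t))"
      unfolding U_def sum_distrib_left sum_distrib_right by (intro sum.cong refl) (simp add: algebra_simps)
    also have "\<dots> = (\<Sum>i<d. \<Sum>j<d. \<Sum>s<d. \<Sum>t<d. V i j * (C s i * Z w s) * (C j t * Z w t))"
      by (rule sum_swap22)
    also have "\<dots> = (\<Sum>i<d. \<Sum>j<d. V i j * (\<Sum>s<d. C s i * Z w s) * (\<Sum>t<d. C j t * Z w t))"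
      by (simp only: sum_prod_scale)
    also have "\<dots> = (\<Sum>i<d. \<Sum>j<d. X0 w i * X0 w j * V i j)"
    proof (intro sum.cong refl)
      fix i j assume "i \<in> {..<d}" "j \<in> {..<d}"
      then have "X0 w i = (\<Sum>s<d. C s i * Z w s)" "X0 w j = (\<Sum>t<d. C j t * Z w t)"
        using XZ[of i w] XZ[of j w] Cs by (auto intro!: sum.cong)
      then show "V i j * (\<Sum>s<d. C s i * Z w s) * (\<Sum>t<d. C j t * Z w t) = X0 w i * X0 w j * V i j"
        by (simp only: mult_ac)
    qed
    finally show ?thesis .
  qed
  have tr: "(\<Sum>s<d. U s s) = (\<Sum>i<d. \<Sum>j<d. Sig i j * V i j)"
  proof -
    have "(\<Sum>s<d. U s s) = (\<Sum>i<d. \<Sum>j<d. \<Sum>s<d. C s i * C j s * V i j)"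
      unfolding U_def by (rule sum_swap2[symmetric, of _ "{..<d}" "{..<d}" "{..<d}", THEN sym, THEN sym])
    also have "\<dots> = (\<Sum>i<d. \<Sum>j<d. Sig i j * V i j)"
    proof (intro sum.cong refl)
      fix i j assume ij: "i \<in> {..<d}" "j \<in> {..<d}"
      have "(\<Sum>s<d. C s i * C j s * V i j) = (\<Sum>s<d. C i s * C s j) * V i j"
        unfolding sum_distrib_right using Cs ij by (intro sum.cong refl) auto
      then show "(\<Sum>s<d. C s i * C j s * V i j) = Sig i j * V i j" using CC ij by simp
    qed
    finally show ?thesis .
  qed
  have feq: "exp (\<Sum>i<d. \<Sum>j<d. (X0 w i * X0 w j - Sig i j) * V i j) = f w" for w
    unfolding f_def q tr by (simp add: sum_subtractf left_diff_distrib)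
  have f0: "0 \<le> f w" for w by (simp add: f_def)
  have "(\<integral>\<^sup>+w. ennreal (f w) \<partial>M) = ennreal (\<integral>w. f w \<partial>M)"
    by (rule nn_integral_eq_integral[OF fi]) (simp add: f0)
  also have "\<dots> \<le> ennreal (exp (om^2 * quad {..<d} Sig V))"
  \<comment> \<open>Only a positive integral can be recovered from its logarithm; otherwise the
    bound is immediate.\<close>
  proof (rule ennreal_leI, cases "0 < (\<integral>w. f w \<partial>M)")
    case True
    have "exp (ln (\<integral>w. f w \<partial>M)) \<le> exp (om^2 * quad {..<d} Sig V)" using fl by simp
    then show "(\<integral>w. f w \<partial>M) \<le> exp (om^2 * quad {..<d} Sig V)" using True by simp
  next
    case False
    then show "(\<integral>w. f w \<partial>M) \<le> exp (om^2 * quad {..<d} Sig V)"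
      by (meson exp_ge_zero not_le order_trans less_imp_le)
  qed
  finally show ?thesis unfolding feq .
qed

text \<open>Index 0 is the generic copy of the vector and the sample is 1 to n. The exponential of
  the sum is a product of independent factors, each distributed like the factor built from copy
  0.\<close>

lemma mgf_iid:
  fixes X :: "nat \<Rightarrow> 'a \<Rightarrow> nat \<Rightarrow> real"
  assumes M: "prob_space M"
    and indep: "prob_space.indep_vars M (\<lambda>_. PiM {..<d} (\<lambda>_. borel)) (\<lambda>i w. restrict (X i w) {..<d}) {0..n}"
    and ident: "\<forall>i\<in>{1..n}. distr M (PiM {..<d} (\<lambda>_. borel)) (\<lambda>w. restrict (X i w) {..<d})
                           = distr M (PiM {..<d} (\<lambda>_. borel)) (\<lambda>w. restrict (X 0 w) {..<d})"
    and single: "(\<integral>\<^sup>+w. ennreal (exp (\<Sum>i<d. \<Sum>j<d. (X 0 w i * X 0 w j - Sig i j) * V i j)) \<partial>M) \<le> ennreal (exp c)"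
  shows "(\<integral>\<^sup>+w. ennreal (exp (\<Sum>i<d. \<Sum>j<d. (\<Sum>l=1..n. X l w i * X l w j - Sig i j) * V i j)) \<partial>M) \<le> ennreal (exp (real n * c))"
proof -
  interpret prob_space M by (rule M)
  define g where "g = (\<lambda>x::nat \<Rightarrow> real. ennreal (exp (\<Sum>i<d. \<Sum>j<d. (x i * x j - Sig i j) * V i j)))"
  have gm: "g \<in> borel_measurable (PiM {..<d} (\<lambda>_. borel))" unfolding g_def by measurable
  have gr: "g (restrict x {..<d}) = g x" for x 
  proof -
    have "(\<Sum>i<d. \<Sum>j<d. (restrict x {..<d} i * restrict x {..<d} j - Sig i j) * V i j)
       = (\<Sum>i<d. \<Sum>j<d. (x i * x j - Sig i j) * V i j)"
      by (intro sum.cong refl) auto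
    then show ?thesis by (simp only: g_def)
  qed
  have rv: "(\<lambda>w. restrict (X l w) {..<d}) \<in> measurable M (PiM {..<d} (\<lambda>_. borel))" if "l \<in> {0..n}" for l
    using indep that unfolding indep_vars_def by auto
  have ind: "indep_vars (\<lambda>_. borel) (\<lambda>l w. g (restrict (X l w) {..<d})) {1..n}"
  proof -
    have "indep_vars (\<lambda>_. PiM {..<d} (\<lambda>_. borel)) (\<lambda>i w. restrict (X i w) {..<d}) {1..n}"
      by (rule indep_vars_subset[OF indep]) auto
    from indep_vars_compose2[OF this, of "\<lambda>_. g" "\<lambda>_. borel"] gm show ?thesis by simp
  qed
  have each: "(\<integral>\<^sup>+w. g (restrict (X l w) {..<d}) \<partial>M) \<le> ennreal (exp c)" if l: "l \<in> {1..n}" for l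
  proof -
    have "(\<integral>\<^sup>+w. g (restrict (X l w) {..<d}) \<partial>M) = (\<integral>\<^sup>+x. g x \<partial>distr M (PiM {..<d} (\<lambda>_. borel)) (\<lambda>w. restrict (X l w) {..<d}))"
      using rv[of l] l gm by (subst nn_integral_distr) auto
    also have "\<dots> = (\<integral>\<^sup>+x. g x \<partial>distr M (PiM {..<d} (\<lambda>_. borel)) (\<lambda>w. restrict (X 0 w) {..<d}))"
      using ident l by simp
    also have "\<dots> = (\<integral>\<^sup>+w. g (restrict (X 0 w) {..<d}) \<partial>M)"
      using rv[of 0] gm by (subst nn_integral_distr) auto
    also have "\<dots> \<le> ennreal (exp c)" using single unfolding gr unfolding g_def .
    finally show ?thesis .
  qed
  have "(\<integral>\<^sup>+w. ennreal (exp (\<Sum>i<d. \<Sum>j<d. (\<Sum>l=1..n. X l w i * X l w j - Sig i j) * V i j)) \<partial>M)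
    = (\<integral>\<^sup>+w. (\<Prod>l\<in>{1..n}. g (restrict (X l w) {..<d})) \<partial>M)"
  proof (rule nn_integral_cong)
    fix w
    have "(\<Sum>i<d. \<Sum>j<d. (\<Sum>l=1..n. X l w i * X l w j - Sig i j) * V i j)
       = (\<Sum>l=1..n. \<Sum>i<d. \<Sum>j<d. (X l w i * X l w j - Sig i j) * V i j)"
      unfolding sum_distrib_right by (rule sum_swap2)
    then have "ennreal (exp (\<Sum>i<d. \<Sum>j<d. (\<Sum>l=1..n. X l w i * X l w j - Sig i j) * V i j))
      = ennreal (\<Prod>l\<in>{1..n}. exp (\<Sum>i<d. \<Sum>j<d. (X l w i * X l w j - Sig i j) * V i j))"
      by (simp only: exp_sum finite_atLeastAtMost)
    also have "\<dots> = (\<Prod>l\<in>{1..n}. ennreal (exp (\<Sum>i<d. \<Sum>j<d. (X l w i * X l w j - Sig i j) * V i j)))"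
      by (rule prod_ennreal[symmetric]) simp
    finally show "ennreal (exp (\<Sum>i<d. \<Sum>j<d. (\<Sum>l=1..n. X l w i * X l w j - Sig i j) * V i j))
      = (\<Prod>l\<in>{1..n}. g (restrict (X l w) {..<d}))"
      unfolding gr by (simp only: g_def)
  qed
  also have "\<dots> = (\<Prod>l\<in>{1..n}. \<integral>\<^sup>+w. g (restrict (X l w) {..<d}) \<partial>M)"
    by (rule indep_vars_nn_integral[OF _ ind]) auto
  also have "\<dots> \<le> (\<Prod>l\<in>{1..n}. ennreal (exp c))" by (intro prod_mono_ennreal each) 
  also have "\<dots> = ennreal (exp (real n * c))"
    by (simp add: ennreal_power exp_of_nat_mult)
  finally show ?thesis .
qed

section \<open>Kronecker indexing and the noise form\<close>

lemma kidx_bound: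
  assumes "a < p" "b < q" "c < r"
  shows "kidx q r a b c < p * q * r" "kidx q r a b c div (q * r) = a"
    "kidx q r a b c div r mod q = b" "kidx q r a b c mod r = c"
proof -
  have e: "b * r + c < q * r"
  proof -
    have "b * r + c < (b + 1) * r" using assms by simp
    also have "\<dots> \<le> q * r" using assms by (intro mult_right_mono) auto
    finally show ?thesis .
  qed
  have k: "kidx q r a b c = (b * r + c) + a * (q * r)" by (simp add: kidx_def algebra_simps)
  have "kidx q r a b c < (a + 1) * (q * r)" unfolding k using e by simp
  also have "\<dots> \<le> p * (q * r)" using assms by (intro mult_right_mono) auto
  finally show "kidx q r a b c < p * q * r" by (simp add: mult.assoc)
  show "kidx q r a b c div (q * r) = a" unfolding k using e assms by simp
  have k2: "kidx q r a b c = c + (a * q + b) * r" by (simp add: kidx_def algebra_simps)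
  show "kidx q r a b c mod r = c" unfolding k2 using assms by simp
  have "kidx q r a b c div r = b + a * q" unfolding k2 using assms by simp
  then show "kidx q r a b c div r mod q = b" using assms by simp
qed

lemma kidx_bij: "bij_betw (\<lambda>(a, b, c). kidx q r a b c) ({..<p} \<times> {..<q} \<times> {..<r}) {..<p * q * r}"
proof (rule bij_betwI[where g="\<lambda>i. (i div (q * r), (i div r) mod q, i mod r)"])
  show "(\<lambda>(a, b, c). kidx q r a b c) \<in> {..<p} \<times> {..<q} \<times> {..<r} \<rightarrow> {..<p * q * r}"
    using kidx_bound(1) by auto
  show "(\<lambda>i. (i div (q * r), i div r mod q, i mod r)) \<in> {..<p * q * r} \<rightarrow> {..<p} \<times> {..<q} \<times> {..<r}"
  proof
    fix i assume i: "i \<in> {..<p * q * r}"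
    then have "0 < p * q * r" by (metis lessThan_iff not_gr_zero not_less0)
    then have "0 < q" "0 < r" by auto
    moreover have "i div (q * r) < p" using i by (simp add: less_mult_imp_div_less mult.assoc)
    ultimately show "(i div (q * r), i div r mod q, i mod r) \<in> {..<p} \<times> {..<q} \<times> {..<r}" by simp
  qed
  show "(case (case x of (a, b, c) \<Rightarrow> kidx q r a b c) of i \<Rightarrow> (i div (q * r), i div r mod q, i mod r)) = x"
    if "x \<in> {..<p} \<times> {..<q} \<times> {..<r}" for x
    using that kidx_bound by auto
  show "(case (i div (q * r), i div r mod q, i mod r) of (a, b, c) \<Rightarrow> kidx q r a b c) = i"
    if "i \<in> {..<p * q * r}" for i
  proof -
    have "i div (q * r) = i div r div q" by (metis div_mult2_eq mult.commute)
    then have "i div (q * r) * q + i div r mod q = i div r" by simp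
    then have "(i div (q * r) * q + i div r mod q) * r + i mod r = i" by simp
    then show ?thesis by (simp add: kidx_def algebra_simps)
  qed
qed

context tri
begin

text \<open>The two pairs of rank indices are glued by Kronecker deltas, so that the form with these
  coefficients pairs the matrix R with the weight \<open>V\<close>, see
  \<open>tl_cf\<close>.\<close>

definition cf :: "(nat \<times> nat \<times> nat \<Rightarrow> nat \<times> nat \<times> nat \<Rightarrow> real) \<Rightarrow> nat \<times> nat \<times> nat \<Rightarrow> nat \<times> nat \<times> nat \<times> nat \<Rightarrow> nat \<times> nat \<times> nat \<Rightarrow> real" where
  "cf R = (\<lambda>(a, a', j) (j', b, b', k) (c, c', k'). if j = j' \<and> k = k' then R (a, b, c) (a', b', c') else 0)"

lemma tl_cf: "tl I1 I2 I3 (cf R) x y z = (\<Sum>m\<in>D. \<Sum>n\<in>D. R m n * V x y z m n)"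
proof -
  define T where "T = (\<lambda>j k a a' b b' c c'. R (a, b, c) (a', b', c') * x (a, a', j) * y (j, b, b', k) * z (c, c', k))"
  have in3: "(\<Sum>i3\<in>I3. cf R (a, a', j) (j', b, b', k) i3 * x (a, a', j) * y (j', b, b', k) * z i3)
     = (if j' = j then \<Sum>c<r. \<Sum>c'<r. T j k a a' b b' c c' else 0)" if "k < K" for a a' j j' b b' k
  proof -
    have "(\<Sum>i3\<in>I3. cf R (a, a', j) (j', b, b', k) i3 * x (a, a', j) * y (j', b, b', k) * z i3)
      = (\<Sum>k'<K. if k' = k then (if j' = j then \<Sum>c<r. \<Sum>c'<r. T j k a a' b b' c c' else 0) else 0)"
      unfolding sum_I3 by (intro sum.cong refl) (auto simp: cf_def T_def)
    then show ?thesis using that by simp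
  qed
  have in2: "(\<Sum>i2\<in>I2. \<Sum>i3\<in>I3. cf R (a, a', j) i2 i3 * x (a, a', j) * y i2 * z i3)
     = (\<Sum>k<K. \<Sum>b<q. \<Sum>b'<q. \<Sum>c<r. \<Sum>c'<r. T j k a a' b b' c c')" if "j < J" for a a' j
  proof -
    have "(\<Sum>i2\<in>I2. \<Sum>i3\<in>I3. cf R (a, a', j) i2 i3 * x (a, a', j) * y i2 * z i3)
      = (\<Sum>j'<J. if j' = j then (\<Sum>k<K. \<Sum>b<q. \<Sum>b'<q. \<Sum>c<r. \<Sum>c'<r. T j k a a' b b' c c') else 0)"
      unfolding sum_I2 by (intro sum.cong refl) (auto simp: in3)
    then show ?thesis using that by simp
  qed
  have "tl I1 I2 I3 (cf R) x y z = (\<Sum>j<J. \<Sum>a<p. \<Sum>a'<p. \<Sum>k<K. \<Sum>b<q. \<Sum>b'<q. \<Sum>c<r. \<Sum>c'<r. T j k a a' b b' c c')"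
    unfolding tl_def sum_I1 by (intro sum.cong refl) (simp add: in2)
  also have "\<dots> = (\<Sum>j<J. \<Sum>k<K. \<Sum>a<p. \<Sum>a'<p. \<Sum>b<q. \<Sum>b'<q. \<Sum>c<r. \<Sum>c'<r. T j k a a' b b' c c')"
    by (rule sum.cong[OF refl], rule sum_swap2)
  also have "\<dots> = (\<Sum>a<p. \<Sum>a'<p. \<Sum>j<J. \<Sum>k<K. \<Sum>b<q. \<Sum>b'<q. \<Sum>c<r. \<Sum>c'<r. T j k a a' b b' c c')"
    by (rule sum_swap22)
  also have "\<dots> = (\<Sum>a<p. \<Sum>a'<p. \<Sum>b<q. \<Sum>b'<q. \<Sum>j<J. \<Sum>k<K. \<Sum>c<r. \<Sum>c'<r. T j k a a' b b' c c')"
    by (rule sum.cong[OF refl], rule sum.cong[OF refl], rule sum_swap22)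
  also have "\<dots> = (\<Sum>a<p. \<Sum>a'<p. \<Sum>b<q. \<Sum>b'<q. \<Sum>c<r. \<Sum>c'<r. \<Sum>j<J. \<Sum>k<K. T j k a a' b b' c c')"
    by (rule sum.cong[OF refl], rule sum.cong[OF refl], rule sum.cong[OF refl], rule sum.cong[OF refl], rule sum_swap22)
  also have "\<dots> = (\<Sum>a<p. \<Sum>a'<p. \<Sum>b<q. \<Sum>b'<q. \<Sum>c<r. \<Sum>c'<r. R (a, b, c) (a', b', c') * V x y z (a, b, c) (a', b', c'))"
    by (simp add: V_def T_def sum_distrib_left mult.assoc)
  also have "\<dots> = (\<Sum>m\<in>D. \<Sum>n\<in>D. R m n * V x y z m n)"
    unfolding D_def
    by (subst sum_pairs, rule sum.cong[OF refl], rule sum.cong[OF refl], rule sum_pairs[symmetric])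
  finally show ?thesis .
qed

end

text \<open>Row (a, a') of the first family is row a p + a' of a matrix acting on the first mode of the
  rearranged tensor, and similarly for the other two.\<close>

definition trilinear_le :: "nat \<Rightarrow> nat \<Rightarrow> nat \<Rightarrow> nat \<Rightarrow> nat \<Rightarrow> mat \<Rightarrow> real \<Rightarrow> bool" where
  "trilinear_le p q r J K A B \<longleftrightarrow> (\<forall>x y z.
     (\<forall>f. (\<Sum>a<p. \<Sum>a'<p. (\<Sum>j<J. x (a, a', j) * f j)^2) \<le> (\<Sum>j<J. (f j)^2)) \<longrightarrow>
     (\<forall>f. (\<Sum>c<r. \<Sum>c'<r. (\<Sum>k<K. z (c, c', k) * f k)^2) \<le> (\<Sum>k<K. (f k)^2)) \<longrightarrow>
     (\<Sum>j<J. \<Sum>k<K. \<Sum>b<q. \<Sum>b'<q. (y (j, b, b', k))^2) \<le> 1 \<longrightarrow>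
     (\<Sum>(a, b, c)\<in>tri.D p q r. \<Sum>(a', b', c')\<in>tri.D p q r. A (kidx q r a b c) (kidx q r a' b' c') * tri.V J K x y z (a, b, c) (a', b', c')) \<le> B)"

text \<open>\<open>pac_bayes\<close> for the centred covariance. Centres are scaled by r1, t, r3 and
  coefficients by e = 1 / (r1 t r3), so the averaged quadratic form is at most 8 s^2 while the form
  at the scaled centre is lam times the one to be bounded.\<close>

lemma noise_bound:
  fixes p q r J K n :: nat and Q :: "'a \<Rightarrow> mat" and Sig :: mat
  defines "d \<equiv> p * q * r"
    and "S \<equiv> (\<lambda>(a, b, c) (a', b', c'). Sig (kidx q r a b c) (kidx q r a' b' c'))"
  assumes M: "prob_space M" and pos: "0 < J" "0 < K" "0 < n" "0 < om" "0 < s" "0 < r1" "0 < r2" "0 < r3" "0 < delta"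
    and Qm: "\<And>i j. i < d \<Longrightarrow> j < d \<Longrightarrow> (\<lambda>w. Q w i j) \<in> borel_measurable M"
    and sym: "sym_pd d Sig"
    and H: "\<And>V. om^2 * quad {..<d} Sig V \<le> 1 \<Longrightarrow>
      (\<integral>\<^sup>+w. ennreal (exp (\<Sum>i<d. \<Sum>j<d. Q w i j * V i j)) \<partial>M) \<le> ennreal (exp (real n * (om^2 * quad {..<d} Sig V)))"
    and nS: "opnorm (tri.D p q r) (tri.D p q r) S \<le> s"
    and n1: "opnorm ({..<q} \<times> {..<r}) ({..<q} \<times> {..<r}) (tri.S1 p S) \<le> r1 * s"
    and n2: "opnorm ({..<p} \<times> {..<r}) ({..<p} \<times> {..<r}) (tri.S2 q S) \<le> r2 * s"
    and n3: "opnorm ({..<p} \<times> {..<q}) ({..<p} \<times> {..<q}) (tri.S3 r S) \<le> r3 * s"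
    and n12: "opnorm {..<r} {..<r} (tri.S12 p q S) \<le> r1 * r2 * s"
    and n13: "opnorm {..<q} {..<q} (tri.S13 p r S) \<le> r1 * r3 * s"
    and n23: "opnorm {..<p} {..<p} (tri.S23 q r S) \<le> r2 * r3 * s"
    and n123: "\<bar>tri.S123 p q r S\<bar> \<le> r1 * r2 * r3 * s"
    and R: "R = (real J * r1^2 + real J * real K * r2^2 + real K * r3^2) / 2 + ln (2 / delta)" "0 < R" "R \<le> real n"
  shows "\<exists>A\<in>sets M. measure M A \<ge> 1 - delta \<and> (\<forall>w\<in>A. trilinear_le p q r J K (Q w) (real n * (40 / 3 * om * s * sqrt (R / real n))))"
proof -
  interpret tri p q r J K S .
  interpret gauss3 I1 I2 I3 by unfold_locales (simp_all add: finI)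
  define k where "k = (\<lambda>(a, b, c). kidx q r a b c)"
  have kb: "bij_betw k D {..<d}" unfolding k_def D_def d_def by (rule kidx_bij)
  define kin where "kin = inv_into D k"
  have kin: "kin (k m) = m" if "m \<in> D" for m
    unfolding kin_def by (rule inv_into_f_f) (use kb that in \<open>auto simp: bij_betw_def\<close>)
  have kd: "k m < d" if "m \<in> D" for m using kb that by (auto simp: bij_betw_def)
  have Sk: "S m n = Sig (k m) (k n)" for m n by (cases m; cases n) (simp add: S_def k_def)
  have reidx: "(\<Sum>i<d. \<Sum>j<d. F i j) = (\<Sum>m\<in>D. \<Sum>n\<in>D. F (k m) (k n))" for F :: "nat \<Rightarrow> nat \<Rightarrow> real"
    by (simp only: sum.reindex_bij_betw[OF kb, symmetric])
  have quadk: "quad {..<d} Sig U = quad D S (\<lambda>m n. U (k m) (k n))" for U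
    unfolding quad_reindex[OF kb] Sk ..
  obtain C where Cs: "\<forall>i<d. \<forall>j<d. C i j = C j i" and CC: "\<forall>i<d. \<forall>j<d. (\<Sum>k<d. C i k * C k j) = Sig i j"
    using inv_sqrt_factor[OF sym] by blast
  define t where "t = sqrt (real J * real K) * r2"
  have t0: "0 < t" using pos by (simp add: t_def)
  have t2: "t^2 = real J * real K * r2^2" by (simp add: t_def power_mult_distrib)
  define e where "e = 1 / (r1 * t * r3)"
  \<comment> \<open>Balancing 16 n (lam om s)^2 against R would put 4 in place of 12; the constraint
    128 (lam om s)^2 <= 1 with R <= n asks for at least sqrt 128, which is just below 12.\<close>
  define lam where "lam = sqrt (R / real n) / (12 * om * s)"
  have lam0: "0 < lam" using R pos by (simp add: lam_def)
  define E where "E = (\<lambda>w. cf (\<lambda>m n. lam * e * Q w (k m) (k n)))"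
  \<comment> \<open>Writes the quadratic form as a finite sum of squares of trilinear forms, the
    shape required by \<open>pac_bayes\<close>: one form for each entry (s, t) of C V C.\<close>
  define W where "W = (\<lambda>(s, t). cf (\<lambda>m n. e * (C s (k m) * C (k n) t)))"
  define Ix where "Ix = {..<d} \<times> {..<d}"
  have WPsi: "(\<Sum>i\<in>Ix. (T (W i) x y z)^2) = e^2 * Psi x y z" for x y z
  proof -
    let ?U = "\<lambda>i j. V x y z (kin i) (kin j)"
    have "(\<Sum>i\<in>Ix. (T (W i) x y z)^2) = (\<Sum>s<d. \<Sum>t<d. (\<Sum>i<d. \<Sum>j<d. C s i * C j t * (e * ?U i j))^2)"
      unfolding Ix_def sum.cartesian_product'
    proof (intro sum.cong refl arg_cong[where f="\<lambda>u. u^2"])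
      fix s t
      show "T (W (s, t)) x y z = (\<Sum>i<d. \<Sum>j<d. C s i * C j t * (e * ?U i j))"
        unfolding W_def prod.case tl_cf reidx by (intro sum.cong refl) (simp add: kin)
    qed
    also have "\<dots> = quad {..<d} Sig (\<lambda>i j. e * ?U i j)" by (rule quad_sqrt[OF Cs CC])
    also have "\<dots> = e^2 * quad D S (V x y z)"
      unfolding quad_scale quadk by (intro arg_cong2[where f="(*)"] refl quad_cong) (simp_all add: kin)
    finally show ?thesis by (simp add: Psi_def)
  qed
  have "\<exists>A\<in>sets M. measure M A \<ge> 1 - delta \<and> (\<forall>w\<in>A. \<forall>x y z.
    (\<Sum>i\<in>Ix. \<Sum>u\<in>opt I1. \<Sum>v\<in>opt I2. \<Sum>w\<in>opt I3. (T (W i) (pk x u) (pk y v) (pk z w))^2) \<le> 8 * s^2 \<longrightarrow>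
    T (E w) x y z \<le> 16 * (real n * (lam * om)^2) * s^2 + ((\<Sum>i\<in>I1. (x i)^2) + (\<Sum>i\<in>I2. (y i)^2) + (\<Sum>i\<in>I3. (z i)^2)) / 2 + ln (2 / delta))"
  proof (rule pac_bayes[OF M, where kap="(lam * om)^2"])
    fix i j l assume ijl: "i \<in> I1" "j \<in> I2" "l \<in> I3"
    obtain a a' j1 j' b b' k1 c c' k' where eq: "i = (a, a', j1)" "j = (j', b, b', k1)" "l = (c, c', k')"
      by (cases i; cases j; cases l) auto
    have D: "(a, b, c) \<in> D" "(a', b', c') \<in> D" using ijl unfolding eq by (auto simp: I1_def I2_def I3_def D_def)
    have "(\<lambda>w. lam * e * Q w (k (a, b, c)) (k (a', b', c'))) \<in> borel_measurable M"
      using Qm[OF kd[OF D(1)] kd[OF D(2)]] by simp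
    then show "(\<lambda>w. E w i j l) \<in> borel_measurable M" by (simp add: E_def cf_def eq)
  next
    fix x y z assume le: "(lam * om)^2 * (\<Sum>i\<in>Ix. (T (W i) x y z)^2) \<le> 1"
    let ?U = "\<lambda>i j. (lam * e) * V x y z (kin i) (kin j)"
    have qU: "quad {..<d} Sig ?U = lam^2 * (\<Sum>i\<in>Ix. (T (W i) x y z)^2)"
      unfolding quad_scale quadk WPsi Psi_def power_mult_distrib mult.assoc
      by (intro arg_cong2[where f="(*)"] refl quad_cong) (simp_all add: kin)
    have TE: "T (E w) x y z = (\<Sum>i<d. \<Sum>j<d. Q w i j * ?U i j)" for w
      unfolding E_def tl_cf reidx by (intro sum.cong refl) (simp add: kin)
    have "om^2 * quad {..<d} Sig ?U \<le> 1" using le unfolding qU by (simp add: power_mult_distrib mult_ac)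
    from H[OF this] show "(\<integral>\<^sup>+w. ennreal (exp (T (E w) x y z)) \<partial>M) \<le>
        ennreal (exp (real n * (lam * om)^2 * (\<Sum>i\<in>Ix. (T (W i) x y z)^2)))"
      unfolding TE qU by (simp add: power_mult_distrib mult_ac)
  next
    have "lam * om * s = sqrt (R / real n) / 12" using pos by (simp add: lam_def)
    then have "(lam * om)^2 * s^2 = (sqrt (R / real n) / 12)^2"
      unfolding power_mult_distrib[symmetric] by (simp only:)
    moreover have "0 \<le> R / real n" using R(2) pos by simp
    then have "(sqrt (R / real n) / 12)^2 = (R / real n) / 144"
      by (simp add: power_divide)
    ultimately have "(lam * om)^2 * s^2 = (R / real n) / 144" by simp
    moreover have "R / real n \<le> 1" using R pos by (simp add: divide_le_eq)
    ultimately show "128 * (lam * om)^2 * s^2 \<le> 1" by simp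
  qed (use pos in auto)
  then obtain A where A: "A \<in> sets M" "measure M A \<ge> 1 - delta"
    and bd: "\<And>w x y z. w \<in> A \<Longrightarrow>
      (\<Sum>i\<in>Ix. \<Sum>u\<in>opt I1. \<Sum>v\<in>opt I2. \<Sum>w\<in>opt I3. (T (W i) (pk x u) (pk y v) (pk z w))^2) \<le> 8 * s^2 \<Longrightarrow>
      T (E w) x y z \<le> 16 * (real n * (lam * om)^2) * s^2 + ((\<Sum>i\<in>I1. (x i)^2) + (\<Sum>i\<in>I2. (y i)^2) + (\<Sum>i\<in>I3. (z i)^2)) / 2 + ln (2 / delta)"
    by blast
  have main: "(\<Sum>m\<in>D. \<Sum>n\<in>D. Q w (k m) (k n) * V x y z m n) \<le> real n * (40 / 3 * om * s * sqrt (R / real n))"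
    if w: "w \<in> A" and xc: "\<And>f. (\<Sum>a<p. \<Sum>a'<p. (\<Sum>j<J. x (a, a', j) * f j)^2) \<le> (\<Sum>j<J. (f j)^2)"
      and zc: "\<And>f. (\<Sum>c<r. \<Sum>c'<r. (\<Sum>k<K. z (c, c', k) * f k)^2) \<le> (\<Sum>k<K. (f k)^2)"
      and y1: "(\<Sum>j<J. \<Sum>k<K. \<Sum>b<q. \<Sum>b'<q. (y (j, b, b', k))^2) \<le> 1" for w x y z
  proof -
    let ?x = "\<lambda>i. r1 * x i" and ?y = "\<lambda>i. t * y i" and ?z = "\<lambda>i. r3 * z i"
    have "(\<Sum>i\<in>Ix. \<Sum>u\<in>opt I1. \<Sum>v\<in>opt I2. \<Sum>w\<in>opt I3. (T (W i) (pk ?x u) (pk ?y v) (pk ?z w))^2)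
      = (\<Sum>u\<in>opt I1. \<Sum>v\<in>opt I2. \<Sum>w\<in>opt I3. \<Sum>i\<in>Ix. (T (W i) (pk ?x u) (pk ?y v) (pk ?z w))^2)"
      by (simp only: sum.swap[of _ _ Ix])
    also have "\<dots> = e^2 * (\<Sum>u\<in>opt I1. \<Sum>v\<in>opt I2. \<Sum>w\<in>opt I3. Psi (pk ?x u) (pk ?y v) (pk ?z w))"
      unfolding WPsi by (simp only: sum_distrib_left)
    also have "\<dots> \<le> e^2 * (8 * ((r1 * t * r3)^2 * s^2))"
      by (intro mult_left_mono moment_bound[OF xc zc y1 nS n1 n2 n3 n12 n13 n23 n123 t2]) simp
    also have "\<dots> = 8 * s^2" using pos t0 by (simp add: e_def power_divide)
    finally have "(\<Sum>i\<in>Ix. \<Sum>u\<in>opt I1. \<Sum>v\<in>opt I2. \<Sum>w\<in>opt I3. (T (W i) (pk ?x u) (pk ?y v) (pk ?z w))^2) \<le> 8 * s^2" .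
    from bd[OF w this]
    have b1: "T (E w) ?x ?y ?z \<le> 16 * (real n * (lam * om)^2) * s^2
        + ((\<Sum>i\<in>I1. (?x i)^2) + (\<Sum>i\<in>I2. (?y i)^2) + (\<Sum>i\<in>I3. (?z i)^2)) / 2 + ln (2 / delta)" .
    have x1: "(\<Sum>a<p. \<Sum>a'<p. (x (a, a', j))^2) \<le> 1" if "j < J" for j
      using xc[of "\<lambda>l. if l = j then 1 else 0"] that by (simp add: mult_ite if_distrib[where f="\<lambda>x. x^2"] cong: if_cong)
    have z1: "(\<Sum>c<r. \<Sum>c'<r. (z (c, c', k))^2) \<le> 1" if "k < K" for k
      using zc[of "\<lambda>l. if l = k then 1 else 0"] that by (simp add: mult_ite if_distrib[where f="\<lambda>x. x^2"] cong: if_cong)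
    have "(\<Sum>i\<in>I1. (?x i)^2) = r1^2 * (\<Sum>j<J. \<Sum>a<p. \<Sum>a'<p. (x (a, a', j))^2)"
      unfolding sum_I1 by (simp add: power_mult_distrib sum_distrib_left)
    also have "\<dots> \<le> r1^2 * (\<Sum>j<J. 1)" by (intro mult_left_mono sum_mono x1) auto
    finally have bx: "(\<Sum>i\<in>I1. (?x i)^2) \<le> real J * r1^2" by (simp add: mult.commute)
    have "(\<Sum>i\<in>I3. (?z i)^2) = r3^2 * (\<Sum>k<K. \<Sum>c<r. \<Sum>c'<r. (z (c, c', k))^2)"
      unfolding sum_I3 by (simp add: power_mult_distrib sum_distrib_left)
    also have "\<dots> \<le> r3^2 * (\<Sum>k<K. 1)" by (intro mult_left_mono sum_mono z1) auto
    finally have bz: "(\<Sum>i\<in>I3. (?z i)^2) \<le> real K * r3^2" by (simp add: mult.commute)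
    have "(\<Sum>i\<in>I2. (?y i)^2) = t^2 * (\<Sum>j<J. \<Sum>k<K. \<Sum>b<q. \<Sum>b'<q. (y (j, b, b', k))^2)"
      unfolding sum_I2 by (simp add: power_mult_distrib sum_distrib_left)
    also have "\<dots> \<le> t^2 * 1" by (intro mult_left_mono y1) simp
    finally have bY: "(\<Sum>i\<in>I2. (?y i)^2) \<le> real J * real K * r2^2" by (simp add: t2)
    have VV: "V ?x ?y ?z m n = (r1 * t * r3) * V x y z m n" for m n
      by (cases m; cases n) (simp add: V_def sum_distrib_left algebra_simps)
    have "T (E w) ?x ?y ?z = lam * (\<Sum>m\<in>D. \<Sum>n\<in>D. Q w (k m) (k n) * V x y z m n)"
      unfolding E_def tl_cf VV sum_distrib_left using pos t0
      by (intro sum.cong refl) (simp add: e_def)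
    then have "lam * (\<Sum>m\<in>D. \<Sum>n\<in>D. Q w (k m) (k n) * V x y z m n) \<le> 16 * (real n * (lam * om)^2) * s^2 + R"
    proof -
      have "v \<le> g + ((x' + y' + z') / 2 + l)"
        if "u = v" "u \<le> g + (x + y + z) / 2 + l" "x \<le> x'" "y \<le> y'" "z \<le> z'"
        for u v g x y z x' y' z' l :: real using that by argo
      from this[OF _ b1 bx bY bz] show "T (E w) ?x ?y ?z = lam * (\<Sum>m\<in>D. \<Sum>n\<in>D. Q w (k m) (k n) * V x y z m n) \<Longrightarrow> ?thesis"
        unfolding R(1) .
    qed
    \<comment> \<open>16 n (lam om s)^2 = 16 R / 144 = R / 9, and dividing 10 R / 9 by lam yields
      the constant 40 / 3.\<close>
    also have "\<dots> = lam * (real n * (40 / 3 * om * s * sqrt (R / real n)))"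
    proof -
      have l: "lam * (om * s) = sqrt (R / real n) / 12" using pos by (simp add: lam_def)
      have sq: "sqrt (R / real n) * sqrt (R / real n) = R / real n" using R pos by simp
      have "(lam * om)^2 * s^2 = (lam * (om * s)) * (lam * (om * s))" by (simp add: power2_eq_square mult_ac)
      also have "\<dots> = (sqrt (R / real n) * sqrt (R / real n)) / 144" unfolding l by simp
      also have "\<dots> = (R / real n) / 144" unfolding sq ..
      finally have a: "16 * (real n * (lam * om)^2) * s^2 = R / 9" using pos by simp
      have "lam * (real n * (40 / 3 * om * s * sqrt (R / real n)))
        = real n * (40 / 3) * (lam * (om * s)) * sqrt (R / real n)" by (simp add: mult_ac)
      also have "\<dots> = real n * (40 / 36) * (sqrt (R / real n) * sqrt (R / real n))" unfolding l by simp
      also have "\<dots> = 10 / 9 * R" unfolding sq using pos by simp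
      finally have e: "lam * (real n * (40 / 3 * om * s * sqrt (R / real n))) = 10 / 9 * R" .
      show ?thesis unfolding a e by simp
    qed
    finally show ?thesis using lam0 by simp
  qed
  show ?thesis
    using A main unfolding k_def trilinear_le_def
    by (intro bexI[of _ A] conjI ballI allI impI) (auto simp: case_prod_unfold)
qed

section \<open>One half-step of the iteration\<close>

definition resid :: "nat \<Rightarrow> nat \<Rightarrow> mat \<Rightarrow> mat \<Rightarrow> mat" where
  "resid m k U Us = (\<lambda>i l. Us i l - proj m k U (\<lambda>i. Us i l) i)"

text \<open>Frobenius norm of (I - U U^T) Us B, the part of the signal Us B that the span of
  \<open>U\<close> misses, computed row by row.\<close>

definition gap :: "'c set \<Rightarrow> nat \<Rightarrow> nat \<Rightarrow> mat \<Rightarrow> mat \<Rightarrow> (nat \<Rightarrow> 'c \<Rightarrow> real) \<Rightarrow> real" where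
  "gap C m k U Us B = sqrt (\<Sum>i<m. (vnorm C (tmv {..<k} B (resid m k U Us i)))^2)"

lemma gap_nonneg [simp]: "0 \<le> gap C m k U Us B"
  by (simp add: gap_def sum_nonneg)

lemma gap_sq: "(gap C m k U Us B)^2 = (\<Sum>i<m. (vnorm C (tmv {..<k} B (resid m k U Us i)))^2)"
  by (simp add: gap_def sum_nonneg)

lemma proj_mv: "proj m k U (mv {..<k'} F y) i = (\<Sum>l<k'. y l * proj m k U (\<lambda>i. F i l) i)"
  unfolding proj_def tmv_mv unfolding mv_def sum_distrib_left
  by (subst sum.swap) (simp add: algebra_simps)

lemma mv_resid: "mv {..<k} (resid m k U Us) y i = mv {..<k} Us y i - proj m k U (mv {..<k} Us y) i"
  unfolding proj_mv by (simp add: mv_def resid_def sum_subtractf[symmetric] algebra_simps)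

text \<open>Left singular vectors ignore the order of the columns, so flattened unfoldings may be
  exchanged for pair-indexed ones.\<close>

lemma lead_reindex:
  assumes f: "bij_betw f C' C" and L: "lead C' m (\<lambda>i j. A i (f j)) k U"
  shows "lead C m A k U"
proof -
  have t: "tmv {..<m} (\<lambda>i j. A i (f j)) z = (\<lambda>j. tmv {..<m} A z (f j))" for z
    by (simp add: tmv_def)
  have "mv C' (\<lambda>i j. A i (f j)) (\<lambda>j. g (f j)) i = mv C A g i" for g i
    unfolding mv_def by (rule sum.reindex_bij_betw[OF f])
  moreover have "vnorm C' (\<lambda>j. g (f j)) = vnorm C g" for g
    unfolding vnorm_def by (rule arg_cong[where f=sqrt], rule sum.reindex_bij_betw[OF f])
  ultimately show ?thesis using L unfolding lead_def t by simp
qed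

text \<open>A vector z orthogonal to the new subspace has |M^T z| <= e |z| by
  \<open>lead_spectral\<close> and |E^T z| <= e |z|, so the signal is at most 2 e |z| there. The
  constant c measures the loss by contraction with V, and s the least singular value of the
  core.\<close>

lemma step_spectral:
  assumes L: "lead C' m M k U" and M: "\<And>i j. i < m \<Longrightarrow> j \<in> C' \<Longrightarrow> M i j = (\<Sum>l<k. Us i l * B' l j) + E i j"
    and e: "\<And>w. vnorm C' (tmv {..<m} E w) \<le> e * vnorm {..<m} w" "0 \<le> e"
    and c: "\<And>r. c * vnorm C (tmv {..<k} B r) \<le> vnorm C' (tmv {..<k} B' r)" "0 \<le> c"
    and s: "\<And>r. s * vnorm {..<k} r \<le> vnorm C (tmv {..<k} B r)"
    and z: "\<forall>l<k. dot {..<m} (\<lambda>i. U i l) z = 0"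
  shows "c * s * vnorm {..<k} (tmv {..<m} Us z) \<le> 2 * e * vnorm {..<m} z"
proof -
  have Mz: "vnorm C' (tmv {..<m} M z) \<le> e * vnorm {..<m} z" by (rule lead_spectral[OF L M e z])
  have B': "tmv {..<k} B' (tmv {..<m} Us z) j = tmv {..<m} M z j - tmv {..<m} E z j" if "j \<in> C'" for j
  proof -
    have "tmv {..<m} M z j = (\<Sum>i<m. (\<Sum>l<k. Us i l * B' l j) * z i) + tmv {..<m} E z j"
      using M that by (simp add: tmv_def sum.distrib[symmetric] algebra_simps)
    also have "(\<Sum>i<m. (\<Sum>l<k. Us i l * B' l j) * z i) = tmv {..<k} B' (tmv {..<m} Us z) j"
      unfolding tmv_def sum_distrib_left sum_distrib_right
      by (subst sum.swap) (simp add: algebra_simps)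
    finally show ?thesis by simp
  qed
  have "c * (s * vnorm {..<k} (tmv {..<m} Us z)) \<le> c * vnorm C (tmv {..<k} B (tmv {..<m} Us z))"
    by (rule mult_left_mono[OF s c(2)])
  also have "\<dots> \<le> vnorm C' (tmv {..<k} B' (tmv {..<m} Us z))" by (rule c(1))
  also have "\<dots> = vnorm C' (\<lambda>j. tmv {..<m} M z j - tmv {..<m} E z j)" using B' by (rule vnorm_cong)
  also have "\<dots> \<le> vnorm C' (tmv {..<m} M z) + vnorm C' (tmv {..<m} E z)" by (rule vnorm_diff)
  also have "\<dots> \<le> 2 * e * vnorm {..<m} z" using Mz e(1)[of z] by simp
  finally show ?thesis by (simp add: mult.assoc)
qed

lemma step_frobenius:
  assumes L: "lead C' m M k U" and Us: "orth m k Us"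
    and M: "\<And>i j. i < m \<Longrightarrow> j \<in> C' \<Longrightarrow> M i j = (\<Sum>l<k. Us i l * B' l j) + E i j"
    and e: "\<And>Q. sub_orth m k Q \<Longrightarrow> (\<Sum>j\<in>C'. (vnorm {..<k} (tmv {..<m} Q (\<lambda>i. E i j)))^2) \<le> e^2" "0 \<le> e"
    and c: "\<And>r. c * vnorm C (tmv {..<k} B r) \<le> vnorm C' (tmv {..<k} B' r)" "0 \<le> c"
  shows "c * gap C m k U Us B \<le> 2 * e"
proof (rule power2_le_imp_le)
  define A where "A = (\<lambda>j. mv {..<k} Us (\<lambda>l. B' l j))"
  have "(\<Sum>j\<in>C'. (vnorm {..<m} (\<lambda>i. A j i - proj m k U (A j) i))^2) \<le> (2 * e)^2"
    by (rule lead_frobenius[OF L Us M e]) (simp_all add: A_def)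
  moreover have "A j i - proj m k U (A j) i = tmv {..<k} B' (resid m k U Us i) j" for i j
    unfolding A_def mv_resid[symmetric] by (simp add: mv_def tmv_def mult.commute)
  ultimately have "(\<Sum>j\<in>C'. \<Sum>i<m. (tmv {..<k} B' (resid m k U Us i) j)^2) \<le> (2 * e)^2"
    by (simp add: vnorm_sq)
  then have 1: "(\<Sum>i<m. (vnorm C' (tmv {..<k} B' (resid m k U Us i)))^2) \<le> (2 * e)^2"
    unfolding vnorm_sq by (subst (asm) sum.swap)
  have "(c * gap C m k U Us B)^2 = (\<Sum>i<m. (c * vnorm C (tmv {..<k} B (resid m k U Us i)))^2)"
    by (simp add: power_mult_distrib gap_sq sum_distrib_left)
  also have "\<dots> \<le> (\<Sum>i<m. (vnorm C' (tmv {..<k} B' (resid m k U Us i)))^2)"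
    by (intro sum_mono power_mono c) (simp add: c)
  finally show "(c * gap C m k U Us B)^2 \<le> (2 * e)^2" using 1 by linarith
qed (simp add: e)

text \<open>Frobenius sine distance of two k-dimensional subspaces; for frames its square is k -
  |U^T Us|^2 by \<open>rfrob_eq\<close>, hence symmetric.\<close>

definition rfrob :: "nat \<Rightarrow> nat \<Rightarrow> mat \<Rightarrow> mat \<Rightarrow> real" where
  "rfrob m k U Us = sqrt (\<Sum>i<m. \<Sum>l<k. (resid m k U Us i l)^2)"

lemma rfrob_nonneg [simp]: "0 \<le> rfrob m k U Us"
  by (simp add: rfrob_def sum_nonneg)

lemma rfrob_sq: "(rfrob m k U Us)^2 = (\<Sum>i<m. \<Sum>l<k. (resid m k U Us i l)^2)"
  by (simp add: rfrob_def sum_nonneg)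

lemma rfrob_eq:
  assumes "orth m k U" "orth m k Us"
  shows "(rfrob m k U Us)^2 = real k - (\<Sum>l<k. \<Sum>l'<k. (dot {..<m} (\<lambda>i. U i l') (\<lambda>i. Us i l))^2)"
proof -
  have "(rfrob m k U Us)^2 = (\<Sum>l<k. (vnorm {..<m} (\<lambda>i. Us i l - proj m k U (\<lambda>i. Us i l) i))^2)"
    unfolding rfrob_sq by (subst sum.swap) (simp add: vnorm_sq resid_def)
  also have "\<dots> = (\<Sum>l<k. 1 - (vnorm {..<k} (tmv {..<m} U (\<lambda>i. Us i l)))^2)"
  proof (rule sum.cong[OF refl])
    fix l assume "l \<in> {..<k}"
    then have "(vnorm {..<m} (\<lambda>i. Us i l))^2 = 1" using orth_dot[OF assms(2), of l l] by (simp add: vnorm_sq_dot)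
    then show "(vnorm {..<m} (\<lambda>i. Us i l - proj m k U (\<lambda>i. Us i l) i))^2 = 1 - (vnorm {..<k} (tmv {..<m} U (\<lambda>i. Us i l)))^2"
      using pythagoras[OF assms(1), of "\<lambda>i. Us i l"] by simp
  qed
  also have "\<dots> = real k - (\<Sum>l<k. \<Sum>l'<k. (dot {..<m} (\<lambda>i. U i l') (\<lambda>i. Us i l))^2)"
    by (simp add: sum_subtractf vnorm_sq tmv_dot)
  finally show ?thesis .
qed

lemma rfrob_sym:
  assumes "orth m k U" "orth m k Us" shows "rfrob m k U Us = rfrob m k Us U"
proof -
  have "(rfrob m k U Us)^2 = (rfrob m k Us U)^2"
    unfolding rfrob_eq[OF assms] rfrob_eq[OF assms(2,1)]
    by (subst sum.swap) (simp add: dot_commute)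
  then show ?thesis by (simp add: power2_eq_iff_nonneg)
qed

text \<open>Converts missed signal into a distance of subspaces. This is where the singular values
  enter the denominators of the contraction factor.\<close>

lemma rfrob_gap:
  assumes "\<And>r. s * vnorm {..<k} r \<le> vnorm C (tmv {..<k} B r)" "0 \<le> s"
  shows "s * rfrob m k U Us \<le> gap C m k U Us B"
proof (rule power2_le_imp_le)
  have "(s * rfrob m k U Us)^2 = (\<Sum>i<m. (s * vnorm {..<k} (resid m k U Us i))^2)"
    by (simp add: power_mult_distrib rfrob_sq vnorm_sq sum_distrib_left)
  also have "\<dots> \<le> (gap C m k U Us B)^2"
    unfolding gap_sq by (intro sum_mono power_mono assms) (simp add: assms)
  finally show "(s * rfrob m k U Us)^2 \<le> (gap C m k U Us B)^2" .
qed simp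

text \<open>From sine to cosine: the part of Us y outside the span of \<open>U\<close> has norm at
  most x |y|, so Pythagoras leaves at least (1 - 1/121) |y|^2, and 0.995^2 is below 1 -
  1/121.\<close>

lemma angle_lower:
  assumes U: "orth m k U" and Us: "orth m k Us" and x: "0 \<le> x" "x \<le> 1 / 11"
    and ang: "\<And>z. \<forall>l<k. dot {..<m} (\<lambda>i. U i l) z = 0 \<Longrightarrow> vnorm {..<k} (tmv {..<m} Us z) \<le> x * vnorm {..<m} z"
  shows "995 / 1000 * vnorm {..<k} y \<le> vnorm {..<k} (tmv {..<m} U (mv {..<k} Us y))"
proof (rule power2_le_imp_le)
  let ?v = "mv {..<k} Us y"
  define z where "z = (\<lambda>i. ?v i - proj m k U ?v i)"
  have z0: "\<forall>l<k. dot {..<m} (\<lambda>i. U i l) z = 0" using tmv_resid[OF U] by (simp add: z_def tmv_dot)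
  have zle: "vnorm {..<m} z \<le> x * vnorm {..<k} y"
  proof (rule sq_le_mult)
    have "dot {..<m} (proj m k U ?v) z = 0"
      unfolding dot_proj using z0 by (simp add: dot_def[of "{..<k}"] tmv_dot)
    then have "(vnorm {..<m} z)^2 = dot {..<m} ?v z"
      unfolding vnorm_sq_dot by (subst (1) z_def) (simp add: dot_diff_left)
    also have "\<dots> = dot {..<k} y (tmv {..<m} Us z)" by (rule dot_adjoint)
    also have "\<dots> \<le> vnorm {..<k} y * vnorm {..<k} (tmv {..<m} Us z)" using dot_le[of "{..<k}" y "tmv {..<m} Us z"] by linarith
    also have "\<dots> \<le> vnorm {..<k} y * (x * vnorm {..<m} z)" by (intro mult_left_mono ang z0) simp
    finally show "(vnorm {..<m} z)^2 \<le> x * vnorm {..<k} y * vnorm {..<m} z" by (simp add: mult_ac)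
  qed (simp add: x)
  have "(vnorm {..<m} z)^2 \<le> (x * vnorm {..<k} y)^2" by (rule power_mono[OF zle]) simp
  also have "\<dots> \<le> (1 / 11)^2 * (vnorm {..<k} y)^2"
    unfolding power_mult_distrib using x by (intro mult_right_mono power_mono) auto
  finally have "(vnorm {..<k} (tmv {..<m} U ?v))^2 \<ge> (1 - (1 / 11)^2) * (vnorm {..<k} y)^2"
    using pythagoras[OF U, of ?v] orth_vnorm[OF Us, of y] unfolding z_def by (simp add: algebra_simps)
  moreover have "(995 / 1000 * vnorm {..<k} y)^2 \<le> (1 - (1 / 11)^2) * (vnorm {..<k} y)^2"
    unfolding power_mult_distrib by (intro mult_right_mono) (simp_all add: power2_eq_square)
  ultimately show "(995 / 1000 * vnorm {..<k} y)^2 \<le> (vnorm {..<k} (tmv {..<m} U ?v))^2" by linarith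
qed simp

text \<open>First unfolding after contracting the third mode with V^T, with columns kept as pairs
  (b, k), so that no integer flattening enters the analysis of a half-step.\<close>

definition con :: "nat \<Rightarrow> mat \<Rightarrow> tensor \<Rightarrow> nat \<Rightarrow> nat \<times> nat \<Rightarrow> real" where
  "con n3 V X = (\<lambda>a (b, k). \<Sum>c<n3. V c k * X a b c)"

lemma con_add: "con n3 V (\<lambda>a b c. X a b c + Y a b c) a j = con n3 V X a j + con n3 V Y a j"
  by (cases j) (simp add: con_def sum.distrib[symmetric] algebra_simps)

definition core :: "tensor \<Rightarrow> nat \<Rightarrow> nat \<times> nat \<Rightarrow> real" where
  "core W = (\<lambda>j (b, k). W j b k)"

text \<open>Splitting V into its component along Vs and an orthogonal remainder is what makes the
  iteration contract: only the remainder meets the full bias.\<close>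

lemma bias_bound:
  assumes Q: "sub_orth n1 k1 Q" and Vs: "orth n3 k3 Vs" and V: "orth n3 k3 V"
    and eps: "\<And>u. vnorm ({..<n2} \<times> {..<k3}) (tmv {..<n1} (con n3 Vs E) u) \<le> eps * vnorm {..<n1} u" "0 \<le> eps"
    and beta: "\<And>v. vnorm ({..<n2} \<times> {..<k1}) (tmv {..<n3} (con n1 Q (\<lambda>c b a. E a b c)) v) \<le> beta * vnorm {..<n3} v" "0 \<le> beta"
  shows "vnorm (({..<n2} \<times> {..<k3}) \<times> {..<k1}) (\<lambda>(j, l). tmv {..<n1} (con n3 V E) (\<lambda>i. Q i l) j)
    \<le> sqrt (real k1) * eps + beta * rfrob n3 k3 Vs V"
proof -
  define g where "g = (\<lambda>V' (j, l). tmv {..<n1} (con n3 V' E) (\<lambda>i. Q i l) j)"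
  define C where "C = ({..<n2} \<times> {..<k3}) \<times> {..<k1}"
  \<comment> \<open>V = Vs Vs^T V + (I - Vs Vs^T) V.\<close>
  define V1 where "V1 = (\<lambda>c k. proj n3 k3 Vs (\<lambda>i. V i k) c)"
  define V2 where "V2 = resid n3 k3 Vs V"
  have gval: "g V' ((b, k), l) = (\<Sum>a<n1. (\<Sum>c<n3. V' c k * E a b c) * Q a l)" for V' b k l
    by (simp add: g_def tmv_def con_def)
  have split: "g V x = g V1 x + g V2 x" for x
  proof -
    obtain b k l where x: "x = ((b, k), l)" by (metis surj_pair)
    show ?thesis unfolding x gval V1_def V2_def resid_def
      by (simp add: sum.distrib[symmetric] sum_subtractf algebra_simps)
  qed
  have C2: "(vnorm C f)^2 = (\<Sum>b<n2. \<Sum>k<k3. \<Sum>l<k1. (f ((b, k), l))^2)" for f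
    unfolding vnorm_sq C_def by (simp only: sum.cartesian_product')
  \<comment> \<open>Vs^T V is a contraction, so this part is no larger than with \<open>Vs\<close>
    itself; each of the k1 columns of \<open>Q\<close>, of norm at most 1, contributes at most
    eps^2.\<close>
  have h1: "vnorm C (g V1) \<le> sqrt (real k1) * eps"
  proof (rule power2_le_imp_le)
    define H where "H = (\<lambda>s k. tmv {..<n3} Vs (\<lambda>i. V i k) s)"
    have gV1: "g V1 ((b, k), l) = tmv {..<n3} V (mv {..<k3} Vs (\<lambda>s. g Vs ((b, s), l))) k" for b k l
    proof -
      have "g V1 ((b, k), l) = (\<Sum>a<n1. (\<Sum>c<n3. (\<Sum>s<k3. Vs c s * H s k) * E a b c) * Q a l)"
        unfolding gval V1_def proj_def mv_def H_def ..
      also have "\<dots> = (\<Sum>s<k3. H s k * g Vs ((b, s), l))"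
      proof -
        have "(\<Sum>c<n3. (\<Sum>s<k3. Vs c s * H s k) * E a b c) = (\<Sum>s<k3. H s k * (\<Sum>c<n3. Vs c s * E a b c))" for a
          unfolding sum_distrib_left sum_distrib_right
          by (subst sum.swap) (simp add: algebra_simps)
        moreover define e where "e = (\<lambda>s a. \<Sum>c<n3. Vs c s * E a b c)"
        moreover have "(\<Sum>a<n1. (\<Sum>s<k3. H s k * e s a) * Q a l) = (\<Sum>s<k3. H s k * (\<Sum>a<n1. e s a * Q a l))"
          unfolding sum_distrib_left sum_distrib_right by (subst sum.swap) (simp add: mult.assoc)
        ultimately show ?thesis unfolding gval by simp
      qed
      also have "\<dots> = dot {..<k3} (\<lambda>s. g Vs ((b, s), l)) (tmv {..<n3} Vs (\<lambda>i. V i k))"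
        by (simp add: dot_def H_def mult.commute)
      also have "\<dots> = dot {..<n3} (mv {..<k3} Vs (\<lambda>s. g Vs ((b, s), l))) (\<lambda>i. V i k)" by (rule dot_adjoint[symmetric])
      finally show ?thesis by (simp add: tmv_dot dot_commute)
    qed
    have le: "(\<Sum>k<k3. (g V1 ((b, k), l))^2) \<le> (\<Sum>k<k3. (g Vs ((b, k), l))^2)" for b l
    proof -
      have "vnorm {..<k3} (tmv {..<n3} V (mv {..<k3} Vs (\<lambda>s. g Vs ((b, s), l)))) \<le> vnorm {..<n3} (mv {..<k3} Vs (\<lambda>s. g Vs ((b, s), l)))"
        by (rule contr_tmv[OF orth_contr[OF V]])
      also have "\<dots> = vnorm {..<k3} (\<lambda>s. g Vs ((b, s), l))" by (rule orth_vnorm[OF Vs])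
      finally have "(vnorm {..<k3} (\<lambda>k. g V1 ((b, k), l)))^2 \<le> (vnorm {..<k3} (\<lambda>s. g Vs ((b, s), l)))^2"
        unfolding gV1 by (intro power_mono) auto
      then show ?thesis by (simp add: vnorm_sq)
    qed
    have "(vnorm C (g V1))^2 = (\<Sum>b<n2. \<Sum>l<k1. \<Sum>k<k3. (g V1 ((b, k), l))^2)"
      unfolding C2 by (intro sum.cong refl sum.swap)
    also have "\<dots> \<le> (\<Sum>b<n2. \<Sum>l<k1. \<Sum>k<k3. (g Vs ((b, k), l))^2)" by (intro sum_mono le)
    also have "\<dots> = (\<Sum>l<k1. \<Sum>b<n2. \<Sum>k<k3. (g Vs ((b, k), l))^2)" by (rule sum.swap)
    also have "\<dots> = (\<Sum>l<k1. (vnorm ({..<n2} \<times> {..<k3}) (tmv {..<n1} (con n3 Vs E) (\<lambda>i. Q i l)))^2)"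
      unfolding vnorm_sq by (simp only: sum.cartesian_product' g_def prod.case)
    also have "\<dots> \<le> (\<Sum>l<k1. eps^2)"
    proof (rule sum_mono)
      fix l assume l: "l \<in> {..<k1}"
      have "(vnorm {..<n1} (\<lambda>i. Q i l))^2 \<le> 1" using Q l unfolding vnorm_sq_dot sub_orth_def by auto
      then have "(vnorm {..<n1} (\<lambda>i. Q i l))^2 \<le> 1^2" by simp
      then have "vnorm {..<n1} (\<lambda>i. Q i l) \<le> 1" by (rule power2_le_imp_le) simp
      then have "eps * vnorm {..<n1} (\<lambda>i. Q i l) \<le> eps * 1" using eps(2) by (intro mult_left_mono)
      then have "vnorm ({..<n2} \<times> {..<k3}) (tmv {..<n1} (con n3 Vs E) (\<lambda>i. Q i l)) \<le> eps"
        using eps(1)[of "\<lambda>i. Q i l"] by linarith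
      then show "(vnorm ({..<n2} \<times> {..<k3}) (tmv {..<n1} (con n3 Vs E) (\<lambda>i. Q i l)))^2 \<le> eps^2"
        by (intro power_mono) auto
    qed
    also have "\<dots> = (sqrt (real k1) * eps)^2" by (simp add: power_mult_distrib)
    finally show "(vnorm C (g V1))^2 \<le> (sqrt (real k1) * eps)^2" .
  qed (simp add: eps)
  \<comment> \<open>The bound beta is applied to every column of the remainder, whose Frobenius norm
    is the distance between the two frames.\<close>
  have h2: "vnorm C (g V2) \<le> beta * rfrob n3 k3 Vs V"
  proof (rule power2_le_imp_le)
    have gV2: "g V2 ((b, k), l) = tmv {..<n3} (con n1 Q (\<lambda>c b a. E a b c)) (\<lambda>c. V2 c k) (b, l)" for b k l
      unfolding gval tmv_def con_def prod.case sum_distrib_left sum_distrib_right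
      by (subst sum.swap) (simp add: algebra_simps)
    have "(vnorm C (g V2))^2 = (\<Sum>k<k3. \<Sum>b<n2. \<Sum>l<k1. (g V2 ((b, k), l))^2)"
      unfolding C2 by (rule sum.swap)
    also have "\<dots> = (\<Sum>k<k3. (vnorm ({..<n2} \<times> {..<k1}) (tmv {..<n3} (con n1 Q (\<lambda>c b a. E a b c)) (\<lambda>c. V2 c k)))^2)"
      unfolding vnorm_sq gV2 by (simp only: sum.cartesian_product')
    also have "\<dots> \<le> (\<Sum>k<k3. (beta * vnorm {..<n3} (\<lambda>c. V2 c k))^2)"
      by (intro sum_mono power_mono beta) simp
    also have "\<dots> = beta^2 * (\<Sum>k<k3. \<Sum>c<n3. (V2 c k)^2)"
      by (simp add: power_mult_distrib vnorm_sq sum_distrib_left)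
    also have "\<dots> = (beta * rfrob n3 k3 Vs V)^2"
      unfolding power_mult_distrib rfrob_sq V2_def by (subst sum.swap) simp
    finally show "(vnorm C (g V2))^2 \<le> (beta * rfrob n3 k3 Vs V)^2" .
  qed (simp add: beta)
  have "vnorm C (g V) = vnorm C (\<lambda>x. g V1 x + g V2 x)" by (simp only: split[abs_def])
  also have "\<dots> \<le> vnorm C (g V1) + vnorm C (g V2)" by (rule vnorm_triangle)
  finally show ?thesis using h1 h2 by (simp add: C_def g_def)
qed

section \<open>Unfoldings and the exchange of modes\<close>

lemma bij_divmod: "bij_betw (\<lambda>i. (i div m, i mod m)) {..<n * m} ({..<n} \<times> {..<m::nat})"
proof (rule bij_betwI[where g="\<lambda>(a, b). a * m + b"])
  show "(\<lambda>i. (i div m, i mod m)) \<in> {..<n * m} \<rightarrow> {..<n} \<times> {..<m}"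
  proof
    fix i assume i: "i \<in> {..<n * m}"
    then have "0 < m" by (cases m) auto
    then show "(i div m, i mod m) \<in> {..<n} \<times> {..<m}" using i by (simp add: less_mult_imp_div_less)
  qed
  show "(\<lambda>(a, b). a * m + b) \<in> {..<n} \<times> {..<m} \<rightarrow> {..<n * m}"
  proof
    fix x assume x: "x \<in> {..<n} \<times> {..<m}"
    obtain a b where ab: "x = (a, b)" by (cases x)
    have "a * m + b < (a + 1) * m" using x ab by simp
    also have "\<dots> \<le> n * m" using x ab by (intro mult_right_mono) auto
    finally show "(case x of (a, b) \<Rightarrow> a * m + b) \<in> {..<n * m}" by (simp add: ab)
  qed
qed auto

lemma bij_moddiv: "bij_betw (\<lambda>i. (i mod m, i div m)) {..<n * m} ({..<m::nat} \<times> {..<n})"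
proof -
  have "bij_betw prod.swap ({..<n} \<times> {..<m}) ({..<m} \<times> {..<n})"
    by (rule bij_betwI[where g=prod.swap]) auto
  from bij_betw_trans[OF bij_divmod this] show ?thesis by (simp add: comp_def)
qed

lemma vnorm_reindex: "bij_betw f A B \<Longrightarrow> vnorm B g = vnorm A (\<lambda>i. g (f i))"
  unfolding vnorm_def by (rule arg_cong[where f=sqrt], rule sum.reindex_bij_betw[symmetric])

text \<open>Exchanging modes 1 and 3 turns an update of V into an update of U, so one half-step
  covers both.\<close>

definition flip :: "tensor \<Rightarrow> tensor" where "flip X = (\<lambda>c b a. X a b c)"

definition unf :: "tensor \<Rightarrow> nat \<Rightarrow> nat \<times> nat \<Rightarrow> real" where "unf X = (\<lambda>a (b, c). X a b c)"

lemma snorm_m1: "vnorm ({..<n2} \<times> {..<n3}) (tmv {..<n1} (unf X) u) \<le> snorm n1 (n2 * n3) (m1 n2 n3 X) * vnorm {..<n1} u"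
proof -
  have "vnorm ({..<n2} \<times> {..<n3}) (tmv {..<n1} (unf X) u) = vnorm {..<n2 * n3} (tmv {..<n1} (m1 n2 n3 X) u)"
    unfolding vnorm_reindex[OF bij_divmod] by (simp add: tmv_def unf_def m1_def)
  also have "\<dots> \<le> snorm n1 (n2 * n3) (m1 n2 n3 X) * vnorm {..<n1} u"
    unfolding snorm_def by (rule vnorm_tmv_le) simp_all
  finally show ?thesis .
qed

lemma snorm_m3: "vnorm ({..<n2} \<times> {..<n1}) (tmv {..<n3} (unf (flip X)) u) \<le> snorm n3 (n1 * n2) (m3 n2 X) * vnorm {..<n3} u"
proof -
  have "vnorm ({..<n2} \<times> {..<n1}) (tmv {..<n3} (unf (flip X)) u) = vnorm {..<n1 * n2} (tmv {..<n3} (m3 n2 X) u)"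
    unfolding vnorm_reindex[OF bij_moddiv] by (simp add: tmv_def unf_def m3_def flip_def)
  also have "\<dots> \<le> snorm n3 (n1 * n2) (m3 n2 X) * vnorm {..<n3} u"
    unfolding snorm_def by (rule vnorm_tmv_le) simp_all
  finally show ?thesis .
qed

lemma con_unf1: "con n3 V X = unf (mode3T n3 V X)"
  by (intro ext) (auto simp: con_def unf_def mode3T_def)

lemma con_unf3: "con n1 U (flip X) = unf (flip (mode1T n1 U X))"
  by (intro ext) (auto simp: con_def unf_def mode1T_def flip_def)

lemma lead_m1: "lead_lsv n1 (n2 * n3) (m1 n2 n3 X) k U \<Longrightarrow> lead ({..<n2} \<times> {..<n3}) n1 (unf X) k U"
  by (rule lead_reindex[OF bij_divmod], drule lead_lsv_lead) (simp add: unf_def m1_def[abs_def])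

lemma lead_m3: "lead_lsv n3 (n1 * n2) (m3 n2 X) k U \<Longrightarrow> lead ({..<n2} \<times> {..<n1}) n3 (unf (flip X)) k U"
  by (rule lead_reindex[OF bij_moddiv], drule lead_lsv_lead) (simp add: unf_def m3_def[abs_def] flip_def)

lemma con_le:
  assumes V: "contr n3 k V"
  shows "vnorm ({..<n2} \<times> {..<k}) (tmv {..<n1} (con n3 V X) w) \<le> vnorm ({..<n2} \<times> {..<n3}) (tmv {..<n1} (unf X) w)"
proof (rule vnorm_le_vnormI)
  have eq: "tmv {..<n1} (con n3 V X) w (b, l) = tmv {..<n3} V (\<lambda>c. tmv {..<n1} (unf X) w (b, c)) l" for b l
    unfolding tmv_def con_def unf_def prod.case sum_distrib_left sum_distrib_right
    by (subst sum.swap) (simp add: algebra_simps)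
  have "(\<Sum>l<k. (tmv {..<n1} (con n3 V X) w (b, l))^2) \<le> (\<Sum>c<n3. (tmv {..<n1} (unf X) w (b, c))^2)" for b
    using power_mono[OF contr_tmv[OF V, of "\<lambda>c. tmv {..<n1} (unf X) w (b, c)"], of 2]
    unfolding eq vnorm_sq by simp
  then show "(vnorm ({..<n2} \<times> {..<k}) (tmv {..<n1} (con n3 V X) w))^2 \<le> (vnorm ({..<n2} \<times> {..<n3}) (tmv {..<n1} (unf X) w))^2"
    unfolding vnorm_sq by (simp only: sum.cartesian_product') (rule sum_mono)
qed

definition lowrank :: "nat \<Rightarrow> nat \<Rightarrow> mat \<Rightarrow> mat \<Rightarrow> tensor \<Rightarrow> tensor" where
  "lowrank k1 k3 Us Vs W = (\<lambda>a b c. \<Sum>j<k1. Us a j * (\<Sum>k<k3. Vs c k * W j b k))"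

lemma flip_lowrank: "flip (lowrank k1 k3 Us Vs W) = lowrank k3 k1 Vs Us (flip W)"
  unfolding flip_def lowrank_def sum_distrib_left
  by (intro ext, subst sum.swap) (simp add: algebra_simps)

text \<open>One half-step of the iteration: the factor Vs is contracted against V, and the new leading
  singular subspace U is compared with Us.\<close>

locale half_step =
  fixes n1 n2 n3 k1 k3 :: nat and Us Vs :: mat and W E N :: tensor and F eps beta g s :: real
  assumes Us: "orth n1 k1 Us" and Vs: "orth n3 k3 Vs"
    and F: "\<And>Q V. contr n1 k1 Q \<Longrightarrow> contr n3 k3 V \<Longrightarrow>
      vnorm (({..<n2} \<times> {..<k3}) \<times> {..<k1}) (\<lambda>(j, l). tmv {..<n1} (con n3 V N) (\<lambda>i. Q i l) j) \<le> F"
    and F0: "0 \<le> F"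
    and eps: "\<And>u. vnorm ({..<n2} \<times> {..<k3}) (tmv {..<n1} (con n3 Vs E) u) \<le> eps * vnorm {..<n1} u" "0 \<le> eps"
    and beta: "\<And>Q v. contr n1 k1 Q \<Longrightarrow>
      vnorm ({..<n2} \<times> {..<k1}) (tmv {..<n3} (con n1 Q (flip E)) v) \<le> beta * vnorm {..<n3} v" "0 \<le> beta"
    and g: "\<And>V w. orth n3 k3 V \<Longrightarrow> vnorm ({..<n2} \<times> {..<k3}) (tmv {..<n1} (con n3 V (\<lambda>a b c. E a b c + N a b c)) w) \<le> g * vnorm {..<n1} w"
      "0 \<le> g"
    and s: "\<And>r. s * vnorm {..<k1} r \<le> vnorm ({..<n2} \<times> {..<k3}) (tmv {..<k1} (core W) r)" "0 < s"
    and gs: "g \<le> 45 / 1000 * s"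
begin

abbreviation "Y \<equiv> (\<lambda>a b c. lowrank k1 k3 Us Vs W a b c + (E a b c + N a b c))"
abbreviation "C \<equiv> {..<n2} \<times> {..<k3}"
abbreviation "delta U \<equiv> gap C n1 k1 U Us (core W)"

definition angle :: "mat \<Rightarrow> bool" where
  "angle U \<longleftrightarrow> (\<forall>z. (\<forall>l<k1. dot {..<n1} (\<lambda>i. U i l) z = 0) \<longrightarrow> vnorm {..<k1} (tmv {..<n1} Us z) \<le> 1 / 11 * vnorm {..<n1} z)"

text \<open>What a half-step asks of its input: all cosines between the spans of \<open>V\<close>
  and \<open>Vs\<close> are at least 0.995. \<open>angle_aligned\<close> derives this from the sine
  bound delivered by the half-step before.\<close>

definition aligned :: "mat \<Rightarrow> bool" where
  "aligned V \<longleftrightarrow> (\<forall>y. 995 / 1000 * vnorm {..<k3} y \<le> vnorm {..<k3} (tmv {..<n3} V (mv {..<k3} Vs y)))"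

text \<open>Third mode of the core multiplied by V^T Vs: the core seen after contraction with
  \<open>V\<close> in place of \<open>Vs\<close>.\<close>

definition coreV :: "mat \<Rightarrow> nat \<Rightarrow> nat \<times> nat \<Rightarrow> real" where
  "coreV V = (\<lambda>j (b, k'). \<Sum>k<k3. tmv {..<n3} V (\<lambda>c. Vs c k) k' * W j b k)"

lemma con_Y: "con n3 V Y i j = (\<Sum>l<k1. Us i l * coreV V l j) + con n3 V (\<lambda>a b c. E a b c + N a b c) i j"
proof -
  obtain b k' where j: "j = (b, k')" by (cases j)
  have "con n3 V (lowrank k1 k3 Us Vs W) i (b, k') = (\<Sum>l<k1. Us i l * coreV V l (b, k'))"
  proof -
    have "con n3 V (lowrank k1 k3 Us Vs W) i (b, k') = (\<Sum>c<n3. \<Sum>l<k1. Us i l * (\<Sum>k<k3. V c k' * Vs c k * W l b k))"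
      unfolding con_def lowrank_def prod.case sum_distrib_left by (intro sum.cong refl) (simp add: algebra_simps)
    also have "\<dots> = (\<Sum>l<k1. \<Sum>c<n3. Us i l * (\<Sum>k<k3. V c k' * Vs c k * W l b k))" by (rule sum.swap)
    also have "\<dots> = (\<Sum>l<k1. Us i l * (\<Sum>c<n3. \<Sum>k<k3. V c k' * Vs c k * W l b k))"
      by (simp only: sum_distrib_left)
    also have "\<dots> = (\<Sum>l<k1. Us i l * coreV V l (b, k'))"
      unfolding coreV_def prod.case tmv_def sum_distrib_right
      by (intro sum.cong refl arg_cong2[where f="(*)"] sum.swap)
    finally show ?thesis .
  qed
  then show ?thesis unfolding con_add j by simp
qed

text \<open>For each b the slice of the core is mapped by V^T Vs, so alignment costs the factor
  0.995 slice by slice.\<close>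

lemma coreV_le:
  assumes "aligned V"
  shows "995 / 1000 * vnorm C (tmv {..<k1} (core W) r) \<le> vnorm C (tmv {..<k1} (coreV V) r)"
proof (rule power2_le_imp_le)
  have eq: "tmv {..<k1} (coreV V) r (b, k') = tmv {..<n3} V (mv {..<k3} Vs (\<lambda>k. tmv {..<k1} (core W) r (b, k))) k'" for b k'
  proof -
    have "tmv {..<k1} (coreV V) r (b, k') = (\<Sum>j<k1. \<Sum>k<k3. tmv {..<n3} V (\<lambda>c. Vs c k) k' * (W j b k * r j))"
      by (simp add: tmv_def[of "{..<k1}"] coreV_def sum_distrib_right mult.assoc)
    also have "\<dots> = (\<Sum>k<k3. \<Sum>j<k1. tmv {..<n3} V (\<lambda>c. Vs c k) k' * (W j b k * r j))" by (rule sum.swap)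
    also have "\<dots> = (\<Sum>k<k3. tmv {..<k1} (core W) r (b, k) * tmv {..<n3} V (\<lambda>c. Vs c k) k')"
      by (simp add: tmv_def[of "{..<k1}"] core_def sum_distrib_left mult.commute)
    finally show ?thesis unfolding tmv_mv .
  qed
  have "(995 / 1000)^2 * (\<Sum>k<k3. (tmv {..<k1} (core W) r (b, k))^2) \<le> (\<Sum>k<k3. (tmv {..<k1} (coreV V) r (b, k))^2)" for b
  proof -
    have "995 / 1000 * vnorm {..<k3} (\<lambda>k. tmv {..<k1} (core W) r (b, k)) \<le> vnorm {..<k3} (\<lambda>k. tmv {..<k1} (coreV V) r (b, k))"
      using assms unfolding aligned_def eq by blast
    then have "(995 / 1000 * vnorm {..<k3} (\<lambda>k. tmv {..<k1} (core W) r (b, k)))^2 \<le> (vnorm {..<k3} (\<lambda>k. tmv {..<k1} (coreV V) r (b, k)))^2"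
      by (intro power_mono) auto
    then show ?thesis by (simp only: power_mult_distrib vnorm_sq)
  qed
  then have "(\<Sum>b<n2. (995 / 1000)^2 * (\<Sum>k<k3. (tmv {..<k1} (core W) r (b, k))^2)) \<le> (\<Sum>b<n2. \<Sum>k<k3. (tmv {..<k1} (coreV V) r (b, k))^2)"
    by (rule sum_mono)
  then show "(995 / 1000 * vnorm C (tmv {..<k1} (core W) r))^2 \<le> (vnorm C (tmv {..<k1} (coreV V) r))^2"
    unfolding power_mult_distrib vnorm_sq by (simp only: sum.cartesian_product' sum_distrib_left)
qed simp

lemma angle_step:
  assumes V: "orth n3 k3 V" "aligned V" and L: "lead C n1 (con n3 V Y) k1 U"
  shows "angle U"
  unfolding angle_def
proof (intro allI impI)
  fix z assume z: "\<forall>l<k1. dot {..<n1} (\<lambda>i. U i l) z = 0"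
  have "995 / 1000 * s * vnorm {..<k1} (tmv {..<n1} Us z) \<le> 2 * g * vnorm {..<n1} z"
    by (rule step_spectral[OF L con_Y g(1)[OF V(1)] g(2) coreV_le[OF V(2)] _ s(1) z]) simp
  \<comment> \<open>2 * 0.045 / 0.995 is just below 1 / 11, and a sine of 1 / 11 restores the cosine
    0.995 that was assumed, which closes the induction over half-steps.\<close>
  also have "\<dots> \<le> 2 * (45 / 1000 * s) * vnorm {..<n1} z"
    using gs by (intro mult_right_mono) auto
  finally have "s * (995 / 1000 * vnorm {..<k1} (tmv {..<n1} Us z)) \<le> s * (90 / 1000 * vnorm {..<n1} z)"
    by (simp add: algebra_simps)
  then have "995 / 1000 * vnorm {..<k1} (tmv {..<n1} Us z) \<le> 90 / 1000 * vnorm {..<n1} z"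
    using s(2) by simp
  then show "vnorm {..<k1} (tmv {..<n1} Us z) \<le> 1 / 11 * vnorm {..<n1} z"
    using vnorm_nonneg[of "{..<n1}" z] by linarith
qed

lemma angle_aligned:
  assumes "orth n1 k1 U" "angle U"
  shows "995 / 1000 * vnorm {..<k1} y \<le> vnorm {..<k1} (tmv {..<n1} U (mv {..<k1} Us y))"
  by (rule angle_lower[OF assms(1) Us, of "1/11"]) (use assms(2) in \<open>auto simp: angle_def\<close>)

text \<open>\<open>step_frobenius\<close>, with the perturbation seen through \<open>Q\<close> split
  into F for the sampling noise and \<open>bias_bound\<close> for the bias. Only the bias carries
  the distance of \<open>V\<close> from \<open>Vs\<close>.\<close>

lemma delta_step:
  assumes V: "orth n3 k3 V" "aligned V" and L: "lead C n1 (con n3 V Y) k1 U"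
  shows "995 / 1000 * delta U \<le> 2 * (F + sqrt (real k1) * eps + beta * rfrob n3 k3 V Vs)"
proof (rule step_frobenius[OF L Us con_Y _ _ coreV_le[OF V(2)]])
  fix Q assume Q: "sub_orth n1 k1 Q"
  let ?f = "\<lambda>X (j, l). tmv {..<n1} (con n3 V X) (\<lambda>i. Q i l) j"
  have "(\<Sum>j\<in>C. (vnorm {..<k1} (tmv {..<n1} Q (\<lambda>i. con n3 V (\<lambda>a b c. E a b c + N a b c) i j)))^2)
     = (vnorm (C \<times> {..<k1}) (?f (\<lambda>a b c. E a b c + N a b c)))^2"
    unfolding vnorm_sq by (simp only: sum.cartesian_product'[of _ C] prod.case tmv_dot dot_commute)
  also have "\<dots> \<le> (F + sqrt (real k1) * eps + beta * rfrob n3 k3 V Vs)^2"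
  proof (rule power_mono)
    have "?f (\<lambda>a b c. E a b c + N a b c) = (\<lambda>x. ?f E x + ?f N x)"
      by (auto simp: tmv_def con_add sum.distrib[symmetric] algebra_simps)
    then have "vnorm (C \<times> {..<k1}) (?f (\<lambda>a b c. E a b c + N a b c)) \<le> vnorm (C \<times> {..<k1}) (?f E) + vnorm (C \<times> {..<k1}) (?f N)"
      by (simp only: vnorm_triangle)
    also have "vnorm (C \<times> {..<k1}) (?f N) \<le> F" by (rule F[OF sub_orth_contr[OF Q] orth_contr[OF V(1)]])
    also have "vnorm (C \<times> {..<k1}) (?f E) \<le> sqrt (real k1) * eps + beta * rfrob n3 k3 Vs V"
      by (rule bias_bound[OF Q Vs V(1) eps beta(1)[OF sub_orth_contr[OF Q], unfolded flip_def] beta(2)])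
    finally show "vnorm (C \<times> {..<k1}) (?f (\<lambda>a b c. E a b c + N a b c)) \<le> F + sqrt (real k1) * eps + beta * rfrob n3 k3 V Vs"
      by (simp add: rfrob_sym[OF V(1) Vs])
  qed simp
  finally show "(\<Sum>j\<in>C. (vnorm {..<k1} (tmv {..<n1} Q (\<lambda>i. con n3 V (\<lambda>a b c. E a b c + N a b c) i j)))^2)
      \<le> (F + sqrt (real k1) * eps + beta * rfrob n3 k3 V Vs)^2" .
qed (use F0 eps(2) beta(2) in simp_all)

lemma rfrob_delta: "s * rfrob n1 k1 U Us \<le> delta U"
  by (rule rfrob_gap[OF s(1)]) (use s(2) in simp)

end

section \<open>Convergence of the iteration\<close>

lemma tfrob_vnorm: "tfrob n1 n2 n3 X = vnorm ({..<n1} \<times> {..<n2} \<times> {..<n3}) (\<lambda>(a, b, c). X a b c)"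
  unfolding tfrob_def vnorm_def by (simp only: sum.cartesian_product' prod.case)

lemma tfrob_nonneg [simp]: "0 \<le> tfrob n1 n2 n3 X"
  by (simp add: tfrob_vnorm)

lemma tfrob_sq: "(tfrob n1 n2 n3 X)^2 = (\<Sum>a<n1. \<Sum>b<n2. \<Sum>c<n3. (X a b c)^2)"
  by (simp add: tfrob_def sum_nonneg)

lemma tfrob_triangle: "tfrob n1 n2 n3 (\<lambda>a b c. X a b c + Y a b c) \<le> tfrob n1 n2 n3 X + tfrob n1 n2 n3 Y"
proof -
  have "(\<lambda>(a, b, c). X a b c + Y a b c) = (\<lambda>x. (\<lambda>(a, b, c). X a b c) x + (\<lambda>(a, b, c). Y a b c) x)"
    by auto
  then show ?thesis unfolding tfrob_vnorm by (simp only: vnorm_triangle)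
qed

lemma tfrob_uminus: "tfrob n1 n2 n3 (\<lambda>a b c. - X a b c) = tfrob n1 n2 n3 X"
  by (simp add: tfrob_def)

lemma tfrob_flip: "tfrob n3 n2 n1 (flip X) = tfrob n1 n2 n3 X"
proof -
  have "(\<Sum>c<n3. \<Sum>b<n2. \<Sum>a<n1. (X a b c)^2) = (\<Sum>b<n2. \<Sum>c<n3. \<Sum>a<n1. (X a b c)^2)" by (rule sum.swap)
  also have "\<dots> = (\<Sum>b<n2. \<Sum>a<n1. \<Sum>c<n3. (X a b c)^2)" by (intro sum.cong refl sum.swap)
  also have "\<dots> = (\<Sum>a<n1. \<Sum>b<n2. \<Sum>c<n3. (X a b c)^2)" by (rule sum.swap)
  finally show ?thesis by (simp add: tfrob_def flip_def)
qed

lemma lowrank_ttprod: "lowrank = ttprod"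
  by (intro ext) (simp add: lowrank_def ttprod_def)

lemma tfrob_lowrank_le:
  assumes B: "contr n3 k3 B"
  shows "(tfrob n1 n2 n3 (lowrank k1 k3 A B W))^2 \<le> (\<Sum>a<n1. (vnorm ({..<n2} \<times> {..<k3}) (tmv {..<k1} (core W) (A a)))^2)"
proof -
  have eq: "lowrank k1 k3 A B W a b c = mv {..<k3} B (\<lambda>k. tmv {..<k1} (core W) (A a) (b, k)) c" for a b c
    unfolding lowrank_def mv_def tmv_def core_def prod.case sum_distrib_left
    by (subst sum.swap) (simp add: algebra_simps)
  have "(\<Sum>c<n3. (lowrank k1 k3 A B W a b c)^2) \<le> (\<Sum>k<k3. (tmv {..<k1} (core W) (A a) (b, k))^2)" for a b
  proof -
    have "(vnorm {..<n3} (mv {..<k3} B (\<lambda>k. tmv {..<k1} (core W) (A a) (b, k))))^2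
       \<le> (vnorm {..<k3} (\<lambda>k. tmv {..<k1} (core W) (A a) (b, k)))^2"
      using B by (intro power_mono) (auto simp: contr_def)
    then show ?thesis unfolding eq vnorm_sq .
  qed
  then show ?thesis unfolding tfrob_sq vnorm_sq
    by (simp only: sum.cartesian_product') (intro sum_mono)
qed

lemma tfrob_ttprod_le:
  assumes U: "contr n1 k1 U" and V: "contr n3 k3 V"
  shows "tfrob n1 n2 n3 (lowrank k1 k3 U V Z) \<le> tfrob k1 n2 k3 Z"
proof (rule power2_le_imp_le)
  have "(tfrob n1 n2 n3 (lowrank k1 k3 U V Z))^2 \<le> (\<Sum>a<n1. \<Sum>b<n2. \<Sum>k<k3. (tmv {..<k1} (core Z) (U a) (b, k))^2)"
    using tfrob_lowrank_le[OF V, of n1 n2 k1 U Z] unfolding vnorm_sq by (simp only: sum.cartesian_product')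
  also have "\<dots> = (\<Sum>b<n2. \<Sum>a<n1. \<Sum>k<k3. (tmv {..<k1} (core Z) (U a) (b, k))^2)" by (rule sum.swap)
  also have "\<dots> = (\<Sum>b<n2. \<Sum>k<k3. \<Sum>a<n1. (mv {..<k1} U (\<lambda>j. Z j b k) a)^2)"
    by (rule sum.cong[OF refl], subst sum.swap) (simp add: tmv_def mv_def core_def mult.commute)
  also have "\<dots> \<le> (\<Sum>b<n2. \<Sum>k<k3. \<Sum>j<k1. (Z j b k)^2)"
  proof (intro sum_mono)
    fix b k
    have "(vnorm {..<n1} (mv {..<k1} U (\<lambda>j. Z j b k)))^2 \<le> (vnorm {..<k1} (\<lambda>j. Z j b k))^2"
      using U by (intro power_mono) (auto simp: contr_def)
    then show "(\<Sum>a<n1. (mv {..<k1} U (\<lambda>j. Z j b k) a)^2) \<le> (\<Sum>j<k1. (Z j b k)^2)" unfolding vnorm_sq .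
  qed
  also have "\<dots> = (tfrob k3 n2 k1 (flip Z))^2"
    unfolding tfrob_sq flip_def by (rule sum.swap)
  finally show "(tfrob n1 n2 n3 (lowrank k1 k3 U V Z))^2 \<le> (tfrob k1 n2 k3 Z)^2" by (simp add: tfrob_flip)
qed simp

lemma mode3_lowrank: "mode3T n3 V (lowrank k1 k3 A B W) = lowrank k1 k3 A (\<lambda>k l. \<Sum>c<n3. V c k * B c l) W"
proof (intro ext)
  fix a b k
  have "mode3T n3 V (lowrank k1 k3 A B W) a b k = (\<Sum>c<n3. \<Sum>j<k1. \<Sum>l<k3. A a j * (V c k * B c l * W j b l))"
    unfolding mode3T_def lowrank_def sum_distrib_left by (intro sum.cong refl) (simp add: algebra_simps)
  also have "\<dots> = (\<Sum>j<k1. \<Sum>c<n3. \<Sum>l<k3. A a j * (V c k * B c l * W j b l))" by (rule sum.swap)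
  also have "\<dots> = (\<Sum>j<k1. \<Sum>l<k3. \<Sum>c<n3. A a j * (V c k * B c l * W j b l))"
    by (intro sum.cong refl sum.swap)
  finally show "mode3T n3 V (lowrank k1 k3 A B W) a b k = lowrank k1 k3 A (\<lambda>k l. \<Sum>c<n3. V c k * B c l) W a b k"
    by (simp add: lowrank_def sum_distrib_left sum_distrib_right)
qed

lemma mode1_lowrank: "mode1T n1 U (lowrank k1 k3 A B W) = lowrank k1 k3 (\<lambda>k l. \<Sum>c<n1. U c k * A c l) B W"
proof (intro ext)
  fix j b c
  have "mode1T n1 U (lowrank k1 k3 A B W) j b c = (\<Sum>a<n1. \<Sum>l<k1. U a j * A a l * (\<Sum>k<k3. B c k * W l b k))"
    unfolding mode1T_def lowrank_def by (simp add: sum_distrib_left mult.assoc)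
  also have "\<dots> = (\<Sum>l<k1. \<Sum>a<n1. U a j * A a l * (\<Sum>k<k3. B c k * W l b k))" by (rule sum.swap)
  finally show "mode1T n1 U (lowrank k1 k3 A B W) j b c = lowrank k1 k3 (\<lambda>k l. \<Sum>c<n1. U c k * A c l) B W j b c"
    by (simp add: lowrank_def sum_distrib_right)
qed

lemma lowrank_lowrank: "lowrank k1 k3 U V (lowrank k1' k3' A B W)
    = lowrank k1' k3' (\<lambda>a j. \<Sum>i<k1. U a i * A i j) (\<lambda>c l. \<Sum>k<k3. V c k * B k l) W"
proof (intro ext)
  fix a b c
  have inner: "(\<Sum>k<k3. V c k * (\<Sum>j<k1'. A i j * (\<Sum>l<k3'. B k l * W j b l)))
     = (\<Sum>j<k1'. A i j * (\<Sum>l<k3'. (\<Sum>k<k3. V c k * B k l) * W j b l))" for i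
  proof -
    have "(\<Sum>k<k3. V c k * (\<Sum>j<k1'. A i j * (\<Sum>l<k3'. B k l * W j b l)))
      = (\<Sum>k<k3. \<Sum>j<k1'. \<Sum>l<k3'. A i j * (V c k * B k l * W j b l))"
      unfolding sum_distrib_left by (intro sum.cong refl) (simp add: algebra_simps)
    also have "\<dots> = (\<Sum>j<k1'. \<Sum>k<k3. \<Sum>l<k3'. A i j * (V c k * B k l * W j b l))" by (rule sum.swap)
    also have "\<dots> = (\<Sum>j<k1'. \<Sum>l<k3'. \<Sum>k<k3. A i j * (V c k * B k l * W j b l))"
      by (intro sum.cong refl sum.swap)
    finally show ?thesis by (simp add: sum_distrib_left sum_distrib_right)
  qed
  have "lowrank k1 k3 U V (lowrank k1' k3' A B W) a b c
    = (\<Sum>i<k1. U a i * (\<Sum>j<k1'. A i j * (\<Sum>l<k3'. (\<Sum>k<k3. V c k * B k l) * W j b l)))"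
    unfolding lowrank_def inner ..
  also have "\<dots> = (\<Sum>i<k1. \<Sum>j<k1'. U a i * A i j * (\<Sum>l<k3'. (\<Sum>k<k3. V c k * B k l) * W j b l))"
    by (simp only: sum_distrib_left mult.assoc)
  also have "\<dots> = (\<Sum>j<k1'. \<Sum>i<k1. U a i * A i j * (\<Sum>l<k3'. (\<Sum>k<k3. V c k * B k l) * W j b l))"
    by (rule sum.swap)
  finally show "lowrank k1 k3 U V (lowrank k1' k3' A B W) a b c =
     lowrank k1' k3' (\<lambda>a j. \<Sum>i<k1. U a i * A i j) (\<lambda>c l. \<Sum>k<k3. V c k * B k l) W a b c"
    by (simp only: lowrank_def sum_distrib_right)
qed

lemma lowrank_add: "lowrank k1 k3 U V (\<lambda>j b k. Z j b k + Z' j b k) a b c = lowrank k1 k3 U V Z a b c + lowrank k1 k3 U V Z' a b c"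
  by (simp add: lowrank_def sum.distrib algebra_simps)

lemma mode_add:
  "mode1T n1 U (mode3T n3 V (\<lambda>a b c. X a b c + Y a b c))
    = (\<lambda>j b k. mode1T n1 U (mode3T n3 V X) j b k + mode1T n1 U (mode3T n3 V Y) j b k)"
  by (intro ext) (simp add: mode1T_def mode3T_def sum.distrib algebra_simps)

lemma tfrob_con: "vnorm (({..<n2} \<times> {..<k3}) \<times> {..<k1}) (\<lambda>(j, l). tmv {..<n1} (con n3 V X) (\<lambda>i. Q i l) j)
    = tfrob k1 n2 k3 (mode1T n1 Q (mode3T n3 V X))"
proof -
  have "(\<Sum>b<n2. \<Sum>k<k3. \<Sum>l<k1. (mode1T n1 Q (mode3T n3 V X) l b k)^2)
      = (\<Sum>l<k1. \<Sum>b<n2. \<Sum>k<k3. (mode1T n1 Q (mode3T n3 V X) l b k)^2)"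
  proof -
    have "(\<Sum>b<n2. \<Sum>k<k3. \<Sum>l<k1. (mode1T n1 Q (mode3T n3 V X) l b k)^2)
      = (\<Sum>b<n2. \<Sum>l<k1. \<Sum>k<k3. (mode1T n1 Q (mode3T n3 V X) l b k)^2)" by (intro sum.cong refl sum.swap)
    also have "\<dots> = (\<Sum>l<k1. \<Sum>b<n2. \<Sum>k<k3. (mode1T n1 Q (mode3T n3 V X) l b k)^2)" by (rule sum.swap)
    finally show ?thesis .
  qed
  moreover have "tmv {..<n1} (con n3 V X) (\<lambda>i. Q i l) (b, k) = mode1T n1 Q (mode3T n3 V X) l b k" for b k l
    by (simp add: tmv_def con_def mode1T_def mode3T_def mult.commute)
  ultimately show ?thesis
    unfolding tfrob_def vnorm_def by (simp only: sum.cartesian_product' prod.case)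
qed

lemma mode_flip: "mode1T n3 Q (mode3T n1 U (flip X)) = flip (mode1T n1 U (mode3T n3 Q X))"
  unfolding mode1T_def mode3T_def flip_def sum_distrib_left
  by (intro ext, subst sum.swap) (simp add: algebra_simps)

lemma contr_proj:
  assumes "orth m k V" "orth m k Vs"
  shows "contr m k (\<lambda>c l. proj m k V (\<lambda>i. Vs i l) c)"
  unfolding contr_def
proof
  fix y
  have "mv {..<k} (\<lambda>c l. proj m k V (\<lambda>i. Vs i l) c) y = proj m k V (mv {..<k} Vs y)"
    unfolding proj_mv[abs_def] by (simp add: mv_def mult.commute)
  then have "vnorm {..<m} (mv {..<k} (\<lambda>c l. proj m k V (\<lambda>i. Vs i l) c) y) = vnorm {..<k} (tmv {..<m} V (mv {..<k} Vs y))"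
    by (simp add: proj_def orth_vnorm[OF assms(1)])
  also have "\<dots> \<le> vnorm {..<m} (mv {..<k} Vs y)" by (rule contr_tmv[OF orth_contr[OF assms(1)]])
  also have "\<dots> = vnorm {..<k} y" by (rule orth_vnorm[OF assms(2)])
  finally show "vnorm {..<m} (mv {..<k} (\<lambda>c l. proj m k V (\<lambda>i. Vs i l) c) y) \<le> vnorm {..<k} y" .
qed

text \<open>The output projects signal, bias and noise in both modes. For the signal T the loss
  telescopes as T - PU PV T = (I - PU) PV T + (I - PV) T, each summand being bounded by one gap,
  while mapping back with orthonormal factors does not enlarge bias and noise.\<close>

lemma reconstruction_error:
  assumes U: "orth n1 k1 U" and V: "orth n3 k3 V" and Us: "orth n1 k1 Us" and Vs: "orth n3 k3 Vs"
  shows "tfrob n1 n2 n3 (\<lambda>a b c.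
      lowrank k1 k3 U V (mode1T n1 U (mode3T n3 V (\<lambda>a b c. lowrank k1 k3 Us Vs W a b c + (E a b c + N a b c)))) a b c
        - (lowrank k1 k3 Us Vs W a b c + E a b c))
    \<le> tfrob n1 n2 n3 E + tfrob k1 n2 k3 (mode1T n1 U (mode3T n3 V E)) + tfrob k1 n2 k3 (mode1T n1 U (mode3T n3 V N))
      + gap ({..<n2} \<times> {..<k3}) n1 k1 U Us (core W) + gap ({..<n2} \<times> {..<k1}) n3 k3 V Vs (core (flip W))"
proof -
  define PU where "PU = (\<lambda>a j. proj n1 k1 U (\<lambda>i. Us i j) a)"
  define PV where "PV = (\<lambda>c l. proj n3 k3 V (\<lambda>i. Vs i l) c)"
  define Z where "Z = (\<lambda>X. mode1T n1 U (mode3T n3 V X))"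
  define R1 where "R1 = lowrank k1 k3 (resid n1 k1 U Us) PV W"
  define R2 where "R2 = lowrank k1 k3 Us (resid n3 k3 V Vs) W"
  have PT: "lowrank k1 k3 U V (Z (lowrank k1 k3 Us Vs W)) = lowrank k1 k3 PU PV W"
    unfolding Z_def mode3_lowrank mode1_lowrank lowrank_lowrank
    by (simp add: PU_def PV_def proj_def mv_def tmv_def)
  have PT2: "lowrank k1 k3 PU PV W a b c = lowrank k1 k3 Us Vs W a b c - R1 a b c - R2 a b c" for a b c
  proof -
    have "R1 a b c = lowrank k1 k3 Us PV W a b c - lowrank k1 k3 PU PV W a b c"
      unfolding R1_def lowrank_def resid_def PU_def by (simp add: sum_subtractf left_diff_distrib)
    moreover have "R2 a b c = lowrank k1 k3 Us Vs W a b c - lowrank k1 k3 Us PV W a b c"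
      unfolding R2_def lowrank_def resid_def PV_def by (simp add: sum_subtractf left_diff_distrib right_diff_distrib)
    ultimately show ?thesis by simp
  qed
  have r1: "tfrob n1 n2 n3 R1 \<le> gap ({..<n2} \<times> {..<k3}) n1 k1 U Us (core W)"
  proof (rule power2_le_imp_le)
    show "(tfrob n1 n2 n3 R1)^2 \<le> (gap ({..<n2} \<times> {..<k3}) n1 k1 U Us (core W))^2"
      unfolding R1_def gap_sq by (rule tfrob_lowrank_le) (unfold PV_def, rule contr_proj[OF V Vs])
  qed simp
  have r2: "tfrob n1 n2 n3 R2 \<le> gap ({..<n2} \<times> {..<k1}) n3 k3 V Vs (core (flip W))"
  proof (rule power2_le_imp_le)
    have "tfrob n1 n2 n3 R2 = tfrob n3 n2 n1 (lowrank k3 k1 (resid n3 k3 V Vs) Us (flip W))"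
      unfolding R2_def flip_lowrank[symmetric] by (rule tfrob_flip[symmetric])
    then show "(tfrob n1 n2 n3 R2)^2 \<le> (gap ({..<n2} \<times> {..<k1}) n3 k3 V Vs (core (flip W)))^2"
      unfolding gap_sq by (simp only: tfrob_lowrank_le[OF orth_contr[OF Us]])
  qed simp
  have "(\<lambda>a b c. lowrank k1 k3 U V (Z (\<lambda>a b c. lowrank k1 k3 Us Vs W a b c + (E a b c + N a b c))) a b c
        - (lowrank k1 k3 Us Vs W a b c + E a b c))
    = (\<lambda>a b c. - E a b c + (lowrank k1 k3 U V (Z E) a b c + (lowrank k1 k3 U V (Z N) a b c + (- R1 a b c + - R2 a b c))))"
    unfolding Z_def mode_add lowrank_add PT[unfolded Z_def] PT2 by (intro ext) simp
  then have "tfrob n1 n2 n3 (\<lambda>a b c. lowrank k1 k3 U V (Z (\<lambda>a b c. lowrank k1 k3 Us Vs W a b c + (E a b c + N a b c))) a b c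
        - (lowrank k1 k3 Us Vs W a b c + E a b c))
    \<le> tfrob n1 n2 n3 E + (tfrob n1 n2 n3 (lowrank k1 k3 U V (Z E)) + (tfrob n1 n2 n3 (lowrank k1 k3 U V (Z N))
      + (tfrob n1 n2 n3 R1 + tfrob n1 n2 n3 R2)))"
    using tfrob_triangle[of n1 n2 n3 "\<lambda>a b c. - E a b c" "\<lambda>a b c. lowrank k1 k3 U V (Z E) a b c + (lowrank k1 k3 U V (Z N) a b c + (- R1 a b c + - R2 a b c))"]
      tfrob_triangle[of n1 n2 n3 "lowrank k1 k3 U V (Z E)" "\<lambda>a b c. lowrank k1 k3 U V (Z N) a b c + (- R1 a b c + - R2 a b c)"]
      tfrob_triangle[of n1 n2 n3 "lowrank k1 k3 U V (Z N)" "\<lambda>a b c. - R1 a b c + - R2 a b c"]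
      tfrob_triangle[of n1 n2 n3 "\<lambda>a b c. - R1 a b c" "\<lambda>a b c. - R2 a b c"]
    unfolding tfrob_uminus by simp
  also have "tfrob n1 n2 n3 (lowrank k1 k3 U V (Z E)) \<le> tfrob k1 n2 k3 (Z E)"
    by (rule tfrob_ttprod_le[OF orth_contr[OF U] orth_contr[OF V]])
  also have "tfrob n1 n2 n3 (lowrank k1 k3 U V (Z N)) \<le> tfrob k1 n2 k3 (Z N)"
    by (rule tfrob_ttprod_le[OF orth_contr[OF U] orth_contr[OF V]])
  finally show ?thesis using r1 r2 unfolding Z_def by linarith
qed

lemma vnorm_core:
  assumes Vs: "orth n3 k3 Vs"
  shows "vnorm ({..<n2} \<times> {..<n3}) (tmv {..<k1} (\<lambda>j (b, c). \<Sum>k<k3. Vs c k * W j b k) r) = vnorm ({..<n2} \<times> {..<k3}) (tmv {..<k1} (core W) r)"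
proof -
  have eq: "tmv {..<k1} (\<lambda>j (b, c). \<Sum>k<k3. Vs c k * W j b k) r (b, c) = mv {..<k3} Vs (\<lambda>k. tmv {..<k1} (core W) r (b, k)) c" for b c
    unfolding mv_def tmv_def core_def prod.case sum_distrib_left sum_distrib_right
    by (subst sum.swap) (simp add: algebra_simps)
  have "(\<Sum>c<n3. (tmv {..<k1} (\<lambda>j (b, c). \<Sum>k<k3. Vs c k * W j b k) r (b, c))^2) = (\<Sum>k<k3. (tmv {..<k1} (core W) r (b, k))^2)" for b
    using orth_vnorm[OF Vs, of "\<lambda>k. tmv {..<k1} (core W) r (b, k)"]
    unfolding eq vnorm_sq[symmetric] by (simp only:)
  then have "(vnorm ({..<n2} \<times> {..<n3}) (tmv {..<k1} (\<lambda>j (b, c). \<Sum>k<k3. Vs c k * W j b k) r))^2 = (vnorm ({..<n2} \<times> {..<k3}) (tmv {..<k1} (core W) r))^2"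
    unfolding vnorm_sq by (simp only: sum.cartesian_product')
  then show ?thesis by (simp add: power2_eq_iff_nonneg)
qed

context half_step
begin

text \<open>The first subspace comes from the whole unfolding: since \<open>Vs\<close> is
  orthonormal the uncontracted core has the same norms, so c = 1, and k1 columns that each see a
  perturbation of spectral size g give the initial error 2 sqrt k1 g.\<close>

lemma init:
  assumes g0: "\<And>w. vnorm ({..<n2} \<times> {..<n3}) (tmv {..<n1} (unf (\<lambda>a b c. E a b c + N a b c)) w) \<le> g * vnorm {..<n1} w"
    and L: "lead ({..<n2} \<times> {..<n3}) n1 (unf Y) k1 U"
  shows "angle U" "delta U \<le> 2 * (sqrt (real k1) * g)"
proof -
  let ?B = "\<lambda>j (b, c). \<Sum>k<k3. Vs c k * W j b k"
  have M: "unf Y i j = (\<Sum>l<k1. Us i l * ?B l j) + unf (\<lambda>a b c. E a b c + N a b c) i j" for i j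
    by (cases j) (simp add: unf_def lowrank_def)
  have c: "1 * vnorm C (tmv {..<k1} (core W) r) \<le> vnorm ({..<n2} \<times> {..<n3}) (tmv {..<k1} ?B r)" for r
    by (simp add: vnorm_core[OF Vs])
  show "angle U" unfolding angle_def
  proof (intro allI impI)
    fix z assume z: "\<forall>l<k1. dot {..<n1} (\<lambda>i. U i l) z = 0"
    have "1 * s * vnorm {..<k1} (tmv {..<n1} Us z) \<le> 2 * g * vnorm {..<n1} z"
      by (rule step_spectral[OF L M g0 g(2) c _ s(1) z]) simp
    also have "\<dots> \<le> 2 * (45 / 1000 * s) * vnorm {..<n1} z"
      using gs by (intro mult_right_mono) auto
    finally have "s * vnorm {..<k1} (tmv {..<n1} Us z) \<le> s * (90 / 1000 * vnorm {..<n1} z)"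
      by (simp add: algebra_simps)
    then have "vnorm {..<k1} (tmv {..<n1} Us z) \<le> 90 / 1000 * vnorm {..<n1} z"
      using s(2) by simp
    then show "vnorm {..<k1} (tmv {..<n1} Us z) \<le> 1 / 11 * vnorm {..<n1} z"
      using vnorm_nonneg[of "{..<n1}" z] by linarith
  qed
  have "1 * delta U \<le> 2 * (sqrt (real k1) * g)"
  proof (rule step_frobenius[OF L Us M _ _ c])
    fix Q assume Q: "sub_orth n1 k1 Q"
    have "(\<Sum>j\<in>{..<n2} \<times> {..<n3}. (vnorm {..<k1} (tmv {..<n1} Q (\<lambda>i. unf (\<lambda>a b c. E a b c + N a b c) i j)))^2)
      = (\<Sum>l<k1. (vnorm ({..<n2} \<times> {..<n3}) (tmv {..<n1} (unf (\<lambda>a b c. E a b c + N a b c)) (\<lambda>i. Q i l)))^2)"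
      unfolding vnorm_sq by (subst sum.swap) (simp add: tmv_dot dot_commute)
    also have "\<dots> \<le> (\<Sum>l<k1. g^2)"
    proof (rule sum_mono)
      fix l assume l: "l \<in> {..<k1}"
      have "(vnorm {..<n1} (\<lambda>i. Q i l))^2 \<le> 1" using Q l unfolding vnorm_sq_dot sub_orth_def by auto
      then have "(vnorm {..<n1} (\<lambda>i. Q i l))^2 \<le> 1^2" by simp
      then have "vnorm {..<n1} (\<lambda>i. Q i l) \<le> 1" by (rule power2_le_imp_le) simp
      then have "g * vnorm {..<n1} (\<lambda>i. Q i l) \<le> g * 1" using g(2) by (intro mult_left_mono)
      then have "vnorm ({..<n2} \<times> {..<n3}) (tmv {..<n1} (unf (\<lambda>a b c. E a b c + N a b c)) (\<lambda>i. Q i l)) \<le> g"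
        using g0[of "\<lambda>i. Q i l"] by linarith
      then show "(vnorm ({..<n2} \<times> {..<n3}) (tmv {..<n1} (unf (\<lambda>a b c. E a b c + N a b c)) (\<lambda>i. Q i l)))^2 \<le> g^2"
        by (intro power_mono) auto
    qed
    also have "\<dots> = (sqrt (real k1) * g)^2" by (simp add: power_mult_distrib)
    finally show "(\<Sum>j\<in>{..<n2} \<times> {..<n3}. (vnorm {..<k1} (tmv {..<n1} Q (\<lambda>i. unf (\<lambda>a b c. E a b c + N a b c) i j)))^2)
      \<le> (sqrt (real k1) * g)^2" .
  qed (use g(2) in simp_all)
  then show "delta U \<le> 2 * (sqrt (real k1) * g)" by simp
qed

end

text \<open>Two half-steps multiply the error by (2 / 0.995)^2 th1 th3, about 4.04 th1 th3. Taking 5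
  th1 th3 as ratio, which is at most 5 / 576, leaves room to keep the constant terms at 2.03 a +
  0.18 b for u and at 2.21 (a + b) for the sum.\<close>

lemma recursion_bound:
  fixes u v :: "nat \<Rightarrow> real"
  assumes pos: "0 \<le> a" "0 \<le> b" "0 \<le> th1" "th1 \<le> 1 / 24" "0 \<le> th3" "th3 \<le> 1 / 24"
    and u: "\<And>t. 995 / 1000 * u (Suc t) \<le> 2 * (a + th3 * v t)"
    and v: "\<And>t. 995 / 1000 * v t \<le> 2 * (b + th1 * u t)"
    and u0: "0 \<le> u 0"
  shows "u t + v t \<le> 221 / 100 * (a + b) + 109 / 100 * (5 * (th1 * th3))^t * u 0"
proof -
  define rho where "rho = 5 * (th1 * th3)"
  have th: "th1 * th3 \<le> 1 / 24 * (1 / 24)" using pos by (intro mult_mono) auto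
  have rho: "0 \<le> rho" "rho \<le> 5 / 576" using pos th by (simp_all add: rho_def)
  have b3: "th3 * b \<le> 1 / 24 * b" using pos by (intro mult_right_mono) auto
  have main: "u t \<le> 203 / 100 * a + 18 / 100 * b + rho^t * u 0" for t
  proof (induction t)
    case 0
    then show ?case using pos by simp
  next
    case (Suc t)
    have "995 / 1000 * (th3 * v t) \<le> 2 * (th3 * b + th3 * (th1 * u t))"
      using mult_left_mono[OF v[of t] pos(5)] by (simp add: algebra_simps)
    moreover have "th3 * (th1 * u t) \<le> 1 / 5 * (rho * (203 / 100 * a + 18 / 100 * b + rho^t * u 0))"
      using mult_left_mono[OF Suc rho(1)] by (simp add: rho_def mult_ac)
    moreover have "rho * (203 / 100 * a + 18 / 100 * b + rho^t * u 0)
      = 203 / 100 * (rho * a) + 18 / 100 * (rho * b) + rho^Suc t * u 0" by (simp add: algebra_simps)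
    moreover have "rho * a \<le> 5 / 576 * a" "rho * b \<le> 5 / 576 * b"
      using mult_right_mono[OF rho(2) pos(1)] mult_right_mono[OF rho(2) pos(2)] by simp_all
    moreover have "0 \<le> rho^Suc t * u 0" using rho u0 by simp
    ultimately show ?case using u[of t] b3 pos by argo
  qed
  have "995 / 1000 * v t \<le> 2 * (b + 1 / 24 * (203 / 100 * a + 18 / 100 * b + rho^t * u 0))"
  proof -
    have nn: "0 \<le> 203 / 100 * a + 18 / 100 * b + rho^t * u 0" using pos rho u0 by simp
    have "th1 * u t \<le> th1 * (203 / 100 * a + 18 / 100 * b + rho^t * u 0)" using main pos by (intro mult_left_mono) auto
    also have "\<dots> \<le> 1 / 24 * (203 / 100 * a + 18 / 100 * b + rho^t * u 0)" using pos nn by (intro mult_right_mono) auto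
    finally have x: "th1 * u t \<le> 1 / 24 * (203 / 100 * a + 18 / 100 * b + rho^t * u 0)" .
    have y: "th1 * u t \<le> R \<Longrightarrow> 995 / 1000 * v t \<le> 2 * (b + R)" for R using v[of t] by argo
    show ?thesis by (rule y[OF x])
  qed
  moreover have "0 \<le> rho^t * u 0" using rho u0 by simp
  ultimately show ?thesis using main[of t] pos unfolding rho_def by argo
qed

text \<open>One interpretation of \<open>half_step\<close> updates U, the other, on flipped tensors,
  updates V. The angles are propagated alternately first, because the error recursion is available
  only for aligned frames.\<close>

lemma hooi_error:
  fixes J K :: nat
  assumes A: "half_step d1 d2 d3 J K Us Vs W E N F eps1 bV g1 s1"
    and B: "half_step d3 d2 d1 K J Vs Us (flip W) (flip E) (flip N) F eps3 bU g3 s3"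
    and g0: "\<And>w. vnorm ({..<d2} \<times> {..<d3}) (tmv {..<d1} (unf (\<lambda>a b c. E a b c + N a b c)) w) \<le> g1 * vnorm {..<d1} w"
    and th: "bV \<le> s3 / 24" "bU \<le> s1 / 24"
    and hard: "hardtth d1 d2 d3 J K T (\<lambda>a b c. lowrank J K Us Vs W a b c + (E a b c + N a b c)) Tt"
    and Sb: "\<And>U V. orth d1 J U \<Longrightarrow> orth d3 K V \<Longrightarrow> tfrob J d2 K (mode1T d1 U (mode3T d3 V E)) \<le> Sb"
  shows "tfrob d1 d2 d3 (\<lambda>a b c. Tt a b c - (lowrank J K Us Vs W a b c + E a b c))
    \<le> tfrob d1 d2 d3 E + Sb + F + 221 / 100 * (2 * F + sqrt (real J) * eps1 + sqrt (real K) * eps3)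
      + 109 / 100 * (5 * (bU * bV / (s1 * s3)))^T * (2 * (sqrt (real J) * g1))"
proof -
  interpret A: half_step d1 d2 d3 J K Us Vs W E N F eps1 bV g1 s1 by (rule A)
  interpret B: half_step d3 d2 d1 K J Vs Us "flip W" "flip E" "flip N" F eps3 bU g3 s3 by (rule B)
  let ?Y = "\<lambda>a b c. lowrank J K Us Vs W a b c + (E a b c + N a b c)"
  have fY: "flip ?Y = B.Y" unfolding flip_lowrank[symmetric] by (simp add: flip_def)
  obtain U V where L0: "lead_lsv d1 (d2 * d3) (m1 d2 d3 ?Y) J (U 0)"
    and LV0: "lead_lsv d3 (J * d2) (m3 d2 (mode1T d1 (U 0) ?Y)) K (V 0)"
    and LT: "\<forall>t\<in>{1..T}. lead_lsv d1 (d2 * K) (m1 d2 K (mode3T d3 (V (t - 1)) ?Y)) J (U t) \<and>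
         lead_lsv d3 (J * d2) (m3 d2 (mode1T d1 (U t) ?Y)) K (V t)"
    and Tt: "Tt = ttprod J K (U T) (V T) (mode1T d1 (U T) (mode3T d3 (V T) ?Y))"
    using hard unfolding hardtth_def by blast
  have oU: "orth d1 J (U t)" if "t \<le> T" for t
    using L0 LT that by (cases t) (auto simp: lead_lsv_def)
  have oV: "orth d3 K (V t)" if "t \<le> T" for t
    using LV0 LT that by (cases t) (auto simp: lead_lsv_def)
  have lV: "lead ({..<d2} \<times> {..<J}) d3 (con d1 (U t) B.Y) K (V t)" if "t \<le> T" for t
  proof -
    have "lead_lsv d3 (J * d2) (m3 d2 (mode1T d1 (U t) ?Y)) K (V t)" using LV0 LT that by (cases t) auto
    from lead_m3[OF this] show ?thesis unfolding fY[symmetric] con_unf3 .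
  qed
  have lU: "lead ({..<d2} \<times> {..<K}) d1 (con d3 (V t) ?Y) J (U (Suc t))" if "Suc t \<le> T" for t
  proof -
    have "lead_lsv d1 (d2 * K) (m1 d2 K (mode3T d3 (V t) ?Y)) J (U (Suc t))" using LT that by force
    from lead_m1[OF this] show ?thesis unfolding con_unf1 .
  qed
  note i0 = A.init[OF g0 lead_m1[OF L0]]
  have angU: "A.angle (U t)" and angV: "B.angle (V t)" if "t \<le> T" for t
  proof -
    have V_from_U: "B.angle (V t)" if "t \<le> T" "A.angle (U t)" for t
    proof (rule B.angle_step[OF oU _ lV])
      show "B.aligned (U t)" unfolding B.aligned_def using A.angle_aligned[OF oU[OF that(1)] that(2)] by blast
    qed (use that in auto)
    have "A.angle (U t)" if "t \<le> T" for t using that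
    proof (induction t)
      case 0
      then show ?case using i0(1) by simp
    next
      case (Suc t)
      then have "B.angle (V t)" using V_from_U by simp
      then have "A.aligned (V t)" unfolding A.aligned_def using B.angle_aligned[OF oV] Suc.prems by simp
      then show ?case using A.angle_step[OF oV _ lU] Suc.prems by simp
    qed
    then show "A.angle (U t)" "B.angle (V t)" using that V_from_U by auto
  qed
  have alU: "B.aligned (U t)" if "t \<le> T" for t
    unfolding B.aligned_def using A.angle_aligned[OF oU[OF that] angU[OF that]] by blast
  have alV: "A.aligned (V t)" if "t \<le> T" for t
    unfolding A.aligned_def using B.angle_aligned[OF oV[OF that] angV[OF that]] by blast
  \<comment> \<open>Extended by 0 beyond iteration T so that the recursion holds for every index; it
    is then evaluated at T.\<close>
  define v where "v = (\<lambda>t. if t \<le> T then B.delta (V t) else 0)"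
  define u' where "u' = (\<lambda>t. if t \<le> T then A.delta (U t) else 0)"
  define a where "a = F + sqrt (real J) * eps1"
  define b where "b = F + sqrt (real K) * eps3"
  have ab: "0 \<le> a" "0 \<le> b" using A.F0 A.eps(2) B.eps(2) by (simp_all add: a_def b_def)
  have th1: "0 \<le> bU / s1" "bU / s1 \<le> 1 / 24" and th3: "0 \<le> bV / s3" "bV / s3 \<le> 1 / 24"
    using th A.s(2) B.s(2) A.beta(2) B.beta(2) by (simp_all add: divide_le_eq)
  have "u' T + v T \<le> 221 / 100 * (a + b) + 109 / 100 * (5 * ((bU / s1) * (bV / s3)))^T * u' 0"
  proof (rule recursion_bound[OF ab th1 th3])
    fix t
    show "995 / 1000 * u' (Suc t) \<le> 2 * (a + bV / s3 * v t)"
    proof (cases "Suc t \<le> T")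
      case True
      then have t: "t \<le> T" by simp
      have "bV * rfrob d3 K (V t) Vs \<le> bV / s3 * B.delta (V t)"
      proof -
        have "bV / s3 * (s3 * rfrob d3 K (V t) Vs) \<le> bV / s3 * B.delta (V t)"
          by (rule mult_left_mono[OF B.rfrob_delta th3(1)])
        then show ?thesis using B.s(2) by simp
      qed
      then show ?thesis using A.delta_step[OF oV[OF t] alV[OF t] lU[OF True]] True t
        by (simp add: u'_def v_def a_def)
    next
      case False
      have "0 \<le> v t" by (simp add: v_def)
      then have "0 \<le> bV / s3 * v t" using th3(1) by (intro mult_nonneg_nonneg)
      then show ?thesis using False ab by (simp add: u'_def)
    qed
    show "995 / 1000 * v t \<le> 2 * (b + bU / s1 * u' t)"
    proof (cases "t \<le> T")
      case True
      have "bU * rfrob d1 J (U t) Us \<le> bU / s1 * A.delta (U t)"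
      proof -
        have "bU / s1 * (s1 * rfrob d1 J (U t) Us) \<le> bU / s1 * A.delta (U t)"
          by (rule mult_left_mono[OF A.rfrob_delta th1(1)])
        then show ?thesis using A.s(2) by simp
      qed
      then show ?thesis using B.delta_step[OF oU[OF True] alU[OF True] lV[OF True]] True
        by (simp add: u'_def v_def b_def)
    next
      case False
      then show ?thesis using ab by (simp add: u'_def v_def)
    qed
  qed (simp add: u'_def)
  also have "\<dots> \<le> 221 / 100 * (a + b) + 109 / 100 * (5 * ((bU / s1) * (bV / s3)))^T * (2 * (sqrt (real J) * g1))"
  proof (rule add_left_mono, rule mult_left_mono)
    show "0 \<le> 109 / 100 * (5 * ((bU / s1) * (bV / s3)))^T"
      by (intro mult_nonneg_nonneg zero_le_power th1(1) th3(1)) simp_all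
  qed (use i0(2) in \<open>simp add: u'_def\<close>)
  finally have uv: "A.delta (U T) + B.delta (V T) \<le> 221 / 100 * (a + b)
      + 109 / 100 * (5 * (bU * bV / (s1 * s3)))^T * (2 * (sqrt (real J) * g1))"
    by (simp add: u'_def v_def)
  have Nf: "tfrob J d2 K (mode1T d1 (U T) (mode3T d3 (V T) N)) \<le> F"
    using A.F[OF orth_contr[OF oU] orth_contr[OF oV], of T T] unfolding tfrob_con by simp
  have rec: "tfrob d1 d2 d3 (\<lambda>a b c. Tt a b c - (lowrank J K Us Vs W a b c + E a b c))
    \<le> tfrob d1 d2 d3 E + tfrob J d2 K (mode1T d1 (U T) (mode3T d3 (V T) E)) + tfrob J d2 K (mode1T d1 (U T) (mode3T d3 (V T) N))
      + A.delta (U T) + B.delta (V T)"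
    unfolding Tt lowrank_ttprod[symmetric]
    by (rule reconstruction_error[OF oU oV A.Us A.Vs]) simp_all
  have Sb': "tfrob J d2 K (mode1T d1 (U T) (mode3T d3 (V T) E)) \<le> Sb" by (rule Sb[OF oU oV]) simp_all
  have comb: "x \<le> e + sb + F + 221 / 100 * (2 * F + e1 + e3) + w"
    if "x \<le> e + y + z + p1 + p2" "y \<le> sb" "z \<le> F" "p1 + p2 \<le> 221 / 100 * (F + e1 + (F + e3)) + w"
    for x e y z p1 p2 sb e1 e3 w :: real
    using that by argo
  show ?thesis by (rule comb[OF rec Sb' Nf uv[unfolded a_def b_def]])
qed

section \<open>Noise of the rearranged covariance\<close>

lemma opnorm_reindex:
  assumes f: "bij_betw f E D"
  shows "opnorm D D A = opnorm E E (\<lambda>m n. A (f m) (f n))"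
proof -
  have s: "(\<Sum>n\<in>D. g n) = (\<Sum>n\<in>E. g (f n))" for g :: "'b \<Rightarrow> real"
    by (rule sum.reindex_bij_betw[OF f, symmetric])
  have v: "vnorm D g = vnorm E (\<lambda>m. g (f m))" for g unfolding vnorm_def s ..
  have "{vnorm D (\<lambda>i. \<Sum>j\<in>D. A i j * x j) | x. vnorm D x \<le> 1}
      = {vnorm E (\<lambda>i. \<Sum>j\<in>E. A (f i) (f j) * x j) | x. vnorm E x \<le> 1}"
  proof (intro equalityI subsetI)
    fix t assume "t \<in> {vnorm D (\<lambda>i. \<Sum>j\<in>D. A i j * x j) | x. vnorm D x \<le> 1}"
    then obtain x where "t = vnorm D (\<lambda>i. \<Sum>j\<in>D. A i j * x j)" "vnorm D x \<le> 1" by blast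
    then show "t \<in> {vnorm E (\<lambda>i. \<Sum>j\<in>E. A (f i) (f j) * x j) | x. vnorm E x \<le> 1}"
      unfolding v s by (intro CollectI exI[of _ "\<lambda>m. x (f m)"]) simp
  next
    fix t assume "t \<in> {vnorm E (\<lambda>i. \<Sum>j\<in>E. A (f i) (f j) * x j) | x. vnorm E x \<le> 1}"
    then obtain x where x: "t = vnorm E (\<lambda>i. \<Sum>j\<in>E. A (f i) (f j) * x j)" "vnorm E x \<le> 1" by blast
    define y where "y = (\<lambda>i. x (inv_into E f i))"
    have y: "y (f m) = x m" if "m \<in> E" for m
      unfolding y_def using f that by (simp add: bij_betw_def)
    have "t = vnorm D (\<lambda>i. \<Sum>j\<in>D. A i j * y j)" unfolding v s x(1) using y by (intro vnorm_cong sum.cong) auto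
    moreover have "vnorm D y \<le> 1" unfolding v using x(2) y vnorm_cong[of E "\<lambda>m. y (f m)" x] by simp
    ultimately show "t \<in> {vnorm D (\<lambda>i. \<Sum>j\<in>D. A i j * x j) | x. vnorm D x \<le> 1}" by blast
  qed
  then show ?thesis by (simp add: opnorm_def)
qed

lemma opnorm_ge_diag:
  assumes "finite I" "i \<in> I"
  shows "\<bar>A i i\<bar> \<le> opnorm I I A"
proof -
  let ?e = "\<lambda>j. if j = i then 1 else 0 :: real"
  have ne: "vnorm I ?e = 1" using assms by (simp add: vnorm_def if_distrib[where f="\<lambda>x. x^2"] cong: if_cong)
  have m: "mv I A ?e j = A j i" for j using assms by (simp add: mv_def mult_ite cong: if_cong)
  have "dot I ?e (mv I A ?e) = A i i" unfolding m dot_def using assms by (simp add: mult_ite cong: if_cong)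
  then have "\<bar>A i i\<bar> \<le> vnorm I ?e * vnorm I (mv I A ?e)" using dot_le[of I ?e "mv I A ?e"] by simp
  also have "\<dots> \<le> vnorm I ?e * (opnorm I I A * vnorm I ?e)"
    by (intro mult_left_mono vnorm_mv_le assms(1)) simp
  finally show ?thesis unfolding ne by simp
qed

lemma opnorm_singleton: "opnorm {x} {x} A \<le> \<bar>A x x\<bar>"
  by (rule opnorm_leI) (simp_all add: mv_def vnorm_def abs_mult)

lemma sum_square: "(\<Sum>u<p^2. f u) = (\<Sum>a<p. \<Sum>a'<p. f (a * p + a' :: nat) :: 'b :: comm_monoid_add)"
proof -
  have "(\<Sum>u<p * p. f u) = (\<Sum>x\<in>{..<p} \<times> {..<p}. f (fst x * p + snd x))"
  proof (rule sum.reindex_bij_witness[where i="\<lambda>x. fst x * p + snd x" and j="\<lambda>u. (u div p, u mod p)"])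
    fix u assume u: "u \<in> {..<p * p}"
    then have "0 < p" by (cases p) auto
    then show "(u div p, u mod p) \<in> {..<p} \<times> {..<p}" using u by (simp add: less_mult_imp_div_less)
  next
    fix x assume x: "x \<in> {..<p} \<times> {..<p}"
    have "fst x * p + snd x < (fst x + 1) * p" using x by auto
    also have "\<dots> \<le> p * p" using x by (intro mult_right_mono) auto
    finally show "fst x * p + snd x \<in> {..<p * p}" by simp
  qed auto
  then show ?thesis by (simp add: power2_eq_square sum.cartesian_product')
qed

lemma Rearr_at:
  assumes "a < p" "a' < p" "b < q" "b' < q" "c < r" "c' < r"
  shows "Rearr p q r A (a * p + a') (b * q + b') (c * r + c') = A (kidx q r a b c) (kidx q r a' b' c')"
  using assms by (simp add: Rearr_def kidx_def)

lemma sum_Rearr: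
  "(\<Sum>u<p^2. \<Sum>v<q^2. \<Sum>w<r^2. Rearr p q r A u v w * f u v w)
   = (\<Sum>a<p. \<Sum>a'<p. \<Sum>b<q. \<Sum>b'<q. \<Sum>c<r. \<Sum>c'<r. A (kidx q r a b c) (kidx q r a' b' c') * f (a * p + a') (b * q + b') (c * r + c'))"
  unfolding sum_square by (intro sum.cong refl) (simp add: Rearr_at)

lemma sum_V:
  "(\<Sum>m\<in>tri.D p q r. \<Sum>n\<in>tri.D p q r. R m n * tri.V J K x y z m n)
   = (\<Sum>a<p. \<Sum>a'<p. \<Sum>b<q. \<Sum>b'<q. \<Sum>c<r. \<Sum>c'<r. R (a, b, c) (a', b', c') * (\<Sum>j<J. \<Sum>k<K. x (a, a', j) * y (j, b, b', k) * z (c, c', k)))"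
proof -
  have "(\<Sum>m\<in>tri.D p q r. \<Sum>n\<in>tri.D p q r. R m n * tri.V J K x y z m n)
    = (\<Sum>a<p. \<Sum>a'<p. \<Sum>b<q. \<Sum>b'<q. \<Sum>c<r. \<Sum>c'<r. R (a, b, c) (a', b', c') * tri.V J K x y z (a, b, c) (a', b', c'))"
    unfolding tri.D_def
    by (subst sum_pairs, rule sum.cong[OF refl], rule sum.cong[OF refl], rule sum_pairs)
  then show ?thesis by (simp only: tri.V_def prod.case)
qed

text \<open>A Euclidean norm is the supremum of pairings with unit vectors; this turns the unit
  tensor y of the trilinear bound into a Frobenius norm.\<close>

lemma vnorm_by_duality:
  assumes "\<And>y. (\<Sum>i\<in>I. (y i)^2) \<le> 1 \<Longrightarrow> dot I g y \<le> c"
  shows "vnorm I g \<le> c"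
proof (cases "vnorm I g = 0")
  case True
  then show ?thesis using assms[of "\<lambda>_. 0"] by (simp add: dot_def)
next
  case False
  then have n: "0 < vnorm I g" by (simp add: less_le)
  define y where "y = (\<lambda>i. (1 / vnorm I g) * g i)"
  have "(vnorm I y)^2 = 1" unfolding y_def vnorm_scale using n by simp
  then have "dot I g y \<le> c" by (intro assms) (simp add: vnorm_sq)
  moreover have "dot I g y = vnorm I g"
    unfolding y_def dot_scale_right vnorm_sq_dot[symmetric] using n by (simp add: power2_eq_square)
  ultimately show ?thesis by simp
qed

text \<open>y ranges over the dual unit ball, while \<open>U\<close> and \<open>Z\<close>, read with
  pair indices (a, a') and (c, c'), are the contractions x and z.\<close>

lemma noise_tfrob:
  assumes main: "trilinear_le p q r J K A B"
    and U: "contr (p^2) J U" and Z: "contr (r^2) K Z"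
  shows "tfrob J (q^2) K (mode1T (p^2) U (mode3T (r^2) Z (Rearr p q r A))) \<le> B"
proof -
  define G where "G = mode1T (p^2) U (mode3T (r^2) Z (Rearr p q r A))"
  let ?S = "{..<J} \<times> {..<q^2} \<times> {..<K}"
  have "vnorm ?S (\<lambda>(j, v, k). G j v k) \<le> B"
  proof (rule vnorm_by_duality)
    fix y' :: "nat \<times> nat \<times> nat \<Rightarrow> real" assume y': "(\<Sum>i\<in>?S. (y' i)^2) \<le> 1"
    define x where "x = (\<lambda>(a, a', j). U (a * p + a') j)"
    define z where "z = (\<lambda>(c, c', k). Z (c * r + c') k)"
    define y where "y = (\<lambda>(j, b, b', k). y' (j, b * q + b', k))"
    have xc: "(\<Sum>a<p. \<Sum>a'<p. (\<Sum>j<J. x (a, a', j) * f j)^2) \<le> (\<Sum>j<J. (f j)^2)" for f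
    proof -
      have "(vnorm {..<p^2} (mv {..<J} U f))^2 \<le> (vnorm {..<J} f)^2"
        using U by (intro power_mono) (auto simp: contr_def)
      then show ?thesis unfolding vnorm_sq sum_square by (simp add: mv_def x_def)
    qed
    have zc: "(\<Sum>c<r. \<Sum>c'<r. (\<Sum>k<K. z (c, c', k) * f k)^2) \<le> (\<Sum>k<K. (f k)^2)" for f
    proof -
      have "(vnorm {..<r^2} (mv {..<K} Z f))^2 \<le> (vnorm {..<K} f)^2"
        using Z by (intro power_mono) (auto simp: contr_def)
      then show ?thesis unfolding vnorm_sq sum_square by (simp add: mv_def z_def)
    qed
    have y1: "(\<Sum>j<J. \<Sum>k<K. \<Sum>b<q. \<Sum>b'<q. (y (j, b, b', k))^2) \<le> 1"
    proof -
      have "(\<Sum>i\<in>?S. (y' i)^2) = (\<Sum>j<J. \<Sum>v<q^2. \<Sum>k<K. (y' (j, v, k))^2)" by (simp only: sum.cartesian_product')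
      also have "\<dots> = (\<Sum>j<J. \<Sum>k<K. \<Sum>v<q^2. (y' (j, v, k))^2)" by (intro sum.cong refl sum.swap)
      finally show ?thesis using y' unfolding sum_square by (simp add: y_def)
    qed
    have Gv: "G j v k = (\<Sum>u<p^2. \<Sum>w<r^2. U u j * Z w k * Rearr p q r A u v w)" for j v k
      unfolding G_def mode1T_def mode3T_def sum_distrib_left by (simp add: mult.assoc)
    have "dot ?S (\<lambda>(j, v, k). G j v k) y' = (\<Sum>j<J. \<Sum>v<q^2. \<Sum>k<K. \<Sum>u<p^2. \<Sum>w<r^2. U u j * Z w k * Rearr p q r A u v w * y' (j, v, k))"
      unfolding dot_def Gv by (simp only: sum.cartesian_product' prod.case sum_distrib_right)
    also have "\<dots> = (\<Sum>v<q^2. \<Sum>j<J. \<Sum>k<K. \<Sum>u<p^2. \<Sum>w<r^2. U u j * Z w k * Rearr p q r A u v w * y' (j, v, k))"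
      by (rule sum.swap)
    also have "\<dots> = (\<Sum>v<q^2. \<Sum>u<p^2. \<Sum>w<r^2. \<Sum>j<J. \<Sum>k<K. U u j * Z w k * Rearr p q r A u v w * y' (j, v, k))"
      by (rule sum.cong[OF refl], rule sum_swap22)
    also have "\<dots> = (\<Sum>u<p^2. \<Sum>v<q^2. \<Sum>w<r^2. \<Sum>j<J. \<Sum>k<K. U u j * Z w k * Rearr p q r A u v w * y' (j, v, k))"
      by (rule sum.swap)
    also have "\<dots> = (\<Sum>u<p^2. \<Sum>v<q^2. \<Sum>w<r^2. Rearr p q r A u v w * (\<Sum>j<J. \<Sum>k<K. U u j * y' (j, v, k) * Z w k))"
      unfolding sum_distrib_left by (intro sum.cong refl) (simp add: algebra_simps)
    also have "\<dots> = (\<Sum>m\<in>tri.D p q r. \<Sum>n\<in>tri.D p q r. (\<lambda>(a, b, c) (a', b', c'). A (kidx q r a b c) (kidx q r a' b' c')) m n * tri.V J K x y z m n)"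
      unfolding sum_Rearr sum_V by (simp add: x_def y_def z_def)
    also have "\<dots> = (\<Sum>(a, b, c)\<in>tri.D p q r. \<Sum>(a', b', c')\<in>tri.D p q r. A (kidx q r a b c) (kidx q r a' b' c') * tri.V J K x y z (a, b, c) (a', b', c'))"
      by (simp only: case_prod_unfold prod.collapse)
    also have "\<dots> \<le> B" using main xc zc y1 unfolding trilinear_le_def by blast
    finally show "dot ?S (\<lambda>(j, v, k). G j v k) y' \<le> B" .
  qed
  then show ?thesis by (simp add: tfrob_vnorm G_def)
qed

text \<open>The normalised v is a contraction with a single column, so the Frobenius bound at ranks
  (J, 1) becomes a spectral bound in the third mode.\<close>

lemma noise_spectral3:
  assumes "\<And>U Z. contr (p^2) J U \<Longrightarrow> contr (r^2) 1 Z \<Longrightarrow> tfrob J d2 1 (mode1T (p^2) U (mode3T (r^2) Z X)) \<le> B" "0 \<le> B"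
    and U: "contr (p^2) J U"
  shows "vnorm ({..<d2} \<times> {..<J}) (tmv {..<r^2} (con (p^2) U (flip X)) v) \<le> B * vnorm {..<r^2} v"
proof (cases "vnorm {..<r^2} v = 0")
  case True
  then have "tmv {..<r^2} (con (p^2) U (flip X)) v = (\<lambda>j. 0)" by (simp add: tmv_def vnorm_eq_0)
  then show ?thesis using assms(2) by simp
next
  case False
  then have n: "0 < vnorm {..<r^2} v" by (simp add: less_le)
  define w where "w = (\<lambda>i. (1 / vnorm {..<r^2} v) * v i)"
  have w1: "vnorm {..<r^2} w = 1" unfolding w_def vnorm_scale using n by simp
  define Z where "Z = (\<lambda>c (k::nat). w c)"
  have "contr (r^2) 1 Z" unfolding contr_def
  proof
    fix y
    have "mv {..<1} Z y = (\<lambda>i. y 0 * w i)" by (simp add: mv_def Z_def mult.commute)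
    then show "vnorm {..<r^2} (mv {..<1} Z y) \<le> vnorm {..<1} y"
      by (simp only: vnorm_scale w1) (simp add: vnorm_def)
  qed
  from assms(1)[OF U this] have le: "tfrob J d2 1 (mode1T (p^2) U (mode3T (r^2) Z X)) \<le> B" .
  have val: "tmv {..<r^2} (con (p^2) U (flip X)) w (b, j) = mode1T (p^2) U (mode3T (r^2) Z X) j b 0" for b j
    unfolding tmv_def con_def mode1T_def mode3T_def flip_def Z_def prod.case sum_distrib_left sum_distrib_right
    by (subst sum.swap) (simp add: algebra_simps)
  have "(vnorm ({..<d2} \<times> {..<J}) (tmv {..<r^2} (con (p^2) U (flip X)) w))^2
     = (\<Sum>b<d2. \<Sum>j<J. (mode1T (p^2) U (mode3T (r^2) Z X) j b 0)^2)"
    unfolding vnorm_sq by (simp only: sum.cartesian_product' val)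
  also have "\<dots> = (\<Sum>j<J. \<Sum>b<d2. (mode1T (p^2) U (mode3T (r^2) Z X) j b 0)^2)" by (rule sum.swap)
  also have "\<dots> = (tfrob J d2 1 (mode1T (p^2) U (mode3T (r^2) Z X)))^2" unfolding tfrob_sq by simp
  finally have "vnorm ({..<d2} \<times> {..<J}) (tmv {..<r^2} (con (p^2) U (flip X)) w) = tfrob J d2 1 (mode1T (p^2) U (mode3T (r^2) Z X))"
    by (simp add: power2_eq_iff_nonneg)
  then have "vnorm ({..<d2} \<times> {..<J}) (tmv {..<r^2} (con (p^2) U (flip X)) w) \<le> B" using le by simp
  then show ?thesis unfolding w_def tmv_scale vnorm_scale using n by (simp add: divide_le_eq)
qed

text \<open>With trivial ranks and third dimension, x is the normalised u and y is dual to the whole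
  unfolding. Grouping (b, c) into one index permutes the columns compared with the order (b, b'),
  (c, c'), which leaves the norm unchanged.\<close>

lemma noise_spectral1:
  assumes main: "trilinear_le p (q * r) 1 1 1 A B"
    and B: "0 \<le> B"
  shows "vnorm ({..<q^2} \<times> {..<r^2}) (tmv {..<p^2} (unf (Rearr p q r A)) u) \<le> B * vnorm {..<p^2} u"
proof (cases "vnorm {..<p^2} u = 0")
  case True
  then have "tmv {..<p^2} (unf (Rearr p q r A)) u = (\<lambda>j. 0)" by (simp add: tmv_def vnorm_eq_0)
  then show ?thesis using B by simp
next
  case False
  then have n: "0 < vnorm {..<p^2} u" by (simp add: less_le)
  define w where "w = (\<lambda>i. (1 / vnorm {..<p^2} u) * u i)"
  have w1: "(\<Sum>a<p. \<Sum>a'<p. (w (a * p + a'))^2) = 1"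
  proof -
    have "(vnorm {..<p^2} w)^2 = 1" unfolding w_def vnorm_scale using n by simp
    then show ?thesis unfolding vnorm_sq sum_square .
  qed
  let ?Q = "{..<q * r} \<times> {..<q * r}"
  define G where "G = (\<lambda>(s, s'). \<Sum>a<p. \<Sum>a'<p. w (a * p + a') * A (a * (q * r) + s) (a' * (q * r) + s'))"
  have Gle: "vnorm ?Q G \<le> B"
  proof (rule vnorm_by_duality)
    fix y' :: "nat \<times> nat \<Rightarrow> real" assume y': "(\<Sum>i\<in>?Q. (y' i)^2) \<le> 1"
    define x where "x = (\<lambda>(a, a', j::nat). w (a * p + a'))"
    define z where "z = (\<lambda>_::nat \<times> nat \<times> nat. 1::real)"
    define y where "y = (\<lambda>(j::nat, b, b', k::nat). y' (b, b'))"
    have xc: "(\<Sum>a<p. \<Sum>a'<p. (\<Sum>j<1. x (a, a', j) * f j)^2) \<le> (\<Sum>j<(1::nat). (f j)^2)" for f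
      using w1 by (simp add: x_def power_mult_distrib sum_distrib_right[symmetric])
    have zc: "(\<Sum>c<1. \<Sum>c'<1. (\<Sum>k<1. z (c, c', k) * f k)^2) \<le> (\<Sum>k<(1::nat). (f k)^2)" for f
      by (simp add: z_def)
    have y1: "(\<Sum>j<(1::nat). \<Sum>k<(1::nat). \<Sum>b<q * r. \<Sum>b'<q * r. (y (j, b, b', k))^2) \<le> 1"
      using y' by (simp add: y_def sum.cartesian_product')
    have "dot ?Q G y' = (\<Sum>s<q * r. \<Sum>s'<q * r. \<Sum>a<p. \<Sum>a'<p. A (a * (q * r) + s) (a' * (q * r) + s') * (w (a * p + a') * y' (s, s')))"
      unfolding dot_def G_def by (simp only: sum.cartesian_product' prod.case sum_distrib_right)
        (simp add: algebra_simps)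
    also have "\<dots> = (\<Sum>a<p. \<Sum>a'<p. \<Sum>s<q * r. \<Sum>s'<q * r. A (a * (q * r) + s) (a' * (q * r) + s') * (w (a * p + a') * y' (s, s')))"
      by (rule sum_swap22)
    also have "\<dots> = (\<Sum>m\<in>tri.D p (q * r) 1. \<Sum>n\<in>tri.D p (q * r) 1. (\<lambda>(a, b, c) (a', b', c'). A (kidx (q * r) 1 a b c) (kidx (q * r) 1 a' b' c')) m n * tri.V 1 1 x y z m n)"
      unfolding sum_V by (simp add: x_def y_def z_def kidx_def mult.assoc)
    also have "\<dots> = (\<Sum>(a, b, c)\<in>tri.D p (q * r) 1. \<Sum>(a', b', c')\<in>tri.D p (q * r) 1. A (kidx (q * r) 1 a b c) (kidx (q * r) 1 a' b' c') * tri.V 1 1 x y z (a, b, c) (a', b', c'))"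
      by (simp only: case_prod_unfold prod.collapse)
    also have "\<dots> \<le> B" using main xc zc y1 unfolding trilinear_le_def by blast
    finally show "dot ?Q G y' \<le> B" .
  qed
  have split: "(\<Sum>s<q * r. f s) = (\<Sum>b<q. \<Sum>c<r. f (b * r + c))" for f :: "nat \<Rightarrow> real"
  proof -
    have "(\<Sum>s<q * r. f s) = (\<Sum>x\<in>{..<q} \<times> {..<r}. f (fst x * r + snd x))"
      using sum.reindex_bij_betw[OF bij_divmod[where n=q and m=r], of "\<lambda>x. f (fst x * r + snd x)"] by simp
    then show ?thesis by (simp add: sum.cartesian_product')
  qed
  have "(vnorm ({..<q^2} \<times> {..<r^2}) (tmv {..<p^2} (unf (Rearr p q r A)) w))^2
    = (\<Sum>b<q. \<Sum>b'<q. \<Sum>c<r. \<Sum>c'<r. (\<Sum>a<p. \<Sum>a'<p. Rearr p q r A (a * p + a') (b * q + b') (c * r + c') * w (a * p + a'))^2)"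
    unfolding vnorm_sq by (simp only: sum.cartesian_product' tmv_def unf_def prod.case sum_square)
  also have "\<dots> = (\<Sum>b<q. \<Sum>b'<q. \<Sum>c<r. \<Sum>c'<r. (G (b * r + c, b' * r + c'))^2)"
  proof (intro sum.cong refl)
    fix b b' c c' assume "b \<in> {..<q}" "b' \<in> {..<q}" "c \<in> {..<r}" "c' \<in> {..<r}"
    then have "(\<Sum>a<p. \<Sum>a'<p. Rearr p q r A (a * p + a') (b * q + b') (c * r + c') * w (a * p + a')) = G (b * r + c, b' * r + c')"
      unfolding G_def prod.case
      by (intro sum.cong refl) (simp only: lessThan_iff Rearr_at kidx_def add.assoc mult.assoc mult.commute[of "w _"])
    then show "(\<Sum>a<p. \<Sum>a'<p. Rearr p q r A (a * p + a') (b * q + b') (c * r + c') * w (a * p + a'))^2 = (G (b * r + c, b' * r + c'))^2"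
      by (simp only:)
  qed
  also have "\<dots> = (\<Sum>b<q. \<Sum>c<r. \<Sum>b'<q. \<Sum>c'<r. (G (b * r + c, b' * r + c'))^2)"
    by (intro sum.cong refl sum.swap)
  also have "\<dots> = (vnorm ?Q G)^2" unfolding vnorm_sq by (simp only: sum.cartesian_product' split)
  finally have "vnorm ({..<q^2} \<times> {..<r^2}) (tmv {..<p^2} (unf (Rearr p q r A)) w) = vnorm ?Q G"
    by (simp add: power2_eq_iff_nonneg)
  then have "vnorm ({..<q^2} \<times> {..<r^2}) (tmv {..<p^2} (unf (Rearr p q r A)) w) \<le> B" using Gle by simp
  then show ?thesis unfolding w_def tmv_scale vnorm_scale using n by (simp add: divide_le_eq)
qed

section \<open>Traces and effective dimensions of the covariance\<close>

lemma pd_diag: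
  assumes "sym_pd d A" "k < d"
  shows "0 < A k k"
proof -
  let ?x = "\<lambda>i. if i = k then 1 else 0 :: real"
  have "0 < (\<Sum>i<d. \<Sum>j<d. ?x i * A i j * ?x j)" using assms by (auto simp: sym_pd_def)
  also have "\<dots> = (\<Sum>i<d. if i = k then (\<Sum>j<d. if j = k then A i j else 0) else 0)"
    by (rule sum.cong) (auto simp: mult_ite cong: if_cong)
  also have "\<dots> = A k k" using assms(2) by (simp cong: if_cong)
  finally show ?thesis .
qed

lemma bij_flat: "bij_betw (\<lambda>(b, c). b * r + c) ({..<q} \<times> {..<r}) {..<q * r :: nat}"
proof (rule bij_betwI[where g="\<lambda>i. (i div r, i mod r)"])
  show "(\<lambda>i. (i div r, i mod r)) \<in> {..<q * r} \<rightarrow> {..<q} \<times> {..<r}"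
    using bij_divmod[of r q] unfolding bij_betw_def by blast
  show "(\<lambda>(b, c). b * r + c) \<in> {..<q} \<times> {..<r} \<rightarrow> {..<q * r}"
  proof
    fix x assume x: "x \<in> {..<q} \<times> {..<r}"
    obtain a b where ab: "x = (a, b)" by (cases x)
    have "a * r + b < (a + 1) * r" using x ab by simp
    also have "\<dots> \<le> q * r" using x ab by (intro mult_right_mono) auto
    finally show "(case x of (a, b) \<Rightarrow> a * r + b) \<in> {..<q * r}" by (simp add: ab)
  qed
qed auto

lemma sum_flat: "(\<Sum>s<q * r. f s) = (\<Sum>b<q. \<Sum>c<r. f (b * r + c :: nat))" for f :: "nat \<Rightarrow> 'a::comm_monoid_add"
  using sum.reindex_bij_betw[OF bij_flat, of f r q, symmetric]
  by (simp add: sum.cartesian_product' case_prod_unfold)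

definition tens :: "nat \<Rightarrow> nat \<Rightarrow> mat \<Rightarrow> nat \<times> nat \<times> nat \<Rightarrow> nat \<times> nat \<times> nat \<Rightarrow> real" where
  "tens q r Sig = (\<lambda>(a, b, c) (a', b', c'). Sig (kidx q r a b c) (kidx q r a' b' c'))"

lemma tens_traces:
  "tri.S1 p (tens q r Sig) = ptr1 p q r Sig"
  "tri.S2 q (tens q r Sig) = ptr2 p q r Sig"
  "tri.S3 r (tens q r Sig) = ptr3 p q r Sig"
  "tri.S12 p q (tens q r Sig) = ptr12 p q r Sig"
  "tri.S13 p r (tens q r Sig) = ptr13 p q r Sig"
  "tri.S23 q r (tens q r Sig) = ptr23 p q r Sig"
  "tri.S123 p q r (tens q r Sig) = ptr123 p q r Sig"
proof -
  show 1: "tri.S1 p (tens q r Sig) = ptr1 p q r Sig" and 2: "tri.S2 q (tens q r Sig) = ptr2 p q r Sig"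
    and "tri.S3 r (tens q r Sig) = ptr3 p q r Sig"
    by (simp_all add: tri.S1_def tri.S2_def tri.S3_def ptr1_def ptr2_def ptr3_def tens_def)
  show 12: "tri.S12 p q (tens q r Sig) = ptr12 p q r Sig"
    unfolding tri.S12_def 1 ptr1_def ptr12_def prod.case by (intro ext) (rule sum.swap)
  show "tri.S13 p r (tens q r Sig) = ptr13 p q r Sig"
    unfolding tri.S13_def 1 ptr1_def ptr13_def prod.case by (intro ext) (rule sum.swap)
  show "tri.S23 q r (tens q r Sig) = ptr23 p q r Sig"
    unfolding tri.S23_def 2 ptr2_def ptr23_def prod.case by (intro ext) (rule sum.swap)
  have "(\<Sum>c<r. \<Sum>a<p. \<Sum>b<q. Sig (kidx q r a b c) (kidx q r a b c)) = (\<Sum>a<p. \<Sum>c<r. \<Sum>b<q. Sig (kidx q r a b c) (kidx q r a b c))"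
    by (rule sum.swap)
  also have "\<dots> = (\<Sum>a<p. \<Sum>b<q. \<Sum>c<r. Sig (kidx q r a b c) (kidx q r a b c))"
    by (intro sum.cong refl sum.swap)
  finally show "tri.S123 p q r (tens q r Sig) = ptr123 p q r Sig"
    unfolding tri.S123_def 12 ptr12_def ptr123_def .
qed

lemma opnorm_tens: "opnorm (tri.D p q r) (tri.D p q r) (tens q r Sig) = snorm (p * q * r) (p * q * r) Sig"
proof -
  have "tens q r Sig = (\<lambda>m n. Sig ((\<lambda>(a, b, c). kidx q r a b c) m) ((\<lambda>(a, b, c). kidx q r a b c) n))"
    by (auto simp: tens_def)
  then show ?thesis unfolding snorm_def opnorm_reindex[OF kidx_bij] tri.D_def by simp
qed

text \<open>The first unfolding of the noise is covered by the trilinear bound for the factorization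
  into dimensions p, q r and 1, with trivial ranks.\<close>

lemma grouped_traces:
  "opnorm ({..<q * r} \<times> {..<1}) ({..<q * r} \<times> {..<1}) (ptr1 p (q * r) 1 Sig) = opnorm ({..<q} \<times> {..<r}) ({..<q} \<times> {..<r}) (ptr1 p q r Sig)"
  "opnorm ({..<p} \<times> {..<1}) ({..<p} \<times> {..<1}) (ptr2 p (q * r) 1 Sig) = snorm p p (ptr23 p q r Sig)"
  "opnorm ({..<p} \<times> {..<q * r}) ({..<p} \<times> {..<q * r}) (ptr3 p (q * r) 1 Sig) = snorm (p * q * r) (p * q * r) Sig"
  "opnorm {..<q * r} {..<q * r} (ptr13 p (q * r) 1 Sig) = opnorm ({..<q} \<times> {..<r}) ({..<q} \<times> {..<r}) (ptr1 p q r Sig)"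
  "opnorm {..<p} {..<p} (ptr23 p (q * r) 1 Sig) = snorm p p (ptr23 p q r Sig)"
  "ptr12 p (q * r) 1 Sig 0 0 = ptr123 p q r Sig"
  "ptr123 p (q * r) 1 Sig = ptr123 p q r Sig"
proof -
  have k: "kidx (q * r) 1 a (b * r + c) 0 = kidx q r a b c" for a b c by (simp add: kidx_def)
  note k = k[unfolded One_nat_def]
  have b1: "bij_betw (\<lambda>(b, c). (b * r + c, 0)) ({..<q} \<times> {..<r}) ({..<q * r} \<times> {..<1::nat})"
  proof -
    have "bij_betw (\<lambda>s. (s, 0)) {..<q * r} ({..<q * r} \<times> {..<1::nat})" by (rule bij_betwI[where g=fst]) auto
    from bij_betw_trans[OF bij_flat this] show ?thesis by (simp add: comp_def case_prod_unfold)
  qed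
  show "opnorm ({..<q * r} \<times> {..<1}) ({..<q * r} \<times> {..<1}) (ptr1 p (q * r) 1 Sig) = opnorm ({..<q} \<times> {..<r}) ({..<q} \<times> {..<r}) (ptr1 p q r Sig)"
    unfolding opnorm_reindex[OF b1] by (rule arg_cong[where f="opnorm _ _"], intro ext) (simp add: case_prod_unfold ptr1_def k)
  show "opnorm {..<q * r} {..<q * r} (ptr13 p (q * r) 1 Sig) = opnorm ({..<q} \<times> {..<r}) ({..<q} \<times> {..<r}) (ptr1 p q r Sig)"
    unfolding opnorm_reindex[OF bij_flat] by (rule arg_cong[where f="opnorm _ _"], intro ext) (simp add: case_prod_unfold ptr1_def ptr13_def k)
  have b2: "bij_betw (\<lambda>a. (a, 0)) {..<p} ({..<p} \<times> {..<1::nat})" by (rule bij_betwI[where g=fst]) auto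
  show "opnorm ({..<p} \<times> {..<1}) ({..<p} \<times> {..<1}) (ptr2 p (q * r) 1 Sig) = snorm p p (ptr23 p q r Sig)"
    unfolding opnorm_reindex[OF b2] snorm_def by (simp add: ptr2_def ptr23_def sum_flat k)
  show "opnorm {..<p} {..<p} (ptr23 p (q * r) 1 Sig) = snorm p p (ptr23 p q r Sig)"
    unfolding snorm_def by (simp add: ptr23_def sum_flat k)
  have b3: "bij_betw (\<lambda>(a, t). a * (q * r) + t) ({..<p} \<times> {..<q * r}) {..<p * q * r}"
    using bij_flat[of "q * r" p] by (simp add: mult.assoc)
  show "opnorm ({..<p} \<times> {..<q * r}) ({..<p} \<times> {..<q * r}) (ptr3 p (q * r) 1 Sig) = snorm (p * q * r) (p * q * r) Sig"
    unfolding snorm_def opnorm_reindex[OF b3] by (rule arg_cong[where f="opnorm _ _"], intro ext) (simp add: case_prod_unfold ptr3_def kidx_def)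
  show "ptr12 p (q * r) 1 Sig 0 0 = ptr123 p q r Sig" by (simp add: ptr12_def ptr123_def sum_flat k)
  show "ptr123 p (q * r) 1 Sig = ptr123 p q r Sig" by (simp add: ptr123_def sum_flat k)
qed

locale covariance =
  fixes p q r :: nat and Sig :: mat
  assumes pqr: "0 < p" "0 < q" "0 < r" and pd: "sym_pd (p * q * r) Sig"
begin

abbreviation "d \<equiv> p * q * r"
abbreviation "nS \<equiv> snorm d d Sig"
abbreviation "r1 \<equiv> reff1 p q r Sig"
abbreviation "r2 \<equiv> reff2 p q r Sig"
abbreviation "r3 \<equiv> reff3 p q r Sig"
abbreviation "t1 \<equiv> opnorm ({..<q} \<times> {..<r}) ({..<q} \<times> {..<r}) (ptr1 p q r Sig)"
abbreviation "t2 \<equiv> opnorm ({..<p} \<times> {..<r}) ({..<p} \<times> {..<r}) (ptr2 p q r Sig)"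
abbreviation "t3 \<equiv> opnorm ({..<p} \<times> {..<q}) ({..<p} \<times> {..<q}) (ptr3 p q r Sig)"
abbreviation "t12 \<equiv> snorm r r (ptr12 p q r Sig)"
abbreviation "t13 \<equiv> snorm q q (ptr13 p q r Sig)"
abbreviation "t23 \<equiv> snorm p p (ptr23 p q r Sig)"

lemma diag: "a < p \<Longrightarrow> b < q \<Longrightarrow> c < r \<Longrightarrow> 0 < Sig (kidx q r a b c) (kidx q r a b c)"
  using pd_diag[OF pd kidx_bound(1)] .

text \<open>The effective dimensions are quotients, and the convention for division by zero would
  break the bounds read off from them. Positive diagonal entries of the covariance exclude zero
  denominators.\<close>

lemma trace_pos: "0 < nS" "0 < t1" "0 < t2" "0 < t3" "0 < t12"
proof -
  have "0 < Sig (kidx q r 0 0 0) (kidx q r 0 0 0)" using diag pqr by simp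
  also have "\<dots> \<le> nS" unfolding snorm_def
    using opnorm_ge_diag[of "{..<d}" "kidx q r 0 0 0" Sig] kidx_bound(1)[OF pqr] by simp
  finally show "0 < nS" .
  have "0 < ptr1 p q r Sig (0, 0) (0, 0)" unfolding ptr1_def prod.case using pqr diag by (intro sum_pos) auto
  also have "\<dots> \<le> t1" using opnorm_ge_diag[of "{..<q} \<times> {..<r}" "(0, 0)" "ptr1 p q r Sig"] pqr by simp
  finally show "0 < t1" .
  have "0 < ptr2 p q r Sig (0, 0) (0, 0)" unfolding ptr2_def prod.case using pqr diag by (intro sum_pos) auto
  also have "\<dots> \<le> t2" using opnorm_ge_diag[of "{..<p} \<times> {..<r}" "(0, 0)" "ptr2 p q r Sig"] pqr by simp
  finally show "0 < t2" .
  have "0 < ptr3 p q r Sig (0, 0) (0, 0)" unfolding ptr3_def prod.case using pqr diag by (intro sum_pos) auto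
  also have "\<dots> \<le> t3" using opnorm_ge_diag[of "{..<p} \<times> {..<q}" "(0, 0)" "ptr3 p q r Sig"] pqr by simp
  finally show "0 < t3" .
  have "0 < ptr12 p q r Sig 0 0" unfolding ptr12_def using pqr diag by (intro sum_pos) auto
  also have "\<dots> \<le> t12" unfolding snorm_def using opnorm_ge_diag[of "{..<r}" 0 "ptr12 p q r Sig"] pqr by simp
  finally show "0 < t12" .
qed

lemma reff_ge:
  "t1 \<le> r1 * nS" "t12 \<le> r1 * t2" "t2 \<le> r2 * nS" "t23 \<le> r2 * t3" "t3 \<le> r3 * nS" "t13 \<le> r3 * t1"
  "\<bar>ptr123 p q r Sig\<bar> \<le> r3 * t12"
  unfolding reff1_def reff2_def reff3_def
  by (simp_all only: pos_divide_le_eq[symmetric] trace_pos max.cobounded1 max.cobounded2 max.coboundedI1)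

lemma reff_pos: "0 < r1" "0 < r2" "0 < r3"
  using trace_pos reff_ge by (meson less_le_trans zero_less_mult_pos2 order_less_imp_le)+

text \<open>Factors are traced out one at a time, as in t12 <= r1 t2 <= r1 r2 nS. The later entries
  of the maxima in the effective dimensions are exactly the ratios for such chains.\<close>

lemma trace_le:
  "t12 \<le> r1 * r2 * nS" "t13 \<le> r1 * r3 * nS" "t23 \<le> r2 * r3 * nS" "\<bar>ptr123 p q r Sig\<bar> \<le> r1 * r2 * r3 * nS"
proof -
  show 12: "t12 \<le> r1 * r2 * nS"
    using order_trans[OF reff_ge(2) mult_left_mono[OF reff_ge(3)]] reff_pos by (simp add: mult_ac)
  show "t13 \<le> r1 * r3 * nS"
    using order_trans[OF reff_ge(6) mult_left_mono[OF reff_ge(1)]] reff_pos by (simp add: mult_ac)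
  show "t23 \<le> r2 * r3 * nS"
    using order_trans[OF reff_ge(4) mult_left_mono[OF reff_ge(5)]] reff_pos by (simp add: mult_ac)
  show "\<bar>ptr123 p q r Sig\<bar> \<le> r1 * r2 * r3 * nS"
    using order_trans[OF reff_ge(7) mult_left_mono[OF 12]] reff_pos by (simp add: mult_ac)
qed

end

locale sample = covariance +
  fixes n :: nat and M :: "'a measure" and X :: "nat \<Rightarrow> 'a \<Rightarrow> nat \<Rightarrow> real" and om :: real
  assumes M: "prob_space M" and n: "0 < n" and om: "0 < om"
    and indep: "prob_space.indep_vars M (\<lambda>_. PiM {..<d} (\<lambda>_. borel)) (\<lambda>i w. restrict (X i w) {..<d}) {0..n}"
    and ident: "\<forall>i\<in>{1..n}. distr M (PiM {..<d} (\<lambda>_. borel)) (\<lambda>w. restrict (X i w) {..<d})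
                           = distr M (PiM {..<d} (\<lambda>_. borel)) (\<lambda>w. restrict (X 0 w) {..<d})"
    and mgf: "\<forall>V. frob d d V \<le> 1 / om \<longrightarrow>
       (let Z = (\<lambda>w i. \<Sum>k<d. inv_sqrt d Sig i k * X 0 w k);
            f = (\<lambda>w. exp ((\<Sum>i<d. \<Sum>j<d. Z w i * V i j * Z w j) - (\<Sum>i<d. V i i)))
        in integrable M f \<and> ln (\<integral>w. f w \<partial>M) \<le> om^2 * (frob d d V)^2)"
begin

text \<open>n times the error of the empirical covariance. The division by n is postponed to
  \<open>noise\<close>, so that here exponential moments of sums multiply.\<close>

definition Q :: "'a \<Rightarrow> mat" where "Q w = (\<lambda>i j. \<Sum>l=1..n. X l w i * X l w j - Sig i j)"

lemma X_measurable: "l \<in> {0..n} \<Longrightarrow> i < d \<Longrightarrow> (\<lambda>w. X l w i) \<in> borel_measurable M"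
proof -
  interpret prob_space M by (rule M)
  assume l: "l \<in> {0..n}" and i: "i < d"
  have "(\<lambda>w. restrict (X l w) {..<d}) \<in> measurable M (PiM {..<d} (\<lambda>_. borel))"
    using indep l unfolding indep_vars_def by auto
  from measurable_compose[OF this measurable_component_singleton, of i] show ?thesis using i by simp
qed

lemma Q_measurable: "i < d \<Longrightarrow> j < d \<Longrightarrow> (\<lambda>w. Q w i j) \<in> borel_measurable M"
  unfolding Q_def
  by (intro borel_measurable_sum borel_measurable_diff borel_measurable_times borel_measurable_const X_measurable) auto

lemma Q_mgf:
  assumes "om^2 * quad {..<d} Sig V \<le> 1"
  shows "(\<integral>\<^sup>+w. ennreal (exp (\<Sum>i<d. \<Sum>j<d. Q w i j * V i j)) \<partial>M) \<le> ennreal (exp (real n * (om^2 * quad {..<d} Sig V)))"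
  unfolding Q_def
  by (rule mgf_iid[OF M indep ident], rule mgf_single[OF M pd om _ mgf assms], rule X_measurable) simp_all

lemma noise_frob:
  assumes JK: "0 < J" "0 < K" "0 < delta"
    and R: "R = (real J * r1^2 + real J * real K * r2^2 + real K * r3^2) / 2 + ln (2 / delta)" "0 < R" "R \<le> real n"
  shows "\<exists>A\<in>sets M. measure M A \<ge> 1 - delta \<and> (\<forall>w\<in>A. \<forall>U Z. contr (p^2) J U \<longrightarrow> contr (r^2) K Z \<longrightarrow>
    tfrob J (q^2) K (mode1T (p^2) U (mode3T (r^2) Z (Rearr p q r (Q w)))) \<le> real n * (40 / 3 * om * nS * sqrt (R / real n)))"
proof -
  have "\<exists>A\<in>sets M. measure M A \<ge> 1 - delta \<and> (\<forall>w\<in>A. trilinear_le p q r J K (Q w) (real n * (40 / 3 * om * nS * sqrt (R / real n))))"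
    by (rule noise_bound[OF M JK(1,2) n om trace_pos(1) reff_pos JK(3) Q_measurable pd Q_mgf _ _ _ _ _ _ _ _ R,
          folded tens_def, unfolded tens_traces[where p=p and q=q and r=r and Sig=Sig] opnorm_tens])
      (use reff_ge trace_le in \<open>simp_all add: snorm_def\<close>)
  then obtain A where "A \<in> sets M" "measure M A \<ge> 1 - delta"
    and A: "\<forall>w\<in>A. trilinear_le p q r J K (Q w) (real n * (40 / 3 * om * nS * sqrt (R / real n)))" by blast
  show ?thesis
  proof (intro bexI[of _ A] conjI ballI allI impI)
    fix w U Z assume "w \<in> A" and UZ: "contr (p^2) J U" "contr (r^2) K Z"
    show "tfrob J (q^2) K (mode1T (p^2) U (mode3T (r^2) Z (Rearr p q r (Q w)))) \<le> real n * (40 / 3 * om * nS * sqrt (R / real n))"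
      by (rule noise_tfrob[OF bspec[OF A \<open>w \<in> A\<close>] UZ])
  qed fact+
qed

text \<open>\<open>noise_bound\<close> for dimensions p, q r, 1 and ranks 1. By
  \<open>grouped_traces\<close> the values r1, r2 r3 and 1 serve as effective dimensions; the last
  is the extra 1 in R.\<close>

lemma noise_unf:
  assumes JK: "0 < delta"
    and R: "R = (r1^2 + r2^2 * r3^2 + 1) / 2 + ln (2 / delta)" "0 < R" "R \<le> real n"
  shows "\<exists>A\<in>sets M. measure M A \<ge> 1 - delta \<and> (\<forall>w\<in>A. \<forall>u.
    vnorm ({..<q^2} \<times> {..<r^2}) (tmv {..<p^2} (unf (Rearr p q r (Q w))) u)
      \<le> real n * (40 / 3 * om * nS * sqrt (R / real n)) * vnorm {..<p^2} u)"
proof -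
  have d': "p * (q * r) * 1 = d" by (simp add: mult.assoc)
  note [simp del] = One_nat_def
  have "\<exists>A\<in>sets M. measure M A \<ge> 1 - delta \<and> (\<forall>w\<in>A. trilinear_le p (q * r) 1 1 1 (Q w) (real n * (40 / 3 * om * nS * sqrt (R / real n))))"
  proof (rule noise_bound[where p=p and q="q * r" and r=1 and J=1 and K=1 and Sig=Sig and ?r1.0=r1 and ?r2.0="r2 * r3" and ?r3.0=1,
          OF M _ _ n om trace_pos(1) _ _ _ JK, folded tens_def, unfolded tens_traces[where p=p and q="q * r" and r=1 and Sig=Sig] opnorm_tens d', OF _ _ _ _ _ Q_measurable pd Q_mgf])
    have "opnorm {..<1} {..<1} (ptr12 p (q * r) 1 Sig) \<le> \<bar>ptr123 p q r Sig\<bar>"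
      using opnorm_singleton[of 0 "ptr12 p (q * r) 1 Sig"] unfolding grouped_traces by (simp add: lessThan_Suc One_nat_def)
    then show "opnorm {..<1} {..<1} (ptr12 p (q * r) 1 Sig) \<le> r1 * (r2 * r3) * nS"
      using trace_le(4) by (simp add: mult.assoc)
    show "R = (real 1 * r1^2 + real 1 * real 1 * (r2 * r3)^2 + real 1 * 1^2) / 2 + ln (2 / delta)"
      unfolding R(1) by (simp add: power_mult_distrib)
    show "0 < R" "R \<le> real n" by (rule R)+
  qed (use reff_ge trace_le reff_pos in \<open>simp_all add: grouped_traces mult.assoc\<close>)
  then obtain A where "A \<in> sets M" "measure M A \<ge> 1 - delta"
    and A: "\<forall>w\<in>A. trilinear_le p (q * r) 1 1 1 (Q w) (real n * (40 / 3 * om * nS * sqrt (R / real n)))" by blast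
  have B: "0 \<le> real n * (40 / 3 * om * nS * sqrt (R / real n))"
    using om trace_pos(1) R(2) by (intro mult_nonneg_nonneg) auto
  show ?thesis
  proof (intro bexI[of _ A] conjI ballI allI)
    fix w u assume "w \<in> A"
    show "vnorm ({..<q^2} \<times> {..<r^2}) (tmv {..<p^2} (unf (Rearr p q r (Q w))) u)
      \<le> real n * (40 / 3 * om * nS * sqrt (R / real n)) * vnorm {..<p^2} u"
      by (rule noise_spectral1[OF bspec[OF A \<open>w \<in> A\<close>] B])
  qed fact+
qed

end

section \<open>Assembling the bound\<close>

text \<open>\<open>sval_lower\<close> read back on pair-indexed columns; since \<open>Vs\<close> is
  orthonormal, expanding the third mode of W by \<open>Vs\<close> preserves the norms.\<close>

lemma core_lower:
  assumes f: "bij_betw f {..<n} ({..<n2} \<times> {..<n3})"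
    and Us: "orth n1 k1 Us" and Vs: "orth n3 k3 Vs" and k: "0 < k1"
    and e: "\<And>w. vnorm ({..<n2} \<times> {..<n3}) (tmv {..<n1} (unf E) w) \<le> e * vnorm {..<n1} w"
    and c: "c < sval n1 n (\<lambda>i j. unf (\<lambda>a b c. lowrank k1 k3 Us Vs W a b c + E a b c) i (f j)) k1 - e" "0 < c"
  shows "c * vnorm {..<k1} w \<le> vnorm ({..<n2} \<times> {..<k3}) (tmv {..<k1} (core W) w)"
proof -
  let ?B = "\<lambda>j (b, c). \<Sum>k<k3. Vs c k * W j b k"
  have "c * vnorm {..<k1} w \<le> vnorm {..<n} (tmv {..<k1} (\<lambda>j l. ?B j (f l)) w)"
  proof (rule sval_lower[OF Us k _ _ c])
    show "unf (\<lambda>a b c. lowrank k1 k3 Us Vs W a b c + E a b c) i (f j) = (\<Sum>l<k1. Us i l * ?B l (f j)) + unf E i (f j)" for i j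
      by (cases "f j") (simp add: unf_def lowrank_def)
    show "vnorm {..<n} (tmv {..<n1} (\<lambda>i j. unf E i (f j)) w) \<le> e * vnorm {..<n1} w" for w
      using e[of w] unfolding vnorm_reindex[OF f] by (simp add: tmv_def)
  qed
  also have "\<dots> = vnorm ({..<n2} \<times> {..<n3}) (tmv {..<k1} ?B w)"
    unfolding vnorm_reindex[OF f] by (simp add: tmv_def)
  finally show ?thesis unfolding vnorm_core[OF Vs] .
qed

lemma snorm_m1_contr:
  assumes V: "contr n3 k V"
  shows "snorm n1 (n2 * k) (m1 n2 k (mode3T n3 V X)) \<le> snorm n1 (n2 * n3) (m1 n2 n3 X)"
  unfolding snorm_def
proof (rule opnorm_leI_tmv)
  fix y
  have "vnorm {..<n2 * k} (tmv {..<n1} (m1 n2 k (mode3T n3 V X)) y) = vnorm ({..<n2} \<times> {..<k}) (tmv {..<n1} (con n3 V X) y)"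
    unfolding vnorm_reindex[OF bij_divmod] con_unf1 by (simp add: tmv_def unf_def m1_def)
  also have "\<dots> \<le> vnorm ({..<n2} \<times> {..<n3}) (tmv {..<n1} (unf X) y)" by (rule con_le[OF V])
  also have "\<dots> \<le> opnorm {..<n1} {..<n2 * n3} (m1 n2 n3 X) * vnorm {..<n1} y"
    using snorm_m1 unfolding snorm_def .
  finally show "vnorm {..<n2 * k} (tmv {..<n1} (m1 n2 k (mode3T n3 V X)) y) \<le> opnorm {..<n1} {..<n2 * n3} (m1 n2 n3 X) * vnorm {..<n1} y" .
qed (simp add: opnorm_nonneg)

lemma snorm_m3_contr:
  assumes U: "contr n1 k U"
  shows "snorm n3 (k * n2) (m3 n2 (mode1T n1 U X)) \<le> snorm n3 (n1 * n2) (m3 n2 X)"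
  unfolding snorm_def
proof (rule opnorm_leI_tmv)
  fix y
  have "vnorm {..<k * n2} (tmv {..<n3} (m3 n2 (mode1T n1 U X)) y) = vnorm ({..<n2} \<times> {..<k}) (tmv {..<n3} (con n1 U (flip X)) y)"
    unfolding vnorm_reindex[OF bij_moddiv] con_unf3 by (simp add: tmv_def unf_def m3_def flip_def)
  also have "\<dots> \<le> vnorm ({..<n2} \<times> {..<n1}) (tmv {..<n3} (unf (flip X)) y)" by (rule con_le[OF U])
  also have "\<dots> \<le> opnorm {..<n3} {..<n1 * n2} (m3 n2 X) * vnorm {..<n3} y"
    using snorm_m3 unfolding snorm_def .
  finally show "vnorm {..<k * n2} (tmv {..<n3} (m3 n2 (mode1T n1 U X)) y) \<le> opnorm {..<n3} {..<n1 * n2} (m3 n2 X) * vnorm {..<n3} y" .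
qed (simp add: opnorm_nonneg)

lemma tfrob_mode1T:
  assumes U: "contr n1 k U"
  shows "tfrob k n2 n3 (mode1T n1 U X) \<le> tfrob n1 n2 n3 X"
proof (rule power2_le_imp_le)
  have le: "(\<Sum>j<k. (mode1T n1 U X j b c)^2) \<le> (\<Sum>a<n1. (X a b c)^2)" for b c
    using power_mono[OF contr_tmv[OF U, of "\<lambda>a. X a b c"], of 2] unfolding vnorm_sq by (simp add: tmv_def mode1T_def)
  have sw: "(\<Sum>b<n2. \<Sum>c<n3. \<Sum>a<m. (Z a b c)^2) = (tfrob m n2 n3 Z)^2" for Z :: tensor and m
  proof -
    have "(\<Sum>b<n2. \<Sum>c<n3. \<Sum>a<m. (Z a b c)^2) = (\<Sum>b<n2. \<Sum>a<m. \<Sum>c<n3. (Z a b c)^2)" by (intro sum.cong refl sum.swap)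
    also have "\<dots> = (\<Sum>a<m. \<Sum>b<n2. \<Sum>c<n3. (Z a b c)^2)" by (rule sum.swap)
    finally show ?thesis unfolding tfrob_sq .
  qed
  show "(tfrob k n2 n3 (mode1T n1 U X))^2 \<le> (tfrob n1 n2 n3 X)^2"
    unfolding sw[symmetric] by (intro sum_mono le)
qed simp

lemma tfrob_mode3T:
  assumes V: "contr n3 k V"
  shows "tfrob n1 n2 k (mode3T n3 V X) \<le> tfrob n1 n2 n3 X"
proof -
  have "mode3T n3 V X = flip (mode1T n3 V (flip X))" by (simp add: mode1T_def mode3T_def flip_def)
  then show ?thesis using tfrob_mode1T[OF V, of n2 n1 "flip X"] by (simp add: tfrob_flip)
qed

lemma tmv_unf_add: "tmv I (unf (\<lambda>a b c. X a b c + Y a b c)) w = (\<lambda>j. tmv I (unf X) w j + tmv I (unf Y) w j)"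
  by (auto simp: tmv_def unf_def sum.distrib[symmetric] algebra_simps)

lemma flip_flip [simp]: "flip (flip X) = X"
  by (simp add: flip_def)

text \<open>Deterministic form of the theorem. From 25 E1 + 24 e1 <= s1 follow E1 < s1 / 25, so the
  core is bounded below by 24/25 s1, and E1 + e1 <= s1 / 24, which is within 0.045 of that lower
  bound. The suprema bU and bV are at most E1 and E3, hence at most 1/24 of the reduced singular
  values.\<close>

lemma hooi_bound:
  fixes S N Tt W :: tensor and Us Vs :: mat and J K T d1 d2 d3 :: nat
  defines "E \<equiv> (\<lambda>a b c. S a b c - ttprod J K Us Vs W a b c)"
  defines "E1 \<equiv> snorm d1 (d2 * d3) (m1 d2 d3 E)" and "E3 \<equiv> snorm d3 (d1 * d2) (m3 d2 E)"
    and "bU \<equiv> Sup {snorm d1 (d2 * K) (m1 d2 K (mode3T d3 V E)) | V. snorm d3 K V \<le> 1}"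
    and "bV \<equiv> Sup {snorm d3 (J * d2) (m3 d2 (mode1T d1 U E)) | U. snorm d1 J U \<le> 1}"
    and "s1 \<equiv> sval d1 (d2 * d3) (m1 d2 d3 S) J" and "s3 \<equiv> sval d3 (d1 * d2) (m3 d2 S) K"
  assumes JK: "0 < J" "0 < K" and Us: "orth d1 J Us" and Vs: "orth d3 K Vs"
    and F: "\<And>U V. contr d1 J U \<Longrightarrow> contr d3 K V \<Longrightarrow> tfrob J d2 K (mode1T d1 U (mode3T d3 V N)) \<le> F" "0 \<le> F"
    and e1: "\<And>w. vnorm ({..<d2} \<times> {..<d3}) (tmv {..<d1} (unf N) w) \<le> e1 * vnorm {..<d1} w" "0 < e1"
    and e3: "\<And>U w. contr d1 J U \<Longrightarrow> vnorm ({..<d2} \<times> {..<J}) (tmv {..<d3} (con d1 U (flip N)) w) \<le> e3 * vnorm {..<d3} w" "0 < e3"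
    and gap: "25 * E1 + 24 * e1 \<le> s1" "25 * E3 + 24 * e3 \<le> s3"
    and hard: "hardtth d1 d2 d3 J K T (\<lambda>a b c. S a b c + N a b c) Tt"
  shows "tfrob d1 d2 d3 (\<lambda>a b c. Tt a b c - S a b c) \<le> tfrob d1 d2 d3 E
      + Sup {tfrob J d2 K (mode1T d1 U (mode3T d3 V E)) | U V. orth d1 J U \<and> orth d3 K V} + F
      + 221 / 100 * (2 * F + sqrt (real J) * snorm d1 (d2 * K) (m1 d2 K (mode3T d3 Vs E))
          + sqrt (real K) * snorm d3 (J * d2) (m3 d2 (mode1T d1 Us E)))
      + 109 / 100 * (5 * (bU * bV / (24 / 25 * s1 * (24 / 25 * s3))))^T * (2 * (sqrt (real J) * (E1 + e1)))" (is "_ \<le> ?rhs")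
    and "0 \<le> bU" "0 \<le> bV"
proof -
  have E0: "0 \<le> E1" "0 \<le> E3" by (simp_all add: E1_def E3_def snorm_def opnorm_nonneg)
  have spos: "0 < s1" "0 < s3" using gap e1(2) e3(2) E0 by linarith+
  have SL: "S = (\<lambda>a b c. lowrank J K Us Vs W a b c + E a b c)"
    by (simp add: E_def lowrank_ttprod)
  have flipSL: "flip S = (\<lambda>a b c. lowrank K J Vs Us (flip W) a b c + flip E a b c)"
    unfolding flip_lowrank[symmetric] by (simp add: SL flip_def)
  have zero: "contr m k (\<lambda>i j. 0)" for m k by (simp add: contr_def mv_def)
  have bV: "snorm d3 (J * d2) (m3 d2 (mode1T d1 U E)) \<le> bV" if "contr d1 J U" for U
    unfolding bV_def
  proof (rule cSup_upper)
    show "bdd_above {snorm d3 (J * d2) (m3 d2 (mode1T d1 U E)) | U. snorm d1 J U \<le> 1}"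
      using snorm_m3_contr contr_snorm by (intro bdd_aboveI[of _ E3]) (auto simp: E3_def)
  qed (use that contr_snorm in blast)
  have bU: "snorm d1 (d2 * K) (m1 d2 K (mode3T d3 V E)) \<le> bU" if "contr d3 K V" for V
    unfolding bU_def
  proof (rule cSup_upper)
    show "bdd_above {snorm d1 (d2 * K) (m1 d2 K (mode3T d3 V E)) | V. snorm d3 K V \<le> 1}"
      using snorm_m1_contr contr_snorm by (intro bdd_aboveI[of _ E1]) (auto simp: E1_def)
  qed (use that contr_snorm in blast)
  have bVE: "bV \<le> E3" unfolding bV_def
  proof (rule cSup_least)
    show "{snorm d3 (J * d2) (m3 d2 (mode1T d1 U E)) | U. snorm d1 J U \<le> 1} \<noteq> {}"
      using zero contr_snorm by blast
  qed (use snorm_m3_contr contr_snorm in \<open>auto simp: E3_def\<close>)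
  have bUE: "bU \<le> E1" unfolding bU_def
  proof (rule cSup_least)
    show "{snorm d1 (d2 * K) (m1 d2 K (mode3T d3 V E)) | V. snorm d3 K V \<le> 1} \<noteq> {}"
      using zero contr_snorm by blast
  qed (use snorm_m1_contr contr_snorm in \<open>auto simp: E1_def\<close>)
  show b0: "0 \<le> bU" "0 \<le> bV"
    by (rule order_trans[OF _ bU[OF zero]], simp add: snorm_def opnorm_nonneg,
        rule order_trans[OF _ bV[OF zero]], simp add: snorm_def opnorm_nonneg)
  have g0: "vnorm ({..<d2} \<times> {..<d3}) (tmv {..<d1} (unf (\<lambda>a b c. E a b c + N a b c)) w) \<le> (E1 + e1) * vnorm {..<d1} w" for w
    unfolding tmv_unf_add
    using order_trans[OF vnorm_triangle add_mono[OF snorm_m1[of d2 d3 d1 E w] e1(1)[of w]]]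
    by (simp add: E1_def distrib_right)
  have A: "half_step d1 d2 d3 J K Us Vs W E N F (snorm d1 (d2 * K) (m1 d2 K (mode3T d3 Vs E))) bV (E1 + e1) (24 / 25 * s1)"
  proof
    fix r
    show "24 / 25 * s1 * vnorm {..<J} r \<le> vnorm ({..<d2} \<times> {..<K}) (tmv {..<J} (core W) r)"
    proof (rule core_lower[OF bij_divmod Us Vs JK(1)])
      show "vnorm ({..<d2} \<times> {..<d3}) (tmv {..<d1} (unf E) w) \<le> E1 * vnorm {..<d1} w" for w
        unfolding E1_def by (rule snorm_m1)
      have "(\<lambda>i j. unf S i (j div d3, j mod d3)) = m1 d2 d3 S" by (simp add: unf_def m1_def)
      then show "24 / 25 * s1 < sval d1 (d2 * d3) (\<lambda>i j. unf (\<lambda>a b c. lowrank J K Us Vs W a b c + E a b c) i (j div d3, j mod d3)) J - E1"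
        unfolding SL[symmetric] using gap e1(2) by (simp add: s1_def)
    qed (use spos in simp)
  next
    show "vnorm (({..<d2} \<times> {..<K}) \<times> {..<J}) (\<lambda>(j, l). tmv {..<d1} (con d3 V N) (\<lambda>i. Q i l) j) \<le> F"
      if "contr d1 J Q" "contr d3 K V" for Q V
      unfolding tfrob_con by (rule F(1)[OF that])
    show "vnorm ({..<d2} \<times> {..<K}) (tmv {..<d1} (con d3 Vs E) u) \<le> snorm d1 (d2 * K) (m1 d2 K (mode3T d3 Vs E)) * vnorm {..<d1} u" for u
      unfolding con_unf1 by (rule snorm_m1)
    show "vnorm ({..<d2} \<times> {..<J}) (tmv {..<d3} (con d1 Q (flip E)) v) \<le> bV * vnorm {..<d3} v" if "contr d1 J Q" for Q v
      using order_trans[OF snorm_m3[of d2 J d3 "mode1T d1 Q E" v] mult_right_mono[OF bV[OF that]]] unfolding con_unf3 by simp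
    show "vnorm ({..<d2} \<times> {..<K}) (tmv {..<d1} (con d3 V (\<lambda>a b c. E a b c + N a b c)) w) \<le> (E1 + e1) * vnorm {..<d1} w"
      if "orth d3 K V" for V w
      by (rule order_trans[OF con_le[OF orth_contr[OF that]] g0])
  qed (use Us Vs F b0 E0 e1 spos gap in \<open>simp_all add: snorm_def opnorm_nonneg\<close>)
  have B: "half_step d3 d2 d1 K J Vs Us (flip W) (flip E) (flip N) F (snorm d3 (J * d2) (m3 d2 (mode1T d1 Us E))) bU (E3 + e3) (24 / 25 * s3)"
  proof
    fix r
    show "24 / 25 * s3 * vnorm {..<K} r \<le> vnorm ({..<d2} \<times> {..<J}) (tmv {..<K} (core (flip W)) r)"
    proof (rule core_lower[OF bij_moddiv Vs Us JK(2)])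
      show "vnorm ({..<d2} \<times> {..<d1}) (tmv {..<d3} (unf (flip E)) w) \<le> E3 * vnorm {..<d3} w" for w
        unfolding E3_def by (rule snorm_m3)
      have "(\<lambda>i j. unf (flip S) i (j mod d2, j div d2)) = m3 d2 S" by (simp add: unf_def m3_def flip_def)
      then show "24 / 25 * s3 < sval d3 (d1 * d2) (\<lambda>i j. unf (\<lambda>a b c. lowrank K J Vs Us (flip W) a b c + flip E a b c) i (j mod d2, j div d2)) K - E3"
        unfolding flipSL[symmetric] using gap e3(2) by (simp add: s3_def)
    qed (use spos in simp)
  next
    show "vnorm (({..<d2} \<times> {..<J}) \<times> {..<K}) (\<lambda>(j, l). tmv {..<d3} (con d1 V (flip N)) (\<lambda>i. Q i l) j) \<le> F"
      if "contr d3 K Q" "contr d1 J V" for Q V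
      unfolding tfrob_con mode_flip tfrob_flip by (rule F(1)[OF that(2,1)])
    show "vnorm ({..<d2} \<times> {..<J}) (tmv {..<d3} (con d1 Us (flip E)) u) \<le> snorm d3 (J * d2) (m3 d2 (mode1T d1 Us E)) * vnorm {..<d3} u" for u
      unfolding con_unf3 by (rule snorm_m3)
    show "vnorm ({..<d2} \<times> {..<K}) (tmv {..<d1} (con d3 Q (flip (flip E))) v) \<le> bU * vnorm {..<d1} v" if "contr d3 K Q" for Q v
      using order_trans[OF snorm_m1[of d2 K d1 "mode3T d3 Q E" v] mult_right_mono[OF bU[OF that]]] unfolding con_unf1 by simp
    show "vnorm ({..<d2} \<times> {..<J}) (tmv {..<d3} (con d1 V (\<lambda>a b c. flip E a b c + flip N a b c)) w) \<le> (E3 + e3) * vnorm {..<d3} w"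
      if "orth d1 J V" for V w
    proof -
      have c: "contr d1 J V" by (rule orth_contr[OF that])
      have "tmv {..<d3} (con d1 V (\<lambda>a b c. flip E a b c + flip N a b c)) w
          = (\<lambda>j. tmv {..<d3} (con d1 V (flip E)) w j + tmv {..<d3} (con d1 V (flip N)) w j)"
        by (simp add: tmv_def con_add sum.distrib[symmetric] algebra_simps)
      then have "vnorm ({..<d2} \<times> {..<J}) (tmv {..<d3} (con d1 V (\<lambda>a b c. flip E a b c + flip N a b c)) w)
          \<le> vnorm ({..<d2} \<times> {..<J}) (tmv {..<d3} (con d1 V (flip E)) w) + vnorm ({..<d2} \<times> {..<J}) (tmv {..<d3} (con d1 V (flip N)) w)"
        by (simp only: vnorm_triangle)
      also have "\<dots> \<le> E3 * vnorm {..<d3} w + e3 * vnorm {..<d3} w"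
        unfolding E3_def by (rule add_mono[OF order_trans[OF con_le[OF c] snorm_m3] e3(1)[OF c]])
      finally show ?thesis by (simp add: distrib_right)
    qed
  qed (use Us Vs F b0 E0 e3 spos gap in \<open>simp_all add: snorm_def opnorm_nonneg\<close>)
  have Sb: "tfrob J d2 K (mode1T d1 U (mode3T d3 V E)) \<le> Sup {tfrob J d2 K (mode1T d1 U (mode3T d3 V E)) | U V. orth d1 J U \<and> orth d3 K V}"
    if "orth d1 J U" "orth d3 K V" for U V
  proof (rule cSup_upper)
    show "bdd_above {tfrob J d2 K (mode1T d1 U (mode3T d3 V E)) | U V. orth d1 J U \<and> orth d3 K V}"
      using order_trans[OF tfrob_mode1T[OF orth_contr] tfrob_mode3T[OF orth_contr]]
      by (intro bdd_aboveI[of _ "tfrob d1 d2 d3 E"]) auto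
  qed (use that in blast)
  have S': "lowrank J K Us Vs W a b c + E a b c = S a b c" for a b c by (simp add: E_def lowrank_ttprod)
  have Y: "(\<lambda>a b c. lowrank J K Us Vs W a b c + (E a b c + N a b c)) = (\<lambda>a b c. S a b c + N a b c)"
    unfolding SL by (simp add: add.assoc)
  show "tfrob d1 d2 d3 (\<lambda>a b c. Tt a b c - S a b c) \<le> ?rhs"
    by (rule hooi_error[OF A B g0 _ _ _ Sb, unfolded Y S', OF _ _ hard])
      (use bVE bUE gap e1(2) e3(2) in simp_all)
qed

text \<open>The rearrangement permutes entries, so the error may be measured in either
  arrangement.\<close>

lemma frob_Rearr_inv:
  "frob (p * q * r) (p * q * r) (\<lambda>i j. Rearr_inv p q r T i j - A i j) = tfrob (p^2) (q^2) (r^2) (\<lambda>a b c. T a b c - Rearr p q r A a b c)"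
proof -
  let ?k = "\<lambda>(a, b, c). kidx q r a b c"
  have at: "Rearr_inv p q r T (kidx q r a b c) (kidx q r a' b' c') = T (a * p + a') (b * q + b') (c * r + c')"
    if "a < p" "a' < p" "b < q" "b' < q" "c < r" "c' < r" for a a' b b' c c'
    using kidx_bound[OF that(1,3,5)] kidx_bound[OF that(2,4,6)] by (simp add: Rearr_inv_def)
  have "(\<Sum>i<p * q * r. \<Sum>j<p * q * r. (Rearr_inv p q r T i j - A i j)^2)
     = (\<Sum>m\<in>{..<p} \<times> {..<q} \<times> {..<r}. \<Sum>n\<in>{..<p} \<times> {..<q} \<times> {..<r}. (Rearr_inv p q r T (?k m) (?k n) - A (?k m) (?k n))^2)"
    by (simp only: sum.reindex_bij_betw[OF kidx_bij, symmetric])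
  also have "\<dots> = (\<Sum>a<p. \<Sum>a'<p. \<Sum>b<q. \<Sum>b'<q. \<Sum>c<r. \<Sum>c'<r.
      (Rearr_inv p q r T (kidx q r a b c) (kidx q r a' b' c') - A (kidx q r a b c) (kidx q r a' b' c'))^2)"
    by (subst sum_pairs, rule sum.cong[OF refl], rule sum.cong[OF refl], subst sum_pairs) simp
  also have "\<dots> = (\<Sum>a<p. \<Sum>a'<p. \<Sum>b<q. \<Sum>b'<q. \<Sum>c<r. \<Sum>c'<r. (T (a * p + a') (b * q + b') (c * r + c')
      - Rearr p q r A (a * p + a') (b * q + b') (c * r + c'))^2)"
    by (intro sum.cong refl) (simp add: at Rearr_at)
  finally show ?thesis by (simp add: frob_def tfrob_def sum_square)
qed

text \<open>At least one iteration is made, so a constant in front of the geometric term can be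
  moved into its ratio: 4 <= 4^T.\<close>

lemma power_absorb:
  fixes a b :: real
  assumes "0 \<le> a" "4 * a \<le> b" "0 < T"
  shows "4 * a^T \<le> b^T"
proof -
  have "(4::real) * a^T \<le> 4^T * a^T"
    using assms power_increasing[of 1 T "4::real"] by (intro mult_right_mono) auto
  also have "\<dots> = (4 * a)^T" by (simp add: power_mult_distrib)
  also have "\<dots> \<le> b^T" using assms by (intro power_mono) auto
  finally show ?thesis .
qed

text \<open>The noise adds up to (1 + 2 * 2.21) 40/3 < 73 times z, below 96, and the bias factor
  2.21 is below 4. The ratio has the constant 5 (25/24)^2 < 5.5, so four times it stays below 200,
  and \<open>power_absorb\<close> swallows the prefactor 2.18.\<close>

lemma assemble:
  fixes x e sb F sJ sK p1 p3 bU bV BU BV s1 s3 g z dia :: real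
  assumes x: "x \<le> e + sb + F + 221 / 100 * (2 * F + sJ * p1 + sK * p3) + 109 / 100 * (5 * (bU * bV / (24 / 25 * s1 * (24 / 25 * s3))))^T * (2 * (sJ * g))"
    and F: "F \<le> 40 / 3 * z" "0 \<le> z" and b: "0 \<le> bU" "0 \<le> bV" "bU \<le> BU" "bV \<le> BV"
    and s: "0 < s1" "0 < s3" and nn: "0 \<le> sJ" "0 \<le> sK" "0 \<le> p1" "0 \<le> p3" "0 \<le> g" "0 \<le> dia" and T: "0 < T"
  shows "x \<le> (e + sb + 4 * sJ * p1 + 4 * sK * p3) + 96 * z + dia + (sJ + sK) * (200 * BV * BU / (s1 * s3))^T * g"
proof -
  define a where "a = 5 * (bU * bV / (24 / 25 * s1 * (24 / 25 * s3)))"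
  define c where "c = 200 * BV * BU / (s1 * s3)"
  have a: "a = 3125 / 576 * (bU * bV / (s1 * s3))" by (simp add: a_def)
  have y: "0 \<le> bU * bV / (s1 * s3)" "bU * bV / (s1 * s3) \<le> BU * BV / (s1 * s3)"
    using b s by (auto intro!: divide_right_mono mult_mono)
  have cy: "c = 200 * (BU * BV / (s1 * s3))" by (simp add: c_def mult.commute)
  have "4 * a^T \<le> c^T" using y T cy by (intro power_absorb) (auto simp: a)
  then have P: "4 * a^T * (sJ * g) \<le> c^T * (sJ * g)" using nn by (intro mult_right_mono) auto
  have PD: "0 \<le> a^T * (sJ * g)" "0 \<le> c^T * (sK * g)"
    using nn y cy by (auto simp: a intro!: mult_nonneg_nonneg zero_le_power)
  have comb: "x \<le> e + sb + 4 * u + 4 * v + 96 * z + dia + (C + D)"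
    if "x \<le> e + sb + F + 221 / 100 * (2 * F + u + v) + 218 / 100 * P" "4 * P \<le> C" "0 \<le> P" "0 \<le> D" "0 \<le> u" "0 \<le> v"
    for u v P C D
    using that F nn(6) by argo
  have "109 / 100 * a^T * (2 * (sJ * g)) = 218 / 100 * (a^T * (sJ * g))" by simp
  note x' = x[folded a_def, unfolded this]
  have "(sJ + sK) * c^T * g = c^T * (sJ * g) + c^T * (sK * g)" by (simp add: algebra_simps)
  then show ?thesis unfolding c_def[symmetric]
    using comb[OF x' P[unfolded mult.assoc] PD] nn by (simp only: mult.assoc[symmetric] mult_nonneg_nonneg add.assoc[symmetric] simp_thms)
qed

section \<open>The high-probability noise event\<close>

lemma (in prob_space) prob_Int_ge:
  assumes "A \<in> events" "B \<in> events" "1 - a \<le> prob A" "1 - b \<le> prob B"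
  shows "1 - (a + b) \<le> prob (A \<inter> B)"
proof -
  have "prob (A - B) = prob A - prob (A \<inter> B)" using assms by (intro finite_measure_Diff')
  moreover have "prob (A - B) \<le> prob (space M - B)"
    using assms sets.sets_into_space by (intro finite_measure_mono) auto
  moreover have "prob (space M - B) = 1 - prob B" using assms by (intro prob_compl)
  ultimately show ?thesis using assms by linarith
qed

lemma sqrt_div_mono:
  assumes "R \<le> c^2 * R'" "0 \<le> c" "0 < n"
  shows "sqrt (R / real n) \<le> c * sqrt (R' / real n)"
proof -
  have "sqrt (R / real n) \<le> sqrt (c^2 * (R' / real n))"
    using assms by (intro real_sqrt_le_mono) (simp add: divide_right_mono)
  also have "\<dots> = c * sqrt (R' / real n)"
    using assms(2) by (simp only: real_sqrt_mult real_sqrt_abs abs_of_nonneg)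
  finally show ?thesis .
qed

lemma noise_level:
  fixes a b c L L' m :: real
  assumes "0 \<le> a" "0 \<le> b" "0 \<le> c" "1 \<le> L" "L \<le> L'" "a + b + c + L' \<le> m"
  shows "0 < (a + b + c) / 2 + L" "(a + b + c) / 2 + L \<le> m" "(a + b + c) / 2 + L \<le> a + b + c + L'"
  using assms by argo+

lemma noise_level1:
  fixes a b L m :: real
  assumes "0 \<le> a" "0 \<le> b" "1 \<le> L" "a + b + (1 + L) \<le> m"
  shows "0 < (a + b + 1) / 2 + L" "(a + b + 1) / 2 + L \<le> m" "(a + b + 1) / 2 + L \<le> 4 * (a + b + L)"
  using assms by argo+

context sample
begin

definition noise :: "'a \<Rightarrow> tensor" where "noise w = (\<lambda>a b c. 1 / real n * Rearr p q r (Q w) a b c)"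

lemma Rearr_empirical:
  "Rearr p q r (\<lambda>j k. 1 / real n * (\<Sum>i=1..n. X i w j * X i w k)) = (\<lambda>a b c. Rearr p q r Sig a b c + noise w a b c)"
proof -
  have "1 / real n * (\<Sum>i=1..n. X i w j * X i w k) = Sig j k + 1 / real n * Q w j k" for j k
    using n by (simp add: Q_def sum_subtractf algebra_simps)
  then show ?thesis by (simp add: Rearr_def noise_def)
qed

text \<open>Three events, each of probability at least 1 - delta / 3: the Frobenius bound at ranks
  (J, K), the third-mode bound at ranks (J, 1), and the first unfolding. Hence ln (2 / (delta / 3))
  = ln (6 / delta).\<close>

lemma noise_event:
  assumes JK: "0 < J" "0 < K" and delta: "0 < delta" "delta < 1"
    and nbig: "real n \<ge> real J * r1^2 + real J * real K * r2^2 + real K * r3^2 + r2^2 * r3^2 + ln (48 / delta)"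
  shows "\<exists>A\<in>sets M. measure M A \<ge> 1 - delta \<and> (\<forall>w\<in>A.
    (\<forall>U V. contr (p^2) J U \<longrightarrow> contr (r^2) K V \<longrightarrow> tfrob J (q^2) K (mode1T (p^2) U (mode3T (r^2) V (noise w)))
       \<le> 40 / 3 * (om * nS * sqrt ((real J * r1^2 + real J * real K * r2^2 + real K * r3^2 + ln (48 / delta)) / real n))) \<and>
    (\<forall>u. vnorm ({..<q^2} \<times> {..<r^2}) (tmv {..<p^2} (unf (noise w)) u)
       \<le> 32 * om * nS * sqrt ((r1^2 + r2^2 * r3^2 + ln (6 / delta)) / real n) * vnorm {..<p^2} u) \<and>
    (\<forall>U v. contr (p^2) J U \<longrightarrow> vnorm ({..<q^2} \<times> {..<J}) (tmv {..<r^2} (con (p^2) U (flip (noise w))) v)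
       \<le> 32 * om * nS * sqrt ((real J * r1^2 + real J * r2^2 + r3^2 + ln (48 / delta)) / real n) * vnorm {..<r^2} v))"
proof -
  interpret P: prob_space M by (rule M)
  define L where "L = ln (6 / delta)"
  have d3: "0 < delta / 3" "2 / (delta / 3) = 6 / delta" using delta by auto
  have "6 \<le> 6 / delta" using delta by (simp add: field_simps)
  then have "exp 1 \<le> 6 / delta" using exp_le by linarith
  then have L: "1 \<le> L" unfolding L_def using delta by (subst ln_ge_iff) auto
  have L48: "ln (48 / delta) = ln 8 + L"
  proof -
    have "48 / delta = 8 * (6 / delta)" by simp
    then show ?thesis unfolding L_def using delta by (simp only:) (subst ln_mult, simp_all)
  qed
  have ln8: "1 \<le> ln (8::real)" using exp_le by (subst ln_ge_iff) auto
  have J1: "1 \<le> real J" "1 \<le> real K" "1 \<le> real J * real K" using JK mult_mono[of 1 "real J" 1 "real K"] by auto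
  have sq: "r1^2 \<le> real J * r1^2" "r3^2 \<le> real K * r3^2" "0 \<le> r1^2" "0 \<le> r2^2" "0 \<le> r3^2" "0 \<le> r2^2 * r3^2"
    using J1 mult_right_mono[of 1 "real J" "r1^2"] mult_right_mono[of 1 "real K" "r3^2"] by auto
  have sq2: "real J * r2^2 \<le> real J * real K * r2^2" "0 \<le> real J * r2^2"
    using J1 mult_right_mono[of "real J" "real J * real K" "r2^2"] by auto
  define RF where "RF = (real J * r1^2 + real J * real K * r2^2 + real K * r3^2) / 2 + ln (2 / (delta / 3))"
  define R3 where "R3 = (real J * r1^2 + real J * real 1 * r2^2 + real 1 * r3^2) / 2 + ln (2 / (delta / 3))"
  define R1 where "R1 = (r1^2 + r2^2 * r3^2 + 1) / 2 + ln (2 / (delta / 3))"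
  have two: "(1::real)^2 = 1" "(2::real)^2 = 4" by simp_all
  have RF: "0 < RF" "RF \<le> real n" "RF \<le> 1^2 * (real J * r1^2 + real J * real K * r2^2 + real K * r3^2 + ln (48 / delta))"
    using noise_level[of "real J * r1^2" "real J * real K * r2^2" "real K * r3^2" L "ln 8 + L" "real n"] nbig sq sq2 L ln8
    unfolding RF_def d3 L48 L_def[symmetric] by simp_all
  have R3: "0 < R3" "R3 \<le> real n" "R3 \<le> 2^2 * (real J * r1^2 + real J * r2^2 + r3^2 + ln (48 / delta))"
    using noise_level[of "real J * r1^2" "real J * r2^2" "r3^2" L "ln 8 + L" "real n"] nbig sq sq2 L ln8
    unfolding R3_def d3 L48 L_def[symmetric] by simp_all
  \<comment> \<open>The trivial third factor costs an extra 1, paid for by the difference ln 8 >= 1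
    between ln (48 / delta) and ln (6 / delta).\<close>
  have "r1^2 + r2^2 * r3^2 + (1 + L) \<le> real n" using nbig sq sq2 ln8 unfolding L48 by linarith
  note level1 = noise_level1[OF sq(3,6) L this]
  have R1: "0 < R1" "R1 \<le> real n" "R1 \<le> 2^2 * (r1^2 + r2^2 * r3^2 + ln (6 / delta))"
    unfolding R1_def d3 L_def[symmetric] two by (rule level1)+
  obtain AF where AF: "AF \<in> sets M" "measure M AF \<ge> 1 - delta / 3"
    "\<forall>w\<in>AF. \<forall>U Z. contr (p^2) J U \<longrightarrow> contr (r^2) K Z \<longrightarrow>
      tfrob J (q^2) K (mode1T (p^2) U (mode3T (r^2) Z (Rearr p q r (Q w)))) \<le> real n * (40 / 3 * om * nS * sqrt (RF / real n))"
    using noise_frob[OF JK d3(1) RF_def RF(1,2)] by blast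
  obtain A3 where A3: "A3 \<in> sets M" "measure M A3 \<ge> 1 - delta / 3"
    "\<forall>w\<in>A3. \<forall>U Z. contr (p^2) J U \<longrightarrow> contr (r^2) 1 Z \<longrightarrow>
      tfrob J (q^2) 1 (mode1T (p^2) U (mode3T (r^2) Z (Rearr p q r (Q w)))) \<le> real n * (40 / 3 * om * nS * sqrt (R3 / real n))"
    using noise_frob[OF JK(1) zero_less_one d3(1) R3_def R3(1,2)] by blast
  obtain A1 where A1: "A1 \<in> sets M" "measure M A1 \<ge> 1 - delta / 3"
    "\<forall>w\<in>A1. \<forall>u. vnorm ({..<q^2} \<times> {..<r^2}) (tmv {..<p^2} (unf (Rearr p q r (Q w))) u)
      \<le> real n * (40 / 3 * om * nS * sqrt (R1 / real n)) * vnorm {..<p^2} u"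
    using noise_unf[OF d3(1) R1_def R1(1,2)] by blast
  have c: "0 \<le> om * nS" using om trace_pos(1) by simp
  have vF: "40 / 3 * om * nS * sqrt (RF / real n) \<le> 40 / 3 * (om * nS * sqrt ((real J * r1^2 + real J * real K * r2^2 + real K * r3^2 + ln (48 / delta)) / real n))"
    using mult_left_mono[OF mult_left_mono[OF sqrt_div_mono[OF RF(3) zero_le_one n] c], of "40 / 3"]
    by (simp add: mult.assoc)
  \<comment> \<open>R is at most four times the level in the theorem, so the square root costs a
    factor 2, and 80/3 <= 32.\<close>
  have v: "40 / 3 * om * nS * sqrt (R / real n) \<le> 32 * om * nS * sqrt (R' / real n)" if "R \<le> 2^2 * R'" "0 < R" for R R'
  proof -
    have "om * nS * sqrt (R / real n) \<le> 2 * (om * nS * sqrt (R' / real n))"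
      using mult_left_mono[OF sqrt_div_mono[OF that(1) _ n] c] by simp
    moreover have "0 \<le> om * nS * sqrt (R' / real n)" using om trace_pos(1) that by (intro mult_nonneg_nonneg) auto
    moreover have "40 / 3 * x \<le> 32 * y" if "x \<le> 2 * y" "0 \<le> y" for x y :: real using that by argo
    ultimately show ?thesis by (simp only: mult.assoc)
  qed
  show ?thesis
  proof (intro bexI[of _ "AF \<inter> A3 \<inter> A1"] conjI ballI allI impI)
    have "1 - (delta / 3 + delta / 3 + delta / 3) \<le> measure M (AF \<inter> A3 \<inter> A1)"
      using AF A3 A1 by (intro P.prob_Int_ge) auto
    then show "1 - delta \<le> measure M (AF \<inter> A3 \<inter> A1)" by simp
    show "AF \<inter> A3 \<inter> A1 \<in> sets M" using AF A3 A1 by auto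
    fix w assume "w \<in> AF \<inter> A3 \<inter> A1"
    then have w: "w \<in> AF" "w \<in> A3" "w \<in> A1" by auto
    {
      fix U V assume UV: "contr (p^2) J U" "contr (r^2) K V"
      have "mode1T (p^2) U (mode3T (r^2) V (noise w)) = (\<lambda>a b c. 1 / real n * mode1T (p^2) U (mode3T (r^2) V (Rearr p q r (Q w))) a b c)"
        by (simp add: mode1T_def mode3T_def noise_def sum_distrib_left mult_ac)
      then have "tfrob J (q^2) K (mode1T (p^2) U (mode3T (r^2) V (noise w))) = 1 / real n * tfrob J (q^2) K (mode1T (p^2) U (mode3T (r^2) V (Rearr p q r (Q w))))"
        using vnorm_scale[of "{..<J} \<times> {..<q^2} \<times> {..<K}" "1 / real n" "\<lambda>(a, b, c). mode1T (p^2) U (mode3T (r^2) V (Rearr p q r (Q w))) a b c"]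
        unfolding tfrob_vnorm by (simp add: case_prod_unfold)
      also have "\<dots> \<le> 1 / real n * (real n * (40 / 3 * om * nS * sqrt (RF / real n)))"
        using AF(3) w(1) UV by (intro mult_left_mono) auto
      also have "\<dots> = 40 / 3 * om * nS * sqrt (RF / real n)" using n by simp
      also note vF
      finally show "tfrob J (q^2) K (mode1T (p^2) U (mode3T (r^2) V (noise w)))
         \<le> 40 / 3 * (om * nS * sqrt ((real J * r1^2 + real J * real K * r2^2 + real K * r3^2 + ln (48 / delta)) / real n))" .
    next
      fix u
      have "vnorm ({..<q^2} \<times> {..<r^2}) (tmv {..<p^2} (unf (noise w)) u) \<le> 40 / 3 * om * nS * sqrt (R1 / real n) * vnorm {..<p^2} u"
      proof -
        have "tmv {..<p^2} (unf (noise w)) u = (\<lambda>j. 1 / real n * tmv {..<p^2} (unf (Rearr p q r (Q w))) u j)"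
          by (auto simp: tmv_def unf_def noise_def sum_distrib_left mult_ac)
        then have "vnorm ({..<q^2} \<times> {..<r^2}) (tmv {..<p^2} (unf (noise w)) u) = 1 / real n * vnorm ({..<q^2} \<times> {..<r^2}) (tmv {..<p^2} (unf (Rearr p q r (Q w))) u)"
          by (simp only: vnorm_scale) simp
        also have "\<dots> \<le> 1 / real n * (real n * (40 / 3 * om * nS * sqrt (R1 / real n)) * vnorm {..<p^2} u)"
          using A1(3) w(3) by (intro mult_left_mono) auto
        finally show ?thesis using n by (simp only: mult.assoc[symmetric]) simp
      qed
      also have "\<dots> \<le> 32 * om * nS * sqrt ((r1^2 + r2^2 * r3^2 + ln (6 / delta)) / real n) * vnorm {..<p^2} u"
        by (rule mult_right_mono[OF v[OF R1(3,1)]]) simp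
      finally show "vnorm ({..<q^2} \<times> {..<r^2}) (tmv {..<p^2} (unf (noise w)) u)
         \<le> 32 * om * nS * sqrt ((r1^2 + r2^2 * r3^2 + ln (6 / delta)) / real n) * vnorm {..<p^2} u" .
    next
      fix U x assume U: "contr (p^2) J U"
      have "vnorm ({..<q^2} \<times> {..<J}) (tmv {..<r^2} (con (p^2) U (flip (noise w))) x) \<le> 40 / 3 * om * nS * sqrt (R3 / real n) * vnorm {..<r^2} x"
      proof -
        have "tmv {..<r^2} (con (p^2) U (flip (noise w))) x = (\<lambda>j. 1 / real n * tmv {..<r^2} (con (p^2) U (flip (Rearr p q r (Q w)))) x j)"
          by (simp add: tmv_def con_def flip_def noise_def case_prod_unfold sum_distrib_left sum_divide_distrib mult_ac)
        then have "vnorm ({..<q^2} \<times> {..<J}) (tmv {..<r^2} (con (p^2) U (flip (noise w))) x)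
            = 1 / real n * vnorm ({..<q^2} \<times> {..<J}) (tmv {..<r^2} (con (p^2) U (flip (Rearr p q r (Q w)))) x)"
          by (simp only: vnorm_scale) simp
        also have "\<dots> \<le> 1 / real n * (real n * (40 / 3 * om * nS * sqrt (R3 / real n)) * vnorm {..<r^2} x)"
        proof (rule mult_left_mono[OF noise_spectral3[OF _ _ U]])
          show "0 \<le> real n * (40 / 3 * om * nS * sqrt (R3 / real n))"
            using om trace_pos(1) R3(1) by (intro mult_nonneg_nonneg) auto
        qed (use A3(3) w(2) in simp_all)
        finally show ?thesis using n by (simp only: mult.assoc[symmetric]) simp
      qed
      also have "\<dots> \<le> 32 * om * nS * sqrt ((real J * r1^2 + real J * r2^2 + r3^2 + ln (48 / delta)) / real n) * vnorm {..<r^2} x"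
        by (rule mult_right_mono[OF v[OF R3(3,1)]]) simp
      finally show "vnorm ({..<q^2} \<times> {..<J}) (tmv {..<r^2} (con (p^2) U (flip (noise w))) x)
         \<le> 32 * om * nS * sqrt ((real J * r1^2 + real J * r2^2 + r3^2 + ln (48 / delta)) / real n) * vnorm {..<r^2} x" .
    }
  qed
qed

end

theorem theorem1:
  fixes p q r J K n T :: nat
    and M :: "'a measure"
    and X :: "nat \<Rightarrow> 'a \<Rightarrow> nat \<Rightarrow> real"
    and Sig :: mat
    and \<omega> \<delta> :: real
    and Ustar Vstar :: mat and Wstar :: tensor
  defines "d \<equiv> p * q * r" and "d1 \<equiv> p^2" and "d2 \<equiv> q^2" and "d3 \<equiv> r^2"
  defines "Tstar \<equiv> ttprod J K Ustar Vstar Wstar"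
  defines "Ebar \<equiv> (\<lambda>a b c. Rearr p q r Sig a b c - Tstar a b c)"
  defines "r1 \<equiv> reff1 p q r Sig" and "r2 \<equiv> reff2 p q r Sig" and "r3 \<equiv> reff3 p q r Sig"
  defines "nS \<equiv> snorm d d Sig"
  defines "s1 \<equiv> sval d1 (d2 * d3) (m1 d2 d3 (Rearr p q r Sig)) J"
    and "s3 \<equiv> sval d3 (d1 * d2) (m3 d2 (Rearr p q r Sig)) K"
  assumes pos: "0 < p" "0 < q" "0 < r" "0 < J" "0 < K" "0 < n" "0 < T"
    and JK: "J \<le> d1" "K \<le> d3"
    and P: "prob_space M"
    and indep: "prob_space.indep_vars M (\<lambda>_. PiM {..<d} (\<lambda>_. borel))
                  (\<lambda>i \<omega>'. restrict (X i \<omega>') {..<d}) {0..n}"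
    and ident: "\<forall>i\<in>{1..n}. distr M (PiM {..<d} (\<lambda>_. borel)) (\<lambda>\<omega>'. restrict (X i \<omega>') {..<d})
                           = distr M (PiM {..<d} (\<lambda>_. borel)) (\<lambda>\<omega>'. restrict (X 0 \<omega>') {..<d})"
    and centered: "\<forall>j<d. integrable M (\<lambda>\<omega>'. X 0 \<omega>' j) \<and> (\<integral>\<omega>'. X 0 \<omega>' j \<partial>M) = 0"
    and second: "\<forall>j<d. \<forall>k<d. integrable M (\<lambda>\<omega>'. X 0 \<omega>' j * X 0 \<omega>' k)"
    and Sig_def: "Sig = (\<lambda>j k. \<integral>\<omega>'. X 0 \<omega>' j * X 0 \<omega>' k \<partial>M)"
    and pd: "sym_pd d Sig"
    and \<omega>pos: "0 < \<omega>"
    and assmA: "\<forall>V. frob d d V \<le> 1 / \<omega> \<longrightarrow>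
       (let Z = (\<lambda>\<omega>' i. \<Sum>k<d. inv_sqrt d Sig i k * X 0 \<omega>' k);
            f = (\<lambda>\<omega>'. exp ((\<Sum>i<d. \<Sum>j<d. Z \<omega>' i * V i j * Z \<omega>' j) - (\<Sum>i<d. V i i)))
        in integrable M f \<and> ln (\<integral>\<omega>'. f \<omega>' \<partial>M) \<le> \<omega>^2 * (frob d d V)^2)"
    and \<delta>: "0 < \<delta>" "\<delta> < 1"
    and best: "orth d1 J Ustar" "orth d3 K Vstar"
      "\<forall>U V W. orth d1 J U \<longrightarrow> orth d3 K V \<longrightarrow>
          tfrob d1 d2 d3 (\<lambda>a b c. Rearr p q r Sig a b c - Tstar a b c)
            \<le> tfrob d1 d2 d3 (\<lambda>a b c. Rearr p q r Sig a b c - ttprod J K U V W a b c)"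
    and gap1: "s1 \<ge> 25 * snorm d1 (d2 * d3) (m1 d2 d3 Ebar)
       + 768 * \<omega> * nS * sqrt ((r1^2 + r2^2 * r3^2 + ln (6 / \<delta>)) / real n)"
    and gap3: "s3 \<ge> 25 * snorm d3 (d1 * d2) (m3 d2 Ebar)
       + 768 * \<omega> * nS * sqrt ((real J * r1^2 + real J * r2^2 + r3^2 + ln (48 / \<delta>)) / real n)"
    and nbig: "real n \<ge> real J * r1^2 + real J * real K * r2^2 + real K * r3^2 + r2^2 * r3^2 + ln (48 / \<delta>)"
  shows "\<exists>A\<in>sets M. measure M A \<ge> 1 - \<delta> \<and>
    (\<forall>\<omega>'\<in>A. \<forall>Tt. hardtth d1 d2 d3 J K T
         (Rearr p q r (\<lambda>j k. (1 / real n) * (\<Sum>i=1..n. X i \<omega>' j * X i \<omega>' k))) Tt \<longrightarrow>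
      (let bbar = tfrob d1 d2 d3 Ebar
             + Sup {tfrob J d2 K (mode1T d1 U (mode3T d3 V Ebar)) | U V. orth d1 J U \<and> orth d3 K V}
             + 4 * sqrt (real J) * snorm d1 (d2 * K) (m1 d2 K (mode3T d3 Vstar Ebar))
             + 4 * sqrt (real K) * snorm d3 (J * d2) (m3 d2 (mode1T d1 Ustar Ebar));
           aU = snorm d1 (d2 * K) (m1 d2 K (mode3T d3 Vstar Ebar))
             + 32 * \<omega> * nS * sqrt ((r1^2 + real K * r2^2 + ln (48 / \<delta>)) / real n);
           bU = Sup {snorm d1 (d2 * K) (m1 d2 K (mode3T d3 V Ebar)) | V. snorm d3 K V \<le> 1}
             + 32 * \<omega> * nS * sqrt ((r1^2 + real K * r2^2 + real K * r3^2 + ln (48 / \<delta>)) / real n);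
           aV = snorm d3 (J * d2) (m3 d2 (mode1T d1 Ustar Ebar))
             + 32 * \<omega> * nS * sqrt ((r3^2 + real J * r2^2 + ln (48 / \<delta>)) / real n);
           bV = Sup {snorm d3 (J * d2) (m3 d2 (mode1T d1 U Ebar)) | U. snorm d1 J U \<le> 1}
             + 32 * \<omega> * nS * sqrt ((r2^2 + real J * r1^2 + real J * r3^2 + ln (48 / \<delta>)) / real n);
           dia2 = 96 * (sqrt (real K) * bV * aU / s1 + sqrt (real J) * bU * aV / s3);
           rT = (sqrt (real J) + sqrt (real K)) * (200 * bV * bU / (s1 * s3)) ^ T
                * (snorm d1 (d2 * d3) (m1 d2 d3 Ebar)
                   + 32 * \<omega> * nS * sqrt ((r1^2 + r2^2 * r3^2 + ln (6 / \<delta>)) / real n))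
       in frob d d (\<lambda>i j. Rearr_inv p q r Tt i j - Sig i j)
            \<le> bbar + 96 * \<omega> * nS * sqrt ((real J * r1^2 + real J * real K * r2^2 + real K * r3^2
                                             + ln (48 / \<delta>)) / real n)
               + dia2 + rT))"
proof -
  note defs = d_def d1_def d2_def d3_def r1_def r2_def r3_def nS_def
  interpret sample p q r Sig n M X \<omega>
    by (intro sample.intro covariance.intro sample_axioms.intro) (fact pos pd[unfolded d_def] P indep[unfolded d_def] ident[unfolded d_def] assmA[unfolded d_def] \<omega>pos)+
  have L: "0 < ln (6 / \<delta>)" "0 < ln (48 / \<delta>)" using \<delta> by simp_all
  have c: "0 < \<omega> * nS" using \<omega>pos trace_pos(1) by (simp add: defs)
  have nS0: "0 < nS" using trace_pos(1) by (simp add: defs)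
  have JK0: "0 < J" "0 < K" by (rule pos)+
  note E_def = Ebar_def[unfolded Tstar_def]
  have dim: "(p * q * r) = d" by (simp add: d_def)
  define eta1 where "eta1 = 32 * \<omega> * nS * sqrt ((r1^2 + r2^2 * r3^2 + ln (6 / \<delta>)) / real n)"
  define eta3 where "eta3 = 32 * \<omega> * nS * sqrt ((real J * r1^2 + real J * r2^2 + r3^2 + ln (48 / \<delta>)) / real n)"
  define z where "z = \<omega> * nS * sqrt ((real J * r1^2 + real J * real K * r2^2 + real K * r3^2 + ln (48 / \<delta>)) / real n)"
  have r0: "0 \<le> r1^2" "0 \<le> r2^2" "0 \<le> r3^2" "0 \<le> r2^2 * r3^2" by simp_all
  have eta: "0 < eta1" "0 < eta3" 
    unfolding eta1_def eta3_def using \<omega>pos nS0 L r0 pos by (auto intro!: mult_pos_pos divide_pos_pos add_nonneg_pos add_nonneg_nonneg simp: mult.assoc)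
  have z0: "0 \<le> z" unfolding z_def using \<omega>pos nS0 L r0 by (intro mult_nonneg_nonneg) (auto intro!: divide_nonneg_nonneg add_nonneg_nonneg)
  obtain A where A: "A \<in> sets M" "measure M A \<ge> 1 - \<delta>"
    and noiseA: "\<forall>w\<in>A.
    (\<forall>U V. contr d1 J U \<longrightarrow> contr d3 K V \<longrightarrow> tfrob J d2 K (mode1T d1 U (mode3T d3 V (noise w))) \<le> 40 / 3 * z) \<and>
    (\<forall>u. vnorm ({..<d2} \<times> {..<d3}) (tmv {..<d1} (unf (noise w)) u) \<le> eta1 * vnorm {..<d1} u) \<and>
    (\<forall>U v. contr d1 J U \<longrightarrow> vnorm ({..<d2} \<times> {..<J}) (tmv {..<d3} (con d1 U (flip (noise w))) v) \<le> eta3 * vnorm {..<d3} v)"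
    using noise_event[OF JK0 \<delta> nbig[unfolded defs]] unfolding eta1_def eta3_def z_def defs by blast
  show ?thesis
  proof (intro bexI[of _ A] conjI ballI allI impI)
    fix w Tt
    assume w: "w \<in> A" and hard: "hardtth d1 d2 d3 J K T (Rearr p q r (\<lambda>j k. (1 / real n) * (\<Sum>i=1..n. X i w j * X i w k))) Tt"
    \<comment> \<open>768 = 24 * 32: the separation is 24 times the noise level of the corresponding
      unfolding.\<close>
    have gaps: "25 * snorm d1 (d2 * d3) (m1 d2 d3 Ebar) + 24 * eta1 \<le> s1"
      "25 * snorm d3 (d1 * d2) (m3 d2 Ebar) + 24 * eta3 \<le> s3"
      using gap1 gap3 by (simp_all add: eta1_def eta3_def)
    have sn: "0 \<le> snorm m k B" for m k B by (simp add: snorm_def opnorm_nonneg)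
    have spos: "0 < s1" "0 < s3"
      using gaps eta sn[of d1 "d2 * d3" "m1 d2 d3 Ebar"] sn[of d3 "d1 * d2" "m3 d2 Ebar"] by linarith+
    let ?bU = "Sup {snorm d1 (d2 * K) (m1 d2 K (mode3T d3 V Ebar)) | V. snorm d3 K V \<le> 1}"
    let ?bV = "Sup {snorm d3 (J * d2) (m3 d2 (mode1T d1 U Ebar)) | U. snorm d1 J U \<le> 1}"
    define aU where "aU = snorm d1 (d2 * K) (m1 d2 K (mode3T d3 Vstar Ebar))
             + 32 * \<omega> * nS * sqrt ((r1^2 + real K * r2^2 + ln (48 / \<delta>)) / real n)"
    define bU where "bU = ?bU + 32 * \<omega> * nS * sqrt ((r1^2 + real K * r2^2 + real K * r3^2 + ln (48 / \<delta>)) / real n)"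
    define aV where "aV = snorm d3 (J * d2) (m3 d2 (mode1T d1 Ustar Ebar))
             + 32 * \<omega> * nS * sqrt ((r3^2 + real J * r2^2 + ln (48 / \<delta>)) / real n)"
    define bV where "bV = ?bV + 32 * \<omega> * nS * sqrt ((r2^2 + real J * r1^2 + real J * r3^2 + ln (48 / \<delta>)) / real n)"
    have root: "0 \<le> 32 * \<omega> * nS * sqrt ((x + ln (48 / \<delta>)) / real n)" if "0 \<le> x" for x
      using \<omega>pos nS0 L that by (simp add: mult.assoc)
    have bound: "tfrob d1 d2 d3 (\<lambda>a b c. Tt a b c - Rearr p q r Sig a b c) \<le> tfrob d1 d2 d3 Ebar
      + Sup {tfrob J d2 K (mode1T d1 U (mode3T d3 V Ebar)) | U V. orth d1 J U \<and> orth d3 K V} + 40 / 3 * z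
      + 221 / 100 * (2 * (40 / 3 * z) + sqrt (real J) * snorm d1 (d2 * K) (m1 d2 K (mode3T d3 Vstar Ebar))
          + sqrt (real K) * snorm d3 (J * d2) (m3 d2 (mode1T d1 Ustar Ebar)))
      + 109 / 100 * (5 * (?bU * ?bV / (24 / 25 * s1 * (24 / 25 * s3))))^T * (2 * (sqrt (real J) * (snorm d1 (d2 * d3) (m1 d2 d3 Ebar) + eta1)))"
      and b0: "0 \<le> ?bU" "0 \<le> ?bV"
    proof -
      note nb = noiseA[rule_format, OF w]
      have z0': "0 \<le> 40 / 3 * z" using z0 by simp
      note hb = hooi_bound[where S="Rearr p q r Sig" and N="noise w" and Us=Ustar and Vs=Vstar and W=Wstar and F="40 / 3 * z"
          and ?e1.0=eta1 and ?e3.0=eta3 and ?d1.0=d1 and ?d2.0=d2 and ?d3.0=d3 and J=J and K=K and T=T and Tt=Tt,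
          folded E_def, folded s1_def s3_def, OF JK0 best(1,2) _ z0' _ eta(1) _ eta(2) gaps hard[unfolded Rearr_empirical]]
      show "tfrob d1 d2 d3 (\<lambda>a b c. Tt a b c - Rearr p q r Sig a b c) \<le> tfrob d1 d2 d3 Ebar
      + Sup {tfrob J d2 K (mode1T d1 U (mode3T d3 V Ebar)) | U V. orth d1 J U \<and> orth d3 K V} + 40 / 3 * z
      + 221 / 100 * (2 * (40 / 3 * z) + sqrt (real J) * snorm d1 (d2 * K) (m1 d2 K (mode3T d3 Vstar Ebar))
          + sqrt (real K) * snorm d3 (J * d2) (m3 d2 (mode1T d1 Ustar Ebar)))
      + 109 / 100 * (5 * (?bU * ?bV / (24 / 25 * s1 * (24 / 25 * s3))))^T * (2 * (sqrt (real J) * (snorm d1 (d2 * d3) (m1 d2 d3 Ebar) + eta1)))"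
        by (rule hb(1)) (use nb in blast)+
      show "0 \<le> ?bU" by (rule hb(2)) (use nb in blast)+
      show "0 \<le> ?bV" by (rule hb(3)) (use nb in blast)+
    qed
    \<comment> \<open>The contraction is governed by the bias suprema; adding the nonnegative noise
      terms only enlarges the ratio.\<close>
    have bUV: "?bU \<le> bU" "?bV \<le> bV" unfolding bU_def bV_def using root r0 by simp_all
    have a0: "0 \<le> aU" "0 \<le> aV" unfolding aU_def aV_def using root r0 sn by (auto intro!: add_nonneg_nonneg)
    have dia0: "0 \<le> 96 * (sqrt (real K) * bV * aU / s1 + sqrt (real J) * bU * aV / s3)"
      using spos a0 b0 bUV by (intro mult_nonneg_nonneg add_nonneg_nonneg divide_nonneg_pos) auto
    have fin: "frob d d (\<lambda>i j. Rearr_inv p q r Tt i j - Sig i j)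
      \<le> (tfrob d1 d2 d3 Ebar + Sup {tfrob J d2 K (mode1T d1 U (mode3T d3 V Ebar)) | U V. orth d1 J U \<and> orth d3 K V}
        + 4 * sqrt (real J) * snorm d1 (d2 * K) (m1 d2 K (mode3T d3 Vstar Ebar))
        + 4 * sqrt (real K) * snorm d3 (J * d2) (m3 d2 (mode1T d1 Ustar Ebar)))
        + 96 * z + 96 * (sqrt (real K) * bV * aU / s1 + sqrt (real J) * bU * aV / s3)
        + (sqrt (real J) + sqrt (real K)) * (200 * bV * bU / (s1 * s3))^T * (snorm d1 (d2 * d3) (m1 d2 d3 Ebar) + eta1)"
      unfolding d_def frob_Rearr_inv d1_def[symmetric] d2_def[symmetric] d3_def[symmetric]
      by (rule assemble[OF bound _ z0 b0 bUV spos _ _ sn sn _ dia0 pos(7)]) (use eta sn in simp_all)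
    then show "let bbar = tfrob d1 d2 d3 Ebar
             + Sup {tfrob J d2 K (mode1T d1 U (mode3T d3 V Ebar)) | U V. orth d1 J U \<and> orth d3 K V}
             + 4 * sqrt (real J) * snorm d1 (d2 * K) (m1 d2 K (mode3T d3 Vstar Ebar))
             + 4 * sqrt (real K) * snorm d3 (J * d2) (m3 d2 (mode1T d1 Ustar Ebar));
           aU = snorm d1 (d2 * K) (m1 d2 K (mode3T d3 Vstar Ebar))
             + 32 * \<omega> * nS * sqrt ((r1^2 + real K * r2^2 + ln (48 / \<delta>)) / real n);
           bU = ?bU + 32 * \<omega> * nS * sqrt ((r1^2 + real K * r2^2 + real K * r3^2 + ln (48 / \<delta>)) / real n);
           aV = snorm d3 (J * d2) (m3 d2 (mode1T d1 Ustar Ebar))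
             + 32 * \<omega> * nS * sqrt ((r3^2 + real J * r2^2 + ln (48 / \<delta>)) / real n);
           bV = ?bV + 32 * \<omega> * nS * sqrt ((r2^2 + real J * r1^2 + real J * r3^2 + ln (48 / \<delta>)) / real n);
           dia2 = 96 * (sqrt (real K) * bV * aU / s1 + sqrt (real J) * bU * aV / s3);
           rT = (sqrt (real J) + sqrt (real K)) * (200 * bV * bU / (s1 * s3)) ^ T
                * (snorm d1 (d2 * d3) (m1 d2 d3 Ebar)
                   + 32 * \<omega> * nS * sqrt ((r1^2 + r2^2 * r3^2 + ln (6 / \<delta>)) / real n))
       in frob d d (\<lambda>i j. Rearr_inv p q r Tt i j - Sig i j)
            \<le> bbar + 96 * \<omega> * nS * sqrt ((real J * r1^2 + real J * real K * r2^2 + real K * r3^2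
                                             + ln (48 / \<delta>)) / real n)
               + dia2 + rT"
      unfolding Let_def aU_def[symmetric] bU_def[symmetric] aV_def[symmetric] bV_def[symmetric] eta1_def[symmetric]
      by (simp only: z_def mult.assoc)
  qed (rule A)+
qed

end
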